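(* Let $k$ be a field of characteristic $0$, let $H$ be a Hopf algebra over $k$ with bijective antipode, let $K$ be a normal semisimple Hopf subalgebra of $H$, and let $M$ be a modular crossed module over $H$. Put $\overline H=H/K_+H$ and $\overline M=M/K_+M$. If $\overline H$ is cocommutative and $\rho(M)\subseteq M\otimes K$, then for every $n\ge0$ $$\mathrm{HC}_n(H,M)\simeq\bigoplus_{i\ge0}\mathrm{Tor}^{\overline H}_{n-2i}(k,\overline M).$$
   Context: $\otimes=\otimes_k$; $H$ has comultiplication $\Delta(h)=\sum h_{(1)}\otimes h_{(2)}$, counit $\varepsilon$, antipode $S$. A crossed module over $H$ is a left $H$-module $M$ which is also a right $H$-comodule via $\rho(m)=\sum m_{\langle0\rangle}\otimes m_{\langle1\rangle}\in M\otimes H$ such that $\rho(hm)=\sum h_{(2)}m_{\langle0\rangle}\otimes h_{(3)}m_{\langle1\rangle}S(h_{(1)})$. It is modular if $\sum m_{\langle1\rangle}m_{\langle0\rangle}=m$ for all $m$. For a modular crossed module $M$ over $H$, $Z_*(H,M)$ is the cyclic object with $Z_n(H,M)=H^{\otimes(n+1)}\otimes_HM$, where $H^{\otimes(n+1)}$ is a right $H$-module by the diagonal action, faces $\delta_i((h^0,\ldots,h^n)\otimes_Hm)=\varepsilon(h^i)(h^0,\ldots,\widehat{h^i},\ldots,h^n)\otimes_Hm$, degeneracies $\sigma_i((h^0,\ldots,h^n)\otimes_Hm)=(h^0,\ldots,\Delta(h^i),\ldots,h^n)\otimes_Hm$, and cyclic operator $\tau_n((h^0,\ldots,h^n)\otimes_Hm)=\sum(h^nm_{\langle1\rangle},h^0,\ldots,h^{n-1})\otimes_Hm_{\langle0\rangle}$.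 $\mathrm{HC}_*(H,M)$ is its cyclic homology (homology of the total complex of the Tsygan double complex). $K_+$ is the kernel of the counit of $K$. The Hopf subalgebra $K$ is normal if $K_+H$ is a two-sided ideal of $H$; then $K_+H$ is a Hopf ideal and $\overline H=H/K_+H$ is a Hopf algebra. $\overline M$ is a modular crossed module over $\overline H$ with the quotient structures. $k$ is the trivial right $\overline H$-module via the counit, and $\mathrm{Tor}_j=0$ for $j<0$. *)

theory Defs
  imports "HOL-Algebra.Module" "HOL-Algebra.QuotRing" "HOL.Hull"
begin

section \<open>Linear algebra over a field \<open>k\<close>\<close>

text \<open>
  Vector spaces over \<open>k\<close> are \<open>HOL-Algebra\<close> modules over \<open>k\<close>.  Where a module is only used as a
  vector space, the fields \<open>mult\<close> and \<open>one\<close> of the record carry no meaning.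
\<close>

definition linear_map ::
    "'k ring \<Rightarrow> ('k, 'v, 'x) module_scheme \<Rightarrow> ('k, 'w, 'y) module_scheme \<Rightarrow> ('v \<Rightarrow> 'w) \<Rightarrow> bool" where
  "linear_map k V W f \<longleftrightarrow>
     f \<in> carrier V \<rightarrow> carrier W \<and>
     (\<forall>x\<in>carrier V. \<forall>y\<in>carrier V. f (x \<oplus>\<^bsub>V\<^esub> y) = f x \<oplus>\<^bsub>W\<^esub> f y) \<and>
     (\<forall>a\<in>carrier k. \<forall>x\<in>carrier V. f (a \<odot>\<^bsub>V\<^esub> x) = a \<odot>\<^bsub>W\<^esub> f x)"

definition linear_isomorphic ::
    "'k ring \<Rightarrow> ('k, 'v, 'x) module_scheme \<Rightarrow> ('k, 'w, 'y) module_scheme \<Rightarrow> bool" where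
  "linear_isomorphic k V W \<longleftrightarrow> (\<exists>f. linear_map k V W f \<and> bij_betw f (carrier V) (carrier W))"

definition lin_span :: "'k ring \<Rightarrow> ('k, 'v, 'x) module_scheme \<Rightarrow> 'v set \<Rightarrow> 'v set" where
  "lin_span k V S = (\<lambda>N. submodule N k V) hull S"

definition ground_module :: "'k ring \<Rightarrow> ('k, 'k) module" where
  "ground_module k = \<lparr>carrier = carrier k, mult = mult k, one = one k, zero = zero k, add = add k,
                      smult = mult k\<rparr>"

definition zero_module :: "('k, 'v) module" where
  "zero_module = \<lparr>carrier = {undefined}, mult = undefined, one = undefined, zero = undefined,
                  add = (\<lambda>_ _. undefined), smult = (\<lambda>_ _. undefined)\<rparr>"

definition direct_sum :: "'i set \<Rightarrow> ('i \<Rightarrow> ('k, 'v, 'x) module_scheme) \<Rightarrow> ('k, 'i \<Rightarrow> 'v) module" where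
  "direct_sum I F =
     \<lparr>carrier = {f \<in> (\<Pi>\<^sub>E i\<in>I. carrier (F i)). finite {i\<in>I. f i \<noteq> \<zero>\<^bsub>F i\<^esub>}},
      mult = undefined, one = undefined,
      zero = (\<lambda>i\<in>I. \<zero>\<^bsub>F i\<^esub>),
      add = (\<lambda>f g. \<lambda>i\<in>I. f i \<oplus>\<^bsub>F i\<^esub> g i),
      smult = (\<lambda>a f. \<lambda>i\<in>I. a \<odot>\<^bsub>F i\<^esub> f i)\<rparr>"

text \<open>The quotient by a subspace \<open>N\<close>; the multiplication and unit are the induced ones when \<open>V\<close> is
  an algebra and \<open>N\<close> is a two-sided ideal.\<close>

definition quot_module :: "('k, 'v, 'x) module_scheme \<Rightarrow> 'v set \<Rightarrow> ('k, 'v set) module" where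
  "quot_module V N =
     \<lparr>carrier = a_rcosets\<^bsub>V\<^esub> N, mult = rcoset_mult V N, one = N +>\<^bsub>V\<^esub> \<one>\<^bsub>V\<^esub>, zero = N,
      add = set_add V, smult = (\<lambda>a X. \<Union>x\<in>X. N +>\<^bsub>V\<^esub> (a \<odot>\<^bsub>V\<^esub> x))\<rparr>"

text \<open>The value on a coset \<open>X\<close> of the map induced by \<open>f\<close>, for \<open>f\<close> constant on \<open>X\<close>.\<close>

definition on_coset :: "('v \<Rightarrow> 'w) \<Rightarrow> 'v set \<Rightarrow> 'w" where
  "on_coset f X = the_elem (f ` X)"


section \<open>Tensor products\<close>

text \<open>
  Tensor products are quotients of free vector spaces.  The free vector space on \<open>X\<close> consists of
  the finitely supported functions \<open>X \<rightarrow> k\<close>, extended by zero outside \<open>X\<close>.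
\<close>

definition free_module :: "'k ring \<Rightarrow> 'x set \<Rightarrow> ('k, 'x \<Rightarrow> 'k) module" where
  "free_module k X =
     \<lparr>carrier = {c. (\<forall>x\<in>X. c x \<in> carrier k) \<and> (\<forall>x. x \<notin> X \<longrightarrow> c x = \<zero>\<^bsub>k\<^esub>) \<and>
                    finite {x. c x \<noteq> \<zero>\<^bsub>k\<^esub>}},
      mult = undefined, one = undefined,
      zero = (\<lambda>_. \<zero>\<^bsub>k\<^esub>), add = (\<lambda>c d x. c x \<oplus>\<^bsub>k\<^esub> d x), smult = (\<lambda>a c x. a \<otimes>\<^bsub>k\<^esub> c x)\<rparr>"

definition delta :: "'k ring \<Rightarrow> 'x \<Rightarrow> 'x \<Rightarrow> 'k" where
  "delta k x = (\<lambda>y. if y = x then \<one>\<^bsub>k\<^esub> else \<zero>\<^bsub>k\<^esub>)"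

definition presented :: "'k ring \<Rightarrow> 'x set \<Rightarrow> ('x \<Rightarrow> 'k) set \<Rightarrow> ('k, ('x \<Rightarrow> 'k) set) module" where
  "presented k X R = quot_module (free_module k X) (lin_span k (free_module k X) R)"

definition gen :: "'k ring \<Rightarrow> 'x set \<Rightarrow> ('x \<Rightarrow> 'k) set \<Rightarrow> 'x \<Rightarrow> ('x \<Rightarrow> 'k) set" where
  "gen k X R x = lin_span k (free_module k X) R +>\<^bsub>free_module k X\<^esub> delta k x"

text \<open>The map \<open>presented k X R \<rightarrow> W\<close> induced by a map \<open>f\<close> on generators that respects the relations
  \<open>R\<close>.  All formulas in Sweedler notation are written with it:
  \<open>\<Sum> f(h\<^sub>(\<^sub>1\<^sub>), h\<^sub>(\<^sub>2\<^sub>))\<close> is \<open>lift k W (\<lambda>hs. f (hs ! 0) (hs ! 1)) (\<Delta> h)\<close>.\<close>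

definition lift ::
    "'k ring \<Rightarrow> ('k, 'w, 'z) module_scheme \<Rightarrow> ('x \<Rightarrow> 'w) \<Rightarrow> ('x \<Rightarrow> 'k) set \<Rightarrow> 'w" where
  "lift k W f = on_coset (\<lambda>c. \<Oplus>\<^bsub>W\<^esub>x\<in>{x. c x \<noteq> \<zero>\<^bsub>k\<^esub>}. c x \<odot>\<^bsub>W\<^esub> f x)"

text \<open>
  The tensor power \<open>V\<^sup>\<otimes>\<^sup>n\<close>, generated by words of length \<open>n\<close> in \<open>V\<close>; in this way all tensor powers
  of \<open>V\<close> live in one type.  The word \<open>[v\<^sub>1, \<dots>, v\<^sub>n]\<close> stands for \<open>v\<^sub>1 \<otimes> \<dots> \<otimes> v\<^sub>n\<close>.
\<close>

definition words :: "('k, 'v, 'x) module_scheme \<Rightarrow> nat \<Rightarrow> 'v list set" where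
  "words V n = {vs. length vs = n \<and> set vs \<subseteq> carrier V}"

definition multilinear_rels ::
    "'k ring \<Rightarrow> ('k, 'v, 'x) module_scheme \<Rightarrow> nat \<Rightarrow> ('v list \<Rightarrow> 'k) set" where
  "multilinear_rels k V n =
     (let F = free_module k (words V n) in
       {delta k (vs[i := x \<oplus>\<^bsub>V\<^esub> y]) \<ominus>\<^bsub>F\<^esub> (delta k (vs[i := x]) \<oplus>\<^bsub>F\<^esub> delta k (vs[i := y])) | vs i x y.
          vs \<in> words V n \<and> i < n \<and> x \<in> carrier V \<and> y \<in> carrier V} \<union>
       {delta k (vs[i := a \<odot>\<^bsub>V\<^esub> x]) \<ominus>\<^bsub>F\<^esub> (a \<odot>\<^bsub>F\<^esub> delta k (vs[i := x])) | vs i a x.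
          vs \<in> words V n \<and> i < n \<and> a \<in> carrier k \<and> x \<in> carrier V})"

definition tpow ::
    "'k ring \<Rightarrow> ('k, 'v, 'x) module_scheme \<Rightarrow> nat \<Rightarrow> ('k, ('v list \<Rightarrow> 'k) set) module" where
  "tpow k V n = presented k (words V n) (multilinear_rels k V n)"

definition ptens :: "'k ring \<Rightarrow> ('k, 'v, 'x) module_scheme \<Rightarrow> 'v list \<Rightarrow> ('v list \<Rightarrow> 'k) set" where
  "ptens k V vs = gen k (words V (length vs)) (multilinear_rels k V (length vs)) vs"

definition bilinear_rels ::
    "'k ring \<Rightarrow> ('k, 'v, 'x) module_scheme \<Rightarrow> ('k, 'w, 'y) module_scheme \<Rightarrow> ('v \<times> 'w \<Rightarrow> 'k) set" where
  "bilinear_rels k V W =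
     (let F = free_module k (carrier V \<times> carrier W) in
       {delta k (x \<oplus>\<^bsub>V\<^esub> x', y) \<ominus>\<^bsub>F\<^esub> (delta k (x, y) \<oplus>\<^bsub>F\<^esub> delta k (x', y)) | x x' y.
          x \<in> carrier V \<and> x' \<in> carrier V \<and> y \<in> carrier W} \<union>
       {delta k (x, y \<oplus>\<^bsub>W\<^esub> y') \<ominus>\<^bsub>F\<^esub> (delta k (x, y) \<oplus>\<^bsub>F\<^esub> delta k (x, y')) | x y y'.
          x \<in> carrier V \<and> y \<in> carrier W \<and> y' \<in> carrier W} \<union>
       {delta k (a \<odot>\<^bsub>V\<^esub> x, y) \<ominus>\<^bsub>F\<^esub> (a \<odot>\<^bsub>F\<^esub> delta k (x, y)) | a x y.
          a \<in> carrier k \<and> x \<in> carrier V \<and> y \<in> carrier W} \<union>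
       {delta k (x, a \<odot>\<^bsub>W\<^esub> y) \<ominus>\<^bsub>F\<^esub> (a \<odot>\<^bsub>F\<^esub> delta k (x, y)) | a x y.
          a \<in> carrier k \<and> x \<in> carrier V \<and> y \<in> carrier W})"

definition tensor ::
    "'k ring \<Rightarrow> ('k, 'v, 'x) module_scheme \<Rightarrow> ('k, 'w, 'y) module_scheme \<Rightarrow>
       ('k, ('v \<times> 'w \<Rightarrow> 'k) set) module" where
  "tensor k V W = presented k (carrier V \<times> carrier W) (bilinear_rels k V W)"

definition tens ::
    "'k ring \<Rightarrow> ('k, 'v, 'x) module_scheme \<Rightarrow> ('k, 'w, 'y) module_scheme \<Rightarrow>
       'v \<Rightarrow> 'w \<Rightarrow> ('v \<times> 'w \<Rightarrow> 'k) set" where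
  "tens k V W x y = gen k (carrier V \<times> carrier W) (bilinear_rels k V W) (x, y)"


section \<open>Algebras and their modules\<close>

locale assoc_algebra = module k A + ring A for k :: "'k ring" and A :: "('k, 'a, 'z) module_scheme" +
  assumes smult_mult_left:
      "\<lbrakk>c \<in> carrier k; x \<in> carrier A; y \<in> carrier A\<rbrakk> \<Longrightarrow> (c \<odot>\<^bsub>A\<^esub> x) \<otimes>\<^bsub>A\<^esub> y = c \<odot>\<^bsub>A\<^esub> (x \<otimes>\<^bsub>A\<^esub> y)"
    and smult_mult_right:
      "\<lbrakk>c \<in> carrier k; x \<in> carrier A; y \<in> carrier A\<rbrakk> \<Longrightarrow> x \<otimes>\<^bsub>A\<^esub> (c \<odot>\<^bsub>A\<^esub> y) = c \<odot>\<^bsub>A\<^esub> (x \<otimes>\<^bsub>A\<^esub> y)"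

record ('k, 'a, 'x) rmodule = "('k, 'x) module" +
  ract :: "'x \<Rightarrow> 'a \<Rightarrow> 'x"

record ('k, 'a, 'm) lmodule = "('k, 'm) module" +
  lact :: "'a \<Rightarrow> 'm \<Rightarrow> 'm"

locale right_module = module k X
  for k :: "'k ring" and A :: "('k, 'a, 'z) module_scheme" and X :: "('k, 'a, 'x, 'y) rmodule_scheme" +
  assumes ract_linear_module: "a \<in> carrier A \<Longrightarrow> linear_map k X X (\<lambda>x. ract X x a)"
    and ract_linear_algebra: "x \<in> carrier X \<Longrightarrow> linear_map k A X (\<lambda>a. ract X x a)"
    and ract_mult: "\<lbrakk>x \<in> carrier X; a \<in> carrier A; b \<in> carrier A\<rbrakk> \<Longrightarrow>
          ract X x (a \<otimes>\<^bsub>A\<^esub> b) = ract X (ract X x a) b"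
    and ract_one: "x \<in> carrier X \<Longrightarrow> ract X x \<one>\<^bsub>A\<^esub> = x"

locale left_module = module k M
  for k :: "'k ring" and A :: "('k, 'a, 'z) module_scheme" and M :: "('k, 'a, 'm, 'y) lmodule_scheme" +
  assumes lact_linear_module: "a \<in> carrier A \<Longrightarrow> linear_map k M M (\<lambda>m. lact M a m)"
    and lact_linear_algebra: "m \<in> carrier M \<Longrightarrow> linear_map k A M (\<lambda>a. lact M a m)"
    and lact_mult: "\<lbrakk>m \<in> carrier M; a \<in> carrier A; b \<in> carrier A\<rbrakk> \<Longrightarrow>
          lact M (a \<otimes>\<^bsub>A\<^esub> b) m = lact M a (lact M b m)"
    and lact_one: "m \<in> carrier M \<Longrightarrow> lact M \<one>\<^bsub>A\<^esub> m = m"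

definition rmodule_map ::
    "'k ring \<Rightarrow> ('k, 'a, 'z) module_scheme \<Rightarrow> ('k, 'a, 'x, 'u) rmodule_scheme \<Rightarrow>
       ('k, 'a, 'y, 'v) rmodule_scheme \<Rightarrow> ('x \<Rightarrow> 'y) \<Rightarrow> bool" where
  "rmodule_map k A X Y f \<longleftrightarrow>
     linear_map k X Y f \<and> (\<forall>x\<in>carrier X. \<forall>a\<in>carrier A. f (ract X x a) = ract Y (f x) a)"

text \<open>\<open>X \<otimes>\<^sub>A M\<close>\<close>

definition over_rels ::
    "'k ring \<Rightarrow> ('k, 'a, 'z) module_scheme \<Rightarrow> ('k, 'a, 'x, 'u) rmodule_scheme \<Rightarrow>
       ('k, 'a, 'm, 'v) lmodule_scheme \<Rightarrow> ('x \<times> 'm \<Rightarrow> 'k) set" where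
  "over_rels k A X M =
     bilinear_rels k X M \<union>
     {delta k (ract X x a, m) \<ominus>\<^bsub>free_module k (carrier X \<times> carrier M)\<^esub> delta k (x, lact M a m) | x a m.
        x \<in> carrier X \<and> a \<in> carrier A \<and> m \<in> carrier M}"

definition tensor_over ::
    "'k ring \<Rightarrow> ('k, 'a, 'z) module_scheme \<Rightarrow> ('k, 'a, 'x, 'u) rmodule_scheme \<Rightarrow>
       ('k, 'a, 'm, 'v) lmodule_scheme \<Rightarrow> ('k, ('x \<times> 'm \<Rightarrow> 'k) set) module" where
  "tensor_over k A X M = presented k (carrier X \<times> carrier M) (over_rels k A X M)"

definition tens_over ::
    "'k ring \<Rightarrow> ('k, 'a, 'z) module_scheme \<Rightarrow> ('k, 'a, 'x, 'u) rmodule_scheme \<Rightarrow>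
       ('k, 'a, 'm, 'v) lmodule_scheme \<Rightarrow> 'x \<Rightarrow> 'm \<Rightarrow> ('x \<times> 'm \<Rightarrow> 'k) set" where
  "tens_over k A X M x m = gen k (carrier X \<times> carrier M) (over_rels k A X M) (x, m)"

text \<open>A ring is semisimple if it is, as a left module over itself, an (internal) direct sum of
  simple submodules, that is, of minimal left ideals.\<close>

definition left_ideal :: "('a, 'z) ring_scheme \<Rightarrow> 'a set \<Rightarrow> bool" where
  "left_ideal R L \<longleftrightarrow>
     additive_subgroup L R \<and> (\<forall>a\<in>carrier R. \<forall>x\<in>L. a \<otimes>\<^bsub>R\<^esub> x \<in> L)"

definition minimal_left_ideal :: "('a, 'z) ring_scheme \<Rightarrow> 'a set \<Rightarrow> bool" where
  "minimal_left_ideal R L \<longleftrightarrow>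
     left_ideal R L \<and> L \<noteq> {\<zero>\<^bsub>R\<^esub>} \<and> (\<forall>J. left_ideal R J \<and> J \<subseteq> L \<longrightarrow> J = {\<zero>\<^bsub>R\<^esub>} \<or> J = L)"

definition semisimple_ring :: "('a, 'z) ring_scheme \<Rightarrow> bool" where
  "semisimple_ring R \<longleftrightarrow>
     (\<exists>\<L>. (\<forall>L\<in>\<L>. minimal_left_ideal R L) \<and>
          (\<forall>x\<in>carrier R. \<exists>!f. f \<in> (\<Pi>\<^sub>E L\<in>\<L>. L) \<and> finite {L\<in>\<L>. f L \<noteq> \<zero>\<^bsub>R\<^esub>} \<and>
             x = (\<Oplus>\<^bsub>R\<^esub>L\<in>{L\<in>\<L>. f L \<noteq> \<zero>\<^bsub>R\<^esub>}. f L)))"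


section \<open>Chain complexes and Tor\<close>

text \<open>A chain complex in nonnegative degrees is given by \<open>C n\<close> and \<open>d n : C n \<rightarrow> C (n - 1)\<close> for
  \<open>n \<ge> 1\<close>; the value of \<open>d 0\<close> is never used.\<close>

definition homology ::
    "(nat \<Rightarrow> ('k, 'c, 'z) module_scheme) \<Rightarrow> (nat \<Rightarrow> 'c \<Rightarrow> 'c) \<Rightarrow> nat \<Rightarrow> ('k, 'c set) module" where
  "homology C d n =
     quot_module (C n \<lparr>carrier := {x \<in> carrier (C n). n = 0 \<or> d n x = \<zero>\<^bsub>C (n - 1)\<^esub>}\<rparr>)
       (d (Suc n) ` carrier (C (Suc n)))"

definition free_rmodule :: "('k, 'a, 'z) module_scheme \<Rightarrow> 'b set \<Rightarrow> ('k, 'a, 'b \<Rightarrow> 'a) rmodule" where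
  "free_rmodule A B =
     module.extend (direct_sum B (\<lambda>_. A)) (rmodule.fields (\<lambda>c a. \<lambda>b\<in>B. c b \<otimes>\<^bsub>A\<^esub> a))"

text \<open>Projective modules are the direct summands of free modules.  It is no restriction to take the
  basis of the free module in the type of elements of \<open>X\<close>: the carrier of \<open>X\<close> can serve as a basis.\<close>

definition projective_rmodule ::
    "'k ring \<Rightarrow> ('k, 'a, 'z) module_scheme \<Rightarrow> ('k, 'a, 'x, 'u) rmodule_scheme \<Rightarrow> bool" where
  "projective_rmodule k A X \<longleftrightarrow>
     right_module k A X \<and>
     (\<exists>(B :: 'x set) i p. rmodule_map k A X (free_rmodule A B) i \<and>
        rmodule_map k A (free_rmodule A B) X p \<and> (\<forall>x\<in>carrier X. p (i x) = x))"

definition projective_resolution ::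
    "'k ring \<Rightarrow> ('k, 'a, 'z) module_scheme \<Rightarrow> ('k, 'a, 'r, 'u) rmodule_scheme \<Rightarrow>
       (nat \<Rightarrow> ('k, 'a, 'x, 'v) rmodule_scheme) \<Rightarrow> (nat \<Rightarrow> 'x \<Rightarrow> 'x) \<Rightarrow> ('x \<Rightarrow> 'r) \<Rightarrow> bool" where
  "projective_resolution k A R P d e \<longleftrightarrow>
     (\<forall>n. projective_rmodule k A (P n)) \<and>
     (\<forall>n. rmodule_map k A (P (Suc n)) (P n) (d (Suc n))) \<and>
     rmodule_map k A (P 0) R e \<and>
     e ` carrier (P 0) = carrier R \<and>
     {x \<in> carrier (P 0). e x = \<zero>\<^bsub>R\<^esub>} = d 1 ` carrier (P 1) \<and>
     (\<forall>n\<ge>1. {x \<in> carrier (P n). d n x = \<zero>\<^bsub>P (n - 1)\<^esub>} = d (Suc n) ` carrier (P (Suc n)))"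

text \<open>\<open>Tor\<^sub>j\<^sup>A(R, M)\<close>, as the homology of \<open>P \<otimes>\<^sub>A M\<close> for a projective resolution
  \<open>P\<close>, \<open>d\<close> of the right \<open>A\<close>-module \<open>R\<close>.  The module \<open>R\<close> enters only through \<open>P\<close>: statements about
  \<open>Tor\<close> are made for an arbitrary \<open>P\<close> with \<open>projective_resolution k A R P d e\<close>.\<close>

definition Tor ::
    "'k ring \<Rightarrow> ('k, 'a, 'z) module_scheme \<Rightarrow> (nat \<Rightarrow> ('k, 'a, 'x, 'u) rmodule_scheme) \<Rightarrow>
       (nat \<Rightarrow> 'x \<Rightarrow> 'x) \<Rightarrow> ('k, 'a, 'm, 'v) lmodule_scheme \<Rightarrow> int \<Rightarrow>
       ('k, ('x \<times> 'm \<Rightarrow> 'k) set set) module" where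
  "Tor k A P d M j =
     (if j < 0 then zero_module
      else homology (\<lambda>n. tensor_over k A (P n) M)
             (\<lambda>n. lift k (tensor_over k A (P (n - 1)) M)
                    (\<lambda>(x, m). tens_over k A (P (n - 1)) M (d n x) m))
             (nat j))"


section \<open>Cyclic objects and cyclic homology\<close>

record ('k, 'c) cyclic_object =
  obj :: "nat \<Rightarrow> ('k, 'c) module"
  face :: "nat \<Rightarrow> nat \<Rightarrow> 'c \<Rightarrow> 'c"
  degen :: "nat \<Rightarrow> nat \<Rightarrow> 'c \<Rightarrow> 'c"
  cyc :: "nat \<Rightarrow> 'c \<Rightarrow> 'c"

definition signed :: "('k, 'v, 'x) module_scheme \<Rightarrow> nat \<Rightarrow> 'v \<Rightarrow> 'v" where
  "signed V n x = (if even n then x else \<ominus>\<^bsub>V\<^esub> x)"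

definition hochschild_b :: "('k, 'c) cyclic_object \<Rightarrow> nat \<Rightarrow> 'c \<Rightarrow> 'c" where
  "hochschild_b Z n x = (\<Oplus>\<^bsub>obj Z (n - 1)\<^esub>i\<in>{..n}. signed (obj Z (n - 1)) i (face Z n i x))"

definition hochschild_b' :: "('k, 'c) cyclic_object \<Rightarrow> nat \<Rightarrow> 'c \<Rightarrow> 'c" where
  "hochschild_b' Z n x = (\<Oplus>\<^bsub>obj Z (n - 1)\<^esub>i\<in>{..<n}. signed (obj Z (n - 1)) i (face Z n i x))"

definition signed_cyc :: "('k, 'c) cyclic_object \<Rightarrow> nat \<Rightarrow> 'c \<Rightarrow> 'c" where
  "signed_cyc Z n x = signed (obj Z n) n (cyc Z n x)"

definition cyclic_norm :: "('k, 'c) cyclic_object \<Rightarrow> nat \<Rightarrow> 'c \<Rightarrow> 'c" where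
  "cyclic_norm Z n x = (\<Oplus>\<^bsub>obj Z n\<^esub>j\<in>{..n}. (signed_cyc Z n ^^ j) x)"

text \<open>
  The Tsygan double complex has \<open>obj Z q\<close> in bidegree \<open>(p, q)\<close>; the vertical differential is \<open>b\<close> in
  even columns and \<open>-b'\<close> in odd columns, and the horizontal differentials are \<open>1 - t\<close> (from odd to
  even columns) and \<open>N\<close> (from even to odd columns), where \<open>t = (-1)\<^sup>n \<tau>\<^sub>n\<close>.
\<close>

definition tsygan_vert :: "('k, 'c) cyclic_object \<Rightarrow> nat \<Rightarrow> nat \<Rightarrow> 'c \<Rightarrow> 'c" where
  "tsygan_vert Z p q x =
     (if even p then hochschild_b Z q x else \<ominus>\<^bsub>obj Z (q - 1)\<^esub> hochschild_b' Z q x)"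

definition tsygan_hor :: "('k, 'c) cyclic_object \<Rightarrow> nat \<Rightarrow> nat \<Rightarrow> 'c \<Rightarrow> 'c" where
  "tsygan_hor Z p q x = (if odd p then x \<ominus>\<^bsub>obj Z q\<^esub> signed_cyc Z q x else cyclic_norm Z q x)"

definition tsygan_tot :: "('k, 'c) cyclic_object \<Rightarrow> nat \<Rightarrow> ('k, nat \<times> nat \<Rightarrow> 'c) module" where
  "tsygan_tot Z n = direct_sum {(p, q). p + q = n} (\<lambda>(p, q). obj Z q)"

definition tsygan_diff ::
    "('k, 'c) cyclic_object \<Rightarrow> nat \<Rightarrow> (nat \<times> nat \<Rightarrow> 'c) \<Rightarrow> (nat \<times> nat \<Rightarrow> 'c)" where
  "tsygan_diff Z n f =
     restrict (\<lambda>(p, q). tsygan_vert Z p (Suc q) (f (p, Suc q)) \<oplus>\<^bsub>obj Z q\<^esub>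
                        tsygan_hor Z (Suc p) q (f (Suc p, q)))
       {(p, q). p + q = n - 1}"

definition cyclic_homology ::
    "('k, 'c) cyclic_object \<Rightarrow> nat \<Rightarrow> ('k, (nat \<times> nat \<Rightarrow> 'c) set) module" where
  "cyclic_homology Z n = homology (tsygan_tot Z) (tsygan_diff Z) n"


section \<open>Hopf algebras\<close>

record ('k, 'h) hopf = "('k, 'h) module" +
  comult :: "'h \<Rightarrow> ('h list \<Rightarrow> 'k) set"
  counit :: "'h \<Rightarrow> 'k"
  antipode :: "'h \<Rightarrow> 'h"

text \<open>The map \<open>H\<^sup>\<otimes>\<^sup>n\<^sup>+\<^sup>1 \<rightarrow> H\<^sup>\<otimes>\<^sup>n\<^sup>+\<^sup>2\<close> applying \<open>\<Delta>\<close> to the tensor factor number \<open>i\<close>, \<open>0 \<le> i \<le> n\<close>.\<close>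

definition comult_at ::
    "'k ring \<Rightarrow> ('k, 'h) hopf \<Rightarrow> nat \<Rightarrow> nat \<Rightarrow> ('h list \<Rightarrow> 'k) set \<Rightarrow> ('h list \<Rightarrow> 'k) set" where
  "comult_at k H n i =
     lift k (tpow k H (n + 2))
       (\<lambda>hs. lift k (tpow k H (n + 2))
          (\<lambda>ab. ptens k H (take i hs @ ab @ drop (Suc i) hs)) (comult H (hs ! i)))"

text \<open>\<open>\<Sum> h\<^sub>(\<^sub>1\<^sub>) \<otimes> \<dots> \<otimes> h\<^sub>(\<^sub>n\<^sub>+\<^sub>1\<^sub>)\<close>\<close>

primrec iter_comult :: "'k ring \<Rightarrow> ('k, 'h) hopf \<Rightarrow> nat \<Rightarrow> 'h \<Rightarrow> ('h list \<Rightarrow> 'k) set" where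
  "iter_comult k H 0 h = ptens k H [h]"
| "iter_comult k H (Suc n) h = comult_at k H n n (iter_comult k H n h)"

text \<open>The product of the algebra \<open>H\<^sup>\<otimes>\<^sup>n\<close>.\<close>

definition tpow_mult ::
    "'k ring \<Rightarrow> ('k, 'h) hopf \<Rightarrow> nat \<Rightarrow> ('h list \<Rightarrow> 'k) set \<Rightarrow> ('h list \<Rightarrow> 'k) set \<Rightarrow>
       ('h list \<Rightarrow> 'k) set" where
  "tpow_mult k H n s t =
     lift k (tpow k H n)
       (\<lambda>as. lift k (tpow k H n) (\<lambda>bs. ptens k H (map2 (\<lambda>a b. a \<otimes>\<^bsub>H\<^esub> b) as bs)) t) s"

locale hopf_algebra = assoc_algebra k H for k :: "'k ring" and H :: "('k, 'h) hopf" +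
  assumes comult_linear: "linear_map k H (tpow k H 2) (comult H)"
    and counit_linear: "linear_map k H (ground_module k) (counit H)"
    and antipode_linear: "linear_map k H H (antipode H)"
    and coassoc: "h \<in> carrier H \<Longrightarrow>
          comult_at k H 1 0 (comult H h) = comult_at k H 1 1 (comult H h)"
    and counit_left: "h \<in> carrier H \<Longrightarrow>
          lift k H (\<lambda>hs. counit H (hs ! 0) \<odot>\<^bsub>H\<^esub> hs ! 1) (comult H h) = h"
    and counit_right: "h \<in> carrier H \<Longrightarrow>
          lift k H (\<lambda>hs. counit H (hs ! 1) \<odot>\<^bsub>H\<^esub> hs ! 0) (comult H h) = h"
    and comult_mult: "\<lbrakk>g \<in> carrier H; h \<in> carrier H\<rbrakk> \<Longrightarrow>
          comult H (g \<otimes>\<^bsub>H\<^esub> h) = tpow_mult k H 2 (comult H g) (comult H h)"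
    and comult_one: "comult H \<one>\<^bsub>H\<^esub> = ptens k H [\<one>\<^bsub>H\<^esub>, \<one>\<^bsub>H\<^esub>]"
    and counit_mult: "\<lbrakk>g \<in> carrier H; h \<in> carrier H\<rbrakk> \<Longrightarrow>
          counit H (g \<otimes>\<^bsub>H\<^esub> h) = counit H g \<otimes>\<^bsub>k\<^esub> counit H h"
    and counit_one: "counit H \<one>\<^bsub>H\<^esub> = \<one>\<^bsub>k\<^esub>"
    and antipode_left: "h \<in> carrier H \<Longrightarrow>
          lift k H (\<lambda>hs. antipode H (hs ! 0) \<otimes>\<^bsub>H\<^esub> hs ! 1) (comult H h) = counit H h \<odot>\<^bsub>H\<^esub> \<one>\<^bsub>H\<^esub>"
    and antipode_right: "h \<in> carrier H \<Longrightarrow>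
          lift k H (\<lambda>hs. hs ! 0 \<otimes>\<^bsub>H\<^esub> antipode H (hs ! 1)) (comult H h) = counit H h \<odot>\<^bsub>H\<^esub> \<one>\<^bsub>H\<^esub>"

definition cocommutative :: "'k ring \<Rightarrow> ('k, 'h) hopf \<Rightarrow> bool" where
  "cocommutative k H \<longleftrightarrow>
     (\<forall>h\<in>carrier H. lift k (tpow k H 2) (\<lambda>hs. ptens k H [hs ! 1, hs ! 0]) (comult H h) = comult H h)"

text \<open>\<open>K \<otimes> K\<close> is regarded as a subspace of \<open>H \<otimes> H\<close>.\<close>

definition hopf_subalgebra :: "'k ring \<Rightarrow> ('k, 'h) hopf \<Rightarrow> 'h set \<Rightarrow> bool" where
  "hopf_subalgebra k H K \<longleftrightarrow>
     submodule K k H \<and> \<one>\<^bsub>H\<^esub> \<in> K \<and>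
     (\<forall>x\<in>K. \<forall>y\<in>K. x \<otimes>\<^bsub>H\<^esub> y \<in> K) \<and>
     (\<forall>x\<in>K. comult H x \<in> lin_span k (tpow k H 2) {ptens k H [a, b] | a b. a \<in> K \<and> b \<in> K}) \<and>
     (\<forall>x\<in>K. antipode H x \<in> K)"

definition aug :: "'k ring \<Rightarrow> ('k, 'h) hopf \<Rightarrow> 'h set \<Rightarrow> 'h set" where
  "aug k H K = {x \<in> K. counit H x = \<zero>\<^bsub>k\<^esub>}"

text \<open>\<open>K\<^sub>+H\<close>\<close>

definition aug_ideal :: "'k ring \<Rightarrow> ('k, 'h) hopf \<Rightarrow> 'h set \<Rightarrow> 'h set" where
  "aug_ideal k H K = lin_span k H {x \<otimes>\<^bsub>H\<^esub> h | x h. x \<in> aug k H K \<and> h \<in> carrier H}"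

definition normal_hopf_subalgebra :: "'k ring \<Rightarrow> ('k, 'h) hopf \<Rightarrow> 'h set \<Rightarrow> bool" where
  "normal_hopf_subalgebra k H K \<longleftrightarrow> hopf_subalgebra k H K \<and> ideal (aug_ideal k H K) H"

text \<open>\<open>H / K\<^sub>+H\<close>\<close>

definition quot_hopf :: "'k ring \<Rightarrow> ('k, 'h) hopf \<Rightarrow> 'h set \<Rightarrow> ('k, 'h set) hopf" where
  "quot_hopf k H K =
     (let I = aug_ideal k H K; Q = quot_module H I in
        module.extend Q (hopf.fields
          (on_coset (\<lambda>h. lift k (tpow k Q 2) (\<lambda>hs. ptens k Q (map (\<lambda>a. I +>\<^bsub>H\<^esub> a) hs)) (comult H h)))
          (on_coset (counit H))
          (on_coset (\<lambda>h. I +>\<^bsub>H\<^esub> antipode H h))))"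

definition trivial_rmodule :: "'k ring \<Rightarrow> ('k, 'h) hopf \<Rightarrow> ('k, 'h, 'k) rmodule" where
  "trivial_rmodule k H =
     module.extend (ground_module k) (rmodule.fields (\<lambda>c h. c \<otimes>\<^bsub>k\<^esub> counit H h))"


section \<open>Crossed modules and the cyclic object \<open>Z\<^sub>*(H, M)\<close>\<close>

record ('k, 'h, 'm) crossed = "('k, 'h, 'm) lmodule" +
  coact :: "'m \<Rightarrow> ('m \<times> 'h \<Rightarrow> 'k) set"

locale crossed_module = left_module k H M
  for k :: "'k ring" and H :: "('k, 'h) hopf" and M :: "('k, 'h, 'm) crossed" +
  assumes coact_linear: "linear_map k M (tensor k M H) (coact M)"
    and coact_coassoc: "m \<in> carrier M \<Longrightarrow>
          lift k (tensor k M (tpow k H 2))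
            (\<lambda>(m0, h). lift k (tensor k M (tpow k H 2))
               (\<lambda>(m00, h'). tens k M (tpow k H 2) m00 (ptens k H [h', h])) (coact M m0)) (coact M m) =
          lift k (tensor k M (tpow k H 2))
            (\<lambda>(m0, h). tens k M (tpow k H 2) m0 (comult H h)) (coact M m)"
    and coact_counit: "m \<in> carrier M \<Longrightarrow>
          lift k M (\<lambda>(m0, h). counit H h \<odot>\<^bsub>M\<^esub> m0) (coact M m) = m"
    and coact_lact: "\<lbrakk>h \<in> carrier H; m \<in> carrier M\<rbrakk> \<Longrightarrow>
          coact M (lact M h m) =
          lift k (tensor k M H)
            (\<lambda>hs. lift k (tensor k M H)
               (\<lambda>(m0, m1). tens k M H (lact M (hs ! 1) m0)
                              (hs ! 2 \<otimes>\<^bsub>H\<^esub> m1 \<otimes>\<^bsub>H\<^esub> antipode H (hs ! 0))) (coact M m))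
            (iter_comult k H 2 h)"

locale modular_crossed_module = crossed_module k H M
  for k :: "'k ring" and H :: "('k, 'h) hopf" and M :: "('k, 'h, 'm) crossed" +
  assumes modular: "m \<in> carrier M \<Longrightarrow> lift k M (\<lambda>(m0, m1). lact M m1 m0) (coact M m) = m"

text \<open>\<open>\<rho>(M) \<subseteq> M \<otimes> K\<close>, where \<open>M \<otimes> K\<close> is regarded as a subspace of \<open>M \<otimes> H\<close>.\<close>

definition coact_within :: "'k ring \<Rightarrow> ('k, 'h) hopf \<Rightarrow> 'h set \<Rightarrow> ('k, 'h, 'm) crossed \<Rightarrow> bool" where
  "coact_within k H K M \<longleftrightarrow>
     coact M ` carrier M \<subseteq> lin_span k (tensor k M H) {tens k M H m x | m x. m \<in> carrier M \<and> x \<in> K}"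

text \<open>\<open>K\<^sub>+M\<close> and the crossed module \<open>M / K\<^sub>+M\<close> over \<open>H / K\<^sub>+H\<close>.\<close>

definition aug_submodule :: "'k ring \<Rightarrow> ('k, 'h) hopf \<Rightarrow> 'h set \<Rightarrow> ('k, 'h, 'm) crossed \<Rightarrow> 'm set" where
  "aug_submodule k H K M = lin_span k M {lact M x m | x m. x \<in> aug k H K \<and> m \<in> carrier M}"

definition quot_crossed ::
    "'k ring \<Rightarrow> ('k, 'h) hopf \<Rightarrow> 'h set \<Rightarrow> ('k, 'h, 'm) crossed \<Rightarrow> ('k, 'h set, 'm set) crossed" where
  "quot_crossed k H K M =
     (let I = aug_ideal k H K; Q = quot_hopf k H K; N = aug_submodule k H K M; V = quot_module M N in
        lmodule.extend
          (module.extend V (lmodule.fields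
             (\<lambda>X Y. on_coset (\<lambda>(h, m). N +>\<^bsub>M\<^esub> lact M h m) (X \<times> Y))))
          (crossed.fields
             (on_coset (\<lambda>m. lift k (tensor k V Q)
                (\<lambda>(m0, h). tens k V Q (N +>\<^bsub>M\<^esub> m0) (I +>\<^bsub>H\<^esub> h)) (coact M m)))))"

text \<open>\<open>H\<^sup>\<otimes>\<^sup>n\<^sup>+\<^sup>1\<close> as a right \<open>H\<close>-module by the diagonal action.\<close>

definition diag_module ::
    "'k ring \<Rightarrow> ('k, 'h) hopf \<Rightarrow> nat \<Rightarrow> ('k, 'h, ('h list \<Rightarrow> 'k) set) rmodule" where
  "diag_module k H n =
     module.extend (tpow k H (Suc n))
       (rmodule.fields (\<lambda>t h. tpow_mult k H (Suc n) t (iter_comult k H n h)))"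

definition Z_obj ::
    "'k ring \<Rightarrow> ('k, 'h) hopf \<Rightarrow> ('k, 'h, 'm) crossed \<Rightarrow> nat \<Rightarrow>
       ('k, (('h list \<Rightarrow> 'k) set \<times> 'm \<Rightarrow> 'k) set) module" where
  "Z_obj k H M n = tensor_over k H (diag_module k H n) M"

text \<open>\<open>t \<otimes>\<^sub>H m\<close> in degree \<open>n\<close>\<close>

definition Z_tens ::
    "'k ring \<Rightarrow> ('k, 'h) hopf \<Rightarrow> ('k, 'h, 'm) crossed \<Rightarrow> nat \<Rightarrow>
       ('h list \<Rightarrow> 'k) set \<Rightarrow> 'm \<Rightarrow> (('h list \<Rightarrow> 'k) set \<times> 'm \<Rightarrow> 'k) set" where
  "Z_tens k H M n t m = tens_over k H (diag_module k H n) M t m"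

definition Z_cyclic ::
    "'k ring \<Rightarrow> ('k, 'h) hopf \<Rightarrow> ('k, 'h, 'm) crossed \<Rightarrow>
       ('k, (('h list \<Rightarrow> 'k) set \<times> 'm \<Rightarrow> 'k) set) cyclic_object" where
  "Z_cyclic k H M =
     \<lparr>obj = Z_obj k H M,
      face = (\<lambda>n i. lift k (Z_obj k H M (n - 1))
        (\<lambda>(t, m). Z_tens k H M (n - 1)
           (lift k (tpow k H n)
              (\<lambda>hs. counit H (hs ! i) \<odot>\<^bsub>tpow k H n\<^esub> ptens k H (take i hs @ drop (Suc i) hs)) t) m)),
      degen = (\<lambda>n i. lift k (Z_obj k H M (Suc n))
        (\<lambda>(t, m). Z_tens k H M (Suc n) (comult_at k H n i t) m)),
      cyc = (\<lambda>n. lift k (Z_obj k H M n)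
        (\<lambda>(t, m). lift k (Z_obj k H M n)
           (\<lambda>(m0, m1). Z_tens k H M n
              (lift k (tpow k H (Suc n)) (\<lambda>hs. ptens k H ((hs ! n \<otimes>\<^bsub>H\<^esub> m1) # take n hs)) t) m0)
           (coact M m)))\<rparr>"

definition HC ::
    "'k ring \<Rightarrow> ('k, 'h) hopf \<Rightarrow> ('k, 'h, 'm) crossed \<Rightarrow> nat \<Rightarrow>
       ('k, (nat \<times> nat \<Rightarrow> (('h list \<Rightarrow> 'k) set \<times> 'm \<Rightarrow> 'k) set) set) module" where
  "HC k H M = cyclic_homology (Z_cyclic k H M)"

end

theory Submission
 imports Defs
begin

text \<open>
  Write \<open>Q = H / K\<^sub>+H\<close> and \<open>T\<^sub>n(A) = A\<^sup>\<otimes>\<^sup>n\<^sup>+\<^sup>1\<close>.  For a Hopf algebra \<open>A\<close> the complex \<open>T(A)\<close> is the standard resolution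
  of \<open>k\<close>; its terms are relatively free: the diagonal module \<open>T\<^sub>n(A)\<close> is isomorphic to \<open>A\<^sup>\<otimes>\<^sup>n \<otimes> A\<close> with \<open>A\<close>
  acting on the last factor.  By definition \<open>Z(H, M) = T(H) \<otimes>\<^sub>H M\<close>.

  Because \<open>Q\<close> is cocommutative, rotating the factors of \<open>T\<^sub>n(Q)\<close> is \<open>Q\<close>-linear, so that the Tsygan double complex
  of \<open>T(Q)\<close> consists of relatively free \<open>Q\<close>-modules.  Its total complex therefore maps to the resolution
  \<open>P\<close>, extending the identity of \<open>k\<close> (\<open>tsygan_to_resolution\<close>).  Compose this with \<open>T(H) \<rightarrow> T(Q)\<close> and tensor
  with \<open>M\<close>.  The cyclic operator of \<open>Z(H, M)\<close> multiplies by the component \<open>m\<^sub>1\<close> of the coaction; it lies in \<open>K\<close>, and in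
  \<open>Q\<close> an element of \<open>K\<close> is the scalar given by its counit.  So the twist disappears, and one obtains a map \<open>\<Phi>\<close>
  from the whole Tsygan double complex of \<open>Z(H, M)\<close> to \<open>P \<otimes>\<^sub>H M\<close> (\<open>Lm_vert\<close>, \<open>Lm_hor\<close>).

  In column \<open>0\<close> the map \<open>\<Phi>\<close> is a homology isomorphism: since \<open>K\<close> is semisimple it has an integral
  (\<open>integral_exists\<close>), hence projective \<open>Q\<close>-modules are projective over \<open>H\<close> (\<open>res_lifts\<close>) and the map
  \<open>T(H) \<rightarrow> P\<close> of resolutions has an inverse up to \<open>H\<close>-linear homotopy (\<open>comparison_exists\<close>).
  Moreover \<open>P \<otimes>\<^sub>H M = P \<otimes>\<^sub>Q (M / K\<^sub>+M)\<close> (\<open>base_change\<close>), which computes Tor.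

  It remains to see what such a \<open>\<Phi>\<close> says about cyclic homology.  The last degeneracy contracts \<open>b'\<close>, so the first two columns
  compute Hochschild homology, and the periodicity operator \<open>S\<close> shifts by two columns.  The maps \<open>\<Phi> \<circ> S\<^sup>i\<close>
  then split \<open>HC\<^sub>n\<close> into the homology groups of degree \<open>n - 2i\<close> (\<open>cyclic_homology_decomposition\<close>).
\<close>

section \<open>Notation\<close>

text \<open>In the infix forms the structure follows the operation in brackets.  They are for input only: the terms are
  those of the library.\<close>

abbreviation (input) rmod where "rmod \<equiv> right_module"
abbreviation (input) tov where "tov \<equiv> tensor_over"
abbreviation (input) tns where "tns \<equiv> tens_over"
abbreviation (input) Fr where "Fr \<equiv> free_module"
abbreviation (input) hb where "hb \<equiv> hochschild_b"
abbreviation (input) hb' where "hb' \<equiv> hochschild_b'"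
abbreviation (input) lmap where "lmap \<equiv> linear_map"
abbreviation (input) rmap where "rmap \<equiv> rmodule_map"
abbreviation (input) mem_carrier (infix "<:" 50) where "x <: V \<equiv> x \<in> carrier V"
abbreviation (input) add_in ("(_ +[_] _)" [65, 0, 66] 65) where "x +[V] y \<equiv> x \<oplus>\<^bsub>V\<^esub> y"
abbreviation (input) minus_in ("(_ -[_] _)" [65, 0, 66] 65) where "x -[V] y \<equiv> x \<ominus>\<^bsub>V\<^esub> y"
abbreviation (input) uminus_in ("(-[_] _)" [0, 81] 80) where "-[V] x \<equiv> \<ominus>\<^bsub>V\<^esub> x"
abbreviation (input) mult_in ("(_ *[_] _)" [70, 0, 71] 70) where "x *[A] y \<equiv> x \<otimes>\<^bsub>A\<^esub> y"
abbreviation (input) smult_in ("(_ .[_] _)" [70, 0, 71] 70) where "a .[V] x \<equiv> a \<odot>\<^bsub>V\<^esub> x"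
abbreviation (input) zero_in ("0[_]") where "0[V] \<equiv> \<zero>\<^bsub>V\<^esub>"
abbreviation (input) one_in ("1[_]") where "1[A] \<equiv> \<one>\<^bsub>A\<^esub>"

section \<open>Linear maps\<close>

lemma module_cring: "module k V ==> cring k"
 by (simp add: module_def)

lemma module_ab: "module k V ==> abelian_group V"
 by (simp add: module_def)

lemma (in abelian_group) minus_eq_zero_iff:
 assumes "x <: G" "y <: G"
 shows "x \<ominus> y = \<zero> \<longleftrightarrow> x = y"
proof
 assume "x \<ominus> y = \<zero>"
 then have "\<ominus> (\<ominus> y) = x" using assms by (intro minus_equality) (auto simp: a_minus_def)
 then show "x = y" using assms by simp
qed (use assms in \<open>simp add: a_minus_def r_neg\<close>)

lemma (in abelian_group) neg_zero [simp]: "\<ominus> \<zero> = \<zero>"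
 by (rule minus_equality) auto

lemma (in abelian_group) minus_zero_right [simp]: "x <: G ==> x \<ominus> \<zero> = x"
 by (simp add: a_minus_def)

lemma linI:
 assumes "!!x. x <: V ==> f x <: W"
  and "!!x y. x <: V ==> y <: V ==> f (x +[V] y) = f x +[W] f y"
  and "!!a x. a <: k ==> x <: V ==> f (a .[V] x) = a .[W] f x"
 shows "lmap k V W f"
 using assms by (auto simp: linear_map_def)

lemma lin_closed: "lmap k V W f ==> x <: V ==> f x <: W"
 by (auto simp: linear_map_def)

lemma lin_add:
 "lmap k V W f ==> x <: V ==> y <: V ==> f (x +[V] y) = f x +[W] f y"
 by (auto simp: linear_map_def)

lemma lin_smult:
 "lmap k V W f ==> a <: k ==> x <: V ==> f (a .[V] x) = a .[W] f x"
 by (auto simp: linear_map_def)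

lemma lin_cong:
 assumes "module k V" "!!x. x <: V ==> f x = g x"
 shows "lmap k V W f \<longleftrightarrow> lmap k V W g"
proof -
 interpret V: module k V by fact
 show ?thesis using assms(2) by (auto simp: linear_map_def Pi_def)
qed

lemma lin_zero:
 assumes "module k V" "module k W" "lmap k V W f"
 shows "f 0[V] = 0[W]"
proof -
 interpret V: module k V by fact
 interpret W: module k W by fact
 have "f (0[k] .[V] 0[V]) = 0[k] .[W] f 0[V]"
  by (rule lin_smult[OF assms(3)]) auto
 then show ?thesis using lin_closed[OF assms(3), of "0[V]"] by auto
qed

lemma lin_neg:
 assumes "module k V" "module k W" "lmap k V W f" "x <: V"
 shows "f (\<ominus>\<^bsub>V\<^esub> x) = -[W] f x"
proof -
 interpret V: module k V by fact
 interpret W: module k W by fact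
 have "f (\<ominus>\<^bsub>V\<^esub> x) +[W] f x = f (\<ominus>\<^bsub>V\<^esub> x +[V] x)"
  using lin_add[OF assms(3)] assms(4) by simp
 also have "... = 0[W]"
  using assms(4) lin_zero[OF assms(1-3)] by (simp add: V.l_neg)
 finally show ?thesis
  using assms(4) lin_closed[OF assms(3)] by (simp add: W.minus_equality)
qed

lemma lin_minus:
 assumes "module k V" "module k W" "lmap k V W f" "x <: V" "y <: V"
 shows "f (x -[V] y) = f x -[W] f y"
proof -
 interpret V: module k V by fact
 show ?thesis
  using assms lin_add[OF assms(3)] lin_neg[OF assms(1-3)]
  by (simp add: a_minus_def)
qed

lemma lin_finsum:
 assumes "module k V" "module k W" "lmap k V W f" "finite J" "g : J \<rightarrow> carrier V"
 shows "f (\<Oplus>\<^bsub>V\<^esub>j\<in>J. g j) = (\<Oplus>\<^bsub>W\<^esub>j\<in>J. f (g j))"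
proof -
 interpret V: module k V by fact
 interpret W: module k W by fact
 show ?thesis
  using assms(4,5)
 proof (induction J)
  case empty
  then show ?case using lin_zero[OF assms(1-3)] by simp
 next
  case (insert j J)
  have "f (\<Oplus>\<^bsub>V\<^esub>j\<in>insert j J. g j) = f (g j +[V] (\<Oplus>\<^bsub>V\<^esub>j\<in>J. g j))"
   using insert by (subst V.finsum_insert) auto
  also have "... = f (g j) +[W] f (\<Oplus>\<^bsub>V\<^esub>j\<in>J. g j)"
   using insert by (intro lin_add[OF assms(3)] V.finsum_closed) auto
  also have "... = f (g j) +[W] (\<Oplus>\<^bsub>W\<^esub>j\<in>J. f (g j))" using insert by auto
  also have "... = (\<Oplus>\<^bsub>W\<^esub>j\<in>insert j J. f (g j))"
   using insert lin_closed[OF assms(3)] by (subst W.finsum_insert) (auto simp: Pi_def)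
  finally show ?case .
 qed
qed

lemma lin_id: "lmap k V V (%x. x)"
 by (auto simp: linear_map_def)

lemma lin_comp:
 "lmap k V W f ==> lmap k U V g ==> lmap k U W (%x. f (g x))"
 by (auto simp: linear_map_def Pi_def)

lemma lin_const_zero:
 assumes "module k W"
 shows "lmap k V W (%x. 0[W])"
proof -
 interpret W: module k W by fact
 show ?thesis by (auto simp: linear_map_def)
qed

lemma lin_plus:
 assumes "module k W" "lmap k V W f" "lmap k V W g"
 shows "lmap k V W (%x. f x +[W] g x)"
proof -
 interpret W: module k W by fact
 show ?thesis
  using assms(2,3) by (auto simp: linear_map_def Pi_def W.a_ac W.smult_r_distr)
qed

lemma lin_uminus:
 assumes "module k W" "lmap k V W f"
 shows "lmap k V W (%x. -[W] f x)"
proof -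
 interpret W: module k W by fact
 show ?thesis
  using assms(2) by (auto simp: linear_map_def Pi_def W.minus_add W.smult_r_minus W.a_ac)
qed

lemma lin_diff:
 assumes "module k W" "lmap k V W f" "lmap k V W g"
 shows "lmap k V W (%x. f x -[W] g x)"
 unfolding a_minus_def
 by (intro lin_plus lin_uminus assms)

lemma lin_smult_const:
 assumes "module k W" "lmap k V W f" "a <: k"
 shows "lmap k V W (%x. a .[W] f x)"
proof -
 interpret W: module k W by fact
 have "a .[W] (b .[W] x) = b .[W] (a .[W] x)" if "b <: k" "x <: W" for b x
  using that assms(3) by (simp add: W.smult_assoc1[symmetric] W.R.m_comm)
 then show ?thesis
  using assms(2,3) by (auto simp: linear_map_def Pi_def W.smult_r_distr)
qed

lemma lin_finsum_fun:
 assumes "module k V" "module k W" "finite J" "!!j. j : J ==> lmap k V W (f j)"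
 shows "lmap k V W (%x. \<Oplus>\<^bsub>W\<^esub>j\<in>J. f j x)"
 using assms(3,4)
proof (induction J)
 case empty
 interpret W: module k W by fact
 show ?case using lin_const_zero[OF assms(2)] by simp
next
 case (insert j J)
 interpret V: module k V by fact
 interpret W: module k W by fact
 have "(\<Oplus>\<^bsub>W\<^esub>j\<in>insert j J. f j x) = f j x +[W] (\<Oplus>\<^bsub>W\<^esub>j\<in>J. f j x)" if "x <: V" for x
  using insert that by (subst W.finsum_insert) (auto intro: lin_closed)
 moreover have "lmap k V W (%x. f j x +[W] (\<Oplus>\<^bsub>W\<^esub>j\<in>J. f j x))"
  using insert by (intro lin_plus assms(1,2)) auto
 ultimately show ?case by (subst lin_cong[OF assms(1)])
qed

lemma ground_module_simps [simp]:
 "carrier (ground_module k) = carrier k" "add (ground_module k) = add k"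
 "zero (ground_module k) = zero k" "smult (ground_module k) = mult k"
 by (simp_all add: ground_module_def)

lemma module_ground: assumes "cring k" shows "module k (ground_module k)"
proof -
 interpret cring k by fact
 show ?thesis
 proof (rule moduleI)
  show "abelian_group (ground_module k)"
   by (rule abelian_groupI) (auto simp: a_ac intro: exI[of _ "-[k] _"] l_neg bexI[of _ "-[k] _"])
 qed (auto simp: l_distr r_distr m_assoc assms)
qed

lemma scalar_lin:
 assumes "module k W" "lmap k V (ground_module k) f" "w <: W"
 shows "lmap k V W (%x. f x .[W] w)"
proof -
 interpret W: module k W by fact
 show ?thesis
  using assms(2,3) by (auto simp: linear_map_def Pi_def W.smult_l_distr W.smult_assoc1)
qed

lemma submodule_abelian_subgroup:
 assumes "module k V" "submodule N k V" shows "abelian_subgroup N V"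
proof -
 interpret V: module k V by fact
 interpret submodule N k V by fact
 show ?thesis
  by (intro abelian_subgroupI3 additive_subgroup.intro V.abelian_group_axioms subgroup_axioms)
qed

lemma submodule_subset: "submodule N k V ==> N <= carrier V"
 using subgroup.subset[OF submodule.axioms(1)] by fastforce

lemma submodule_zero: "submodule N k V ==> 0[V] : N"
 using subgroup.one_closed[OF submodule.axioms(1)] by fastforce

lemma submodule_add: "submodule N k V ==> x : N ==> y : N ==> x +[V] y : N"
 using subgroup.m_closed[OF submodule.axioms(1)] by fastforce

lemma submodule_smult: "submodule N k V ==> a <: k ==> x : N ==> a .[V] x : N"
 using submodule.smult_closed by fastforce

lemma submodule_neg: "module k V ==> submodule N k V ==> x : N ==> -[V] x : N"
 by (rule module.submoduleE(3))

lemma submoduleI':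
 assumes "module k V" "N <= carrier V" "0[V] : N"
  "!!x y. x : N ==> y : N ==> x +[V] y : N"
  "!!a x. a <: k ==> x : N ==> a .[V] x : N"
 shows "submodule N k V"
proof -
 interpret V: module k V by fact
 have "-[V] x : N" if "x : N" for x
 proof -
  have "(\<ominus>\<^bsub>k\<^esub> 1[k]) .[V] x : N" using assms(5) that by simp
  then show ?thesis using that assms(2) by (auto simp: V.smult_l_minus subset_iff)
 qed
 then show ?thesis using assms by (intro V.submoduleI) auto
qed

lemma submodule_kernel:
 assumes "module k V" "module k W" "lmap k V W f"
 shows "submodule {x : carrier V. f x = 0[W]} k V"
proof -
 interpret V: module k V by fact
 interpret W: module k W by fact
 show ?thesis
  using lin_zero[OF assms]
  by (intro submoduleI')
   (auto simp: lin_add[OF assms(3)] lin_smult[OF assms(3)] assms(1))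
qed

lemma submodule_image:
 assumes "module k V" "module k W" "lmap k V W f"
 shows "submodule (f ` carrier V) k W"
proof -
 interpret V: module k V by fact
 interpret W: module k W by fact
 show ?thesis
 proof (rule submoduleI')
  show "0[W] : f ` carrier V"
   using lin_zero[OF assms] by (auto intro: rev_image_eqI[of "0[V]"])
  show "x +[W] y : f ` carrier V" if xy: "x : f ` carrier V" "y : f ` carrier V" for x y
  proof -
   obtain x' y' where "x' <: V" "y' <: V" "x = f x'" "y = f y'" using xy by auto
   then show ?thesis using lin_add[OF assms(3)] by (intro image_eqI[of _ _ "x' +[V] y'"]) auto
  qed
  show "a .[W] x : f ` carrier V" if xy: "a <: k" "x : f ` carrier V" for a x
  proof -
   obtain x' where "x' <: V" "x = f x'" using xy by auto
   then show ?thesis using lin_smult[OF assms(3)] xy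
    by (intro image_eqI[of _ _ "a .[V] x'"]) auto
  qed
 qed (use assms lin_closed in fastforce)+
qed

lemma submodule_module: "module k V ==> submodule N k V ==> module k (V\<lparr>carrier := N\<rparr>)"
 by (rule submodule.submodule_is_module)

section \<open>Spans and quotients\<close>

lemma lin_span_submodule:
 assumes "module k V" "S <= carrier V"
 shows "submodule (lin_span k V S) k V"
proof -
 interpret V: module k V by fact
 have c: "submodule (carrier V) k V" by (rule V.carrier_is_submodule)
 show ?thesis
  unfolding lin_span_def hull_def
 proof (rule submoduleI'[OF assms(1)])
  show "\<Inter> {t. submodule t k V & S <= t} <= carrier V" using c assms by auto
 qed (auto intro: submodule_zero submodule_add submodule_smult)
qed

lemma lin_span_superset: "S <= lin_span k V S"
 by (simp add: lin_span_def hull_subset)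

lemma lin_span_minimal: "S <= N ==> submodule N k V ==> lin_span k V S <= N"
 by (simp add: lin_span_def hull_minimal)

lemma lin_zero_on_span:
 assumes "module k V" "module k W" "lmap k V W f" "S <= carrier V"
  and "!!x. x : S ==> f x = 0[W]" "x : lin_span k V S"
 shows "f x = 0[W]"
 using lin_span_minimal[of S "{x : carrier V. f x = 0[W]}" k V]
  submodule_kernel[OF assms(1-3)] assms by auto

locale module_quotient = module k V for k :: "'k ring" and V :: "('k, 'v, 'x) module_scheme" +
 fixes N :: "'v set"
 assumes sub: "submodule N k V"
begin

sublocale abelian_subgroup N V
 using submodule_abelian_subgroup[OF module_axioms sub] .

abbreviation quot where "quot == quot_module V N"

lemma module_V: "module k V" by (rule module_axioms)

lemma quot_simps:
 "carrier quot = a_rcosets\<^bsub>V\<^esub> N" "zero quot = N" "add quot = set_add V"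
 "smult quot = (%a X. \<Union>x\<in>X. N +>\<^bsub>V\<^esub> (a .[V] x))" "one quot = N +>\<^bsub>V\<^esub> 1[V]"
 "mult quot = rcoset_mult V N"
 by (simp_all add: quot_module_def)

lemma coset_closed: "x <: V ==> N +>\<^bsub>V\<^esub> x <: quot"
 using a_rcosetsI[OF a_subset] by (simp add: quot_simps)

lemma quot_cases:
 assumes "X <: quot" obtains x where "x <: V" "X = N +>\<^bsub>V\<^esub> x"
 using assms by (auto simp: quot_simps A_RCOSETS_def')

lemma coset_zero: "N +>\<^bsub>V\<^esub> 0[V] = zero quot"
 by (simp add: quot_simps a_coset_add_zero[OF a_subset])

lemma coset_add:
 "x <: V ==> y <: V ==> N +>\<^bsub>V\<^esub> (x +[V] y) = (N +>\<^bsub>V\<^esub> x) +[quot] (N +>\<^bsub>V\<^esub> y)"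
 by (simp add: quot_simps a_rcos_sum)

lemma coset_eq_iff:
 assumes "x <: V" "y <: V"
 shows "N +>\<^bsub>V\<^esub> x = N +>\<^bsub>V\<^esub> y \<longleftrightarrow> x -[V] y : N"
proof
 assume "N +>\<^bsub>V\<^esub> x = N +>\<^bsub>V\<^esub> y"
 then have "x : N +>\<^bsub>V\<^esub> y" using a_rcos_self[OF assms(1)] by simp
 then show "x -[V] y : N" using a_rcos_module_imp[OF assms(2)] by (simp add: a_minus_def)
next
 assume "x -[V] y : N"
 then have "x : N +>\<^bsub>V\<^esub> y" using a_rcos_module_rev[OF assms(2,1)] by (simp add: a_minus_def)
 then show "N +>\<^bsub>V\<^esub> x = N +>\<^bsub>V\<^esub> y" using a_repr_independence' assms(2) by simp
qed

lemma coset_smult: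
 assumes "a <: k" "x <: V"
 shows "N +>\<^bsub>V\<^esub> (a .[V] x) = a .[quot] (N +>\<^bsub>V\<^esub> x)"
proof -
 have "N +>\<^bsub>V\<^esub> (a .[V] y) = N +>\<^bsub>V\<^esub> (a .[V] x)" if y: "y : N +>\<^bsub>V\<^esub> x" for y
 proof -
  have yV: "y <: V" using y assms a_elemrcos_carrier by blast
  have "y -[V] x : N"
   using a_rcos_module_imp[OF assms(2) y] by (simp add: a_minus_def)
  then have "a .[V] (y -[V] x) : N" using submodule_smult[OF sub] assms by auto
  then have "a .[V] y -[V] a .[V] x : N"
   using assms yV by (simp add: a_minus_def smult_r_distr smult_r_minus)
  then show ?thesis using coset_eq_iff assms yV by simp
 qed
 moreover have "x : N +>\<^bsub>V\<^esub> x" by (rule a_rcos_self[OF assms(2)])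
 ultimately show ?thesis unfolding quot_simps by blast
qed

lemma coset_zero_iff: "x <: V ==> N +>\<^bsub>V\<^esub> x = zero quot \<longleftrightarrow> x : N"
 using coset_eq_iff[of x "0[V]"] coset_zero by simp

lemma module_quot: "module k quot"
proof (rule moduleI)
 show "cring k" by (rule module_cring[OF module_V])
 show "abelian_group quot"
 proof (rule abelian_groupI)
  fix X Y assume X: "X <: quot" and Y: "Y <: quot"
  obtain x where x: "x <: V" "X = N +>\<^bsub>V\<^esub> x" using X by (rule quot_cases)
  obtain y where y: "y <: V" "Y = N +>\<^bsub>V\<^esub> y" using Y by (rule quot_cases)
  show "X +[quot] Y <: quot" using x y coset_closed by (simp add: coset_add[symmetric])
  show "X +[quot] Y = Y +[quot] X" using x y by (simp add: coset_add[symmetric] a_ac)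
  fix Z assume Z: "Z <: quot"
  obtain z where z: "z <: V" "Z = N +>\<^bsub>V\<^esub> z" using Z by (rule quot_cases)
  show "X +[quot] Y +[quot] Z = X +[quot] (Y +[quot] Z)"
   using x y z by (simp add: coset_add[symmetric] a_ac)
 next
  fix X assume X: "X <: quot"
  obtain x where x: "x <: V" "X = N +>\<^bsub>V\<^esub> x" using X by (rule quot_cases)
  show "0[quot] +[quot] X = X" using x by (simp add: coset_add[symmetric] coset_zero[symmetric])
  show "EX Y:carrier quot. Y +[quot] X = 0[quot]"
   using x by (intro bexI[of _ "N +>\<^bsub>V\<^esub> (\<ominus>\<^bsub>V\<^esub> x)"])
    (simp_all add: coset_add[symmetric] coset_zero[symmetric] l_neg coset_closed)
 next
  show "0[quot] <: quot" using coset_zero coset_closed by (metis M.zero_closed)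
 qed
next
 fix a b X assume a: "a <: k" and b: "b <: k" and X: "X <: quot"
 obtain x where x: "x <: V" "X = N +>\<^bsub>V\<^esub> x" using X by (rule quot_cases)
 show "(a +[k] b) .[quot] X = a .[quot] X +[quot] b .[quot] X"
  using x a b by (simp add: coset_smult[symmetric] coset_add[symmetric] smult_l_distr)
 show "(a *[k] b) .[quot] X = a .[quot] (b .[quot] X)"
  using x a b by (simp add: coset_smult[symmetric] smult_assoc1)
next
 fix a X Y assume a: "a <: k" and X: "X <: quot" and Y: "Y <: quot"
 obtain x where x: "x <: V" "X = N +>\<^bsub>V\<^esub> x" using X by (rule quot_cases)
 obtain y where y: "y <: V" "Y = N +>\<^bsub>V\<^esub> y" using Y by (rule quot_cases)
 show "a .[quot] (X +[quot] Y) = a .[quot] X +[quot] a .[quot] Y"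
  using x y a by (simp add: coset_smult[symmetric] coset_add[symmetric] smult_r_distr)
next
 fix a X assume a: "a <: k" and X: "X <: quot"
 obtain x where x: "x <: V" "X = N +>\<^bsub>V\<^esub> x" using X by (rule quot_cases)
 show "a .[quot] X <: quot" using x a by (simp add: coset_smult[symmetric] coset_closed)
next
 fix X assume X: "X <: quot"
 obtain x where x: "x <: V" "X = N +>\<^bsub>V\<^esub> x" using X by (rule quot_cases)
 show "1[k] .[quot] X = X" using x by (simp add: coset_smult[symmetric])
qed

lemma linear_coset: "lmap k V quot (%x. N +>\<^bsub>V\<^esub> x)"
 by (intro linI) (auto simp: coset_closed coset_add coset_smult)

lemma on_coset_eq:
 assumes "!!y. y <: V ==> y -[V] x : N ==> f y = f x" "x <: V"
 shows "on_coset f (N +>\<^bsub>V\<^esub> x) = f x"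
proof -
 have "f y = f x" if y: "y : N +>\<^bsub>V\<^esub> x" for y
  using a_rcos_module_imp[OF assms(2) y] a_elemrcos_carrier[OF assms(2) y]
  by (intro assms(1)) (simp_all add: a_minus_def)
 moreover have "x : N +>\<^bsub>V\<^esub> x" by (rule a_rcos_self[OF assms(2)])
 ultimately have "f ` (N +>\<^bsub>V\<^esub> x) = {f x}" by blast
 then show ?thesis by (simp add: on_coset_def)
qed

lemma on_coset_linear_eq:
 assumes "module k W" "lmap k V W f" "!!x. x : N ==> f x = 0[W]" "x <: V"
 shows "on_coset f (N +>\<^bsub>V\<^esub> x) = f x"
proof (rule on_coset_eq[OF _ assms(4)])
 interpret W: module k W by fact
 fix y assume y: "y <: V" "y -[V] x : N"
 then have "f y -[W] f x = 0[W]"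
  using assms lin_minus[OF module_V assms(1,2)] by metis
 then show "f y = f x"
  using y assms(4) lin_closed[OF assms(2)] by (simp add: W.minus_eq_zero_iff)
qed

lemma on_coset_linear:
 assumes "module k W" "lmap k V W f" "!!x. x : N ==> f x = 0[W]"
 shows "lmap k quot W (on_coset f)"
proof (rule linI)
 fix X Y assume X: "X <: quot" and Y: "Y <: quot"
 obtain x where x: "x <: V" "X = N +>\<^bsub>V\<^esub> x" using X by (rule quot_cases)
 obtain y where y: "y <: V" "Y = N +>\<^bsub>V\<^esub> y" using Y by (rule quot_cases)
 note e = on_coset_linear_eq[OF assms]
 show "on_coset f (X +[quot] Y) = on_coset f X +[W] on_coset f Y"
  using x y by (simp add: coset_add[symmetric] e lin_add[OF assms(2)])
next
 fix a X assume a: "a <: k" and X: "X <: quot"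
 obtain x where x: "x <: V" "X = N +>\<^bsub>V\<^esub> x" using X by (rule quot_cases)
 note e = on_coset_linear_eq[OF assms]
 show "on_coset f (a .[quot] X) = a .[W] on_coset f X"
  using x a by (simp add: coset_smult[symmetric] e lin_smult[OF assms(2)])
next
 fix X assume X: "X <: quot"
 obtain x where x: "x <: V" "X = N +>\<^bsub>V\<^esub> x" using X by (rule quot_cases)
 then show "on_coset f X <: W"
  using on_coset_linear_eq[OF assms] lin_closed[OF assms(2)] by simp
qed

end

text \<open>The first isomorphism theorem in the form in which homology groups are computed.\<close>

lemma first_isomorphism:
 assumes "module k V" "module k W" "lmap k V W f" "f ` carrier V = carrier W"
  and "N = {x : carrier V. f x = 0[W]}"
 shows "linear_isomorphic k (quot_module V N) W"
proof -
 have "submodule N k V" using submodule_kernel[OF assms(1-3)] assms(5) by simp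
 then interpret module_quotient k V N
  using assms(1) by (simp add: module_quotient_def module_quotient_axioms_def)
 interpret W: module k W by fact
 have N0: "f x = 0[W]" if "x : N" for x using that assms(5) by blast
 note e = on_coset_linear_eq[OF assms(2,3) N0]
 have "inj_on (on_coset f) (carrier quot)"
 proof (rule inj_onI)
  fix X Y assume X: "X <: quot" and Y: "Y <: quot"
   and eq: "on_coset f X = on_coset f Y"
  obtain x where x: "x <: V" "X = N +>\<^bsub>V\<^esub> x" using X by (rule quot_cases)
  obtain y where y: "y <: V" "Y = N +>\<^bsub>V\<^esub> y" using Y by (rule quot_cases)
  have "f x = f y" using eq x y e by simp
  then have "f (x -[V] y) = 0[W]"
   using lin_minus[OF assms(1-3)] x y lin_closed[OF assms(3)]
   by (simp add: W.r_neg a_minus_def)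
  then have "x -[V] y : N" using x(1) y(1) assms(5) minus_closed by blast
  then show "X = Y" using x y coset_eq_iff by simp
 qed
 moreover have "on_coset f ` carrier quot = carrier W"
 proof
  show "on_coset f ` carrier quot <= carrier W"
   using lin_closed[OF on_coset_linear[OF assms(2,3) N0]] by blast
  show "carrier W <= on_coset f ` carrier quot"
  proof
   fix w assume "w <: W"
   then obtain x where "x <: V" "w = f x" using assms(4) by blast
   then show "w : on_coset f ` carrier quot"
    using e coset_closed by (intro image_eqI[of _ _ "N +>\<^bsub>V\<^esub> x"]) auto
  qed
 qed
 ultimately show ?thesis
  using on_coset_linear[OF assms(2,3) N0] by (auto simp: linear_isomorphic_def bij_betw_def)
qed

section \<open>Modules given by generators and relations\<close>

lemma foldSetD_cong:
 assumes "(A, y) : foldSetD D f e" "!!x. x : A ==> f x = g x"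
 shows "(A, y) : foldSetD D g e"
 using assms
proof (induction rule: foldSetD.induct)
 case emptyI
 then show ?case by (intro foldSetD.emptyI)
next
 case (insertI x A y)
 then have "(insert x A, g x y) : foldSetD D g e"
  by (intro foldSetD.insertI) auto
 then show ?case using insertI.prems[of x] by simp
qed

text \<open>Closedness of the values is not asked for: \<open>finsum\<close> depends only on the values at the indices, also where it is a default
  value.\<close>

lemma sum_cong:
 assumes "!!x. x : A ==> f x = g x"
 shows "(\<Oplus>\<^bsub>W\<^esub>x\<in>A. f x) = (\<Oplus>\<^bsub>W\<^esub>x\<in>A. g x)"
proof -
 have "(A, y) : foldSetD D ((\<oplus>\<^bsub>W\<^esub>) \<circ> f) e \<longleftrightarrow> (A, y) : foldSetD D ((\<oplus>\<^bsub>W\<^esub>) \<circ> g) e" for y D e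
  using foldSetD_cong[of A y D "(\<oplus>\<^bsub>W\<^esub>) \<circ> f" e "(\<oplus>\<^bsub>W\<^esub>) \<circ> g"]
   foldSetD_cong[of A y D "(\<oplus>\<^bsub>W\<^esub>) \<circ> g" e "(\<oplus>\<^bsub>W\<^esub>) \<circ> f"] assms by auto
 then show ?thesis by (simp add: finsum_def finprod_def foldD_def)
qed

definition ext_lin :: "'k ring => ('k, 'w, 'z) module_scheme => ('x => 'w) => ('x => 'k) => 'w" where
 "ext_lin k W f c = (\<Oplus>\<^bsub>W\<^esub>x\<in>{x. c x ~= 0[k]}. c x .[W] f x)"

definition kills_rels ::
  "'k ring => 'x set => ('x => 'k) set => ('k, 'w, 'z) module_scheme => ('x => 'w) => bool" where
 "kills_rels k X R W f \<longleftrightarrow> f : X \<rightarrow> carrier W & (ALL r:R. ext_lin k W f r = 0[W])"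

lemma lift_conv_ext: "lift k W f = on_coset (ext_lin k W f)"
 by (simp add: lift_def ext_lin_def[abs_def])

lemma fm_simps:
 "carrier (Fr k X) = {c. (ALL x:X. c x <: k) & (ALL x. x \<notin> X --> c x = 0[k]) &
          finite {x. c x ~= 0[k]}}"
 "zero (Fr k X) = (%_. 0[k])"
 "add (Fr k X) = (%c d x. c x +[k] d x)"
 "smult (Fr k X) = (%a c x. a *[k] c x)"
 by (simp_all add: free_module_def)

context
 fixes k :: "'k ring" and X :: "'x set"
 assumes k: "cring k"
begin

interpretation k: cring k by (rule k)

lemma module_free: "module k (Fr k X)"
proof (rule moduleI[OF k])
 show "abelian_group (Fr k X)"
 proof (rule abelian_groupI)
  fix c d assume c: "c <: Fr k X" and d: "d <: Fr k X"
  have "{x. c x +[k] d x ~= 0[k]} <= {x. c x ~= 0[k]} \<union> {x. d x ~= 0[k]}"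
   by auto
  then have "finite {x. c x +[k] d x ~= 0[k]}"
   using c d by (auto simp: fm_simps intro: finite_subset)
  then show "c +[Fr k X] d <: Fr k X"
   using c d by (auto simp: fm_simps)
  have ck: "c x <: k" "d x <: k" for x
   using c d by (cases "x : X"; auto simp: fm_simps)+
  then show "c +[Fr k X] d = d +[Fr k X] c"
   by (auto simp: fm_simps k.a_comm)
  fix e assume e: "e <: Fr k X"
  have "e x <: k" for x
   using e by (cases "x : X"; auto simp: fm_simps)
  then show "c +[Fr k X] d +[Fr k X] e =
    c +[Fr k X] (d +[Fr k X] e)"
   using ck by (auto simp: fm_simps k.a_assoc)
 next
  fix c assume c: "c <: Fr k X"
  have ck: "c x <: k" for x
   using c by (cases "x : X"; auto simp: fm_simps)
  then show "0[Fr k X] +[Fr k X] c = c"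
   by (auto simp: fm_simps)
  have "{x. -[k] c x ~= 0[k]} <= {x. c x ~= 0[k]}" using ck by auto
  then have "(%x. -[k] c x) <: Fr k X"
   using c by (auto simp: fm_simps intro: finite_subset)
  moreover have "(%x. -[k] c x) +[Fr k X] c = 0[Fr k X]"
   using ck by (auto simp: fm_simps k.l_neg)
  ultimately show "EX d:carrier (Fr k X). d +[Fr k X] c = 0[Fr k X]"
   by blast
 qed (auto simp: fm_simps)
 fix a c assume a: "a <: k" and c: "c <: Fr k X"
 have "{x. a *[k] c x ~= 0[k]} <= {x. c x ~= 0[k]}" using a by auto
 then show "a .[Fr k X] c <: Fr k X"
  using a c by (auto simp: fm_simps intro: finite_subset)
next
 fix a b c assume a: "a <: k" "b <: k" and c: "c <: Fr k X"
 have ck: "c x <: k" for x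
  using c by (cases "x : X"; auto simp: fm_simps)
 show "(a +[k] b) .[Fr k X] c =
   (a .[Fr k X] c) +[Fr k X] (b .[Fr k X] c)"
  "(a *[k] b) .[Fr k X] c = a .[Fr k X] (b .[Fr k X] c)"
  using ck a by (auto simp: fm_simps k.l_distr k.m_assoc)
next
 fix a c d assume a: "a <: k" and c: "c <: Fr k X" "d <: Fr k X"
 have ck: "c x <: k" "d x <: k" for x
  using c by (cases "x : X"; auto simp: fm_simps)+
 show "a .[Fr k X] (c +[Fr k X] d) =
   (a .[Fr k X] c) +[Fr k X] (a .[Fr k X] d)"
  using ck a by (auto simp: fm_simps k.r_distr)
next
 fix c assume c: "c <: Fr k X"
 have ck: "c x <: k" for x
  using c by (cases "x : X"; auto simp: fm_simps)
 show "1[k] .[Fr k X] c = c"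
  using ck by (auto simp: fm_simps)
qed

interpretation F: module k "Fr k X" by (rule module_free)

lemma delta_closed: "x : X ==> delta k x <: Fr k X"
proof -
 have "{y. delta k x y ~= 0[k]} <= {x}" by (auto simp: delta_def)
 then show "x : X ==> delta k x <: Fr k X"
  using finite_subset by (auto simp: fm_simps delta_def)
qed

lemma free_module_induct:
 assumes "c <: Fr k X"
  and "!!x. x : X ==> Q (delta k x)" "Q 0[Fr k X]"
  and "!!c d. c <: Fr k X ==> d <: Fr k X ==> Q c ==> Q d ==>
   Q (c +[Fr k X] d)"
  and "!!a c. a <: k ==> c <: Fr k X ==> Q c ==> Q (a .[Fr k X] c)"
 shows "Q c"
 using assms(1)
proof (induction "card {x. c x ~= 0[k]}" arbitrary: c)
 case 0
 then have "{x. c x ~= 0[k]} = {}" by (simp add: fm_simps)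
 then have "c = 0[Fr k X]" by (auto simp: fm_simps)
 then show ?case using assms(3) by simp
next
 case (Suc n)
 then obtain x where x: "c x ~= 0[k]"
  by (metis (mono_tags, lifting) Collect_empty_eq card.empty nat.distinct(1))
 have ck: "c y <: k" for y
  using Suc.prems by (cases "y : X"; auto simp: fm_simps)
 have xX: "x : X" using x Suc.prems by (auto simp: fm_simps)
 define d where "d = c(x := 0[k])"
 have supp: "{y. d y ~= 0[k]} = {y. c y ~= 0[k]} - {x}" by (auto simp: d_def)
 have fin: "finite {y. c y ~= 0[k]}" using Suc.prems by (simp add: fm_simps)
 have d: "d <: Fr k X"
  using Suc.prems supp fin by (auto simp: fm_simps d_def)
 have "card {y. d y ~= 0[k]} = n" using Suc(2) x fin by (simp add: supp)
 then have "Q d" using Suc.hyps(1) d by simp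
 moreover have "Q (c x .[Fr k X] delta k x)"
  using assms(5)[OF ck delta_closed[OF xX] assms(2)[OF xX]] .
 moreover have "c = d +[Fr k X] (c x .[Fr k X] delta k x)"
  using ck by (auto simp: fm_simps d_def delta_def)
 ultimately show ?case
  using assms(4)[OF d F.smult_closed[OF ck delta_closed[OF xX]]] by metis
qed

lemma free_module_linear_ext:
 assumes "module k W" "lmap k (Fr k X) W f" "lmap k (Fr k X) W g"
  and "!!x. x : X ==> f (delta k x) = g (delta k x)" "c <: Fr k X"
 shows "f c = g c"
 using assms(5)
proof (rule free_module_induct)
 show "f 0[Fr k X] = g 0[Fr k X]"
  by (simp add: lin_zero[OF module_free assms(1,2)] lin_zero[OF module_free assms(1,3)])
qed (simp_all add: assms(4) lin_add[OF assms(2)] lin_add[OF assms(3)]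
   lin_smult[OF assms(2)] lin_smult[OF assms(3)])

context
 fixes W :: "('k, 'w, 'z) module_scheme" and f :: "'x => 'w"
 assumes W: "module k W" and f: "f : X \<rightarrow> carrier W"
begin

interpretation W: module k W by (rule W)

lemma ext_on:
 assumes "c <: Fr k X" "{x. c x ~= 0[k]} <= S" "S <= X" "finite S"
 shows "ext_lin k W f c = (\<Oplus>\<^bsub>W\<^esub>x\<in>S. c x .[W] f x)"
 unfolding ext_lin_def
proof (rule W.add.finprod_mono_neutral_cong_left)
 have ck: "c y <: k" for y
  using assms(1) by (cases "y : X"; auto simp: fm_simps)
 show "(%x. c x .[W] f x) : S \<rightarrow> carrier W"
  using f assms(3) ck by auto
 show "c x .[W] f x = 0[W]" if "x : S - {x. c x ~= 0[k]}" for x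
 proof -
  have "c x = 0[k]" "f x <: W" using that f assms(3) by auto
  then show ?thesis by simp
 qed
qed (use assms in auto)

lemma ext_delta: assumes "x : X" shows "ext_lin k W f (delta k x) = f x"
proof -
 have "ext_lin k W f (delta k x) = (\<Oplus>\<^bsub>W\<^esub>y\<in>{x}. delta k x y .[W] f y)"
  using assms by (intro ext_on delta_closed) (auto simp: delta_def)
 also have "... = f x" using f assms by (auto simp: delta_def Pi_def)
 finally show ?thesis .
qed

lemma ext_linear: "lmap k (Fr k X) W (ext_lin k W f)"
proof (rule linI)
 fix c assume c: "c <: Fr k X"
 have ck: "c y <: k" for y
  using c by (cases "y : X"; auto simp: fm_simps)
 have s: "{x. c x ~= 0[k]} <= X" using c by (auto simp: fm_simps)
 show "ext_lin k W f c <: W"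
  unfolding ext_lin_def using ck s f by (intro W.finsum_closed) auto
next
 fix c d assume c: "c <: Fr k X" and d: "d <: Fr k X"
 have ck: "c y <: k" "d y <: k" for y
  using c d by (cases "y : X"; auto simp: fm_simps)+
 let ?S = "{x. c x ~= 0[k]} \<union> {x. d x ~= 0[k]}"
 have S: "?S <= X" "finite ?S" using c d by (auto simp: fm_simps)
 have fS: "f x <: W" if "x : ?S" for x using f S that by blast
 have "ext_lin k W f (c +[Fr k X] d) =
   (\<Oplus>\<^bsub>W\<^esub>x\<in>?S. (c +[Fr k X] d) x .[W] f x)"
  using S by (intro ext_on F.a_closed c d) (auto simp: fm_simps)
 also have "... = (\<Oplus>\<^bsub>W\<^esub>x\<in>?S. c x .[W] f x +[W] d x .[W] f x)"
  using ck fS by (intro W.finsum_cong') (auto simp: fm_simps W.smult_l_distr)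
 also have "... = (\<Oplus>\<^bsub>W\<^esub>x\<in>?S. c x .[W] f x) +[W] (\<Oplus>\<^bsub>W\<^esub>x\<in>?S. d x .[W] f x)"
  using ck fS by (intro W.finsum_addf) auto
 also have "... = ext_lin k W f c +[W] ext_lin k W f d"
  using S c d by (subst (1 2) ext_on) auto
 finally show "ext_lin k W f (c +[Fr k X] d) = ext_lin k W f c +[W] ext_lin k W f d" .
next
 fix a c assume a: "a <: k" and c: "c <: Fr k X"
 have ck: "c y <: k" for y
  using c by (cases "y : X"; auto simp: fm_simps)+
 let ?S = "{x. c x ~= 0[k]}"
 have S: "?S <= X" "finite ?S" using c by (auto simp: fm_simps)
 have fS: "f x <: W" if "x : ?S" for x using f S that by blast
 have "ext_lin k W f (a .[Fr k X] c) = (\<Oplus>\<^bsub>W\<^esub>x\<in>?S. (a .[Fr k X] c) x .[W] f x)"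
  using S a by (intro ext_on F.smult_closed c) (auto simp: fm_simps)
 also have "... = (\<Oplus>\<^bsub>W\<^esub>x\<in>?S. a .[W] (c x .[W] f x))"
  using ck fS a by (intro W.finsum_cong') (auto simp: fm_simps W.smult_assoc1)
 also have "... = a .[W] ext_lin k W f c"
  unfolding ext_lin_def using ck fS a S by (intro W.finsum_smult_ldistr[symmetric]) auto
 finally show "ext_lin k W f (a .[Fr k X] c) = a .[W] ext_lin k W f c" .
qed

lemma ext_rel_add:
 assumes "x : X" "y : X" "z : X"
 shows "ext_lin k W f (delta k x -[Fr k X] (delta k y +[Fr k X] delta k z)) = 0[W]
  \<longleftrightarrow> f x = f y +[W] f z"
 using assms f
 by (auto simp: lin_minus[OF module_free W ext_linear] lin_add[OF ext_linear]
   delta_closed ext_delta W.minus_eq_zero_iff Pi_def)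

lemma ext_rel_smult:
 assumes "x : X" "y : X" "a <: k"
 shows "ext_lin k W f (delta k x -[Fr k X] (a .[Fr k X] delta k y)) = 0[W]
  \<longleftrightarrow> f x = a .[W] f y"
 using assms f
 by (auto simp: lin_minus[OF module_free W ext_linear] lin_smult[OF ext_linear]
   delta_closed ext_delta W.minus_eq_zero_iff Pi_def)

lemma ext_rel_eq:
 assumes "x : X" "y : X"
 shows "ext_lin k W f (delta k x -[Fr k X] delta k y) = 0[W] \<longleftrightarrow> f x = f y"
 using assms f
 by (auto simp: lin_minus[OF module_free W ext_linear]
   delta_closed ext_delta W.minus_eq_zero_iff Pi_def)

end

end

locale presentation = cring k for k :: "'k ring" +
 fixes X :: "'x set" and R :: "('x => 'k) set"
 assumes rels: "R <= carrier (Fr k X)"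
begin

lemma ck: "cring k" by (rule is_cring)

lemma span: "submodule (lin_span k (Fr k X) R) k (Fr k X)"
 by (rule lin_span_submodule[OF module_free[OF ck] rels])

interpretation Q: module_quotient k "Fr k X" "lin_span k (Fr k X) R"
 using span module_free[OF ck] by (simp add: module_quotient_def module_quotient_axioms_def)

lemma module_presented: "module k (presented k X R)"
 unfolding presented_def by (rule Q.module_quot)

lemma gen_closed: "x : X ==> gen k X R x <: presented k X R"
 unfolding presented_def gen_def by (rule Q.coset_closed[OF delta_closed[OF ck]])

lemma presented_induct [consumes 1, case_names gen zero add smult]:
 assumes "z <: presented k X R"
  and "!!x. x : X ==> Q (gen k X R x)"
  and "Q 0[presented k X R]"
  and "!!y z. y <: presented k X R ==> z <: presented k X R ==> Q y ==> Q z ==>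
   Q (y +[presented k X R] z)"
  and "!!a z. a <: k ==> z <: presented k X R ==> Q z ==> Q (a .[presented k X R] z)"
 shows "Q z"
proof -
 let ?c = "%c. lin_span k (Fr k X) R +>\<^bsub>Fr k X\<^esub> c"
 obtain c where c: "c <: Fr k X" "z = ?c c"
  using assms(1) unfolding presented_def by (rule Q.quot_cases)
 have "Q (?c c)"
  using c(1)
 proof (rule free_module_induct[OF ck])
  show "Q (?c (delta k x))" if "x : X" for x using assms(2)[OF that] by (simp add: gen_def)
  show "Q (?c 0[Fr k X])" using assms(3) by (simp add: Q.coset_zero presented_def)
  show "Q (?c (c +[Fr k X] d))"
   if "c <: Fr k X" "d <: Fr k X" "Q (?c c)" "Q (?c d)" for c d
   using that assms(4)[of "?c c" "?c d"] unfolding presented_def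
   by (simp add: Q.coset_add Q.coset_closed)
  show "Q (?c (a .[Fr k X] c))"
   if "a <: k" "c <: Fr k X" "Q (?c c)" for a c
   using that assms(5)[of a "?c c"] unfolding presented_def
   by (simp add: Q.coset_smult Q.coset_closed)
 qed
 then show ?thesis using c by simp
qed

lemma kills_rels_span:
 assumes "module k W" "kills_rels k X R W f" "c : lin_span k (Fr k X) R"
 shows "ext_lin k W f c = 0[W]"
proof (rule lin_zero_on_span[OF module_free[OF ck] assms(1) ext_linear[OF ck assms(1)] rels])
 show "f : X \<rightarrow> carrier W" "!!x. x : R ==> ext_lin k W f x = 0[W]"
  using assms(2) by (auto simp: kills_rels_def)
qed (rule assms(3))

lemma lift_linear:
 assumes "module k W" "kills_rels k X R W f"
 shows "lmap k (presented k X R) W (lift k W f)"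
 unfolding presented_def lift_conv_ext
 using assms(2)
 by (intro Q.on_coset_linear[OF assms(1)] ext_linear[OF ck assms(1)] kills_rels_span[OF assms])
  (auto simp: kills_rels_def)

lemma lift_gen:
 assumes "module k W" "kills_rels k X R W f" "x : X"
 shows "lift k W f (gen k X R x) = f x"
proof -
 have f: "f : X \<rightarrow> carrier W" using assms(2) by (simp add: kills_rels_def)
 have "lift k W f (gen k X R x) = ext_lin k W f (delta k x)"
  unfolding gen_def lift_conv_ext
  using assms(3)
  by (intro Q.on_coset_linear_eq[OF assms(1)] ext_linear[OF ck assms(1) f] kills_rels_span[OF assms(1,2)]
   delta_closed[OF ck])
 then show ?thesis using ext_delta[OF ck assms(1) f assms(3)] by simp
qed

lemma lift_cong:
 assumes "z <: presented k X R" "!!x. x : X ==> f x = g x"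
 shows "lift k W f z = lift k W g z"
proof -
 have z: "z <= carrier (Fr k X)"
  using assms(1) Q.a_rcosets_carrier by (simp add: presented_def Q.quot_simps)
 have "ext_lin k W f c = ext_lin k W g c" if "c : z" for c
 proof -
  have "{x. c x ~= 0[k]} <= X" using that z by (auto simp: fm_simps)
  then have "c x .[W] f x = c x .[W] g x" if "c x ~= 0[k]" for x
   using that assms(2) by auto
  then show ?thesis unfolding ext_lin_def by (intro sum_cong) simp
 qed
 then show ?thesis by (simp add: lift_conv_ext on_coset_def)
qed

lemma linear_ext:
 assumes "module k W" "lmap k (presented k X R) W f" "lmap k (presented k X R) W g"
  and "!!x. x : X ==> f (gen k X R x) = g (gen k X R x)" "z <: presented k X R"
 shows "f z = g z"
 using assms(5)
 by (induction rule: presented_induct)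
  (simp_all add: assms(4) lin_zero[OF module_presented assms(1)] assms(2,3)
   lin_add[OF assms(2)] lin_add[OF assms(3)]
   lin_smult[OF assms(2)] lin_smult[OF assms(3)])

lemma gen_kills_rels: "kills_rels k X R (presented k X R) (gen k X R)"
proof -
 let ?c = "%c. lin_span k (Fr k X) R +>\<^bsub>Fr k X\<^esub> c"
 have f: "gen k X R : X \<rightarrow> carrier (presented k X R)" using gen_closed by auto
 note l = ext_linear[OF ck module_presented f]
 have lc: "lmap k (Fr k X) (presented k X R) ?c"
  unfolding presented_def by (rule Q.linear_coset)
 have "ext_lin k (presented k X R) (gen k X R) c = ?c c" if "c <: Fr k X" for c
 proof (rule free_module_linear_ext[OF ck module_presented l lc _ that])
  show "ext_lin k (presented k X R) (gen k X R) (delta k x) = ?c (delta k x)" if "x : X" for x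
   using ext_delta[OF ck module_presented f that] by (simp add: gen_def)
 qed
 moreover have "?c r = 0[presented k X R]" if "r : R" for r
  using that lin_span_superset[of R k "Fr k X"] rels unfolding presented_def
  by (subst Q.coset_zero_iff) blast+
 ultimately show ?thesis using f rels by (auto simp: kills_rels_def)
qed

text \<open>A family of maps depending linearly on a parameter lifts to one depending linearly on it.\<close>

lemma lift_param_linear:
 assumes "module k V" "module k W" "!!x. x <: V ==> kills_rels k X R W (g x)"
  and "!!u. u : X ==> lmap k V W (%x. g x u)" "z <: presented k X R"
 shows "lmap k V W (%x. lift k W (g x) z)"
proof -
 note lin = lift_linear[OF assms(2) assms(3)]
 from assms(5) show ?thesis
 proof (induction rule: presented_induct)
  case (gen u)
  then show ?case
   using assms(4)[OF gen] by (subst lin_cong[OF assms(1)]) (auto simp: lift_gen[OF assms(2,3)])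
 next
  case zero
  show ?case
   using lin_const_zero[OF assms(2)]
   by (subst lin_cong[OF assms(1)]) (auto simp: lin_zero[OF module_presented assms(2) lin])
 next
  case (add y z)
  show ?case
   using lin_plus[OF assms(2) add(3,4)] add(1,2)
   by (subst lin_cong[OF assms(1)]) (auto simp: lin_add[OF lin])
 next
  case (smult a z)
  show ?case
   using lin_smult_const[OF assms(2) smult(3,1)] smult(1,2)
   by (subst lin_cong[OF assms(1)]) (auto simp: lin_smult[OF lin])
 qed
qed

lemma kills_rels_comp:
 assumes "module k W" "module k U" "lmap k W U L" "kills_rels k X R W f"
 shows "kills_rels k X R U (%x. L (f x))"
proof -
 have f: "f : X \<rightarrow> carrier W" using assms(4) by (simp add: kills_rels_def)
 have Lf: "(%x. L (f x)) : X \<rightarrow> carrier U" using f lin_closed[OF assms(3)] by auto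
 note l = ext_linear[OF ck assms(1) f]
 note l2 = ext_linear[OF ck assms(2) Lf]
 have "ext_lin k U (%x. L (f x)) c = L (ext_lin k W f c)" if "c <: Fr k X" for c
 proof (rule free_module_linear_ext[OF ck assms(2) l2 lin_comp[OF assms(3) l] _ that])
  show "ext_lin k U (%x. L (f x)) (delta k x) = L (ext_lin k W f (delta k x))" if "x : X" for x
   using ext_delta[OF ck assms(1) f that] ext_delta[OF ck assms(2) Lf that] by simp
 qed
 then show ?thesis
  using rels assms(4) Lf lin_zero[OF assms(1-3)] by (auto simp: kills_rels_def subset_iff)
qed

lemma lift_hom:
 assumes "module k W" "module k U" "lmap k W U L" "kills_rels k X R W f" "z <: presented k X R"
 shows "L (lift k W f z) = lift k U (%x. L (f x)) z"
 by (rule linear_ext[OF assms(2) lin_comp[OF assms(3) lift_linear[OF assms(1,4)]]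
   lift_linear[OF assms(2) kills_rels_comp[OF assms(1-4)]] _ assms(5)])
  (simp add: lift_gen[OF assms(1,4)] lift_gen[OF assms(2) kills_rels_comp[OF assms(1-4)]])

end

section \<open>Tensor powers\<close>

definition multilin ::
  "'k ring => ('k, 'v, 'x) module_scheme => nat => ('k, 'w, 'z) module_scheme => ('v list => 'w) => bool" where
 "multilin k V n W f \<longleftrightarrow>
   (ALL vs:words V n. f vs <: W) &
   (ALL us vs. set us <= carrier V & set vs <= carrier V & Suc (length us + length vs) = n -->
    lmap k V W (%x. f (us @ x # vs)))"

lemma words_iff: "vs : words V n \<longleftrightarrow> length vs = n & set vs <= carrier V"
 by (auto simp: words_def)

lemma words_update: "vs : words V n ==> x <: V ==> vs[i := x] : words V n"
 using set_update_subset_insert[of vs i x] by (auto simp: words_iff)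

lemma multilin_closed: "multilin k V n W f ==> length vs = n ==> set vs <= carrier V ==> f vs <: W"
 by (auto simp: multilin_def words_iff)

lemma multilin_linear:
 "multilin k V n W f ==> set us <= carrier V ==> set vs <= carrier V ==> Suc (length us + length vs) = n ==>
  lmap k V W (%x. f (us @ x # vs))"
 by (auto simp: multilin_def)

lemma multilinI:
 assumes "!!vs. set vs <= carrier V ==> length vs = n ==> f vs <: W"
  and "!!us vs. set us <= carrier V ==> set vs <= carrier V ==> Suc (length us + length vs) = n ==>
    lmap k V W (%x. f (us @ x # vs))"
 shows "multilin k V n W f"
 using assms by (auto simp: multilin_def words_iff)

locale tensor_power = module k V for k :: "'k ring" and V :: "('k, 'v, 'x) module_scheme"
begin

lemma ck: "cring k" by (rule R.is_cring)
lemma mV: "module k V" by (rule module_axioms)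

lemma multilinear_rels_closed: "multilinear_rels k V n <= carrier (Fr k (words V n))"
proof -
 interpret F: module k "Fr k (words V n)" by (rule module_free[OF ck])
 show ?thesis
  by (auto simp: multilinear_rels_def Let_def intro!: F.minus_closed F.a_closed F.smult_closed
    delta_closed[OF ck] words_update)
qed

interpretation P: presentation k "words V n" "multilinear_rels k V n" for n
 using multilinear_rels_closed by unfold_locales

lemma multilin_kills_rels:
 assumes "module k W"
 shows "multilin k V n W f \<longleftrightarrow> kills_rels k (words V n) (multilinear_rels k V n) W f"
proof
 assume f: "multilin k V n W f"
 then have c: "f : words V n \<rightarrow> carrier W" by (auto simp: multilin_def)
 have lin: "lmap k V W (%x. f (vs[i := x]))" if "vs : words V n" "i < n" for vs i
  using that multilin_linear[OF f, of "take i vs" "drop (Suc i) vs"]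
  by (auto simp: upd_conv_take_nth_drop words_iff dest: in_set_takeD in_set_dropD)
 show "kills_rels k (words V n) (multilinear_rels k V n) W f"
  unfolding kills_rels_def
 proof (intro conjI ballI c)
  fix r assume "r : multilinear_rels k V n"
  then consider (a) vs i x y where "vs : words V n" "i < n" "x <: V" "y <: V"
    "r = delta k (vs[i := x +[V] y]) -[Fr k (words V n)]
     (delta k (vs[i := x]) +[Fr k (words V n)] delta k (vs[i := y]))"
   | (s) vs i a x where "vs : words V n" "i < n" "a <: k" "x <: V"
    "r = delta k (vs[i := a .[V] x]) -[Fr k (words V n)]
     (a .[Fr k (words V n)] delta k (vs[i := x]))"
   by (auto simp: multilinear_rels_def Let_def)
  then show "ext_lin k W f r = 0[W]"
  proof cases
   case a
   then show ?thesis
    by (simp add: ext_rel_add[OF ck assms c] words_update lin_add[OF lin])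
  next
   case s
   then show ?thesis
    by (simp add: ext_rel_smult[OF ck assms c] words_update lin_smult[OF lin])
  qed
 qed
next
 assume f: "kills_rels k (words V n) (multilinear_rels k V n) W f"
 then have c: "f : words V n \<rightarrow> carrier W" by (simp add: kills_rels_def)
 show "multilin k V n W f"
 proof (rule multilinI)
  show "f vs <: W" if "set vs <= carrier V" "length vs = n" for vs
   using c that by (auto simp: words_iff)
  fix us vs assume uv: "set us <= carrier V" "set vs <= carrier V" "Suc (length us + length vs) = n"
  let ?w = "%x. us @ x # vs"
  have w: "?w x : words V n" if "x <: V" for x using that uv by (auto simp: words_iff)
  have u: "(?w z)[length us := x] = ?w x" for x z by simp
  have i: "length us < n" using uv by simp
  have r1: "delta k (?w (x +[V] y)) -[Fr k (words V n)]
     (delta k (?w x) +[Fr k (words V n)] delta k (?w y)) : multilinear_rels k V n"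
   if xy: "x <: V" "y <: V" for x y
   unfolding multilinear_rels_def Let_def
   using w[OF xy(1)] xy i
   by (intro UnI1 CollectI exI[of _ "?w x"] exI[of _ "length us"] exI[of _ x] exI[of _ y]) simp
  have r2: "delta k (?w (a .[V] x)) -[Fr k (words V n)]
     (a .[Fr k (words V n)] delta k (?w x)) : multilinear_rels k V n"
   if xy: "a <: k" "x <: V" for a x
   unfolding multilinear_rels_def Let_def
   using w[OF xy(2)] xy i
   by (intro UnI2 CollectI exI[of _ "?w x"] exI[of _ "length us"] exI[of _ x] exI[of _ a]) simp
  show "lmap k V W (%x. f (?w x))"
  proof (rule linI)
   show "f (?w x) <: W" if "x <: V" for x using c w[OF that] by auto
   show "f (?w (x +[V] y)) = f (?w x) +[W] f (?w y)" if "x <: V" "y <: V" for x y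
    using f r1[OF that] that w by (simp add: kills_rels_def ext_rel_add[OF ck assms c, symmetric])
   show "f (?w (a .[V] x)) = a .[W] f (?w x)" if "a <: k" "x <: V" for a x
    using f r2[OF that] that w by (simp add: kills_rels_def ext_rel_smult[OF ck assms c, symmetric])
  qed
 qed
qed

lemma T_mod: "module k (tpow k V n)"
 unfolding tpow_def by (rule P.module_presented)

lemma ptens_gen: "length vs = n ==> ptens k V vs = gen k (words V n) (multilinear_rels k V n) vs"
 by (simp add: ptens_def)

lemma ptens_closed: "set vs <= carrier V ==> length vs = n ==> ptens k V vs <: tpow k V n"
 by (simp add: ptens_gen tpow_def P.gen_closed words_iff)

lemma ptens_multilin: "multilin k V n (tpow k V n) (ptens k V)"
proof -
 have "multilin k V n (tpow k V n) (gen k (words V n) (multilinear_rels k V n))"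
  unfolding multilin_kills_rels[OF T_mod] unfolding tpow_def by (rule P.gen_kills_rels)
 then show ?thesis by (auto simp: multilin_def ptens_gen words_iff)
qed

lemma tpow_lift_linear:
 "module k W ==> multilin k V n W f ==> lmap k (tpow k V n) W (lift k W f)"
 unfolding tpow_def by (rule P.lift_linear) (simp_all add: multilin_kills_rels)

lemma tpow_lift_ptens:
 "module k W ==> multilin k V n W f ==> set vs <= carrier V ==> length vs = n ==>
  lift k W f (ptens k V vs) = f vs"
 by (simp add: ptens_gen P.lift_gen multilin_kills_rels[symmetric] words_iff)

lemma tpow_lift_cong:
 assumes "z <: tpow k V n" "!!vs. set vs <= carrier V ==> length vs = n ==> f vs = g vs"
 shows "lift k W f z = lift k W g z"
 using assms P.lift_cong[of z n f g W] by (simp add: tpow_def words_iff)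

lemma tpow_linear_ext:
 assumes "module k W" "lmap k (tpow k V n) W f" "lmap k (tpow k V n) W g"
  and "!!vs. set vs <= carrier V ==> length vs = n ==> f (ptens k V vs) = g (ptens k V vs)"
  and "z <: tpow k V n"
 shows "f z = g z"
proof (rule P.linear_ext[OF assms(1), where f = f and g = g and n = n])
 show "f (gen k (words V n) (multilinear_rels k V n) x) = g (gen k (words V n) (multilinear_rels k V n) x)"
  if "x : words V n" for x
  using assms(4)[of x] that by (simp add: words_iff ptens_def)
qed (use assms(2,3,5) in \<open>simp_all add: tpow_def\<close>)

lemma tpow_lift_param:
 assumes "module k U" "module k W" "!!x. x <: U ==> multilin k V n W (g x)"
  and "!!vs. set vs <= carrier V ==> length vs = n ==> lmap k U W (%x. g x vs)"
  and "z <: tpow k V n"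
 shows "lmap k U W (%x. lift k W (g x) z)"
 using assms unfolding tpow_def
 by (intro P.lift_param_linear[where n = n]) (auto simp: words_iff multilin_kills_rels[symmetric])

lemma tpow_lift_hom:
 assumes "module k W" "module k U" "lmap k W U L" "multilin k V n W f"
  "z <: tpow k V n"
 shows "L (lift k W f z) = lift k U (%x. L (f x)) z"
 using assms unfolding tpow_def
 by (intro P.lift_hom[where n = n]) (auto simp: multilin_kills_rels[symmetric])

end

lemma multilin_comp:
 assumes "lmap k W U L" "multilin k V n W f"
 shows "multilin k V n U (%x. L (f x))"
 using assms
 by (intro multilinI) (auto intro: lin_closed multilin_closed lin_comp multilin_linear)

section \<open>Tensor products\<close>

definition bilin ::
  "'k ring => ('k, 'v, 'x) module_scheme => ('k, 'w, 'y) module_scheme => ('k, 'u, 'z) module_scheme =>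
   ('v => 'w => 'u) => bool" where
 "bilin k V W U f \<longleftrightarrow>
  (ALL x:carrier V. lmap k W U (%y. f x y)) & (ALL y:carrier W. lmap k V U (%x. f x y))"

lemma bilinI:
 "(!!x. x <: V ==> lmap k W U (%y. f x y)) ==>
  (!!y. y <: W ==> lmap k V U (%x. f x y)) ==> bilin k V W U f"
 by (auto simp: bilin_def)

lemma bil_left: "bilin k V W U f ==> y <: W ==> lmap k V U (%x. f x y)"
 by (auto simp: bilin_def)

lemma bil_right: "bilin k V W U f ==> x <: V ==> lmap k W U (%y. f x y)"
 by (auto simp: bilin_def)

lemma bil_closed: "bilin k V W U f ==> x <: V ==> y <: W ==> f x y <: U"
 by (auto simp: bilin_def intro: lin_closed)

lemma multilin_2:
 assumes "bilin k V V W (%x y. f [x, y])"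
 shows "multilin k V 2 W f"
proof (rule multilinI)
 fix vs assume "set vs <= carrier V" "length vs = 2"
 then obtain x y where "vs = [x, y]" "x <: V" "y <: V"
  by (auto simp: numeral_2_eq_2 length_Suc_conv)
 then show "f vs <: W" using bil_closed[OF assms] by simp
next
 fix us vs assume uv: "set us <= carrier V" "set vs <= carrier V" "Suc (length us + length vs) = 2"
 then consider x where "us = [x]" "vs = []" "x <: V" | y where "us = []" "vs = [y]" "y <: V"
  by (cases us; cases vs) auto
 then show "lmap k V W (%x. f (us @ x # vs))"
  by cases (use bil_left[OF assms] bil_right[OF assms] in auto)
qed

locale tensor_product = V: module k V + W: module k W
 for k :: "'k ring" and V :: "('k, 'v, 'x) module_scheme" and W :: "('k, 'w, 'y) module_scheme"
begin

lemma ck: "cring k" by (rule V.R.is_cring)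

lemma bilinear_rels_closed: "bilinear_rels k V W <= carrier (Fr k (carrier V \<times> carrier W))"
proof -
 interpret F: module k "Fr k (carrier V \<times> carrier W)" by (rule module_free[OF ck])
 show ?thesis
  by (auto simp: bilinear_rels_def Let_def intro!: F.minus_closed F.a_closed F.smult_closed
    delta_closed[OF ck])
qed

lemma bilin_kills_rels:
 assumes U: "module k U"
 shows "bilin k V W U f \<longleftrightarrow>
  kills_rels k (carrier V \<times> carrier W) (bilinear_rels k V W) U (%(x, y). f x y)"
proof
 assume f: "bilin k V W U f"
 then have c: "(%(x, y). f x y) : carrier V \<times> carrier W \<rightarrow> carrier U" by (auto intro: bil_closed)
 have "ext_lin k U (%(x, y). f x y) r = 0[U]" if "r : bilinear_rels k V W" for r
  using that unfolding bilinear_rels_def Let_def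
  by (elim UnE CollectE exE conjE)
   (simp_all add: ext_rel_add[OF ck U c] ext_rel_smult[OF ck U c]
    lin_add[OF bil_left[OF f]] lin_add[OF bil_right[OF f]]
    lin_smult[OF bil_left[OF f]] lin_smult[OF bil_right[OF f]])
 then show "kills_rels k (carrier V \<times> carrier W) (bilinear_rels k V W) U (%(x, y). f x y)"
  using c by (simp add: kills_rels_def)
next
 assume f: "kills_rels k (carrier V \<times> carrier W) (bilinear_rels k V W) U (%(x, y). f x y)"
 then have c: "(%(x, y). f x y) : carrier V \<times> carrier W \<rightarrow> carrier U" by (simp add: kills_rels_def)
 have fr: "ALL r:bilinear_rels k V W. ext_lin k U (%(x, y). f x y) r = 0[U]"
  using f by (simp add: kills_rels_def)
 have 1: "f (x +[V] x') y = f x y +[U] f x' y" if "x <: V" "x' <: V" "y <: W" for x x' y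
 proof -
  have "delta k (x +[V] x', y) -[Fr k (carrier V \<times> carrier W)]
    (delta k (x, y) +[Fr k (carrier V \<times> carrier W)] delta k (x', y)) : bilinear_rels k V W"
   unfolding bilinear_rels_def Let_def by (insert that, rule UnI1, rule UnI1, rule UnI1, blast)
  then show ?thesis using fr that by (auto simp: ext_rel_add[OF ck U c])
 qed
 have 2: "f x (y +[W] y') = f x y +[U] f x y'" if "x <: V" "y' <: W" "y <: W" for x y y'
 proof -
  have "delta k (x, y +[W] y') -[Fr k (carrier V \<times> carrier W)]
    (delta k (x, y) +[Fr k (carrier V \<times> carrier W)] delta k (x, y')) : bilinear_rels k V W"
   unfolding bilinear_rels_def Let_def by (insert that, rule UnI1, rule UnI1, rule UnI2, blast)
  then show ?thesis using fr that by (auto simp: ext_rel_add[OF ck U c])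
 qed
 have 3: "f (a .[V] x) y = a .[U] f x y" if "a <: k" "x <: V" "y <: W" for x a y
 proof -
  have "delta k (a .[V] x, y) -[Fr k (carrier V \<times> carrier W)]
    (a .[Fr k (carrier V \<times> carrier W)] delta k (x, y)) : bilinear_rels k V W"
   unfolding bilinear_rels_def Let_def by (insert that, rule UnI1, rule UnI2, blast)
  then show ?thesis using fr that by (auto simp: ext_rel_smult[OF ck U c])
 qed
 have 4: "f x (a .[W] y) = a .[U] f x y" if "a <: k" "x <: V" "y <: W" for x a y
 proof -
  have "delta k (x, a .[W] y) -[Fr k (carrier V \<times> carrier W)]
    (a .[Fr k (carrier V \<times> carrier W)] delta k (x, y)) : bilinear_rels k V W"
   unfolding bilinear_rels_def Let_def by (insert that, rule UnI2, blast)
  then show ?thesis using fr that by (auto simp: ext_rel_smult[OF ck U c])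
 qed
 show "bilin k V W U f"
  using c unfolding Pi_iff by (intro bilinI linI) (auto simp: 1 2 3 4)
qed

interpretation P: presentation k "carrier V \<times> carrier W" "bilinear_rels k V W"
 using bilinear_rels_closed by unfold_locales

lemma module_tensor: "module k (tensor k V W)"
 unfolding tensor_def by (rule P.module_presented)

lemma tens_bilin: "bilin k V W (tensor k V W) (tens k V W)"
 unfolding bilin_kills_rels[OF module_tensor] unfolding tensor_def tens_def
 using P.gen_kills_rels by (simp add: case_prod_beta' )

lemma tens_closed: "x <: V ==> y <: W ==> tens k V W x y <: tensor k V W"
 by (rule bil_closed[OF tens_bilin])

lemma tensor_lift_linear:
 "module k U ==> bilin k V W U f ==> lmap k (tensor k V W) U (lift k U (%(x, y). f x y))"
 unfolding tensor_def by (rule P.lift_linear) (simp_all add: bilin_kills_rels)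

lemma tensor_lift_tens:
 "module k U ==> bilin k V W U f ==> x <: V ==> y <: W ==>
  lift k U (%(x, y). f x y) (tens k V W x y) = f x y"
 unfolding tens_def by (subst P.lift_gen) (simp_all add: bilin_kills_rels)

lemma tensor_lift_cong:
 assumes "z <: tensor k V W" "!!x y. x <: V ==> y <: W ==> f x y = g x y"
 shows "lift k U (%(x, y). f x y) z = lift k U (%(x, y). g x y) z"
 using assms by (intro P.lift_cong) (auto simp: tensor_def)

lemma tensor_lift_param:
 assumes "module k U'" "module k U" "!!x. x <: U' ==> bilin k V W U (g x)"
  and "!!v w. v <: V ==> w <: W ==> lmap k U' U (%x. g x v w)"
  and "z <: tensor k V W"
 shows "lmap k U' U (%x. lift k U (%(v, w). g x v w) z)"
 using assms unfolding tensor_def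
 by (intro P.lift_param_linear) (auto simp: bilin_kills_rels[symmetric])

lemma tensor_lift_hom:
 assumes "module k U" "module k U'" "lmap k U U' L" "bilin k V W U f"
  "z <: tensor k V W"
 shows "L (lift k U (%(v, w). f v w) z) = lift k U' (%(v, w). L (f v w)) z"
proof -
 have "L (lift k U (%(v, w). f v w) z) = lift k U' (%x. L ((%(v, w). f v w) x)) z"
  using assms unfolding tensor_def
  by (intro P.lift_hom) (auto simp: bilin_kills_rels[symmetric])
 then show ?thesis by (simp add: case_prod_beta')
qed

end

lemma bilin_comp:
 assumes "lmap k W U L" "bilin k V V' W f"
 shows "bilin k V V' U (%x y. L (f x y))"
 using assms by (auto simp: bilin_def intro: lin_comp)

section \<open>Tensor products over an algebra\<close>

definition balanced ::
  "'k ring => ('k, 'a, 'z) module_scheme => ('k, 'a, 'x, 'u) rmodule_scheme =>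
    ('k, 'a, 'm, 'v) lmodule_scheme => ('k, 'y, 'w) module_scheme => ('x => 'm => 'y) => bool" where
 "balanced k A X M U f \<longleftrightarrow> bilin k X M U f &
  (ALL x:carrier X. ALL a:carrier A. ALL m:carrier M. f (ract X x a) m = f x (lact M a m))"

locale tensor_over_algebra = tensor_product k X M
 for k :: "'k ring" and X :: "('k, 'a, 'x, 'u) rmodule_scheme" and M :: "('k, 'a, 'm, 'v) lmodule_scheme" +
 fixes A :: "('k, 'a, 'z) module_scheme"
 assumes ract_closed: "x <: X ==> a <: A ==> ract X x a <: X"
  and lact_closed: "m <: M ==> a <: A ==> lact M a m <: M"
begin

lemma over_rels_closed: "over_rels k A X M <= carrier (Fr k (carrier X \<times> carrier M))"
proof -
 interpret F: module k "Fr k (carrier X \<times> carrier M)" by (rule module_free[OF ck])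
 show ?thesis
  using bilinear_rels_closed
  by (auto simp: over_rels_def intro!: F.minus_closed delta_closed[OF ck] ract_closed lact_closed)
qed

lemma balanced_kills_rels:
 assumes U: "module k U"
 shows "balanced k A X M U f \<longleftrightarrow>
  kills_rels k (carrier X \<times> carrier M) (over_rels k A X M) U (%(x, y). f x y)"
proof -
 have "kills_rels k (carrier X \<times> carrier M) (over_rels k A X M) U (%(x, y). f x y) \<longleftrightarrow>
  bilin k X M U f &
  (ALL x a m. x <: X & a <: A & m <: M -->
   ext_lin k U (%(x, y). f x y)
    (delta k (ract X x a, m) -[Fr k (carrier X \<times> carrier M)] delta k (x, lact M a m)) = 0[U])"
  unfolding bilin_kills_rels[OF U] kills_rels_def over_rels_def ball_Un by blast
 also have "... \<longleftrightarrow> balanced k A X M U f"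
 proof -
  have "ext_lin k U (%(x, y). f x y)
    (delta k (ract X x a, m) -[Fr k (carrier X \<times> carrier M)] delta k (x, lact M a m)) = 0[U] \<longleftrightarrow>
    f (ract X x a) m = f x (lact M a m)"
   if "bilin k X M U f" "x <: X" "a <: A" "m <: M" for x a m
  proof -
   have c: "(%(x, y). f x y) : carrier X \<times> carrier M \<rightarrow> carrier U"
    using that by (auto intro: bil_closed)
   show ?thesis using that by (simp add: ext_rel_eq[OF ck U c] ract_closed lact_closed)
  qed
  then show ?thesis by (auto simp: balanced_def)
 qed
 finally show ?thesis by simp
qed

interpretation P: presentation k "carrier X \<times> carrier M" "over_rels k A X M"
 using over_rels_closed by unfold_locales

lemma module_tensor_over: "module k (tov k A X M)"
 unfolding tensor_over_def by (rule P.module_presented)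

lemma tens_over_balanced: "balanced k A X M (tov k A X M) (tns k A X M)"
 unfolding balanced_kills_rels[OF module_tensor_over] unfolding tensor_over_def tens_over_def
 using P.gen_kills_rels by (simp add: case_prod_beta' )

lemma tens_over_bilin: "bilin k X M (tov k A X M) (tns k A X M)"
 using tens_over_balanced by (simp add: balanced_def)

lemma tens_over_move:
 "x <: X ==> a <: A ==> m <: M ==>
  tns k A X M (ract X x a) m = tns k A X M x (lact M a m)"
 using tens_over_balanced by (simp add: balanced_def)

lemma over_lift_linear:
 "module k U ==> balanced k A X M U f ==> lmap k (tov k A X M) U (lift k U (%(x, y). f x y))"
 unfolding tensor_over_def by (rule P.lift_linear) (simp_all add: balanced_kills_rels)

lemma over_lift_tens:
 "module k U ==> balanced k A X M U f ==> x <: X ==> y <: M ==>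
  lift k U (%(x, y). f x y) (tns k A X M x y) = f x y"
 unfolding tens_over_def by (subst P.lift_gen) (simp_all add: balanced_kills_rels)

lemma over_lift_cong:
 assumes "z <: tov k A X M" "!!x y. x <: X ==> y <: M ==> f x y = g x y"
 shows "lift k U (%(x, y). f x y) z = lift k U (%(x, y). g x y) z"
 using assms by (intro P.lift_cong) (auto simp: tensor_over_def)

lemma over_linear_ext:
 assumes "module k U" "lmap k (tov k A X M) U f" "lmap k (tov k A X M) U g"
  and "!!x y. x <: X ==> y <: M ==> f (tns k A X M x y) = g (tns k A X M x y)"
  and "z <: tov k A X M"
 shows "f z = g z"
proof (rule P.linear_ext[OF assms(1), where f = f and g = g])
 show "f (gen k (carrier X \<times> carrier M) (over_rels k A X M) p) =
   g (gen k (carrier X \<times> carrier M) (over_rels k A X M) p)" if "p : carrier X \<times> carrier M" for p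
  using assms(4) that by (auto simp: tens_over_def)
qed (use assms(2,3,5) in \<open>simp_all add: tensor_over_def\<close>)

end

section \<open>Adding a tensor factor at either end\<close>

lemma multilin_cong:
 assumes "module k V" "!!vs. set vs <= carrier V ==> length vs = n ==> f vs = g vs" "multilin k V n W g"
 shows "multilin k V n W f"
proof (rule multilinI)
 show "f vs <: W" if "set vs <= carrier V" "length vs = n" for vs
  using that assms(2) multilin_closed[OF assms(3)] by simp
 show "lmap k V W (%x. f (us @ x # vs))"
  if "set us <= carrier V" "set vs <= carrier V" "Suc (length us + length vs) = n" for us vs
  using that assms(2) multilin_linear[OF assms(3) that]
  by (subst lin_cong[OF assms(1), where g = "%x. g (us @ x # vs)"]) auto
qed

lemma linear_bilin_left:
 "bilin k V W U f ==> lmap k X V g ==> y <: W ==> lmap k X U (%x. f (g x) y)"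
 by (rule lin_comp[OF bil_left])

lemma linear_bilin_right:
 "bilin k V W U f ==> lmap k X W g ==> y <: V ==> lmap k X U (%x. f y (g x))"
 by (rule lin_comp[OF bil_right])

lemma multilin_3:
 assumes "!!b c. b <: V ==> c <: V ==> lmap k V W (%a. F a b c)"
  and "!!a c. a <: V ==> c <: V ==> lmap k V W (%b. F a b c)"
  and "!!a b. a <: V ==> b <: V ==> lmap k V W (%c. F a b c)"
 shows "multilin k V 3 W (%hs. F (hs ! 0) (hs ! 1) (hs ! 2))"
proof (rule multilinI)
 fix vs :: "'a list" assume vs: "set vs <= carrier V" "length vs = 3"
 then obtain a b c where "vs = [a, b, c]" by (auto simp: numeral_3_eq_3 length_Suc_conv)
 then show "F (vs ! 0) (vs ! 1) (vs ! 2) <: W" using vs lin_closed[OF assms(1)] by simp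
next
 fix us vs :: "'a list"
 assume uv: "set us <= carrier V" "set vs <= carrier V" "Suc (length us + length vs) = 3"
 consider b c where "us = []" "vs = [b, c]" | a c where "us = [a]" "vs = [c]"
  | a b where "us = [a, b]" "vs = []"
  using uv(3) by (cases us; cases "tl us"; cases vs; cases "tl vs") auto
 then show "lmap k V W (%x. F ((us @ x # vs) ! 0) ((us @ x # vs) ! 1) ((us @ x # vs) ! 2))"
  using uv assms by cases (auto simp: nth_Cons')
qed

context tensor_power
begin

abbreviation T where "T n == tpow k V n"
abbreviation T' where "T' n == tpow k V (Suc n)"

definition snoc where "snoc n z b = lift k (T' n) (%vs. ptens k V (vs @ [b])) z"
definition cns where "cns n b z = lift k (T' n) (%vs. ptens k V (b # vs)) z"
definition unsnoc where "unsnoc W g = lift k W (%ws. g (ptens k V (butlast ws)) (last ws))"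

lemma snoc_multilin: "b <: V ==> multilin k V n (T' n) (%vs. ptens k V (vs @ [b]))"
 using multilin_linear[OF ptens_multilin, where vs = "_ @ [b]"]
 by (intro multilinI) (auto simp: ptens_closed)

lemma cns_multilin: "b <: V ==> multilin k V n (T' n) (%vs. ptens k V (b # vs))"
 using multilin_linear[OF ptens_multilin, where us = "b # _"]
 by (intro multilinI) (auto simp: ptens_closed)

lemma snoc_ptens: "set vs <= carrier V ==> length vs = n ==> b <: V ==>
  snoc n (ptens k V vs) b = ptens k V (vs @ [b])"
 unfolding snoc_def by (simp add: tpow_lift_ptens[OF T_mod snoc_multilin])

lemma cns_ptens: "set vs <= carrier V ==> length vs = n ==> b <: V ==>
  cns n b (ptens k V vs) = ptens k V (b # vs)"
 unfolding cns_def by (simp add: tpow_lift_ptens[OF T_mod cns_multilin])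

lemma snoc_bilin: "bilin k (T n) V (T' n) (snoc n)"
proof (rule bilinI)
 show "lmap k V (T' n) (%y. snoc n x y)" if "x <: T n" for x
  unfolding snoc_def using multilin_linear[OF ptens_multilin, where vs = "[]"] that
  by (intro tpow_lift_param[OF mV T_mod snoc_multilin]) auto
 show "lmap k (T n) (T' n) (%x. snoc n x y)" if "y <: V" for y
  unfolding snoc_def using tpow_lift_linear[OF T_mod snoc_multilin[OF that]] .
qed

lemma cns_bilin: "bilin k V (T n) (T' n) (cns n)"
proof (rule bilinI)
 show "lmap k V (T' n) (%y. cns n y x)" if "x <: T n" for x
  unfolding cns_def using multilin_linear[OF ptens_multilin, where us = "[]"] that
  by (intro tpow_lift_param[OF mV T_mod cns_multilin]) auto
 show "lmap k (T n) (T' n) (%x. cns n y x)" if "y <: V" for y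
  unfolding cns_def using tpow_lift_linear[OF T_mod cns_multilin[OF that]] .
qed

lemmas snoc_closed = bil_closed[OF snoc_bilin]
lemmas cns_closed = bil_closed[OF cns_bilin]
lemmas lin_snoc = linear_bilin_left[OF snoc_bilin] linear_bilin_right[OF snoc_bilin]
lemmas lin_cns = linear_bilin_left[OF cns_bilin] linear_bilin_right[OF cns_bilin]

lemma word_snoc:
 assumes "set vs <= carrier V" "length vs = Suc n"
 shows "set (butlast vs) <= carrier V" "last vs <: V" "length (butlast vs) = n"
  "ptens k V vs = snoc n (ptens k V (butlast vs)) (last vs)" "butlast vs @ [last vs] = vs"
proof -
 have "vs ~= []" using assms by auto
 then show e: "butlast vs @ [last vs] = vs" by simp
 show "set (butlast vs) <= carrier V" "last vs <: V" "length (butlast vs) = n"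
  using assms \<open>vs \<noteq> []\<close> by (auto dest: in_set_butlastD)
 then show "ptens k V vs = snoc n (ptens k V (butlast vs)) (last vs)"
  using snoc_ptens[of "butlast vs" n "last vs"] e by simp
qed

lemma snoc_ext:
 assumes "module k W" "lmap k (T' n) W f" "lmap k (T' n) W g"
  and "!!z b. z <: T n ==> b <: V ==> f (snoc n z b) = g (snoc n z b)"
  and "z <: T' n"
 shows "f z = g z"
proof (rule tpow_linear_ext[OF assms(1,2,3) _ assms(5)])
 show "f (ptens k V vs) = g (ptens k V vs)" if "set vs <= carrier V" "length vs = Suc n" for vs
  using assms(4)[of "ptens k V (butlast vs)" "last vs"] word_snoc[OF that] ptens_closed by simp
qed

text \<open>The isomorphism between the power \<open>Suc n\<close> and the product of the power \<open>n\<close> with \<open>V\<close>, as a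
  universal property: bilinear maps on the product are linear maps on the power.\<close>

lemma unsnoc_multilin:
 assumes "bilin k (T n) V W g"
 shows "multilin k V (Suc n) W (%ws. g (ptens k V (butlast ws)) (last ws))"
proof (rule multilinI)
 show "g (ptens k V (butlast vs)) (last vs) <: W"
  if "set vs <= carrier V" "length vs = Suc n" for vs
  using word_snoc[OF that] ptens_closed bil_closed[OF assms] by simp
 show "lmap k V W (%x. g (ptens k V (butlast (us @ x # vs))) (last (us @ x # vs)))"
  if uv: "set us <= carrier V" "set vs <= carrier V" "Suc (length us + length vs) = Suc n" for us vs
 proof (cases vs rule: rev_cases)
  case Nil
  then show ?thesis using uv bil_right[OF assms, of "ptens k V us"] ptens_closed by simp
 next
  case (snoc vs' y)
  then have "lmap k V W (%x. g (ptens k V (us @ x # vs')) y)"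
   using uv multilin_linear[OF ptens_multilin, of us vs' n]
   by (intro lin_comp[OF bil_left[OF assms]]) auto
  then show ?thesis using snoc by (simp add: butlast_append)
 qed
qed

lemma unsnoc_linear: "module k W ==> bilin k (T n) V W g ==> lmap k (T' n) W (unsnoc W g)"
 unfolding unsnoc_def by (rule tpow_lift_linear[OF _ unsnoc_multilin])

lemma unsnoc_snoc:
 assumes "module k W" "bilin k (T n) V W g" "z <: T n" "b <: V"
 shows "unsnoc W g (snoc n z b) = g z b"
proof (rule tpow_linear_ext[OF assms(1) _ bil_left[OF assms(2,4)] _ assms(3)])
 show "lmap k (T n) W (%z. unsnoc W g (snoc n z b))"
  by (rule lin_comp[OF unsnoc_linear[OF assms(1,2)] bil_left[OF snoc_bilin assms(4)]])
 show "unsnoc W g (snoc n (ptens k V vs) b) = g (ptens k V vs) b"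
  if "set vs <= carrier V" "length vs = n" for vs
  using that assms(4) unfolding unsnoc_def
  by (simp add: snoc_ptens tpow_lift_ptens[OF assms(1) unsnoc_multilin[OF assms(2)]])
qed

lemma lift_unsnoc:
 assumes "module k W" "bilin k (T n) V W g"
  and "!!vs b. set vs <= carrier V ==> length vs = n ==> b <: V ==> f (vs @ [b]) = g (ptens k V vs) b"
 shows "multilin k V (Suc n) W f" "lmap k (T' n) W (lift k W f)"
  "z <: T n ==> b <: V ==> lift k W f (snoc n z b) = g z b"
proof -
 have e: "f vs = g (ptens k V (butlast vs)) (last vs)" if "set vs <= carrier V" "length vs = Suc n" for vs
  using assms(3)[of "butlast vs" "last vs"] word_snoc[OF that] by simp
 show m: "multilin k V (Suc n) W f"
  by (rule multilin_cong[OF mV e unsnoc_multilin[OF assms(2)]])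
 then show "lmap k (T' n) W (lift k W f)" by (rule tpow_lift_linear[OF assms(1)])
 assume z: "z <: T n" "b <: V"
 have "lift k W f (snoc n z b) = unsnoc W g (snoc n z b)"
  unfolding unsnoc_def by (rule tpow_lift_cong[OF snoc_closed[OF z] e])
 then show "lift k W f (snoc n z b) = g z b"
  using unsnoc_snoc[OF assms(1,2) z] by simp
qed

lemma cns_snoc:
 assumes "z <: T n" "a <: V" "b <: V"
 shows "cns (Suc n) a (snoc n z b) = snoc (Suc n) (cns n a z) b"
 by (rule tpow_linear_ext[OF T_mod _ _ _ assms(1)])
  (use assms in \<open>auto intro!: lin_snoc lin_cns lin_id simp: snoc_ptens cns_ptens\<close>)

lemma cns_0: "b <: V ==> cns 0 b z0 = snoc 0 z0 b" if "z0 <: T 0"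
 by (rule tpow_linear_ext[OF T_mod _ _ _ that])
  (auto intro!: lin_snoc lin_cns lin_id simp: snoc_ptens cns_ptens)

end

section \<open>Sweedler calculus\<close>

definition sw :: "'k ring => ('k, 'h) hopf => ('k, 'w, 'z) module_scheme => ('h => 'h => 'w) => 'h => 'w" where
 "sw k H W f h = lift k W (%hs. f (hs ! 0) (hs ! 1)) (comult H h)"

sublocale hopf_algebra \<subseteq> tensor_power k H
 by unfold_locales

context hopf_algebra
begin

abbreviation eH where "eH == counit H"
abbreviation pH where "pH == ptens k H"

abbreviation sw' where "sw' == sw k H"

lemma module_H: "module k H" by (rule module_axioms)

lemma module_k: "module k (ground_module k)" by (rule module_ground[OF ck])

lemma word_2: "set vs <= carrier H ==> length vs = 2 ==> EX a b. vs = [a, b] & a <: H & b <: H"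
 by (auto simp: numeral_2_eq_2 length_Suc_conv)

lemma sw_multilin: "bilin k H H W f ==> multilin k H 2 W (%hs. f (hs ! 0) (hs ! 1))"
 by (intro multilin_2) simp

lemma comult_closed: "h <: H ==> comult H h <: T 2"
 by (rule lin_closed[OF comult_linear])

lemma eps_cl: "h <: H ==> eH h <: k"
 using lin_closed[OF counit_linear] by simp

lemma antipode_closed: "h <: H ==> antipode H h <: H"
 by (rule lin_closed[OF antipode_linear])

lemma sw_linear: "module k W ==> bilin k H H W f ==> lmap k H W (sw' W f)"
 unfolding sw_def by (intro lin_comp[OF tpow_lift_linear comult_linear] sw_multilin)

lemma sw_closed: "module k W ==> bilin k H H W f ==> h <: H ==> sw' W f h <: W"
 by (rule lin_closed[OF sw_linear])

lemma sw_cong: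
 assumes "h <: H" "!!a b. a <: H ==> b <: H ==> f a b = g a b"
 shows "sw' W f h = sw' W g h"
 unfolding sw_def using assms(2)
 by (intro tpow_lift_cong[OF comult_closed[OF assms(1)]]) (auto dest: word_2)

lemma sw_hom:
 assumes "module k W" "module k U" "lmap k W U L" "bilin k H H W f" "h <: H"
 shows "L (sw' W f h) = sw' U (%a b. L (f a b)) h"
 unfolding sw_def
 by (rule tpow_lift_hom[OF assms(1-3) sw_multilin[OF assms(4)] comult_closed[OF assms(5)]])

lemma sw_param:
 assumes "module k U" "module k W" "!!x. x <: U ==> bilin k H H W (f x)"
  and "!!a b. a <: H ==> b <: H ==> lmap k U W (%x. f x a b)" "h <: H"
 shows "lmap k U W (%x. sw' W (f x) h)"
 unfolding sw_def
 by (rule tpow_lift_param[OF assms(1,2) sw_multilin[OF assms(3)] _ comult_closed[OF assms(5)]])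
  (use assms(4) in \<open>auto dest: word_2\<close>)

lemma lin_sw: "module k W ==> bilin k H H W f ==> lmap k U H g ==> lmap k U W (%x. sw' W f (g x))"
 by (rule lin_comp[OF sw_linear])

lemma lin_mult_left: "lmap k U H g ==> a <: H ==> lmap k U H (%x. g x *[H] a)"
 by (intro linI) (simp_all add: lin_closed lin_add lin_smult l_distr smult_mult_left)

lemma lin_mult_right: "lmap k U H g ==> a <: H ==> lmap k U H (%x. a *[H] g x)"
 by (intro linI) (simp_all add: lin_closed lin_add lin_smult r_distr smult_mult_right)

lemmas lin_antipode = lin_comp[OF antipode_linear]
lemmas lin_counit = lin_comp[OF counit_linear]

lemma lin_scalar:
 "module k W ==> lmap k U H g ==> w <: W ==> lmap k U W (%x. eH (g x) .[W] w)"
 by (intro scalar_lin lin_counit)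

lemmas lin = lin_id lin_mult_left lin_mult_right lin_antipode lin_scalar lin_smult_const
 lin_snoc lin_cns lin_sw sw_param bilinI

lemmas cl = comult_closed eps_cl antipode_closed m_closed snoc_closed cns_closed T_mod module_H
 module_k sw_closed

lemma sw_swap:
 assumes "module k W" "g <: H" "h <: H"
  and "!!a b. a <: H ==> b <: H ==> bilin k H H W (F a b)"
  and "!!c d. c <: H ==> d <: H ==> bilin k H H W (%a b. F a b c d)"
 shows "sw' W (%a b. sw' W (F a b) h) g = sw' W (%c d. sw' W (%a b. F a b c d) g) h"
proof -
 have 1: "bilin k H H W (%a b. sw' W (F a b) h)"
  by (intro bilinI sw_param assms(1,3,4) module_H bil_left[OF assms(5)] bil_right[OF assms(5)])
 note m1 = sw_multilin[OF 1]
 have 2: "multilin k H 2 W (%as. F (as ! 0) (as ! 1) c d)" if "c <: H" "d <: H" for c d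
  by (rule sw_multilin[OF assms(5)[OF that]])
 have 3: "bilin k H H W (%c d. lift k W (%as. F (as ! 0) (as ! 1) c d) z)" if z: "z <: T 2" for z
 proof (rule bilinI)
  fix c assume c: "c <: H"
  show "lmap k H W (%d. lift k W (%as. F (as ! 0) (as ! 1) c d) z)"
   by (rule tpow_lift_param[OF module_H assms(1) 2 _ z])
    (auto simp: c dest!: word_2 intro: bil_right[OF assms(4)])
  show "lmap k H W (%d. lift k W (%as. F (as ! 0) (as ! 1) d c) z)"
   by (rule tpow_lift_param[OF module_H assms(1) 2 _ z])
    (auto simp: c dest!: word_2 intro: bil_left[OF assms(4)])
 qed
 have "lift k W (%as. sw' W (F (as ! 0) (as ! 1)) h) z =
   sw' W (%c d. lift k W (%as. F (as ! 0) (as ! 1) c d) z) h" if z: "z <: T 2" for z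
 proof (rule tpow_linear_ext[OF assms(1) tpow_lift_linear[OF assms(1) m1] _ _ z])
  show "lmap k (T 2) W (%z. sw' W (%c d. lift k W (%as. F (as ! 0) (as ! 1) c d) z) h)"
   by (intro sw_param T_mod assms(1,3) 3 tpow_lift_linear 2)
  fix vs assume vs: "set vs <= carrier H" "length vs = 2"
  then have "sw' W (%c d. lift k W (%as. F (as ! 0) (as ! 1) c d) (pH vs)) h =
    sw' W (%c d. F (vs ! 0) (vs ! 1) c d) h"
   by (intro sw_cong assms(3) tpow_lift_ptens[OF assms(1) 2])
  then show "lift k W (%as. sw' W (F (as ! 0) (as ! 1)) h) (pH vs) =
    sw' W (%c d. lift k W (%as. F (as ! 0) (as ! 1) c d) (pH vs)) h"
   using tpow_lift_ptens[OF assms(1) m1 vs] by simp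
 qed
 from this[OF comult_closed[OF assms(2)]] show ?thesis by (simp add: sw_def)
qed

lemma sw_counit_left:
 assumes "module k W" "lmap k H W f" "h <: H"
 shows "sw' W (%a b. eH a .[W] f b) h = f h"
proof -
 have b: "bilin k H H H (%a b. eH a .[H] b)"
  by (intro lin) (simp_all add: cl)
 have "f h = f (sw' H (%a b. eH a .[H] b) h)"
  using counit_left[OF assms(3)] by (simp add: sw_def)
 also have "... = sw' W (%a b. f (eH a .[H] b)) h"
  by (rule sw_hom[OF module_H assms(1,2) b assms(3)])
 also have "... = sw' W (%a b. eH a .[W] f b) h"
  by (intro sw_cong assms(3)) (simp add: lin_smult[OF assms(2)] cl)
 finally show ?thesis by simp
qed

lemma sw_counit_right:
 assumes "module k W" "lmap k H W f" "h <: H"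
 shows "sw' W (%a b. eH b .[W] f a) h = f h"
proof -
 have b: "bilin k H H H (%a b. eH b .[H] a)"
  by (intro lin) (simp_all add: cl)
 have "f h = f (sw' H (%a b. eH b .[H] a) h)"
  using counit_right[OF assms(3)] by (simp add: sw_def)
 also have "... = sw' W (%a b. f (eH b .[H] a)) h"
  by (rule sw_hom[OF module_H assms(1,2) b assms(3)])
 also have "... = sw' W (%a b. eH b .[W] f a) h"
  by (intro sw_cong assms(3)) (simp add: lin_smult[OF assms(2)] cl)
 finally show ?thesis by simp
qed

lemma sw_antipode_left:
 assumes "module k W" "lmap k H W f" "h <: H"
 shows "sw' W (%a b. f (antipode H a *[H] b)) h = eH h .[W] f 1[H]"
proof -
 have b: "bilin k H H H (%a b. antipode H a *[H] b)"
  by (intro lin) (simp_all add: cl)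
 have "f (sw' H (%a b. antipode H a *[H] b) h) = sw' W (%a b. f (antipode H a *[H] b)) h"
  by (rule sw_hom[OF module_H assms(1,2) b assms(3)])
 then show ?thesis
  using antipode_left[OF assms(3)] by (simp add: sw_def lin_smult[OF assms(2)] cl assms(3))
qed

lemma sw_antipode_right:
 assumes "module k W" "lmap k H W f" "h <: H"
 shows "sw' W (%a b. f (a *[H] antipode H b)) h = eH h .[W] f 1[H]"
proof -
 have b: "bilin k H H H (%a b. a *[H] antipode H b)"
  by (intro lin) (simp_all add: cl)
 have "f (sw' H (%a b. a *[H] antipode H b) h) = sw' W (%a b. f (a *[H] antipode H b)) h"
  by (rule sw_hom[OF module_H assms(1,2) b assms(3)])
 then show ?thesis
  using antipode_right[OF assms(3)] by (simp add: sw_def lin_smult[OF assms(2)] cl assms(3))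
qed

lemma sw_one: "module k W ==> bilin k H H W f ==> sw' W f 1[H] = f 1[H] 1[H]"
 unfolding sw_def comult_one by (subst tpow_lift_ptens[OF _ sw_multilin]) simp_all

lemma pair_bilin: "bilin k H H (T 2) (%a b. pH [a, b])"
 using multilin_linear[OF ptens_multilin, of "[]" "[_]" 2]
  multilin_linear[OF ptens_multilin, of "[_]" "[]" 2] by (auto intro!: bilinI)

lemma sw_coassoc:
 assumes "module k W" "h <: H"
  and l1: "!!b c. b <: H ==> c <: H ==> lmap k H W (%a. F a b c)"
  and l2: "!!a c. a <: H ==> c <: H ==> lmap k H W (%b. F a b c)"
  and l3: "!!a b. a <: H ==> b <: H ==> lmap k H W (%c. F a b c)"
 shows "sw' W (%a b. sw' W (%c d. F c d b) a) h = sw' W (%a b. sw' W (%c d. F a c d) b) h"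
proof -
 let ?G = "%hs. F (hs ! 0) (hs ! 1) (hs ! 2)"
 have G: "multilin k H 3 W ?G"
  by (rule multilin_3[where F = F]; (rule l1 | rule l2 | rule l3); assumption)
 have p3: "bilin k H H (T 3) (%c d. pH [c, d, b])" "bilin k H H (T 3) (%c d. pH [b, c, d])"
  if "b <: H" for b
  using multilin_linear[OF ptens_multilin, of "[]" "[_, _]" 3]
   multilin_linear[OF ptens_multilin, of "[_]" "[_]" 3]
   multilin_linear[OF ptens_multilin, of "[_, _]" "[]" 3] that
  by (auto intro!: bilinI simp: numeral_3_eq_3)
 have p3': "bilin k H H (T 3) (%a b. sw' (T 3) (%c d. pH [c, d, b]) a)"
  "bilin k H H (T 3) (%a b. sw' (T 3) (%c d. pH [a, c, d]) b)"
  using multilin_linear[OF ptens_multilin, of "[]" "[_, _]" 3]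
   multilin_linear[OF ptens_multilin, of "[_, _]" "[]" 3]
  by (intro bilinI lin_sw lin_id sw_param p3 T_mod module_H; simp)+
 have c0: "comult_at k H 1 0 (comult H h) = sw' (T 3) (%a b. sw' (T 3) (%c d. pH [c, d, b]) a) h"
  unfolding comult_at_def sw_def
  by (auto intro!: tpow_lift_cong[OF comult_closed] dest!: word_2 simp: assms(2) numeral_3_eq_3)
 have c1: "comult_at k H 1 1 (comult H h) = sw' (T 3) (%a b. sw' (T 3) (%c d. pH [a, c, d]) b) h"
  unfolding comult_at_def sw_def
  by (auto intro!: tpow_lift_cong[OF comult_closed] dest!: word_2 simp: assms(2) numeral_3_eq_3)
 note L = tpow_lift_linear[OF assms(1) G]
 have v: "lift k W ?G (pH [a, b, c]) = F a b c" if "a <: H" "b <: H" "c <: H" for a b c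
  using tpow_lift_ptens[OF assms(1) G, of "[a, b, c]"] that by simp
 have "lift k W ?G (sw' (T 3) (%a b. sw' (T 3) (%c d. pH [c, d, b]) a) h) =
   sw' W (%a b. sw' W (%c d. F c d b) a) h"
  by (subst sw_hom[OF T_mod assms(1) L p3'(1) assms(2)], rule sw_cong[OF assms(2)],
    subst sw_hom[OF T_mod assms(1) L p3(1)], assumption, assumption, rule sw_cong, assumption, rule v)
 moreover have "lift k W ?G (sw' (T 3) (%a b. sw' (T 3) (%c d. pH [a, c, d]) b) h) =
   sw' W (%a b. sw' W (%c d. F a c d) b) h"
  by (subst sw_hom[OF T_mod assms(1) L p3'(2) assms(2)], rule sw_cong[OF assms(2)],
    subst sw_hom[OF T_mod assms(1) L p3(2)], assumption, assumption, rule sw_cong, assumption, rule v)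
 ultimately show ?thesis using coassoc[OF assms(2)] unfolding c0 c1 by metis
qed

end

section \<open>Tensor powers of a Hopf algebra\<close>

context hopf_algebra
begin

text \<open>The map \<open>h \<mapsto> h\<^sub>(\<^sub>1\<^sub>) \<otimes> \<dots> \<otimes> h\<^sub>(\<^sub>n\<^sub>)\<close>, including the case \<open>n = 0\<close>, where it is the counit.\<close>

fun it where
 "it 0 h = eH h .[T 0] pH []"
| "it (Suc n) h = iter_comult k H n h"

abbreviation tm where "tm == tpow_mult k H"
abbreviation sg where "sg n == comult_at k H n n"

text \<open>Faces and rotation of the standard complex.  The rotation carries a factor \<open>c\<close>, which becomes the component
  \<open>m\<^sub>1\<close> in the cyclic operator of \<open>Z(H, M)\<close>.\<close>

definition fc where
 "fc n i = lift k (T n) (%hs. eH (hs ! i) .[T n] pH (take i hs @ drop (Suc i) hs))"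

definition rt where
 "rt n c = lift k (T' n) (%hs. pH ((hs ! n *[H] c) # take n hs))"

lemma sw_snoc:
 assumes "bilin k H H (T n) f" "h <: H" "b <: H"
 shows "snoc n (sw' (T n) f h) b = sw' (T' n) (%c d. snoc n (f c d) b) h"
 by (rule sw_hom[OF T_mod T_mod bil_left[OF snoc_bilin assms(3)] assms(1,2)])

lemma sw_cns:
 assumes "bilin k H H (T n) f" "h <: H" "b <: H"
 shows "cns n b (sw' (T n) f h) = sw' (T' n) (%c d. cns n b (f c d)) h"
 by (rule sw_hom[OF T_mod T_mod bil_right[OF cns_bilin assms(3)] assms(1,2)])

lemma smult_T: "a <: k ==> z <: T n ==> a .[T n] z <: T n"
 by (rule module.smult_closed[OF T_mod])

lemma snoc_smult: "a <: k ==> z <: T n ==> b <: H ==>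
  snoc n (a .[T n] z) b = a .[T' n] snoc n z b"
 by (rule lin_smult[OF bil_left[OF snoc_bilin]])

lemma cns_smult: "a <: k ==> z <: T n ==> b <: H ==>
  cns n b (a .[T n] z) = a .[T' n] cns n b z"
 by (rule lin_smult[OF bil_right[OF cns_bilin]])

lemma nil_closed: "pH [] <: T 0"
 by (rule ptens_closed) auto

lemma sg_lift:
 shows sg_linear: "lmap k (T' n) (T' (Suc n)) (sg n)"
  and sg_snoc: "z <: T n ==> b <: H ==>
   sg n (snoc n z b) = sw' (T' (Suc n)) (%c d. snoc (Suc n) (snoc n z c) d) b"
proof -
 let ?g = "%z b. sw' (T' (Suc n)) (%c d. snoc (Suc n) (snoc n z c) d) b"
 have b: "bilin k H H (T' (Suc n)) (%c d. snoc (Suc n) (snoc n z c) d)" if "z <: T n" for z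
  by (intro lin) (simp_all add: cl that)
 have g: "bilin k (T n) H (T' (Suc n)) ?g"
  by (intro lin) (simp_all add: cl)
 have e: "lift k (T (n + 2)) (%ab. pH (take n (vs @ [c]) @ ab @ drop (Suc n) (vs @ [c])))
    (comult H ((vs @ [c]) ! n)) = ?g (pH vs) c"
  if "set vs <= carrier H" "length vs = n" "c <: H" for vs c
 proof -
  have "pH (take n (vs @ [c]) @ ab @ drop (Suc n) (vs @ [c])) =
    snoc (Suc n) (snoc n (pH vs) (ab ! 0)) (ab ! 1)" if ab: "set ab <= carrier H" "length ab = 2" for ab
  proof -
   obtain a b where "ab = [a, b]" "a <: H" "b <: H" using word_2[OF ab] by blast
   then show ?thesis using \<open>set vs \<subseteq> carrier H\<close> \<open>length vs = n\<close> by (simp add: snoc_ptens)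
  qed
  then show ?thesis
   unfolding sw_def using that by (simp add: nth_append) (intro tpow_lift_cong[OF comult_closed]; simp)
 qed
 have "lmap k (T' n) (T (n + 2)) (sg n)"
  unfolding comult_at_def using e g by (intro lift_unsnoc(2)[OF T_mod]) simp_all
 then show "lmap k (T' n) (T' (Suc n)) (sg n)" by simp
 assume z: "z <: T n" "b <: H"
 show "sg n (snoc n z b) = ?g z b"
  unfolding comult_at_def using lift_unsnoc(3)[OF T_mod g _ z] e by simp
qed

lemma it_linear: "lmap k H (T n) (it n)"
proof (cases n)
 case 0
 have "lmap k H (T 0) (%h. eH h .[T 0] pH [])"
  by (intro lin nil_closed T_mod)
 moreover have "it 0 = (%h. eH h .[T 0] pH [])" by auto
 ultimately show ?thesis using 0 by simp
next
 case (Suc m)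
 have "lmap k H (T' m) (iter_comult k H m)"
 proof (induction m)
  case 0
  show ?case using multilin_linear[OF ptens_multilin, of "[]" "[]"] by simp
 next
  case (Suc m)
  show ?case using lin_comp[OF sg_linear Suc] by simp
 qed
 moreover have "it (Suc m) = iter_comult k H m" by auto
 ultimately show ?thesis using Suc by simp
qed

lemmas lin_it = lin_comp[OF it_linear]
lemma it_closed: "h <: H ==> it n h <: T n"
 by (rule lin_closed[OF it_linear])

lemma it_1: "h <: H ==> it (Suc 0) h = snoc 0 (pH []) h"
 by (simp add: snoc_ptens)

lemma it_Suc_Suc: "it (Suc (Suc n)) h = sg n (it (Suc n) h)"
 by simp

declare it.simps [simp del]

lemma it_snoc: "h <: H ==> it (Suc n) h = sw' (T' n) (%a b. snoc n (it n a) b) h"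
proof (induction n arbitrary: h)
 case 0
 have "sw' (T' 0) (%a b. snoc 0 (it 0 a) b) h =
   sw' (T' 0) (%a b. eH a .[T' 0] snoc 0 (pH []) b) h"
  by (intro sw_cong 0) (simp add: it.simps(1) snoc_smult cl nil_closed)
 also have "... = snoc 0 (pH []) h"
  by (rule sw_counit_left[OF T_mod bil_right[OF snoc_bilin nil_closed] 0])
 finally show ?case using it_1[OF 0] by simp
next
 case (Suc n)
 let ?W = "T' (Suc n)"
 have b: "bilin k H H (T' n) (%a b. snoc n (it n a) b)"
  by (intro lin lin_it) (simp_all add: it_closed)
 have "it (Suc (Suc n)) h = sg n (sw' (T' n) (%a b. snoc n (it n a) b) h)"
  using Suc by (simp add: it_Suc_Suc)
 also have "... = sw' ?W (%a b. sg n (snoc n (it n a) b)) h"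
  by (rule sw_hom[OF T_mod T_mod sg_linear b Suc.prems])
 also have "... = sw' ?W (%a b. sw' ?W (%c d. snoc (Suc n) (snoc n (it n a) c) d) b) h"
  by (intro sw_cong Suc.prems sg_snoc it_closed)
 also have "... = sw' ?W (%a b. sw' ?W (%c d. snoc (Suc n) (snoc n (it n c) d) b) a) h"
  by (intro sw_coassoc[symmetric] T_mod Suc.prems lin lin_it) (simp_all add: cl it_closed)
 also have "... = sw' ?W (%a b. snoc (Suc n) (sw' (T' n) (%c d. snoc n (it n c) d) a) b) h"
  by (intro sw_cong Suc.prems sw_snoc[symmetric] b)
 also have "... = sw' ?W (%a b. snoc (Suc n) (it (Suc n) a) b) h"
  by (intro sw_cong Suc.prems) (simp add: Suc.IH)
 finally show ?case .
qed

text \<open>Coassociativity: the recursion of the iterated comultiplication may also be run at the front.\<close>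

lemma it_cns: "h <: H ==> it (Suc n) h = sw' (T' n) (%a b. cns n a (it n b)) h"
proof (induction n arbitrary: h)
 case 0
 have "sw' (T' 0) (%a b. cns 0 a (it 0 b)) h =
   sw' (T' 0) (%a b. eH b .[T' 0] cns 0 a (pH [])) h"
  by (intro sw_cong 0) (simp add: it.simps(1) cns_smult cl nil_closed)
 also have "... = cns 0 h (pH [])"
  by (rule sw_counit_right[OF T_mod bil_left[OF cns_bilin nil_closed] 0])
 finally show ?case using it_1[OF 0] 0 by (simp add: cns_0 nil_closed)
next
 case (Suc n)
 let ?W = "T' (Suc n)"
 have b: "bilin k H H (T' n) (%a b. cns n a (it n b))"
  "bilin k H H (T' n) (%a b. snoc n (it n a) b)"
  by (intro lin lin_it; simp add: it_closed)+
 have "it (Suc (Suc n)) h = sw' ?W (%a b. snoc (Suc n) (it (Suc n) a) b) h"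
  by (rule it_snoc[OF Suc.prems])
 also have "... = sw' ?W (%a b. snoc (Suc n) (sw' (T' n) (%c d. cns n c (it n d)) a) b) h"
  by (intro sw_cong Suc.prems) (simp add: Suc.IH)
 also have "... = sw' ?W (%a b. sw' ?W (%c d. snoc (Suc n) (cns n c (it n d)) b) a) h"
  by (intro sw_cong Suc.prems sw_snoc b)
 also have "... = sw' ?W (%a b. sw' ?W (%c d. snoc (Suc n) (cns n a (it n c)) d) b) h"
  by (intro sw_coassoc T_mod Suc.prems lin lin_it) (simp_all add: cl it_closed)
 also have "... = sw' ?W (%a b. sw' ?W (%c d. cns (Suc n) a (snoc n (it n c) d)) b) h"
  by (intro sw_cong Suc.prems) (simp_all add: cns_snoc it_closed)
 also have "... = sw' ?W (%a b. cns (Suc n) a (sw' (T' n) (%c d. snoc n (it n c) d) b)) h"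
  by (intro sw_cong Suc.prems sw_cns[symmetric] b)
 also have "... = sw' ?W (%a b. cns (Suc n) a (it (Suc n) b)) h"
  by (intro sw_cong Suc.prems) (simp add: it_snoc)
 finally show ?case .
qed

subsection \<open>The product\<close>

lemma split_at:
 assumes "length bs = Suc (length us + length vs)"
 obtains b1 b b2 where "bs = b1 @ b # b2" "length b1 = length us" "length b2 = length vs"
proof
 show "bs = take (length us) bs @ bs ! length us # drop (Suc (length us)) bs"
  using assms by (intro id_take_nth_drop) auto
qed (use assms in auto)

lemma map2_multilin:
 assumes "!!b. b <: H ==> lmap k H H (%a. f a b)" "set bs <= carrier H" "length bs = n"
 shows "multilin k H n (T n) (%as. pH (map2 f as bs))"
proof (rule multilinI)
 have c: "set (map2 f as bs) <= carrier H" if "set as <= carrier H" "set bs <= carrier H" for as bs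
 proof -
  have "f a b <: H" if ab: "(a, b) : set (zip as bs)" for a b
   using set_zip_leftD[OF ab] set_zip_rightD[OF ab] lin_closed[OF assms(1)]
    \<open>set as \<subseteq> carrier H\<close> \<open>set bs \<subseteq> carrier H\<close> by blast
  then show ?thesis by auto
 qed
 show "pH (map2 f vs bs) <: T n" if "set vs <= carrier H" "length vs = n" for vs
  using that assms c by (intro ptens_closed) auto
 fix us vs assume uv: "set us <= carrier H" "set vs <= carrier H" "Suc (length us + length vs) = n"
 obtain b1 b b2 where bs: "bs = b1 @ b # b2" "length b1 = length us" "length b2 = length vs"
  using split_at[of bs us vs] uv assms(3) by metis
 have "lmap k H (T n) (%x. pH (map2 f us b1 @ f x b # map2 f vs b2))"
  using uv assms(2) bs
  by (intro lin_comp[OF multilin_linear[OF ptens_multilin] assms(1)] c) auto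
 then show "lmap k H (T n) (%x. pH (map2 f (us @ x # vs) bs))"
  using bs by simp
qed

lemma map2_swap: "map2 f as bs = map2 (%b a. f a b) bs as"
 by (subst zip_commute) (auto simp: case_prod_beta')

lemma tm_multilin: "set as <= carrier H ==> length as = n ==>
  multilin k H n (T n) (%bs. pH (map2 (%a b. a *[H] b) as bs))"
 by (subst map2_swap, rule map2_multilin) (auto intro!: lin)

lemma tm_multilin2:
 assumes "t <: T n"
 shows "multilin k H n (T n)
  (%as. lift k (T n) (%bs. pH (map2 (%a b. a *[H] b) as bs)) t)"
proof (rule multilinI)
 show "lift k (T n) (%bs. pH (map2 (%a b. a *[H] b) as bs)) t <: T n"
  if "set as <= carrier H" "length as = n" for as
  by (rule lin_closed[OF tpow_lift_linear[OF T_mod tm_multilin[OF that]] assms])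
 fix us vs assume uv: "set us <= carrier H" "set vs <= carrier H" "Suc (length us + length vs) = n"
 show "lmap k H (T n)
   (%x. lift k (T n) (%bs. pH (map2 (%a b. a *[H] b) (us @ x # vs) bs)) t)"
 proof (rule tpow_lift_param[OF module_H T_mod tm_multilin _ assms])
  show "lmap k H (T n) (%x. pH (map2 (%a b. a *[H] b) (us @ x # vs) bs))"
   if "set bs <= carrier H" "length bs = n" for bs
   by (rule multilin_linear[OF map2_multilin[OF _ that] uv]) (auto intro!: lin)
 qed (use uv in auto)
qed

lemma tm_bilin: "bilin k (T n) (T n) (T n) (tm n)"
proof (rule bilinI)
 show "lmap k (T n) (T n) (%s. tm n s t)" if "t <: T n" for t
  unfolding tpow_mult_def by (rule tpow_lift_linear[OF T_mod tm_multilin2[OF that]])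
 show "lmap k (T n) (T n) (%t. tm n s t)" if "s <: T n" for s
  unfolding tpow_mult_def
  by (rule tpow_lift_param[OF T_mod T_mod tm_multilin2 _ that])
   (auto intro!: tpow_lift_linear T_mod tm_multilin)
qed

lemmas tm_closed = bil_closed[OF tm_bilin]
lemmas lin_tm = linear_bilin_left[OF tm_bilin] linear_bilin_right[OF tm_bilin]

lemma tm_ptens: "set as <= carrier H ==> length as = n ==> set bs <= carrier H ==> length bs = n ==>
  tm n (pH as) (pH bs) = pH (map2 (%a b. a *[H] b) as bs)"
 unfolding tpow_mult_def
 by (subst tpow_lift_ptens[OF T_mod tm_multilin2]; (simp add: ptens_closed)?)
  (subst tpow_lift_ptens[OF T_mod tm_multilin]; simp)

lemma tm_snoc:
 assumes "s <: T n" "t <: T n" "a <: H" "b <: H"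
 shows "tm (Suc n) (snoc n s a) (snoc n t b) = snoc n (tm n s t) (a *[H] b)"
proof -
 have m: "set (map2 (%a b. a *[H] b) as bs) <= carrier H"
  if "set as <= carrier H" "set bs <= carrier H" for as bs
  using that by (fastforce dest: set_zip_leftD set_zip_rightD)
 have 1: "tm (Suc n) (snoc n (pH as) a) (snoc n (pH bs) b) =
   snoc n (tm n (pH as) (pH bs)) (a *[H] b)"
  if "set as <= carrier H" "length as = n" "set bs <= carrier H" "length bs = n" for as bs
  using that assms m[of as bs] by (simp add: snoc_ptens tm_ptens)
 have 2: "tm (Suc n) (snoc n (pH as) a) (snoc n t b) =
   snoc n (tm n (pH as) t) (a *[H] b)"
  if as: "set as <= carrier H" "length as = n" for as
  by (rule tpow_linear_ext[OF T_mod _ _ _ assms(2)])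
   (use assms as 1[OF as] in \<open>auto intro!: lin lin_tm cl ptens_closed\<close>)
 show ?thesis
  by (rule tpow_linear_ext[OF T_mod _ _ _ assms(1)])
   (use assms 2 in \<open>auto intro!: lin lin_tm cl ptens_closed\<close>)
qed

lemma tm_assoc:
 assumes "s <: T n" "t <: T n" "u <: T n"
 shows "tm n (tm n s t) u = tm n s (tm n t u)"
 using assms
proof (induction n arbitrary: s t u)
 case 0
 have n: "pH [] <: T 0" by (rule nil_closed)
 have 1: "tm 0 (tm 0 (pH []) (pH [])) (pH []) =
   tm 0 (pH []) (tm 0 (pH []) (pH []))" by (simp add: tm_ptens)
 have 2: "tm 0 (tm 0 (pH []) (pH [])) u = tm 0 (pH []) (tm 0 (pH []) u)"
  by (rule tpow_linear_ext[OF T_mod _ _ _ 0(3)])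
   (use 1 0 n in \<open>auto intro!: lin_tm lin_id tm_closed\<close>)
 have 3: "tm 0 (tm 0 (pH []) t) u = tm 0 (pH []) (tm 0 t u)"
  by (rule tpow_linear_ext[OF T_mod _ _ _ 0(2)])
   (use 2 0 n in \<open>auto intro!: lin_tm lin_id tm_closed\<close>)
 show ?case
  by (rule tpow_linear_ext[OF T_mod _ _ _ 0(1)])
   (use 3 0 n in \<open>auto intro!: lin_tm lin_id tm_closed\<close>)
next
 case (Suc n)
 have 1: "tm (Suc n) (tm (Suc n) (snoc n s a) (snoc n t b)) (snoc n u c) =
   tm (Suc n) (snoc n s a) (tm (Suc n) (snoc n t b) (snoc n u c))"
  if "s <: T n" "t <: T n" "u <: T n" "a <: H" "b <: H" "c <: H"
  for s t u a b c
  using that Suc.IH by (simp add: tm_snoc cl tm_closed m_assoc)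
 have 2: "tm (Suc n) (tm (Suc n) (snoc n s a) (snoc n t b)) u =
   tm (Suc n) (snoc n s a) (tm (Suc n) (snoc n t b) u)"
  if "s <: T n" "t <: T n" "a <: H" "b <: H" for s t a b
  by (rule snoc_ext[OF T_mod _ _ _ Suc.prems(3)])
   (use 1 Suc.prems that in \<open>auto intro!: lin_tm lin_id tm_closed snoc_closed\<close>)
 have 3: "tm (Suc n) (tm (Suc n) (snoc n s a) t) u = tm (Suc n) (snoc n s a) (tm (Suc n) t u)"
  if "s <: T n" "a <: H" for s a
  by (rule snoc_ext[OF T_mod _ _ _ Suc.prems(2)])
   (use 2 Suc.prems that in \<open>auto intro!: lin_tm lin_id tm_closed snoc_closed\<close>)
 show ?case
  by (rule snoc_ext[OF T_mod _ _ _ Suc.prems(1)])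
   (use 3 Suc.prems in \<open>auto intro!: lin_tm lin_id tm_closed snoc_closed\<close>)
qed

lemma it_one_closed: "it n 1[H] <: T n"
 by (simp add: it_closed)

lemma it_one_Suc: "it (Suc n) 1[H] = snoc n (it n 1[H]) 1[H]"
proof -
 have "bilin k H H (T' n) (%a b. snoc n (it n a) b)"
  by (intro lin lin_it) (simp_all add: it_closed)
 then show ?thesis by (simp add: it_snoc sw_one[OF T_mod])
qed

lemma tm_one: "t <: T n ==> tm n t (it n 1[H]) = t"
proof (induction n arbitrary: t)
 case 0
 have i: "it 0 1[H] = pH []"
  using nil_closed by (simp add: it.simps(1) counit_one module.smult_one[OF T_mod])
 show ?case
  by (rule tpow_linear_ext[OF T_mod _ _ _ 0])
   (auto intro!: lin_tm lin_id it_one_closed nil_closed simp: tm_ptens i)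
next
 case (Suc n)
 show ?case
  by (rule snoc_ext[OF T_mod _ _ _ Suc.prems])
   (auto intro!: lin_tm lin_id it_one_closed simp: it_one_Suc tm_snoc Suc.IH snoc_closed it_one_closed)
qed

lemma sw_mult:
 assumes W: "module k W" and f: "bilin k H H W f" and gh: "g <: H" "h <: H"
 shows "sw' W f (g *[H] h) = sw' W (%a b. sw' W (%c d. f (a *[H] c) (b *[H] d)) h) g"
proof -
 let ?L = "lift k W (%hs. f (hs ! 0) (hs ! 1))"
 note L = tpow_lift_linear[OF W sw_multilin[OF f]]
 have m: "?L (tm 2 (pH as) (pH bs)) = f (as ! 0 *[H] bs ! 0) (as ! 1 *[H] bs ! 1)"
  if ab: "set as <= carrier H" "length as = 2" "set bs <= carrier H" "length bs = 2" for as bs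
 proof -
  obtain a b c d where "as = [a, b]" "bs = [c, d]" "a <: H" "b <: H" "c <: H" "d <: H"
   using word_2 ab by metis
  then show ?thesis using tpow_lift_ptens[OF W sw_multilin[OF f], of "[a *[H] c, b *[H] d]"]
   by (simp add: tm_ptens)
 qed
 have b1: "bilin k H H W (%c d. f (a *[H] c) (b *[H] d))" if "a <: H" "b <: H" for a b
  by (intro bilinI linear_bilin_left[OF f] linear_bilin_right[OF f] lin) (simp_all add: that)
 have b1': "bilin k H H W (%a b. f (a *[H] c) (b *[H] d))" if "c <: H" "d <: H" for c d
  by (intro bilinI linear_bilin_left[OF f] linear_bilin_right[OF f] lin) (simp_all add: that)
 have b2: "bilin k H H W (%a b. sw' W (%c d. f (a *[H] c) (b *[H] d)) h)"
  by (intro bilinI sw_param module_H W b1 bil_left[OF b1'] bil_right[OF b1'] gh)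
 have 1: "?L (tm 2 (pH as) t) = lift k W (%hs. f (as ! 0 *[H] hs ! 0) (as ! 1 *[H] hs ! 1)) t"
  if ab: "set as <= carrier H" "length as = 2" "t <: T 2" for as t
 proof -
  obtain a b where e: "as = [a, b]" "a <: H" "b <: H"
   using word_2 ab by metis
  note mm = sw_multilin[OF b1[OF e(2,3)]]
  show ?thesis
   by (rule tpow_linear_ext[OF W lin_comp[OF L bil_right[OF tm_bilin]]
      tpow_lift_linear[OF W] _ ab(3)])
    (use e mm m[OF ab(1,2)] ptens_closed[OF ab(1,2)] tpow_lift_ptens[OF W mm] in auto)
 qed
 have "?L (tm 2 s (comult H h)) = lift k W (%as. sw' W (%c d. f (as ! 0 *[H] c) (as ! 1 *[H] d)) h) s"
  if s: "s <: T 2" for s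
  by (rule tpow_linear_ext[OF W lin_comp[OF L bil_left[OF tm_bilin comult_closed]]
     tpow_lift_linear[OF W sw_multilin[OF b2]] _ s])
   (use gh 1 comult_closed tpow_lift_ptens[OF W sw_multilin[OF b2]] in \<open>auto simp: sw_def\<close>)
 from this[OF comult_closed[OF gh(1)]] show ?thesis
  using comult_mult[OF gh] by (simp add: sw_def)
qed

lemma sw_tm:
 assumes "bilin k H H (T n) f" "bilin k H H (T n) f'" "g <: H" "h <: H"
 shows "tm n (sw' (T n) f g) (sw' (T n) f' h) = sw' (T n) (%a b. sw' (T n) (%c d. tm n (f a b) (f' c d)) h) g"
proof -
 have "tm n (sw' (T n) f g) (sw' (T n) f' h) = sw' (T n) (%a b. tm n (f a b) (sw' (T n) f' h)) g"
  by (rule sw_hom[OF T_mod T_mod bil_left[OF tm_bilin] assms(1,3)])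
   (intro sw_closed T_mod assms)
 also have "... = sw' (T n) (%a b. sw' (T n) (%c d. tm n (f a b) (f' c d)) h) g"
  by (intro sw_cong assms(3) sw_hom[OF T_mod T_mod bil_right[OF tm_bilin] assms(2,4)]
    bil_closed[OF assms(1)])
 finally show ?thesis .
qed

lemma it_mult: "g <: H ==> h <: H ==> it n (g *[H] h) = tm n (it n g) (it n h)"
proof (induction n arbitrary: g h)
 case 0
 have "tm 0 (pH []) (pH []) = pH []" by (simp add: tm_ptens)
 then show ?case using 0 nil_closed
  by (simp add: it.simps(1) counit_mult lin_smult[OF bil_left[OF tm_bilin]]
    lin_smult[OF bil_right[OF tm_bilin]] cl smult_T module.smult_assoc1[OF T_mod, symmetric] R.m_comm)
next
 case (Suc n)
 have b: "bilin k H H (T' n) (%a b. snoc n (it n a) b)"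
  by (intro lin lin_it) (simp_all add: it_closed)
 show ?case
  using Suc
  by (simp add: it_snoc sw_mult[OF T_mod b] sw_tm[OF b b])
   (intro sw_cong; simp add: tm_snoc it_closed)
qed

subsection \<open>Faces, degeneracies and rotations\<close>

lemma fc_all:
 assumes "i <= n"
 shows "lmap k (T' n) (T n) (fc n i) &
  (ALL z:carrier (T n). ALL b:carrier H. fc n i (snoc n z b) =
    (if i = n then eH b .[T n] z else snoc (n - 1) (fc (n - 1) i z) b)) &
  (ALL hs. set hs <= carrier H & length hs = Suc n -->
    fc n i (pH hs) = eH (hs ! i) .[T n] pH (take i hs @ drop (Suc i) hs))"
 using assms
proof (induction n)
 case 0
 let ?g = "%z b. eH b .[T 0] z"
 have g: "bilin k (T 0) H (T 0) ?g"
  by (intro lin) (simp_all add: cl)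
 have e: "eH ((vs @ [b]) ! 0) .[T 0] pH (take 0 (vs @ [b]) @ drop (Suc 0) (vs @ [b])) =
   ?g (pH vs) b" if "length vs = 0" for vs b using that by simp
 note l = lift_unsnoc[OF T_mod g e]
 show ?case using 0 l tpow_lift_ptens[OF T_mod l(1)] by (auto simp: fc_def)
next
 case (Suc n)
 show ?case
 proof (cases "i = Suc n")
  case True
  let ?g = "%z b. eH b .[T' n] z"
  have g: "bilin k (T' n) H (T' n) ?g"
   by (intro lin) (simp_all add: cl)
  have e: "eH ((vs @ [b]) ! i) .[T' n] pH (take i (vs @ [b]) @ drop (Suc i) (vs @ [b])) =
    ?g (pH vs) b" if "length vs = Suc n" for vs b using that True by (simp add: nth_append)
  note l = lift_unsnoc[OF T_mod g e]
  show ?thesis using True l tpow_lift_ptens[OF T_mod l(1)] by (auto simp: fc_def)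
 next
  case False
  then have i: "i <= n" using Suc.prems by simp
  note IH = Suc.IH[OF i]
  then have L: "lmap k (T' n) (T n) (fc n i)" by simp
  let ?g = "%z b. snoc n (fc n i z) b"
  have g: "bilin k (T' n) H (T' n) ?g"
   by (intro lin L) (simp_all add: lin_closed[OF L])
  have e: "eH ((vs @ [b]) ! i) .[T' n] pH (take i (vs @ [b]) @ drop (Suc i) (vs @ [b])) =
    ?g (pH vs) b" if "set vs <= carrier H" "length vs = Suc n" "b <: H" for vs b
  proof -
   have s: "set (take i vs @ drop (Suc i) vs) <= carrier H" "length (take i vs @ drop (Suc i) vs) = n"
    using that i by (auto dest: in_set_takeD in_set_dropD)
   have v: "vs ! i <: H" using that i by (simp add: subset_iff)
   show ?thesis using IH that i s v
    by (simp add: nth_append snoc_smult ptens_closed snoc_ptens cl)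
  qed
  note l = lift_unsnoc[OF T_mod g e]
  show ?thesis using False l tpow_lift_ptens[OF T_mod l(1)] by (auto simp: fc_def)
 qed
qed

lemma fc_linear: "i <= n ==> lmap k (T' n) (T n) (fc n i)"
 using fc_all by simp

lemma fc_closed: "i <= n ==> t <: T' n ==> fc n i t <: T n"
 by (rule lin_closed[OF fc_linear])

lemma fc_snoc_last: "z <: T n ==> b <: H ==> fc n n (snoc n z b) = eH b .[T n] z"
 using fc_all[of n n] by simp

lemma fc_snoc: "i <= n ==> z <: T' n ==> b <: H ==>
  fc (Suc n) i (snoc (Suc n) z b) = snoc n (fc n i z) b"
 using fc_all[of i "Suc n"] by simp

lemma fc_ptens: "i <= n ==> set hs <= carrier H ==> length hs = Suc n ==>
  fc n i (pH hs) = eH (hs ! i) .[T n] pH (take i hs @ drop (Suc i) hs)"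
 using fc_all[of i n] by simp

lemmas lin_fc = lin_comp[OF fc_linear]

lemma fc_cns_0: "z <: T n ==> a <: H ==> fc n 0 (cns n a z) = eH a .[T n] z"
 by (rule tpow_linear_ext[OF T_mod])
  (auto intro!: lin_fc lin lin_cns T_mod simp: cns_ptens fc_ptens cl)

lemma fc_cns:
 assumes "i <= n" "z <: T' n" "a <: H"
 shows "fc (Suc n) (Suc i) (cns (Suc n) a z) = cns n a (fc n i z)"
proof (rule tpow_linear_ext[OF T_mod _ _ _ assms(2)])
 show "lmap k (T' n) (T' n) (%z. fc (Suc n) (Suc i) (cns (Suc n) a z))"
  "lmap k (T' n) (T' n) (%z. cns n a (fc n i z))"
  using assms by (auto intro!: lin_fc lin lin_cns T_mod simp: cl)
 fix hs assume hs: "set hs <= carrier H" "length hs = Suc n"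
 have s: "set (take i hs @ drop (Suc i) hs) <= carrier H" "length (take i hs @ drop (Suc i) hs) = n"
  using hs assms by (auto dest: in_set_takeD in_set_dropD)
 have v: "hs ! i <: H" using hs assms by (simp add: subset_iff)
 show "fc (Suc n) (Suc i) (cns (Suc n) a (pH hs)) = cns n a (fc n i (pH hs))"
  using assms hs s v by (simp add: fc_ptens cns_ptens cns_smult ptens_closed cl)
qed

lemma fc_fc:
 assumes "i <= j" "j <= n" "t <: T' (Suc n)"
 shows "fc n i (fc (Suc n) (Suc j) t) = fc n j (fc (Suc n) i t)"
 using assms
proof (induction n arbitrary: t)
 case 0
 show ?case
  by (rule snoc_ext[OF T_mod _ _ _ 0(3)])
   (use 0 in \<open>auto intro!: lin_fc lin_id simp: fc_snoc fc_snoc_last lin_smult[OF fc_linear] cl fc_closed\<close>)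
next
 case (Suc n)
 have ij: "i <= Suc n" "j <= Suc n" using Suc by auto
 show ?case
 proof (rule snoc_ext[OF T_mod _ _ _ Suc.prems(3)])
  show "lmap k (T (Suc (Suc (Suc n)))) (T' n) (%t. fc (Suc n) i (fc (Suc (Suc n)) (Suc j) t))"
   "lmap k (T (Suc (Suc (Suc n)))) (T' n) (%t. fc (Suc n) j (fc (Suc (Suc n)) i t))"
   using ij by (auto intro!: lin_fc lin_id)
  fix z b assume z: "z <: T' (Suc n)" "b <: H"
  show "fc (Suc n) i (fc (Suc (Suc n)) (Suc j) (snoc (Suc (Suc n)) z b)) =
    fc (Suc n) j (fc (Suc (Suc n)) i (snoc (Suc (Suc n)) z b))"
  proof (cases "j = Suc n")
   case True
   then show ?thesis using ij z
    by (simp add: fc_snoc_last fc_snoc lin_smult[OF fc_linear] cl fc_closed)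
  next
   case False
   then show ?thesis using ij z Suc.IH[OF Suc.prems(1) _ z(1)] Suc.prems(1)
    by (simp add: fc_snoc fc_closed)
  qed
 qed
qed

lemma sw_fc:
 assumes "bilin k H H (T' n) f" "h <: H" "i <= n"
 shows "fc n i (sw' (T' n) f h) = sw' (T n) (%c d. fc n i (f c d)) h"
 by (rule sw_hom[OF T_mod T_mod fc_linear[OF assms(3)] assms(1,2)])

lemma fc_it: "i <= n ==> h <: H ==> fc n i (it (Suc n) h) = it n h"
proof (induction n arbitrary: h)
 case 0
 have "fc 0 0 (it (Suc 0) h) = eH h .[T 0] pH []"
  using 0 by (simp add: it_1 fc_snoc_last nil_closed)
 then show ?case using 0 by (simp add: it.simps(1))
next
 case (Suc n)
 have b: "bilin k H H (T' (Suc n)) (%a b. snoc (Suc n) (it (Suc n) a) b)"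
  by (intro lin lin_it) (simp_all add: it_closed)
 have e: "fc (Suc n) i (it (Suc (Suc n)) h) =
   sw' (T' n) (%a b. fc (Suc n) i (snoc (Suc n) (it (Suc n) a) b)) h"
  using Suc.prems by (subst it_snoc, simp, subst sw_fc[OF b]) simp_all
 show ?case
 proof (cases "i = Suc n")
  case True
  have "fc (Suc n) i (it (Suc (Suc n)) h) = sw' (T' n) (%a b. eH b .[T' n] it (Suc n) a) h"
   unfolding e using True Suc.prems by (intro sw_cong) (simp_all add: fc_snoc_last it_closed)
  also have "... = it (Suc n) h"
   by (rule sw_counit_right[OF T_mod it_linear Suc.prems(2)])
  finally show ?thesis .
 next
  case False
  then have "fc (Suc n) i (it (Suc (Suc n)) h) = sw' (T' n) (%a b. snoc n (it n a) b) h"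
   unfolding e using Suc by (intro sw_cong) (simp_all add: fc_snoc it_closed)
  then show ?thesis using Suc.prems by (simp add: it_snoc)
 qed
qed

lemma tm_smult: "a <: k ==> s <: T n ==> t <: T n ==>
   tm n (a .[T n] s) t = a .[T n] tm n s t"
 "a <: k ==> s <: T n ==> t <: T n ==>
   tm n s (a .[T n] t) = a .[T n] tm n s t"
 by (rule lin_smult[OF bil_left[OF tm_bilin]]; simp)
  (rule lin_smult[OF bil_right[OF tm_bilin]]; simp)

text \<open>Identities between bilinear maps of tensor powers are checked one tensor factor at a time.\<close>

lemma snoc_ext2:
 assumes "module k W" "bilin k (T' n) (T' n) W f" "bilin k (T' n) (T' n) W g"
  and "!!s t a b. s <: T n ==> t <: T n ==> a <: H ==> b <: H ==>
   f (snoc n s a) (snoc n t b) = g (snoc n s a) (snoc n t b)"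
  and "s <: T' n" "t <: T' n"
 shows "f s t = g s t"
proof -
 have 1: "f (snoc n s a) t = g (snoc n s a) t" if "s <: T n" "a <: H" for s a
  by (rule snoc_ext[OF assms(1) bil_right[OF assms(2)] bil_right[OF assms(3)] _ assms(6)])
   (use that assms(4) snoc_closed in auto)
 show ?thesis
  by (rule snoc_ext[OF assms(1) bil_left[OF assms(2)] bil_left[OF assms(3)] _ assms(5)])
   (use assms(6) 1 in auto)
qed

lemma fc_tm:
 assumes "i <= n" "s <: T' n" "t <: T' n"
 shows "fc n i (tm (Suc n) s t) = tm n (fc n i s) (fc n i t)"
 using assms
proof (induction n arbitrary: s t)
 case 0
 show ?case
  by (rule snoc_ext2[OF T_mod _ _ _ 0(2,3)])
   (use 0 in \<open>auto intro!: bilinI lin_fc lin_tm lin_id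
    simp: tm_snoc fc_snoc_last counit_mult tm_smult smult_T tm_closed fc_closed cl
     module.smult_assoc1[OF T_mod, symmetric] R.m_comm\<close>)
next
 case (Suc n)
 show ?case
 proof (rule snoc_ext2[OF T_mod _ _ _ Suc.prems(2,3)])
  show "bilin k (T' (Suc n)) (T' (Suc n)) (T' n) (%s t. fc (Suc n) i (tm (Suc (Suc n)) s t))"
   "bilin k (T' (Suc n)) (T' (Suc n)) (T' n) (%s t. tm (Suc n) (fc (Suc n) i s) (fc (Suc n) i t))"
   using Suc.prems(1) by (auto intro!: bilinI lin_fc lin_tm lin_id fc_closed)
  fix s t a b assume st: "s <: T' n" "t <: T' n" "a <: H" "b <: H"
  show "fc (Suc n) i (tm (Suc (Suc n)) (snoc (Suc n) s a) (snoc (Suc n) t b)) =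
    tm (Suc n) (fc (Suc n) i (snoc (Suc n) s a)) (fc (Suc n) i (snoc (Suc n) t b))"
  proof (cases "i = Suc n")
   case True
   then show ?thesis using st
    by (simp add: tm_snoc fc_snoc_last counit_mult tm_smult smult_T tm_closed cl
      module.smult_assoc1[OF T_mod, symmetric] R.m_comm)
  next
   case False
   then show ?thesis using st Suc.IH[OF _ st(1,2)] Suc.prems(1)
    by (simp add: tm_snoc fc_snoc tm_closed fc_closed cl)
  qed
 qed
qed

lemma sg_closed: "t <: T' n ==> sg n t <: T' (Suc n)"
 by (rule lin_closed[OF sg_linear])

lemmas lin_sg = lin_comp[OF sg_linear]

lemma ss_bilin: "z <: T n ==> bilin k H H (T' (Suc n)) (%c d. snoc (Suc n) (snoc n z c) d)"
 by (intro lin) (simp_all add: cl)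

lemma fc_sg_last:
 assumes "t <: T' n" shows "fc (Suc n) n (sg n t) = t"
proof (rule snoc_ext[OF T_mod _ _ _ assms])
 fix z b assume z: "z <: T n" "b <: H"
 have "fc (Suc n) n (sg n (snoc n z b)) = sw' (T' n) (%c d. eH c .[T' n] snoc n z d) b"
  using z ss_bilin
  by (simp add: sg_snoc sw_fc) (intro sw_cong; simp add: fc_snoc fc_snoc_last snoc_smult cl)
 also have "... = snoc n z b"
  by (rule sw_counit_left[OF T_mod bil_right[OF snoc_bilin z(1)] z(2)])
 finally show "fc (Suc n) n (sg n (snoc n z b)) = snoc n z b" .
qed (auto intro!: lin_fc lin_sg lin_id)

lemma fc_sg:
 assumes "i <= n" "t <: T' (Suc n)"
 shows "fc (Suc (Suc n)) i (sg (Suc n) t) = sg n (fc (Suc n) i t)"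
proof (rule snoc_ext[OF T_mod _ _ _ assms(2)])
 fix z b assume z: "z <: T' n" "b <: H"
 show "fc (Suc (Suc n)) i (sg (Suc n) (snoc (Suc n) z b)) = sg n (fc (Suc n) i (snoc (Suc n) z b))"
  using z ss_bilin assms(1)
  by (simp add: sg_snoc sw_fc fc_snoc fc_closed) (intro sw_cong; simp add: fc_snoc cl)
qed (use assms in \<open>auto intro!: lin_fc lin_sg lin_id\<close>)

lemma sg_tm:
 assumes "s <: T' n" "t <: T' n"
 shows "sg n (tm (Suc n) s t) = tm (Suc (Suc n)) (sg n s) (sg n t)"
proof (rule snoc_ext2[OF T_mod _ _ _ assms])
 show "bilin k (T' n) (T' n) (T' (Suc n)) (%s t. sg n (tm (Suc n) s t))"
  "bilin k (T' n) (T' n) (T' (Suc n)) (%s t. tm (Suc (Suc n)) (sg n s) (sg n t))"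
  by (auto intro!: bilinI lin_sg lin_tm lin_id sg_closed)
 fix s t a b assume st: "s <: T n" "t <: T n" "a <: H" "b <: H"
 show "sg n (tm (Suc n) (snoc n s a) (snoc n t b)) =
   tm (Suc (Suc n)) (sg n (snoc n s a)) (sg n (snoc n t b))"
  using st
  by (simp add: tm_snoc sg_snoc tm_closed sw_mult[OF T_mod ss_bilin] sw_tm[OF ss_bilin ss_bilin])
   (intro sw_cong; simp add: tm_snoc cl)
qed

lemma rt_all:
 assumes c: "c <: H"
 shows rt_linear: "lmap k (T' n) (T' n) (rt n c)"
  and rt_snoc: "z <: T n ==> b <: H ==> rt n c (snoc n z b) = cns n (b *[H] c) z"
  and rt_multilin: "multilin k H (Suc n) (T' n) (%hs. pH ((hs ! n *[H] c) # take n hs))"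
proof -
 let ?g = "%z b. cns n (b *[H] c) z"
 have g: "bilin k (T n) H (T' n) ?g"
  by (intro lin) (simp_all add: cl c)
 have e: "pH (((vs @ [b]) ! n *[H] c) # take n (vs @ [b])) = ?g (pH vs) b"
  if "set vs <= carrier H" "length vs = n" "b <: H" for vs b
  using that c by (simp add: nth_append cns_ptens)
 note l = lift_unsnoc[OF T_mod g e]
 show "lmap k (T' n) (T' n) (rt n c)" unfolding rt_def by (rule l(2))
 show "rt n c (snoc n z b) = cns n (b *[H] c) z" if "z <: T n" "b <: H"
  unfolding rt_def by (rule l(3)[OF _ _ _ that])
 show "multilin k H (Suc n) (T' n) (%hs. pH ((hs ! n *[H] c) # take n hs))"
  by (rule l(1))
qed

lemma rt_bilin: "bilin k H (T' n) (T' n) (rt n)"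
proof (rule bilinI)
 show "lmap k H (T' n) (%c. rt n c t)" if "t <: T' n" for t
  unfolding rt_def
 proof (rule tpow_lift_param[OF module_H T_mod rt_multilin _ that])
  fix hs assume hs: "set hs <= carrier H" "length hs = Suc n"
  have "lmap k H (T' n) (%c. cns n (hs ! n *[H] c) (pH (take n hs)))"
   using hs by (intro lin) (auto intro!: ptens_closed dest: in_set_takeD simp: subset_iff)
  moreover have "pH ((hs ! n *[H] c) # take n hs) = cns n (hs ! n *[H] c) (pH (take n hs))"
   if "c <: H" for c
   using hs that by (subst cns_ptens) (auto dest: in_set_takeD simp: subset_iff)
  ultimately show "lmap k H (T' n) (%c. pH ((hs ! n *[H] c) # take n hs))"
   by (subst lin_cong[OF module_H]) auto
 qed
qed (rule rt_linear)

lemmas lin_rt = linear_bilin_left[OF rt_bilin] linear_bilin_right[OF rt_bilin]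
lemmas rt_closed = bil_closed[OF rt_bilin]

lemma fc_rt_0:
 assumes "t <: T' n" "c <: H"
 shows "fc n 0 (rt n c t) = eH c .[T n] fc n n t"
 by (rule snoc_ext[OF T_mod _ _ _ assms(1)])
  (use assms(2) in \<open>auto intro!: lin_fc lin_rt lin_id lin_smult_const T_mod
   simp: rt_snoc fc_cns_0 fc_snoc_last counit_mult cl module.smult_assoc1[OF T_mod, symmetric] R.m_comm\<close>)

lemma fc_rt:
 assumes "i <= n" "t <: T' (Suc n)" "c <: H"
 shows "fc (Suc n) (Suc i) (rt (Suc n) c t) = rt n c (fc (Suc n) i t)"
 by (rule snoc_ext[OF T_mod _ _ _ assms(2)])
  (use assms(1,3) in \<open>auto intro!: lin_fc lin_rt lin_id
   simp: rt_snoc fc_cns fc_snoc cl fc_closed\<close>)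

end

section \<open>Modules over the Hopf algebra\<close>

lemma module_transfer:
 fixes V :: "('k, 'v, 'x) module_scheme" and V' :: "('k, 'v, 'y) module_scheme"
 assumes "module k V" "carrier V' = carrier V" "add V' = add V" "zero V' = zero V" "smult V' = smult V"
 shows "module k V'"
proof -
 interpret V: module k V by fact
 have "abelian_group V'"
  using assms(2-) by (intro abelian_groupI)
   (auto simp: V.a_ac intro: V.l_neg bexI[of _ "-[V] _"])
 then show ?thesis
  using assms(2-) by (intro moduleI V.R.is_cring)
   (auto simp: V.smult_l_distr V.smult_r_distr V.smult_assoc1)
qed

lemma lin_transfer:
 assumes "lmap k V W f" "carrier V' = carrier V" "add V' = add V" "smult V' = smult V"
  "carrier W' = carrier W" "add W' = add W" "smult W' = smult W"
 shows "lmap k V' W' f"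
 using assms by (simp add: linear_map_def)

text \<open>A submodule of a vector space has a complement, by Zorn's lemma; hence linear maps
  split over their image.\<close>

lemma linear_split:
 assumes k: "field k" and V: "module k V" and W: "module k W" and f: "lmap k V W f"
 shows "EX s. lmap k (W\<lparr>carrier := f ` carrier V\<rparr>) V s & (ALL y:f ` carrier V. f (s y) = y)"
proof -
 interpret k: field k by (rule k)
 interpret V: module k V by (rule V)
 interpret W: module k W by (rule W)
 define N where "N = {x : carrier V. f x = 0[W]}"
 define \<A> where "\<A> = {C. submodule C k V & C \<inter> N = {0[V]}}"
 have N: "submodule N k V" unfolding N_def by (rule submodule_kernel[OF V W f])
 have "submodule {0[V]} k V" by (intro submoduleI' V) auto
 then have ne: "\<A> ~= {}" using submodule_zero[OF N] by (auto simp: \<A>_def)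
 have un: "\<Union>\<C> : \<A>" if ne: "\<C> ~= {}" and ch: "subset.chain \<A> \<C>" for \<C>
 proof -
  have C: "submodule C k V" "C \<inter> N = {0[V]}" if "C : \<C>" for C
   using ch that by (auto simp: subset.chain_def \<A>_def)
  have "submodule (\<Union>\<C>) k V"
  proof (rule submoduleI'[OF V])
   show "\<Union>\<C> <= carrier V" using C(1) submodule_subset by blast
   show "0[V] : \<Union>\<C>" using ne C(1) submodule_zero by blast
   show "x +[V] y : \<Union>\<C>" if xy: "x : \<Union>\<C>" "y : \<Union>\<C>" for x y
   proof -
    obtain C D where CD: "C : \<C>" "D : \<C>" "x : C" "y : D" using xy by blast
    then have "C <= D \<or> D <= C" using ch by (auto simp: subset_chain_def)
    then show ?thesis
     using CD submodule_add[OF C(1)[OF CD(1)]] submodule_add[OF C(1)[OF CD(2)]] by blast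
   qed
   show "a .[V] x : \<Union>\<C>" if ax: "a <: k" "x : \<Union>\<C>" for a x
   proof -
    obtain D where D: "D : \<C>" "x : D" using ax(2) by blast
    show ?thesis using submodule_smult[OF C(1)[OF D(1)] ax(1) D(2)] D(1) by blast
   qed
  qed
  moreover have "\<Union>\<C> \<inter> N = {0[V]}" using C(2) ne by blast
  ultimately show ?thesis by (simp add: \<A>_def)
 qed
 have "EX C:\<A>. ALL D:\<A>. C <= D --> D = C"
  by (rule subset_Zorn_nonempty[OF ne un])
 then obtain C where CA: "C : \<A>" and max: "!!D. D : \<A> ==> C <= D ==> D = C"
  by blast
 have C: "submodule C k V" and C0: "C \<inter> N = {0[V]}" using CA by (auto simp: \<A>_def)
 have CV: "C <= carrier V" by (rule submodule_subset[OF C])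
 have dec: "EX c:C. v -[V] c : N" if v: "v <: V" for v
 proof (rule ccontr)
  assume no: "\<not> (EX c:C. v -[V] c : N)"
  define D where "D = {c +[V] a .[V] v | c a. c : C & a <: k}"
  have DI: "c +[V] a .[V] v : D" if "c : C" "a <: k" for c a
   using that by (auto simp: D_def)
  have CD: "C <= D"
  proof
   fix c assume c: "c : C"
   then have "c +[V] 0[k] .[V] v = c" using v CV by (simp add: subset_iff)
   then show "c : D" using DI[OF c, of "0[k]"] by simp
  qed
  have "submodule D k V"
  proof (rule submoduleI'[OF V])
   show "D <= carrier V" using CV v by (auto simp: D_def)
   show "0[V] : D" using CD submodule_zero[OF C] by blast
   show "x +[V] y : D" if xy: "x : D" "y : D" for x y
   proof -
    obtain c a c' a' where e: "x = c +[V] a .[V] v" "y = c' +[V] a' .[V] v" "c : C" "c' : C"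
     "a <: k" "a' <: k" using xy by (auto simp: D_def)
    then have cc: "c <: V" "c' <: V" using CV by auto
    have "x +[V] y = (c +[V] c') +[V] (a +[k] a') .[V] v"
     using e cc v by (simp add: V.smult_l_distr V.a_ac)
    then show ?thesis using DI submodule_add[OF C] e by simp
   qed
   show "b .[V] x : D" if xy: "b <: k" "x : D" for b x
   proof -
    obtain c a where e: "x = c +[V] a .[V] v" "c : C" "a <: k" using xy by (auto simp: D_def)
    then have "b .[V] x = b .[V] c +[V] (b *[k] a) .[V] v"
     using xy v CV by (simp add: V.smult_r_distr V.smult_assoc1 subset_iff)
    then show ?thesis using DI submodule_smult[OF C] e xy by simp
   qed
  qed
  moreover have "x = 0[V]" if xD: "x : D" "x : N" for x
  proof -
   obtain c a where e: "x = c +[V] a .[V] v" "c : C" "a <: k" using xD by (auto simp: D_def)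
   have c: "c <: V" using e CV by auto
   show ?thesis
   proof (cases "a = 0[k]")
    case True
    then have "x = c" using e c v by simp
    then show ?thesis using e xD C0 by blast
   next
    case False
    then have ia: "inv\<^bsub>k\<^esub> a <: k" "inv\<^bsub>k\<^esub> a *[k] a = 1[k]"
     using k.field_Units e(3) by auto
    have "inv\<^bsub>k\<^esub> a .[V] x = inv\<^bsub>k\<^esub> a .[V] c +[V] v"
     using e c v ia by (simp add: V.smult_r_distr V.smult_assoc1[symmetric])
    also have "... = v -[V] (\<ominus>\<^bsub>V\<^esub> (inv\<^bsub>k\<^esub> a .[V] c))"
     using c v ia by (simp add: a_minus_def V.a_comm)
    finally have "v -[V] (\<ominus>\<^bsub>V\<^esub> (inv\<^bsub>k\<^esub> a .[V] c)) : N"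
     using submodule_smult[OF N ia(1) xD(2)] by simp
    moreover have "-[V] (inv\<^bsub>k\<^esub> a .[V] c) : C"
     using submodule_neg[OF V C] submodule_smult[OF C ia(1) e(2)] by simp
    ultimately show ?thesis using no by blast
   qed
  qed
  moreover have "0[V] : D \<inter> N" using CD submodule_zero[OF N] submodule_zero[OF C] by blast
  ultimately have "submodule D k V & D \<inter> N = {0[V]}" by blast
  then have "D : \<A>" unfolding \<A>_def by blast
  then have "D = C" using max CD by blast
  moreover have "0[V] +[V] 1[k] .[V] v : D" using DI submodule_zero[OF C] by simp
  ultimately have "v : C" using v by simp
  moreover have "v -[V] v : N" using v submodule_zero[OF N] by (simp add: a_minus_def V.r_neg)
  ultimately show False using no by blast
 qed
 have inj: "inj_on f C"
 proof (rule inj_onI)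
  fix x y assume xy: "x : C" "y : C" "f x = f y"
  then have V2: "x <: V" "y <: V" using CV by auto
  have "f (x -[V] y) = 0[W]"
   using xy V2 lin_closed[OF f] by (simp add: lin_minus[OF V W f] W.minus_eq_zero_iff)
  moreover have "x -[V] y : C"
   unfolding a_minus_def using submodule_add[OF C] submodule_neg[OF V C] xy by simp
  ultimately have "x -[V] y = 0[V]" using C0 V2 by (auto simp: N_def)
  then show "x = y" using V2 by (simp add: V.minus_eq_zero_iff)
 qed
 have im: "y : f ` C" if y: "y : f ` carrier V" for y
 proof -
  from y obtain v where v: "y = f v" "v <: V" ..
  from dec[OF v(2)] obtain c where c: "v -[V] c : N" "c : C" ..
  have cV: "c <: V" by (rule subsetD[OF CV c(2)])
  have "f (v -[V] c) = 0[W]" using c(1) unfolding N_def mem_Collect_eq ..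
  then have "f v -[W] f c = 0[W]" unfolding lin_minus[OF V W f v(2) cV] .
  then have "f v = f c"
   unfolding W.minus_eq_zero_iff[OF lin_closed[OF f v(2)] lin_closed[OF f cV]] .
  then show ?thesis unfolding v(1) by (rule image_eqI[OF _ c(2)])
 qed
 define s where "s = inv_into C f"
 have s: "s y : C" "f (s y) = y" if "y : f ` carrier V" for y
  unfolding s_def by (rule inv_into_into[OF im[OF that]], rule f_inv_into_f[OF im[OF that]])
 have su: "s (f c) = c" if "c : C" for c unfolding s_def by (rule inv_into_f_f[OF inj that])
 have "lmap k (W\<lparr>carrier := f ` carrier V\<rparr>) V s"
 proof (rule linI, simp_all)
  show "s y <: V" if "y : f ` carrier V" for y using s[OF that] CV by auto
  fix y assume y: "y : f ` carrier V"
  show "s (y +[W] z) = s y +[V] s z" if z: "z : f ` carrier V" for z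
  proof -
   have "f (s y +[V] s z) = y +[W] z" using s y z CV by (simp add: lin_add[OF f] subset_iff)
   then show ?thesis using su[of "s y +[V] s z"] submodule_add[OF C] s y z by simp
  qed
  show "s (a .[W] y) = a .[V] s y" if a: "a <: k" for a
  proof -
   have "f (a .[V] s y) = a .[W] y" using s y a CV by (simp add: lin_smult[OF f] subset_iff)
   then show ?thesis using su[of "a .[V] s y"] submodule_smult[OF C] s y a by simp
  qed
 qed
 then show ?thesis using s by blast
qed

text \<open>The lifting property of \<open>X\<close> against one linear map \<open>d : Y' \<rightarrow> Y\<close> of right modules.\<close>

definition lifts where
 "lifts k A X Y' Y d \<longleftrightarrow> (ALL \<psi>. rmap k A X Y \<psi> & \<psi> ` carrier X <= d ` carrier Y' -->
   (EX \<phi>. rmap k A X Y' \<phi> & (ALL x:carrier X. d (\<phi> x) = \<psi> x)))"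

lemma rmap_linear: "rmap k A X Y f ==> lmap k X Y f"
 by (simp add: rmodule_map_def)

lemma rmap_ract: "rmap k A X Y f ==> x <: X ==> a <: A ==>
  f (ract X x a) = ract Y (f x) a"
 by (simp add: rmodule_map_def)

lemma rmap_closed: "rmap k A X Y f ==> x <: X ==> f x <: Y"
 by (rule lin_closed[OF rmap_linear])

lemma rmap_comp: "rmap k A Y Z g ==> rmap k A X Y f ==> rmap k A X Z (%x. g (f x))"
 unfolding rmodule_map_def by (auto intro: lin_comp lin_closed)

lemma rmod_mod: "rmod k A X ==> module k X"
 by (simp add: right_module_def)

lemma ract_bilin: "rmod k A X ==> bilin k X A X (ract X)"
 by (intro bilinI right_module.ract_linear_module right_module.ract_linear_algebra)

lemma ract_closed: "rmod k A X ==> x <: X ==> a <: A ==> ract X x a <: X"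
 by (rule bil_closed[OF ract_bilin])

lemma rmap_plus:
 assumes "rmod k A Y" "rmap k A X Y f" "rmap k A X Y g"
 shows "rmap k A X Y (%x. f x +[Y] g x)"
 using assms unfolding rmodule_map_def
 by (auto intro!: lin_plus rmod_mod
  simp: lin_add[OF right_module.ract_linear_module[OF assms(1)]] lin_closed)

lemma rmap_uminus:
 assumes "rmod k A Y" "rmap k A X Y f"
 shows "rmap k A X Y (%x. -[Y] f x)"
 using assms unfolding rmodule_map_def
 by (auto intro!: lin_uminus rmod_mod lin_neg[symmetric]
   right_module.ract_linear_module lin_closed[of k X Y f])

lemma rmap_diff:
 assumes "rmod k A Y" "rmap k A X Y f" "rmap k A X Y g"
 shows "rmap k A X Y (%x. f x -[Y] g x)"
 unfolding a_minus_def by (intro rmap_plus rmap_uminus assms)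

subsection \<open>Tensor powers are relatively free\<close>

context hopf_algebra
begin

abbreviation Dg where "Dg == diag_module k H"

lemma diag_simps:
 "carrier (Dg n) = carrier (T' n)" "add (Dg n) = add (T' n)"
 "zero (Dg n) = zero (T' n)" "smult (Dg n) = smult (T' n)"
 "ract (Dg n) t h = tm (Suc n) t (it (Suc n) h)"
 by (simp_all add: diag_module_def module.extend_def rmodule.fields_def it.simps)

lemma diag_linear: "lmap k V (Dg n) f \<longleftrightarrow> lmap k V (T' n) f"
 "lmap k (Dg n) W g \<longleftrightarrow> lmap k (T' n) W g"
 by (simp_all add: linear_map_def diag_simps)

lemma module_diag: "module k (Dg n)"
 by (rule module_transfer[OF T_mod]) (simp_all add: diag_simps)

lemma rmod_diag: "rmod k H (Dg n)"
proof (intro right_module.intro right_module_axioms.intro module_diag)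
 fix a assume a: "a <: H"
 show "lmap k (Dg n) (Dg n) (%x. ract (Dg n) x a)"
  unfolding diag_linear unfolding diag_simps by (intro lin_tm lin_id it_closed a)
next
 fix x assume x: "x <: Dg n"
 show "lmap k H (Dg n) (ract (Dg n) x)"
  unfolding diag_linear unfolding diag_simps
  using x by (auto intro!: lin_tm it_linear simp: diag_simps)
next
 fix x a b assume x: "x <: Dg n" "a <: H" "b <: H"
 then show "ract (Dg n) x (a *[H] b) = ract (Dg n) (ract (Dg n) x a) b"
  by (simp add: diag_simps it_mult tm_assoc it_closed)
next
 fix x assume "x <: Dg n"
 then show "ract (Dg n) x 1[H] = x" by (simp add: diag_simps tm_one)
qed

text \<open>The isomorphism \<open>z \<otimes> h \<mapsto> z h\<^sub>1 \<otimes> h\<^sub>2\<close> from the relatively free module to the diagonal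
  module, and its inverse \<open>z \<otimes> h \<mapsto> z S(h\<^sub>1) \<otimes> h\<^sub>2\<close>.\<close>

definition al where
 "al n = unsnoc (T' n) (%z h. sw' (T' n) (%a b. snoc n (tm n z (it n a)) b) h)"
definition be where
 "be n = unsnoc (T' n) (%z h. sw' (T' n) (%a b. snoc n (tm n z (it n (antipode H a))) b) h)"

lemma al_b: "z <: T n ==> bilin k H H (T' n) (%a b. snoc n (tm n z (it n a)) b)"
 by (intro lin lin_tm lin_it) (simp_all add: it_closed tm_closed)

lemma be_b: "z <: T n ==> bilin k H H (T' n) (%a b. snoc n (tm n z (it n (antipode H a))) b)"
 by (intro lin lin_tm lin_it) (simp_all add: it_closed tm_closed cl)

lemma al_lin: "lmap k (T' n) (T' n) (al n)"
 and al_snoc: "z <: T n ==> h <: H ==>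
  al n (snoc n z h) = sw' (T' n) (%a b. snoc n (tm n z (it n a)) b) h"
proof -
 have g: "bilin k (T n) H (T' n) (%z h. sw' (T' n) (%a b. snoc n (tm n z (it n a)) b) h)"
  by (intro lin lin_tm lin_it) (simp_all add: it_closed tm_closed cl)
 show "lmap k (T' n) (T' n) (al n)"
  unfolding al_def by (rule unsnoc_linear[OF T_mod g])
 show "z <: T n ==> h <: H ==>
  al n (snoc n z h) = sw' (T' n) (%a b. snoc n (tm n z (it n a)) b) h"
  unfolding al_def by (rule unsnoc_snoc[OF T_mod g])
qed

lemma be_lin: "lmap k (T' n) (T' n) (be n)"
 and be_snoc: "z <: T n ==> h <: H ==>
  be n (snoc n z h) = sw' (T' n) (%a b. snoc n (tm n z (it n (antipode H a))) b) h"
proof -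
 have g: "bilin k (T n) H (T' n)
   (%z h. sw' (T' n) (%a b. snoc n (tm n z (it n (antipode H a))) b) h)"
  by (intro lin lin_tm lin_it) (simp_all add: it_closed tm_closed cl)
 show "lmap k (T' n) (T' n) (be n)"
  unfolding be_def by (rule unsnoc_linear[OF T_mod g])
 show "z <: T n ==> h <: H ==>
  be n (snoc n z h) = sw' (T' n) (%a b. snoc n (tm n z (it n (antipode H a))) b) h"
  unfolding be_def by (rule unsnoc_snoc[OF T_mod g])
qed

lemma al_be:
 assumes "t <: T' n"
 shows "al n (be n t) = t"
proof (rule snoc_ext[OF T_mod lin_comp[OF al_lin be_lin] lin_id _ assms])
 fix z h assume z: "z <: T n" and h: "h <: H"
 let ?W = "T' n"
 have m: "tm n (tm n z (it n (antipode H a))) (it n c) = tm n z (it n (antipode H a *[H] c))"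
  if "a <: H" "c <: H" for a c
  using that z by (simp add: tm_assoc it_mult it_closed cl)
 have "al n (be n (snoc n z h)) = sw' ?W (%a b. al n (snoc n (tm n z (it n (antipode H a))) b)) h"
  unfolding be_snoc[OF z h] by (rule sw_hom[OF T_mod T_mod al_lin be_b[OF z] h])
 also have "... = sw' ?W (%a b. sw' ?W (%c d. snoc n (tm n z (it n (antipode H a *[H] c))) d) b) h"
  using z by (intro sw_cong h) (simp add: al_snoc tm_closed it_closed cl, intro sw_cong; simp add: m)
 also have "... = sw' ?W (%a b. sw' ?W (%c d. snoc n (tm n z (it n (antipode H c *[H] d))) b) a) h"
  by (intro sw_coassoc[symmetric] T_mod h lin lin_tm lin_it) (simp_all add: tm_closed it_closed cl z)
 also have "... = sw' ?W (%a b. eH a .[?W] snoc n (tm n z (it n 1[H])) b) h"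
  by (intro sw_cong h sw_antipode_left T_mod lin lin_tm lin_it) (simp_all add: z)
 also have "... = snoc n (tm n z (it n 1[H])) h"
  by (intro sw_counit_left T_mod h lin) (simp add: tm_closed it_closed z)
 finally show "al n (be n (snoc n z h)) = snoc n z h" using z by (simp add: tm_one)
qed

lemma be_al:
 assumes "t <: T' n"
 shows "be n (al n t) = t"
proof (rule snoc_ext[OF T_mod lin_comp[OF be_lin al_lin] lin_id _ assms])
 fix z h assume z: "z <: T n" and h: "h <: H"
 let ?W = "T' n"
 have m: "tm n (tm n z (it n a)) (it n (antipode H c)) = tm n z (it n (a *[H] antipode H c))"
  if "a <: H" "c <: H" for a c
  using that z by (simp add: tm_assoc it_mult it_closed cl)
 have "be n (al n (snoc n z h)) = sw' ?W (%a b. be n (snoc n (tm n z (it n a)) b)) h"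
  unfolding al_snoc[OF z h] by (rule sw_hom[OF T_mod T_mod be_lin al_b[OF z] h])
 also have "... = sw' ?W (%a b. sw' ?W (%c d. snoc n (tm n z (it n (a *[H] antipode H c))) d) b) h"
  using z by (intro sw_cong h) (simp add: be_snoc tm_closed it_closed cl, intro sw_cong; simp add: m)
 also have "... = sw' ?W (%a b. sw' ?W (%c d. snoc n (tm n z (it n (c *[H] antipode H d))) b) a) h"
  by (intro sw_coassoc[symmetric] T_mod h lin lin_tm lin_it) (simp_all add: tm_closed it_closed cl z)
 also have "... = sw' ?W (%a b. eH a .[?W] snoc n (tm n z (it n 1[H])) b) h"
  by (intro sw_cong h sw_antipode_right T_mod lin lin_tm lin_it) (simp_all add: z)
 also have "... = snoc n (tm n z (it n 1[H])) h"
  by (intro sw_counit_left T_mod h lin) (simp add: tm_closed it_closed z)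
 finally show "be n (al n (snoc n z h)) = snoc n z h" using z by (simp add: tm_one)
qed

text \<open>Multiplication of the last factor only.\<close>

abbreviation lm where "lm n t g == tm (Suc n) t (snoc n (it n 1[H]) g)"

lemma lm_snoc: "z <: T n ==> b <: H ==> g <: H ==>
  lm n (snoc n z b) g = snoc n z (b *[H] g)"
 by (simp add: tm_snoc it_closed tm_one)

lemma al_lm:
 assumes "t <: T' n" "g <: H"
 shows "al n (lm n t g) = tm (Suc n) (al n t) (it (Suc n) g)"
proof (rule snoc_ext[OF T_mod _ _ _ assms(1)])
 show "lmap k (T' n) (T' n) (%t. al n (lm n t g))"
  "lmap k (T' n) (T' n) (%t. tm (Suc n) (al n t) (it (Suc n) g))"
  using assms(2)
  by (auto intro!: lin_comp[OF al_lin] lin_tm lin_id al_lin snoc_closed it_closed)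
 fix z h assume z: "z <: T n" and h: "h <: H"
 have b: "bilin k H H (T' n) (%a b. snoc n (it n a) b)"
  by (intro lin lin_it) (simp_all add: it_closed)
 show "al n (lm n (snoc n z h) g) = tm (Suc n) (al n (snoc n z h)) (it (Suc n) g)"
  using z h assms(2)
  by (simp add: lm_snoc al_snoc it_snoc sw_mult[OF T_mod al_b] sw_tm[OF al_b b])
   (intro sw_cong; simp add: tm_snoc tm_closed it_closed it_mult tm_assoc)
qed

text \<open>A linear map on the elements \<open>z \<otimes> 1\<close> extends to a map of modules.\<close>

lemma average:
 assumes Y: "rmod k H Y" and f: "lmap k (T' n) Y f"
 defines "u == unsnoc Y (%z h. ract Y (f (snoc n z 1[H])) h)"
 shows average_map: "rmap k H (Dg n) Y (%t. u (be n t))"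
  and average_snoc: "!!z h. z <: T n ==> h <: H ==>
   u (snoc n z h) = ract Y (f (snoc n z 1[H])) h"
  and average_lin: "lmap k (T' n) Y u"
proof -
 have g: "bilin k (T n) H Y (%z h. ract Y (f (snoc n z 1[H])) h)"
  by (intro bilinI linear_bilin_left[OF ract_bilin[OF Y]] lin_comp[OF f] lin
    bil_right[OF ract_bilin[OF Y]] lin_closed[OF f]) (simp_all add: cl)
 note mY = rmod_mod[OF Y]
 show u: "lmap k (T' n) Y u" unfolding u_def by (rule unsnoc_linear[OF mY g])
 show us: "u (snoc n z h) = ract Y (f (snoc n z 1[H])) h" if "z <: T n" "h <: H" for z h
  unfolding u_def by (rule unsnoc_snoc[OF mY g that])
 have ul: "u (lm n t h) = ract Y (u t) h" if t: "t <: T' n" and h: "h <: H" for t h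
 proof (rule snoc_ext[OF mY _ _ _ t])
  show "lmap k (T' n) Y (%t. u (lm n t h))"
   using h by (intro lin_comp[OF u] lin_tm lin_id snoc_closed it_closed) simp_all
  show "lmap k (T' n) Y (%t. ract Y (u t) h)"
   by (intro linear_bilin_left[OF ract_bilin[OF Y]] u h)
  show "u (lm n (snoc n z b) h) = ract Y (u (snoc n z b)) h" if "z <: T n" "b <: H" for z b
   using that h lin_closed[OF f] by (simp add: lm_snoc us right_module.ract_mult[OF Y] cl)
 qed
 have "u (be n (tm (Suc n) t (it (Suc n) h))) = ract Y (u (be n t)) h"
  if t: "t <: T' n" and h: "h <: H" for t h
 proof -
  have bt: "be n t <: T' n" by (rule lin_closed[OF be_lin t])
  have "tm (Suc n) t (it (Suc n) h) = al n (lm n (be n t) h)"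
   using t h bt by (simp add: al_lm al_be)
  then show ?thesis using bt h by (simp add: be_al ul tm_closed snoc_closed it_closed)
 qed
 then show "rmap k H (Dg n) Y (%t. u (be n t))"
  by (auto simp: rmodule_map_def diag_linear diag_simps intro!: lin_comp[OF u be_lin])
qed

lemma average_id:
 assumes Y: "rmod k H Y" and f: "rmap k H (Dg n) Y f"
  and u: "lmap k (T' n) Y u"
   "!!z h. z <: T n ==> h <: H ==> u (snoc n z h) = ract Y (f (snoc n z 1[H])) h"
  and t: "t <: T' n"
 shows "u (be n t) = f t"
proof -
 have fl: "lmap k (T' n) Y f" using f by (simp add: rmodule_map_def diag_linear)
 have "u s = f (al n s)" if "s <: T' n" for s
 proof (rule snoc_ext[OF rmod_mod[OF Y] u(1) lin_comp[OF fl al_lin] _ that])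
  fix z h assume z: "z <: T n" and h: "h <: H"
  have "al n (snoc n z h) = tm (Suc n) (al n (snoc n z 1[H])) (it (Suc n) h)"
   using z h al_lm[of "snoc n z 1[H]" n h] by (simp add: lm_snoc cl)
  also have "al n (snoc n z 1[H]) = snoc n z 1[H]"
   using z by (simp add: al_snoc sw_one[OF T_mod al_b] tm_one)
  finally have "f (al n (snoc n z h)) = ract Y (f (snoc n z 1[H])) h"
   using f z h by (simp add: rmodule_map_def diag_simps cl)
  then show "u (snoc n z h) = f (al n (snoc n z h))" using u(2) z h by simp
 qed
 from this[OF lin_closed[OF be_lin t]] show ?thesis using t by (simp add: al_be)
qed

text \<open>Over a field the values on the elements \<open>z \<otimes> 1\<close> can be lifted linearly, by a section of \<open>d\<close>.\<close>

lemma diag_lifts: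
 assumes k: "field k" and Y': "rmod k H Y'" and Y: "rmod k H Y" and d: "rmap k H Y' Y d"
 shows "lifts k H (Dg n) Y' Y d"
 unfolding lifts_def
proof (intro allI impI, elim conjE)
 fix \<psi> assume \<psi>: "rmap k H (Dg n) Y \<psi>" "\<psi> ` carrier (Dg n) <= d ` carrier Y'"
 note mY' = rmod_mod[OF Y'] and mY = rmod_mod[OF Y]
 note dl = rmap_linear[OF d]
 obtain s where s: "lmap k (Y\<lparr>carrier := d ` carrier Y'\<rparr>) Y' s" "!!y. y : d ` carrier Y' ==> d (s y) = y"
  using linear_split[OF k mY' mY dl] by blast
 have pl: "lmap k (T' n) Y \<psi>" using \<psi>(1) by (simp add: rmodule_map_def diag_linear)
 then have "lmap k (T' n) (Y\<lparr>carrier := d ` carrier Y'\<rparr>) \<psi>"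
  using \<psi>(2) by (auto simp: linear_map_def diag_simps)
 then have f: "lmap k (T' n) Y' (%t. s (\<psi> t))" by (rule lin_comp[OF s(1)])
 have ds: "d (s (\<psi> t)) = \<psi> t" if "t <: T' n" for t
  using s(2) \<psi>(2) that by (auto simp: diag_simps)
 define u where "u = unsnoc Y' (%z h. ract Y' (s (\<psi> (snoc n z 1[H]))) h)"
 note av = average[OF Y' f, folded u_def]
 have "d (u (be n t)) = \<psi> t" if t: "t <: T' n" for t
  by (rule average_id[OF Y \<psi>(1) lin_comp[OF dl av(3)] _ t])
   (use lin_closed[OF f] ds in \<open>simp add: av(2) rmap_ract[OF d] cl\<close>)
 then show "EX \<phi>. rmap k H (Dg n) Y' \<phi> & (ALL x:carrier (Dg n). d (\<phi> x) = \<psi> x)"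
  using av(1) by (intro exI[of _ "%t. u (be n t)"]) (auto simp: diag_simps)
qed

section \<open>The antipode reverses products\<close>

text \<open>Both sides are inverse to the product \<open>H \<otimes> H \<rightarrow> H\<close> under convolution.\<close>

lemma antipode_mult:
 assumes g: "g <: H" and h: "h <: H"
 shows "antipode H (g *[H] h) = antipode H h *[H] antipode H g"
proof -
 let ?S = "antipode H"
 define G where "G a b1 b2 =
  sw' H (%c d. sw' H (%d1 d2. ?S (a *[H] c) *[H] (b1 *[H] d1 *[H] (?S d2 *[H] ?S b2))) d) h" for a b1 b2
 have Gl: "lmap k H H (%a. G a b c)" "lmap k H H (%a. G b a c)" "lmap k H H (%a. G b c a)"
  if "b <: H" "c <: H" for b c
  unfolding G_def by (intro lin h module_H; (simp add: cl that)?)+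
 have G1: "G a b1 b2 = ?S (a *[H] h) *[H] (b1 *[H] ?S b2)"
  if "a <: H" "b1 <: H" "b2 <: H" for a b1 b2
 proof -
  have "sw' H (%d1 d2. ?S (a *[H] c) *[H] (b1 *[H] d1 *[H] (?S d2 *[H] ?S b2))) d =
    eH d .[H] (?S (a *[H] c) *[H] (b1 *[H] ?S b2))" if cd: "c <: H" "d <: H" for c d
  proof -
   have "sw' H (%d1 d2. ?S (a *[H] c) *[H] (b1 *[H] d1 *[H] (?S d2 *[H] ?S b2))) d =
     sw' H (%d1 d2. ?S (a *[H] c) *[H] (b1 *[H] ((d1 *[H] ?S d2) *[H] ?S b2))) d"
    using cd \<open>a \<in> carrier H\<close> \<open>b1 \<in> carrier H\<close> \<open>b2 \<in> carrier H\<close> by (intro sw_cong) (simp_all add: m_assoc cl)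
   also have "... = eH d .[H] (?S (a *[H] c) *[H] (b1 *[H] (1[H] *[H] ?S b2)))"
    using cd \<open>a \<in> carrier H\<close> \<open>b1 \<in> carrier H\<close> \<open>b2 \<in> carrier H\<close>
    by (intro sw_antipode_right module_H lin) (simp_all add: cl)
   finally show ?thesis using \<open>b2 \<in> carrier H\<close> by (simp add: cl)
  qed
  then have "G a b1 b2 = sw' H (%c d. eH d .[H] (?S (a *[H] c) *[H] (b1 *[H] ?S b2))) h"
   unfolding G_def by (intro sw_cong h)
  also have "... = ?S (a *[H] h) *[H] (b1 *[H] ?S b2)"
   using that by (intro sw_counit_right module_H lin h) (simp_all add: cl)
  finally show ?thesis .
 qed
 have G2: "G a b1 b2 = sw' H (%c d. sw' H (%c1 c2. ?S (a *[H] c1) *[H] (b1 *[H] c2 *[H] (?S d *[H] ?S b2))) c) h"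
  if "a <: H" "b1 <: H" "b2 <: H" for a b1 b2
  unfolding G_def using that by (intro sw_coassoc[symmetric] module_H h lin) (simp_all add: cl)
 have "sw' H (%a b. sw' H (%b1 b2. G a b1 b2) b) g = sw' H (%a b. eH b .[H] ?S (a *[H] h)) g"
 proof (rule sw_cong[OF g])
  fix a b assume ab: "a <: H" "b <: H"
  have "sw' H (%b1 b2. G a b1 b2) b = sw' H (%b1 b2. ?S (a *[H] h) *[H] (b1 *[H] ?S b2)) b"
   using ab by (intro sw_cong G1)
  also have "... = eH b .[H] (?S (a *[H] h) *[H] 1[H])"
   using ab h by (intro sw_antipode_right module_H lin) (simp_all add: cl)
  finally show "sw' H (%b1 b2. G a b1 b2) b = eH b .[H] ?S (a *[H] h)"
   using ab h by (simp add: cl)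
 qed
 also have "... = ?S (g *[H] h)"
  using h g by (intro sw_counit_right module_H lin)
 finally have E1: "sw' H (%a b. sw' H (%b1 b2. G a b1 b2) b) g = ?S (g *[H] h)" .
 have "sw' H (%a b. sw' H (%b1 b2. G a b1 b2) b) g = sw' H (%a b. sw' H (%a1 a2. G a1 a2 b) a) g"
  by (intro sw_coassoc[symmetric] module_H g Gl)
 also have "... = sw' H (%a b. eH a .[H] (?S h *[H] ?S b)) g"
 proof (rule sw_cong[OF g])
  fix a b assume ab: "a <: H" "b <: H"
  have "sw' H (%a1 a2. G a1 a2 b) a =
    sw' H (%a1 a2. sw' H (%c d. sw' H (%c1 c2. ?S (a1 *[H] c1) *[H] (a2 *[H] c2 *[H] (?S d *[H] ?S b))) c) h) a"
   using ab by (intro sw_cong G2)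
  also have "... =
    sw' H (%c d. sw' H (%a1 a2. sw' H (%c1 c2. ?S (a1 *[H] c1) *[H] (a2 *[H] c2 *[H] (?S d *[H] ?S b))) c) a) h"
   using ab h by (intro sw_swap module_H lin) (simp_all add: cl)
  also have "... = sw' H (%c d. eH c .[H] (eH a .[H] (?S d *[H] ?S b))) h"
  proof (rule sw_cong[OF h])
   fix c d assume cd: "c <: H" "d <: H"
   have bb: "bilin k H H H (%x y. ?S x *[H] (y *[H] (?S d *[H] ?S b)))"
    using ab cd by (intro lin) (simp_all add: cl)
   have "sw' H (%a1 a2. sw' H (%c1 c2. ?S (a1 *[H] c1) *[H] (a2 *[H] c2 *[H] (?S d *[H] ?S b))) c) a =
     sw' H (%x y. ?S x *[H] (y *[H] (?S d *[H] ?S b))) (a *[H] c)"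
    by (rule sw_mult[OF module_H bb ab(1) cd(1), symmetric])
   also have "... = sw' H (%x y. (?S x *[H] y) *[H] (?S d *[H] ?S b)) (a *[H] c)"
    using ab cd by (intro sw_cong) (simp_all add: m_assoc cl)
   also have "... = eH (a *[H] c) .[H] (1[H] *[H] (?S d *[H] ?S b))"
    using ab cd by (intro sw_antipode_left module_H lin) (simp_all add: cl)
   finally show "sw' H (%a1 a2. sw' H (%c1 c2. ?S (a1 *[H] c1) *[H] (a2 *[H] c2 *[H] (?S d *[H] ?S b))) c) a =
     eH c .[H] (eH a .[H] (?S d *[H] ?S b))"
    using ab cd by (simp add: counit_mult cl smult_assoc1[symmetric] R.m_comm)
  qed
  also have "... = eH a .[H] (?S h *[H] ?S b)"
   using ab h by (intro sw_counit_left[where f = "%d. eH a .[H] (?S d *[H] ?S b)"] module_H lin) (simp_all add: cl)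
  finally show "sw' H (%a1 a2. G a1 a2 b) a = eH a .[H] (?S h *[H] ?S b)" .
 qed
 also have "... = ?S h *[H] ?S g"
  using h g by (intro sw_counit_left module_H lin) (simp_all add: cl)
 finally show ?thesis using E1 by simp
qed

section \<open>Rotations\<close>

lemma tm_cns:
 assumes "s <: T n" "t <: T n" "a <: H" "b <: H"
 shows "tm (Suc n) (cns n a s) (cns n b t) = cns n (a *[H] b) (tm n s t)"
 using assms
proof (induction n arbitrary: s t)
 case 0
 show ?case using 0 by (simp add: cns_0 tm_snoc tm_closed)
next
 case (Suc n)
 show ?case
  by (rule snoc_ext2[OF T_mod _ _ _ Suc.prems(1,2)])
   (use Suc.prems(3,4) in \<open>auto intro!: bilinI lin_tm lin_cns lin_id cns_closed
    simp: cns_snoc tm_snoc cns_closed Suc.IH tm_closed\<close>)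
qed

lemma sw_rt:
 assumes "bilin k H H (T' n) f" "h <: H" "c <: H"
 shows "rt n c (sw' (T' n) f h) = sw' (T' n) (%x y. rt n c (f x y)) h"
 by (rule sw_hom[OF T_mod T_mod rt_linear[OF assms(3)] assms(1,2)])

lemma snoc_it_bilin: "bilin k H H (T' n) (%a b. snoc n (it n a) b)"
 by (intro lin lin_it) (simp_all add: it_closed)

lemma cns_it_bilin: "bilin k H H (T' n) (%a b. cns n a (it n b))"
 by (intro lin lin_it) (simp_all add: it_closed)

lemma sw_comm:
 assumes c: "cocommutative k H" and W: "module k W" and f: "bilin k H H W f" and h: "h <: H"
 shows "sw' W f h = sw' W (%a b. f b a) h"
proof -
 have p: "bilin k H H (T 2) (%a b. pH [b, a])"
  using multilin_linear[OF ptens_multilin, of "[]" "[_]" 2]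
   multilin_linear[OF ptens_multilin, of "[_]" "[]" 2]
  by (auto intro!: bilinI)
 have "comult H h = sw' (T 2) (%a b. pH [b, a]) h"
  using c h by (simp add: cocommutative_def sw_def)
 then have "sw' W f h = lift k W (%hs. f (hs ! 0) (hs ! 1)) (sw' (T 2) (%a b. pH [b, a]) h)"
  by (simp add: sw_def)
 also have "... = sw' W (%a b. lift k W (%hs. f (hs ! 0) (hs ! 1)) (pH [b, a])) h"
  by (rule sw_hom[OF T_mod W tpow_lift_linear[OF W sw_multilin[OF f]] p h])
 also have "... = sw' W (%a b. f b a) h"
  by (intro sw_cong h) (subst tpow_lift_ptens[OF W sw_multilin[OF f]]; simp)
 finally show ?thesis .
qed

text \<open>In the cocommutative case the iterated comultiplication is symmetric; this makes the rotation a map of modules.\<close>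

lemma rt_it:
 assumes "cocommutative k H" "h <: H"
 shows "rt n 1[H] (it (Suc n) h) = it (Suc n) h"
proof -
 have "rt n 1[H] (it (Suc n) h) = sw' (T' n) (%x y. cns n y (it n x)) h"
  using assms(2) by (simp add: it_snoc sw_rt[OF snoc_it_bilin]) (intro sw_cong; simp add: rt_snoc it_closed)
 also have "... = it (Suc n) h"
  using assms sw_comm[OF assms(1) T_mod cns_it_bilin] by (simp add: it_cns)
 finally show ?thesis .
qed

lemma rt_tm:
 assumes "s <: T' n" "t <: T' n"
 shows "rt n 1[H] (tm (Suc n) s t) = tm (Suc n) (rt n 1[H] s) (rt n 1[H] t)"
 by (rule snoc_ext2[OF T_mod _ _ _ assms])
  (auto intro!: bilinI lin_tm lin_rt lin_id rt_closed
   simp: rt_snoc tm_snoc tm_cns tm_closed)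

lemma rt_power:
 assumes "j <= Suc n" "set hs <= carrier H" "length hs = Suc n"
 shows "(rt n 1[H] ^^ j) (pH hs) = pH (drop (Suc n - j) hs @ take (Suc n - j) hs)"
 using assms(1)
proof (induction j)
 case 0
 then show ?case using assms by simp
next
 case (Suc j)
 define xs where "xs = drop (Suc n - j) hs"
 define ys where "ys = take (n - j) hs"
 have m: "Suc n - j = Suc (n - j)" using Suc by simp
 have t: "take (Suc n - j) hs = ys @ [hs ! (n - j)]"
  unfolding m ys_def using assms Suc.prems by (simp add: take_Suc_conv_app_nth)
 have d: "drop (n - j) hs = hs ! (n - j) # xs"
  unfolding xs_def m using assms Suc.prems by (simp add: Cons_nth_drop_Suc)
 have c: "set xs <= carrier H" "set ys <= carrier H" "hs ! (n - j) <: H" "length (xs @ ys) = n"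
  using assms Suc.prems by (auto simp: xs_def ys_def dest: in_set_takeD in_set_dropD)
 have "(rt n 1[H] ^^ Suc j) (pH hs) = rt n 1[H] (pH ((xs @ ys) @ [hs ! (n - j)]))"
  using Suc t by (simp add: xs_def)
 also have "... = rt n 1[H] (snoc n (pH (xs @ ys)) (hs ! (n - j)))"
  using c by (subst snoc_ptens) auto
 also have "... = cns n (hs ! (n - j)) (pH (xs @ ys))"
  using c by (subst rt_snoc) (auto simp: ptens_closed)
 also have "... = pH (hs ! (n - j) # xs @ ys)"
  using c by (subst cns_ptens) auto
 finally show ?case using d by (simp add: ys_def)
qed

lemma rt_power_linear: "lmap k (T' n) (T' n) (rt n 1[H] ^^ j)"
proof (induction j)
 case 0
 show ?case using lin_id by (simp add: id_def)
next
 case (Suc j)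
 show ?case using lin_comp[OF rt_linear[OF one_closed] Suc] by (simp add: comp_def)
qed

lemma rt_order: "t <: T' n ==> (rt n 1[H] ^^ Suc n) t = t"
 by (rule tpow_linear_ext[OF T_mod rt_power_linear lin_id])
  (simp_all add: rt_power del: funpow.simps)

end

section \<open>Projective modules\<close>

lemma fr_simps:
 "carrier (free_rmodule A B) = {f : (\<Pi>\<^sub>E i\<in>B. carrier A). finite {i\<in>B. f i ~= 0[A]}}"
 "add (free_rmodule A B) = (%f g. \<lambda>i\<in>B. f i +[A] g i)"
 "smult (free_rmodule A B) = (%a f. \<lambda>i\<in>B. a .[A] f i)"
 "ract (free_rmodule A B) = (%c a. \<lambda>b\<in>B. c b *[A] a)"
 by (simp_all add: free_rmodule_def module.extend_def rmodule.fields_def direct_sum_def)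

context assoc_algebra
begin

definition unit_vec where "unit_vec B b = (\<lambda>b'\<in>B. if b' = b then 1[A] else 0[A])"

lemma unit_vec_closed: "b : B ==> unit_vec B b <: free_rmodule A B"
proof -
 have "{i : B. (unit_vec B b) i ~= 0[A]} <= {b}" by (auto simp: unit_vec_def)
 then show ?thesis using finite_subset by (auto simp: fr_simps unit_vec_def)
qed

lemma free_rmodule_add_closed:
 assumes "c <: free_rmodule A B" "d <: free_rmodule A B"
 shows "c +[free_rmodule A B] d <: free_rmodule A B"
proof -
 have "{i : B. c i +[A] d i ~= 0[A]} <= {i : B. c i ~= 0[A]} \<union> {i : B. d i ~= 0[A]}" by auto
 then have "finite {i : B. c i +[A] d i ~= 0[A]}"
  using assms by (auto simp: fr_simps intro: finite_subset)
 moreover have "{i : B. (c +[free_rmodule A B] d) i ~= 0[A]} = {i : B. c i +[A] d i ~= 0[A]}"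
  by (auto simp: fr_simps)
 ultimately show ?thesis using assms by (auto simp: fr_simps Pi_def PiE_def)
qed

lemma free_rmodule_ract_closed:
 assumes "c <: free_rmodule A B" "a <: A"
 shows "ract (free_rmodule A B) c a <: free_rmodule A B"
proof -
 have "{i : B. c i *[A] a ~= 0[A]} <= {i : B. c i ~= 0[A]}" using assms(2) by auto
 then have "finite {i : B. c i *[A] a ~= 0[A]}"
  using assms by (auto simp: fr_simps intro: finite_subset)
 moreover have "{i : B. (ract (free_rmodule A B) c a) i ~= 0[A]} = {i : B. c i *[A] a ~= 0[A]}"
  by (auto simp: fr_simps)
 ultimately show ?thesis using assms by (auto simp: fr_simps Pi_def PiE_def)
qed

text \<open>By induction on the size of the support.\<close>

lemma free_rmodule_ext:
 assumes Y: "rmod k A Y" and f: "rmap k A (free_rmodule A B) Y f"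
  and g: "rmap k A (free_rmodule A B) Y g"
  and eq: "!!b. b : B ==> f (unit_vec B b) = g (unit_vec B b)" and c: "c <: free_rmodule A B"
 shows "f c = g c"
 using c
proof (induction "card {i : B. c i ~= 0[A]}" arbitrary: c)
 case 0
 interpret Y: module k Y by (rule rmod_mod[OF Y])
 have "{i : B. c i ~= 0[A]} = {}" using 0 by (simp add: fr_simps)
 then have z: "c = 0[k] .[free_rmodule A B] c"
  using 0(2) by (auto simp: fr_simps PiE_def extensional_def fun_eq_iff)
 have "f c = 0[k] .[Y] f c" "g c = 0[k] .[Y] g c"
  using z lin_smult[OF rmap_linear[OF f] _ 0(2)]
   lin_smult[OF rmap_linear[OF g] _ 0(2)] by (metis R.zero_closed)+
 then show ?case
  using rmap_closed[OF f 0(2)] rmap_closed[OF g 0(2)] by (metis Y.smult_l_null)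
next
 case (Suc n)
 then obtain b where b: "b : B" "c b ~= 0[A]"
  by (metis (mono_tags, lifting) Collect_empty_eq card.empty nat.distinct(1))
 define d where "d = c(b := 0[A])"
 have supp: "{i : B. d i ~= 0[A]} = {i : B. c i ~= 0[A]} - {b}" by (auto simp: d_def)
 have fin: "finite {i : B. c i ~= 0[A]}" using Suc.prems by (simp add: fr_simps)
 have dc: "d <: free_rmodule A B"
  using Suc.prems supp fin b by (auto simp: fr_simps d_def PiE_def Pi_def extensional_def)
 have "card {i : B. d i ~= 0[A]} = n" using Suc(2) b fin by (simp add: supp)
 then have IH: "f d = g d" using Suc.hyps(1)[OF _ dc] by simp
 have cA: "c i <: A" if "i : B" for i using Suc.prems that by (auto simp: fr_simps)
 have r: "ract (free_rmodule A B) (unit_vec B b) (c b) <: free_rmodule A B"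
  using b cA by (intro free_rmodule_ract_closed unit_vec_closed)
 have "c = d +[free_rmodule A B] ract (free_rmodule A B) (unit_vec B b) (c b)"
  using Suc.prems cA b
  by (auto simp: fr_simps d_def unit_vec_def fun_eq_iff PiE_def extensional_def)
 then have "f c = f d +[Y] ract Y (f (unit_vec B b)) (c b)" "g c = g d +[Y] ract Y (g (unit_vec B b)) (c b)"
  using lin_add[OF rmap_linear[OF f] dc r] lin_add[OF rmap_linear[OF g] dc r]
   rmap_ract[OF f unit_vec_closed[OF b(1)] cA[OF b(1)]]
   rmap_ract[OF g unit_vec_closed[OF b(1)] cA[OF b(1)]] by simp_all
 then show ?case using IH eq[OF b(1)] by simp
qed

lemma free_rmodule_map:
 assumes Y: "rmod k A Y" and y: "!!b. b : B ==> y b <: Y"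
 shows "EX f. rmap k A (free_rmodule A B) Y f & (ALL b:B. f (unit_vec B b) = y b)"
proof -
 interpret Y: module k Y by (rule rmod_mod[OF Y])
 let ?F = "free_rmodule A B"
 define f where "f c = (\<Oplus>\<^bsub>Y\<^esub>b\<in>{b\<in>B. c b ~= 0[A]}. ract Y (y b) (c b))" for c
 have cA: "c i <: A" if "c <: ?F" "i : B" for c i using that by (auto simp: fr_simps)
 have t: "ract Y (y b) a <: Y" if "b : B" "a <: A" for b a
  using ract_closed[OF Y] y that by simp
 have z: "ract Y (y b) 0[A] = 0[Y]" if "b : B" for b
  by (rule lin_zero[OF module_axioms Y.module_axioms bil_right[OF ract_bilin[OF Y] y[OF that]]])
 have on: "f c = (\<Oplus>\<^bsub>Y\<^esub>b\<in>S. ract Y (y b) (c b))"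
  if "c <: ?F" "{b\<in>B. c b ~= 0[A]} <= S" "S <= B" "finite S" for c S
  unfolding f_def
 proof (rule Y.add.finprod_mono_neutral_cong_left[OF that(4,2)])
  show "ract Y (y i) (c i) = 0[Y]" if "i : S - {b : B. c b ~= 0[A]}" for i
  proof -
   have "i : B" "c i = 0[A]" using that \<open>S \<subseteq> B\<close> by auto
   then show ?thesis using z by simp
  qed
  show "(%b. ract Y (y b) (c b)) : S \<rightarrow> carrier Y" using that cA t by blast
 qed simp
 have "rmap k A ?F Y f"
  unfolding rmodule_map_def
 proof (intro conjI linI ballI)
  fix c assume c: "c <: ?F"
  show "f c <: Y" unfolding f_def using c cA t by (intro Y.finsum_closed) auto
  have fc: "finite {b\<in>B. c b ~= 0[A]}" using c by (simp add: fr_simps)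
  have Sc: "{b\<in>B. c b ~= 0[A]} <= B" by auto
  show "f (c +[?F] d) = f c +[Y] f d" if d: "d <: ?F" for d
  proof -
   let ?S = "{b\<in>B. c b ~= 0[A]} \<union> {b\<in>B. d b ~= 0[A]}"
   have S: "?S <= B" "finite ?S" using c d by (auto simp: fr_simps)
   have cS: "c b <: A" "d b <: A" if "b : ?S" for b using cA c d S that by blast+
   have tS: "ract Y (y b) (c b) <: Y" "ract Y (y b) (d b) <: Y" if "b : ?S" for b
    using cS t S that by blast+
   have "f (c +[?F] d) = (\<Oplus>\<^bsub>Y\<^esub>b\<in>?S. ract Y (y b) ((c +[?F] d) b))"
    using S by (intro on free_rmodule_add_closed c d) (auto simp: fr_simps)
   also have "... = (\<Oplus>\<^bsub>Y\<^esub>b\<in>?S. ract Y (y b) (c b) +[Y] ract Y (y b) (d b))"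
   proof (intro sum_cong)
    fix b assume b: "b : ?S"
    then have "b : B" using S by blast
    then show "ract Y (y b) ((c +[?F] d) b) = ract Y (y b) (c b) +[Y] ract Y (y b) (d b)"
     using lin_add[OF bil_right[OF ract_bilin[OF Y] y]] cS[OF b]
     by (simp add: fr_simps)
   qed
   also have "... = (\<Oplus>\<^bsub>Y\<^esub>b\<in>?S. ract Y (y b) (c b)) +[Y] (\<Oplus>\<^bsub>Y\<^esub>b\<in>?S. ract Y (y b) (d b))"
    using tS by (intro Y.finsum_addf) blast+
   also have "... = f c +[Y] f d" using on[OF c _ S] on[OF d _ S] by simp
   finally show ?thesis .
  qed
  show "f (a .[?F] c) = a .[Y] f c" if a: "a <: k" for a
  proof -
   let ?S = "{b\<in>B. c b ~= 0[A]}"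
   have sub: "{b\<in>B. (a .[?F] c) b ~= 0[A]} <= ?S" using a by (auto simp: fr_simps)
   then have "finite {b\<in>B. (a .[?F] c) b ~= 0[A]}" using fc by (rule finite_subset)
   moreover have "a .[?F] c : (\<Pi>\<^sub>E i\<in>B. carrier A)"
    using cA[OF c] a by (auto simp: fr_simps)
   ultimately have "a .[?F] c <: ?F" unfolding fr_simps(1) by blast
   then have "f (a .[?F] c) = (\<Oplus>\<^bsub>Y\<^esub>b\<in>?S. ract Y (y b) ((a .[?F] c) b))"
    by (rule on[OF _ sub Sc fc])
   also have "... = (\<Oplus>\<^bsub>Y\<^esub>b\<in>?S. a .[Y] ract Y (y b) (c b))"
    using lin_smult[OF bil_right[OF ract_bilin[OF Y] y]] cA[OF c] a
    by (intro sum_cong) (simp add: fr_simps)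
   also have "... = a .[Y] f c"
    unfolding f_def using fc a t cA[OF c] by (intro Y.finsum_smult_ldistr[symmetric]) auto
   finally show ?thesis .
  qed
  show "f (ract ?F c a) = ract Y (f c) a" if a: "a <: A" for a
  proof -
   let ?S = "{b\<in>B. c b ~= 0[A]}"
   have sub: "{b\<in>B. (ract ?F c a) b ~= 0[A]} <= ?S" using a by (auto simp: fr_simps)
   have "f (ract ?F c a) = (\<Oplus>\<^bsub>Y\<^esub>b\<in>?S. ract Y (y b) ((ract ?F c a) b))"
    by (rule on[OF free_rmodule_ract_closed[OF c a] sub Sc fc])
   also have "... = (\<Oplus>\<^bsub>Y\<^esub>b\<in>?S. ract Y (ract Y (y b) (c b)) a)"
    using right_module.ract_mult[OF Y y] cA[OF c] a
    by (intro sum_cong) (simp add: fr_simps)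
   also have "... = ract Y (f c) a"
    unfolding f_def using fc a t cA[OF c]
    by (intro lin_finsum[OF Y.module_axioms Y.module_axioms
       bil_left[OF ract_bilin[OF Y] a], symmetric]) auto
   finally show ?thesis .
  qed
 qed
 moreover have "f (unit_vec B b) = y b" if b: "b : B" for b
 proof -
  have "f (unit_vec B b) = (\<Oplus>\<^bsub>Y\<^esub>i\<in>{b}. ract Y (y i) (unit_vec B b i))"
   using b by (intro on unit_vec_closed) (auto simp: unit_vec_def)
  also have "... = ract Y (y b) 1[A]"
   using b t by (subst Y.finsum_insert) (auto simp: unit_vec_def)
  finally show ?thesis using right_module.ract_one[OF Y y[OF b]] by simp
 qed
 ultimately show ?thesis by blast
qed

lemma projective_lifts:
 fixes X :: "('k, 'a, 'x, 'u) rmodule_scheme"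
 assumes P: "projective_rmodule k A X" and Y': "rmod k A Y'" and Y: "rmod k A Y"
  and d: "rmap k A Y' Y d"
 shows "lifts k A X Y' Y d"
 unfolding lifts_def
proof (intro allI impI, elim conjE)
 fix \<psi> assume \<psi>: "rmap k A X Y \<psi>" "\<psi> ` carrier X <= d ` carrier Y'"
 obtain B :: "'x set" and i p where ip: "rmap k A X (free_rmodule A B) i"
  "rmap k A (free_rmodule A B) X p" "ALL x:carrier X. p (i x) = x"
  using P unfolding projective_rmodule_def by blast
 have "EX y:carrier Y'. d y = \<psi> (p (unit_vec B b))" if "b : B" for b
 proof -
  have "\<psi> (p (unit_vec B b)) : d ` carrier Y'"
   by (rule subsetD[OF \<psi>(2) imageI[OF rmap_closed[OF ip(2) unit_vec_closed[OF that]]]])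
  then show ?thesis by auto
 qed
 then obtain y where y: "!!b. b : B ==> y b <: Y' & d (y b) = \<psi> (p (unit_vec B b))"
  by metis
 obtain f where f: "rmap k A (free_rmodule A B) Y' f" "ALL b:B. f (unit_vec B b) = y b"
  using free_rmodule_map[OF Y', of B y] y by blast
 have "d (f c) = \<psi> (p c)" if "c <: free_rmodule A B" for c
  by (rule free_rmodule_ext[OF Y rmap_comp[OF d f(1)] rmap_comp[OF \<psi>(1) ip(2)] _ that])
   (use f(2) y in simp)
 then show "EX \<phi>. rmap k A X Y' \<phi> & (ALL x:carrier X. d (\<phi> x) = \<psi> x)"
  using ip rmap_closed[OF ip(1)]
  by (intro exI[of _ "%x. f (i x)"] conjI rmap_comp[OF f(1) ip(1)]) auto
qed

end

section \<open>Cyclic modules without degeneracies\<close>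

lemma signed_closed: "module k V ==> x <: V ==> signed V j x <: V"
 using abelian_group.a_inv_closed[OF module_ab] by (auto simp: signed_def)

lemma signed_linear: "module k W ==> lmap k V W f ==> lmap k V W (%x. signed W j (f x))"
 using lin_uminus by (cases "even j") (auto simp: signed_def)

lemma linear_signed:
 assumes "module k V" "module k W" "lmap k V W f" "x <: V"
 shows "f (signed V j x) = signed W j (f x)"
 using lin_neg[OF assms] by (simp add: signed_def)

lemma signed_Suc:
 assumes "module k V" "x <: V"
 shows "signed V (Suc j) x = -[V] signed V j x"
proof -
 interpret V: module k V by fact
 show ?thesis using assms by (simp add: signed_def)
qed

lemma signed_signed:
 assumes "module k V" "x <: V"
 shows "signed V i (signed V j x) = signed V (i + j) x"
proof -
 interpret V: module k V by fact
 show ?thesis using assms by (simp add: signed_def)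
qed

lemma signed_even: "even j ==> signed V j x = x"
 by (simp add: signed_def)

locale precyclic =
 fixes k :: "'k ring" and Z :: "('k, 'c) cyclic_object"
 assumes obj_mod: "module k (obj Z n)"
  and face_linear: "i <= Suc n ==> lmap k (obj Z (Suc n)) (obj Z n) (face Z (Suc n) i)"
  and cyc_linear: "lmap k (obj Z n) (obj Z n) (cyc Z n)"
  and face_face: "i <= j ==> j <= Suc n ==> x <: obj Z (Suc (Suc n)) ==>
    face Z (Suc n) i (face Z (Suc (Suc n)) (Suc j) x) = face Z (Suc n) j (face Z (Suc (Suc n)) i x)"
  and face_cyc_0: "x <: obj Z (Suc n) ==>
    face Z (Suc n) 0 (cyc Z (Suc n) x) = face Z (Suc n) (Suc n) x"
  and face_cyc: "i <= n ==> x <: obj Z (Suc n) ==>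
    face Z (Suc n) (Suc i) (cyc Z (Suc n) x) = cyc Z n (face Z (Suc n) i x)"
  and cyc_order: "x <: obj Z n ==> (cyc Z n ^^ Suc n) x = x"
begin

interpretation O: module k "obj Z n" for n by (rule obj_mod)

lemma face_closed: "i <= Suc n ==> x <: obj Z (Suc n) ==> face Z (Suc n) i x <: obj Z n"
 by (rule lin_closed[OF face_linear])

text \<open>Partial alternating sums of the faces, so that one induction serves both \<open>b\<close> and \<open>b'\<close>.\<close>

primrec bs where
 "bs n 0 x = 0[obj Z n]"
| "bs n (Suc j) x = bs n j x +[obj Z n] signed (obj Z n) j (face Z (Suc n) j x)"

lemma bs_linear: "j <= Suc (Suc n) ==> lmap k (obj Z (Suc n)) (obj Z n) (bs n j)"
proof (induction j)
 case 0
 show ?case using lin_const_zero[OF obj_mod] by (simp add: bs.simps[abs_def])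
next
 case (Suc j)
 then show ?case
  using lin_plus[OF obj_mod Suc.IH signed_linear[OF obj_mod face_linear]] by simp
qed

lemma bs_closed: "j <= Suc (Suc n) ==> x <: obj Z (Suc n) ==> bs n j x <: obj Z n"
 by (rule lin_closed[OF bs_linear])

lemma bs_finsum:
 assumes "j <= Suc (Suc n)" "x <: obj Z (Suc n)"
 shows "(\<Oplus>\<^bsub>obj Z n\<^esub>i\<in>{..<j}. signed (obj Z n) i (face Z (Suc n) i x)) = bs n j x"
 using assms
proof (induction j)
 case (Suc j)
 have "(%i. signed (obj Z n) i (face Z (Suc n) i x)) : {..<j} \<rightarrow> carrier (obj Z n)"
  using Suc.prems by (auto intro!: signed_closed[OF obj_mod] face_closed)
 moreover have "signed (obj Z n) j (face Z (Suc n) j x) <: obj Z n"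
  using Suc.prems by (intro signed_closed[OF obj_mod] face_closed) auto
 ultimately show ?case
  using Suc by (simp add: lessThan_Suc O.a_comm bs_closed)
qed simp

lemma b_eq: "x <: obj Z (Suc n) ==> hb Z (Suc n) x = bs n (Suc (Suc n)) x"
 using bs_finsum[of "Suc (Suc n)" n x] by (simp add: hochschild_b_def lessThan_Suc_atMost del: bs.simps)

lemma b'_eq: "x <: obj Z (Suc n) ==> hb' Z (Suc n) x = bs n (Suc n) x"
 using bs_finsum[of "Suc n" n x] by (simp add: hochschild_b'_def del: bs.simps)

lemma b_linear: "lmap k (obj Z (Suc n)) (obj Z n) (hb Z (Suc n))"
 using bs_linear[of "Suc (Suc n)" n] by (simp add: lin_cong[OF obj_mod b_eq] del: bs.simps)

lemma b'_linear: "lmap k (obj Z (Suc n)) (obj Z n) (hb' Z (Suc n))"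
 using bs_linear[of "Suc n" n] by (simp add: lin_cong[OF obj_mod b'_eq] del: bs.simps)

lemma bs_face:
 assumes "j <= Suc m" "m <= Suc n" "x <: obj Z (Suc (Suc n))"
 shows "bs n j (face Z (Suc (Suc n)) (Suc m) x) = face Z (Suc n) m (bs (Suc n) j x)"
 using assms
proof (induction j)
 case 0
 show ?case using lin_zero[OF obj_mod obj_mod face_linear[OF 0(2)]] by simp
next
 case (Suc j)
 have f: "face Z (Suc (Suc n)) j x <: obj Z (Suc n)" using Suc.prems by (intro face_closed) auto
 have "face Z (Suc n) m (bs (Suc n) (Suc j) x) =
   face Z (Suc n) m (bs (Suc n) j x) +[obj Z n]
    signed (obj Z n) j (face Z (Suc n) m (face Z (Suc (Suc n)) j x))"
  using Suc.prems f
  by (simp add: lin_add[OF face_linear] bs_closed signed_closed[OF obj_mod]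
    linear_signed[OF obj_mod obj_mod face_linear])
 then show ?case using Suc face_face[of j m n x] by simp
qed

lemma bs_bs:
 assumes "j <= Suc (Suc n)" "x <: obj Z (Suc (Suc n))"
 shows "bs n j (bs (Suc n) (Suc j) x) = 0[obj Z n]"
 using assms
proof (induction j)
 case (Suc j)
 define u where "u = bs (Suc n) (Suc j) x"
 define v where "v = face Z (Suc (Suc n)) (Suc j) x"
 define P where "P = face Z (Suc n) j (bs (Suc n) j x)"
 define Q where "Q = face Z (Suc n) j (face Z (Suc (Suc n)) j x)"
 have j: "j <= Suc n" using Suc.prems by simp
 have c: "u <: obj Z (Suc n)" "v <: obj Z (Suc n)" "P <: obj Z n" "Q <: obj Z n"
  "bs (Suc n) j x <: obj Z (Suc n)" "face Z (Suc (Suc n)) j x <: obj Z (Suc n)"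
  using Suc.prems j unfolding u_def v_def P_def Q_def by (auto intro!: bs_closed face_closed simp del: bs.simps)
 have sc: "signed (obj Z (Suc n)) i v <: obj Z (Suc n)" "signed (obj Z n) i P <: obj Z n" for i
  using c by (auto intro!: signed_closed[OF obj_mod])
 have 1: "bs (Suc n) (Suc (Suc j)) x = u +[obj Z (Suc n)] signed (obj Z (Suc n)) (Suc j) v"
  by (simp add: u_def v_def)
 have 2: "bs n j (bs (Suc n) (Suc (Suc j)) x) = -[obj Z n] signed (obj Z n) j P"
 proof -
  have "bs n j (bs (Suc n) (Suc (Suc j)) x) = bs n j u +[obj Z n] signed (obj Z n) (Suc j) (bs n j v)"
   unfolding 1 using c sc j
   by (simp add: lin_add[OF bs_linear] linear_signed[OF obj_mod obj_mod bs_linear])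
  also have "bs n j u = 0[obj Z n]" unfolding u_def using Suc by simp
  also have "bs n j v = P" unfolding v_def P_def using Suc.prems j by (intro bs_face) auto
  finally show ?thesis using c sc by (simp add: signed_Suc[OF obj_mod])
 qed
 have 3: "signed (obj Z n) j (face Z (Suc n) j (bs (Suc n) (Suc (Suc j)) x)) = signed (obj Z n) j P"
 proof -
  have "face Z (Suc n) j u = P +[obj Z n] signed (obj Z n) j Q"
   unfolding u_def P_def Q_def using c j
   by (simp add: lin_add[OF face_linear] linear_signed[OF obj_mod obj_mod face_linear]
     signed_closed[OF obj_mod])
  moreover have "face Z (Suc n) j (signed (obj Z (Suc n)) (Suc j) v) = -[obj Z n] signed (obj Z n) j Q"
   using c j face_face[OF order_refl j Suc.prems(2)]
   by (simp add: linear_signed[OF obj_mod obj_mod face_linear] v_def Q_def)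
    (simp add: signed_Suc[OF obj_mod])
  ultimately have "face Z (Suc n) j (bs (Suc n) (Suc (Suc j)) x) = P"
   unfolding 1 using c sc j signed_closed[OF obj_mod c(4), of j]
   by (simp add: lin_add[OF face_linear] O.a_assoc O.r_neg)
  then show ?thesis by simp
 qed
 have "bs n (Suc j) (bs (Suc n) (Suc (Suc j)) x) =
   bs n j (bs (Suc n) (Suc (Suc j)) x) +[obj Z n]
    signed (obj Z n) j (face Z (Suc n) j (bs (Suc n) (Suc (Suc j)) x))" by simp
 then show ?case unfolding 2 3 using sc by (simp add: O.l_neg)
qed simp

lemma b_b: "x <: obj Z (Suc (Suc n)) ==>
  hb Z (Suc n) (hb Z (Suc (Suc n)) x) = 0[obj Z n]"
 using lin_closed[OF b_linear, of x "Suc n"] bs_bs[of "Suc (Suc n)" n x]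
 by (simp add: b_eq del: bs.simps)

lemma b'_b': "x <: obj Z (Suc (Suc n)) ==>
  hb' Z (Suc n) (hb' Z (Suc (Suc n)) x) = 0[obj Z n]"
 using lin_closed[OF b'_linear, of x "Suc n"] bs_bs[of "Suc n" n x]
 by (simp add: b'_eq del: bs.simps)

abbreviation t where "t == signed_cyc Z"

lemma t_linear: "lmap k (obj Z n) (obj Z n) (t n)"
 using signed_linear[OF obj_mod cyc_linear] by (simp add: signed_cyc_def[abs_def])

lemma t_closed: "x <: obj Z n ==> t n x <: obj Z n"
 by (rule lin_closed[OF t_linear])

lemma cyc_closed: "x <: obj Z n ==> cyc Z n x <: obj Z n"
 by (rule lin_closed[OF cyc_linear])

text \<open>The signed faces \<open>d\<^sub>i = (-1)\<^sup>i \<delta>\<^sub>i\<close> satisfy \<open>d\<^sub>i t = t d\<^sub>i\<^sub>-\<^sub>1\<close> without any further sign.\<close>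

definition dd where "dd n i x = signed (obj Z n) i (face Z (Suc n) i x)"

lemma dd_linear: "i <= Suc n ==> lmap k (obj Z (Suc n)) (obj Z n) (dd n i)"
 unfolding dd_def[abs_def] by (intro signed_linear obj_mod face_linear)

lemma dd_closed: "i <= Suc n ==> x <: obj Z (Suc n) ==> dd n i x <: obj Z n"
 by (rule lin_closed[OF dd_linear])

lemma dd_t_0: "x <: obj Z (Suc n) ==> dd n 0 (t (Suc n) x) = dd n (Suc n) x"
 by (simp add: dd_def signed_cyc_def linear_signed[OF obj_mod obj_mod face_linear] cyc_closed face_cyc_0
   signed_even)

lemma dd_t: "i <= n ==> x <: obj Z (Suc n) ==> dd n (Suc i) (t (Suc n) x) = t n (dd n i x)"
 by (simp add: dd_def signed_cyc_def linear_signed[OF obj_mod obj_mod face_linear] cyc_closed face_cyc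
   linear_signed[OF obj_mod obj_mod cyc_linear] face_closed signed_signed[OF obj_mod])
  (simp add: signed_def add.commute)

lemma bs_Suc_dd: "bs n (Suc j) x = bs n j x +[obj Z n] dd n j x"
 by (simp add: dd_def)

lemma bs_t: "j <= Suc n ==> x <: obj Z (Suc n) ==>
  bs n (Suc j) (t (Suc n) x) = dd n (Suc n) x +[obj Z n] t n (bs n j x)"
proof (induction j)
 case 0
 then show ?case
  using dd_closed[of "Suc n" n x] lin_zero[OF obj_mod obj_mod t_linear]
  by (simp add: bs_Suc_dd dd_t_0 del: bs.simps(2))
next
 case (Suc j)
 have "bs n (Suc (Suc j)) (t (Suc n) x) = bs n (Suc j) (t (Suc n) x) +[obj Z n] dd n (Suc j) (t (Suc n) x)"
  by (rule bs_Suc_dd)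
 also have "... = dd n (Suc n) x +[obj Z n] t n (bs n j x) +[obj Z n] t n (dd n j x)"
  using Suc by (simp add: dd_t del: bs.simps)
 also have "... = dd n (Suc n) x +[obj Z n] t n (bs n j x +[obj Z n] dd n j x)"
  using Suc.prems dd_closed[of j n x] dd_closed[of "Suc n" n x] bs_closed[of j n x]
  by (simp add: lin_add[OF t_linear] O.a_assoc t_closed)
 finally show ?case by (simp add: bs_Suc_dd del: bs.simps)
qed

text \<open>The identities \<open>b (1 - t) = (1 - t) b'\<close> and \<open>b' N = N b\<close> follow by moving \<open>t\<close> past each signed
  face.\<close>

lemma b_one_minus_t:
 assumes "x <: obj Z (Suc n)"
 shows "hb Z (Suc n) (x -[obj Z (Suc n)] t (Suc n) x) =
  hb' Z (Suc n) x -[obj Z n] t n (hb' Z (Suc n) x)"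
proof -
 have c: "bs n (Suc n) x <: obj Z n" "dd n (Suc n) x <: obj Z n"
  "t n (bs n (Suc n) x) <: obj Z n"
  using assms by (auto intro!: bs_closed dd_closed t_closed simp del: bs.simps)
 have "hb Z (Suc n) (x -[obj Z (Suc n)] t (Suc n) x) =
   bs n (Suc (Suc n)) x -[obj Z n] bs n (Suc (Suc n)) (t (Suc n) x)"
  unfolding lin_minus[OF obj_mod obj_mod b_linear assms t_closed[OF assms]]
  using assms t_closed[OF assms] by (simp add: b_eq del: bs.simps)
 also have "... = (bs n (Suc n) x +[obj Z n] dd n (Suc n) x) -[obj Z n]
   (dd n (Suc n) x +[obj Z n] t n (bs n (Suc n) x))"
  unfolding bs_t[OF order_refl assms] bs_Suc_dd[of n "Suc n" x] ..
 also have "... = bs n (Suc n) x -[obj Z n] t n (bs n (Suc n) x)"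
  using c by (simp add: a_minus_def O.minus_add O.a_ac O.r_neg2 del: bs.simps)
 finally show ?thesis using assms by (simp add: b'_eq del: bs.simps)
qed

lemma t_power_linear: "lmap k (obj Z n) (obj Z n) (t n ^^ j)"
proof (induction j)
 case 0
 show ?case using lin_id by (simp add: id_def)
next
 case (Suc j)
 show ?case using lin_comp[OF t_linear Suc] by (simp add: comp_def)
qed

lemma t_power_closed: "x <: obj Z n ==> (t n ^^ j) x <: obj Z n"
 by (rule lin_closed[OF t_power_linear])

lemma t_power_cyc: "x <: obj Z n ==> (t n ^^ j) x = signed (obj Z n) (n * j) ((cyc Z n ^^ j) x) &
  (cyc Z n ^^ j) x <: obj Z n"
 by (induction j)
  (simp_all add: signed_even signed_cyc_def cyc_closed linear_signed[OF obj_mod obj_mod cyc_linear]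
   signed_signed[OF obj_mod])

lemma t_order: "x <: obj Z n ==> (t n ^^ Suc n) x = x"
 using t_power_cyc[of x n "Suc n"] cyc_order[of x n] by (simp add: signed_even del: funpow.simps)

abbreviation N where "N == cyclic_norm Z"

lemma N_linear: "lmap k (obj Z n) (obj Z n) (N n)"
 unfolding cyclic_norm_def[abs_def]
 by (rule lin_finsum_fun[OF obj_mod obj_mod _ t_power_linear]) simp

lemma N_closed: "x <: obj Z n ==> N n x <: obj Z n"
 by (rule lin_closed[OF N_linear])

lemma t_N: assumes x: "x <: obj Z n" shows "t n (N n x) = N n x" and "N n (t n x) = N n x"
proof -
 have f: "(%j. (t n ^^ j) x) : A \<rightarrow> carrier (obj Z n)" for A using t_power_closed[OF x] by auto
 have "t n (N n x) = (\<Oplus>\<^bsub>obj Z n\<^esub>j\<in>{..n}. (t n ^^ Suc j) x)"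
  unfolding cyclic_norm_def using f by (subst lin_finsum[OF obj_mod obj_mod t_linear]) auto
 also have "... +[obj Z n] (t n ^^ 0) x = (\<Oplus>\<^bsub>obj Z n\<^esub>j\<in>{..Suc n}. (t n ^^ j) x)"
  using f by (subst O.finsum_Suc2) auto
 also have "... = (t n ^^ Suc n) x +[obj Z n] N n x"
  unfolding cyclic_norm_def using f by (subst O.finsum_Suc) auto
 finally have e: "t n (N n x) +[obj Z n] x = x +[obj Z n] N n x"
  using t_order[OF x] by (simp del: funpow.simps(2))
 have "t n (N n x) +[obj Z n] x = N n x +[obj Z n] x"
  unfolding e using x N_closed[OF x] by (rule O.a_comm)
 then show e2: "t n (N n x) = N n x"
  using x N_closed[OF x] t_closed[OF N_closed[OF x]] O.add.right_cancel by blast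
 have "N n (t n x) = (\<Oplus>\<^bsub>obj Z n\<^esub>j\<in>{..n}. t n ((t n ^^ j) x))"
  unfolding cyclic_norm_def by (intro sum_cong) (simp add: funpow_swap1)
 also have "... = t n (N n x)"
  unfolding cyclic_norm_def using f
  by (intro lin_finsum[OF obj_mod obj_mod t_linear, symmetric]) auto
 finally show "N n (t n x) = N n x" using e2 by simp
qed

lemma t_power_N: "x <: obj Z n ==> (t n ^^ j) (N n x) = N n x"
 by (induction j) (simp_all add: t_N(1))

lemma N_t_power: "x <: obj Z n ==> N n ((t n ^^ j) x) = N n x"
 by (induction j) (simp_all add: t_N(2) t_power_closed)

lemma dd_t_power: "i <= Suc n ==> x <: obj Z (Suc n) ==>
  dd n i ((t (Suc n) ^^ i) x) = (t n ^^ i) (dd n 0 x)"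
 by (induction i) (simp_all add: dd_t t_power_closed)

lemma b'_N:
 assumes x: "x <: obj Z (Suc n)"
 shows "hb' Z (Suc n) (N (Suc n) x) = N n (hb Z (Suc n) x)"
proof -
 let ?d = "%y. dd n 0 y"
 have d0: "lmap k (obj Z (Suc n)) (obj Z n) ?d" by (rule dd_linear) simp
 have Nx: "N (Suc n) x <: obj Z (Suc n)" by (rule N_closed[OF x])
 have "hb' Z (Suc n) (N (Suc n) x) = (\<Oplus>\<^bsub>obj Z n\<^esub>i\<in>{..n}. dd n i (N (Suc n) x))"
  by (simp add: hochschild_b'_def dd_def lessThan_Suc_atMost)
 also have "... = (\<Oplus>\<^bsub>obj Z n\<^esub>i\<in>{..n}. (t n ^^ i) (?d (N (Suc n) x)))"
 proof (rule sum_cong)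
  fix i assume "i : {..n}"
  then have "dd n i ((t (Suc n) ^^ i) (N (Suc n) x)) = (t n ^^ i) (?d (N (Suc n) x))"
   by (intro dd_t_power[OF _ Nx]) simp
  then show "dd n i (N (Suc n) x) = (t n ^^ i) (?d (N (Suc n) x))" unfolding t_power_N[OF x] .
 qed
 also have "... = N n (?d (N (Suc n) x))" by (simp add: cyclic_norm_def)
 finally have L: "hb' Z (Suc n) (N (Suc n) x) = N n (?d (N (Suc n) x))" .
 let ?m = "Suc n"
 have dx: "N n (dd n i x) = N n (?d (t ?m ((t ?m ^^ (?m - i)) x)))" if i: "i <= ?m" for i
 proof -
  have "x = (t ?m ^^ (i + Suc (?m - i))) x" using t_order[OF x] i by (simp del: funpow.simps)
  then have "dd n i x = dd n i ((t ?m ^^ i) ((t ?m ^^ Suc (?m - i)) x))"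
   by (metis funpow_add o_apply)
  also have "... = (t n ^^ i) (?d ((t ?m ^^ Suc (?m - i)) x))"
   by (rule dd_t_power[OF i t_power_closed[OF x]])
  finally show ?thesis
   using N_t_power[OF lin_closed[OF d0 t_power_closed[OF x, of "Suc (?m - i)"]], of i] by simp
 qed
 have ddc: "(%i. dd n i x) : {..?m} \<rightarrow> carrier (obj Z n)" using x dd_closed by auto
 have tc: "(%i. (t ?m ^^ i) x) : A \<rightarrow> carrier (obj Z ?m)" for A using t_power_closed[OF x] by auto
 have bsx: "hb Z (Suc n) x = (\<Oplus>\<^bsub>obj Z n\<^esub>i\<in>{..?m}. dd n i x)"
  by (simp add: hochschild_b_def dd_def)
 have "N n (hb Z (Suc n) x) = (\<Oplus>\<^bsub>obj Z n\<^esub>i\<in>{..?m}. N n (dd n i x))"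
  unfolding bsx using ddc by (intro lin_finsum[OF obj_mod obj_mod N_linear]) auto
 also have "... = (\<Oplus>\<^bsub>obj Z n\<^esub>i\<in>{..?m}. N n (?d (t ?m ((t ?m ^^ (?m - i)) x))))"
  using dx by (intro sum_cong) simp
 also have "... = N n (?d (t ?m (\<Oplus>\<^bsub>obj Z ?m\<^esub>i\<in>{..?m}. (t ?m ^^ (?m - i)) x)))"
  using t_power_closed[OF x]
  by (intro lin_finsum[OF obj_mod obj_mod
     lin_comp[OF N_linear lin_comp[OF d0 t_linear]], symmetric]) auto
 also have "(\<Oplus>\<^bsub>obj Z ?m\<^esub>i\<in>{..?m}. (t ?m ^^ (?m - i)) x) = N ?m x"
 proof -
  have inj: "inj_on (%i. ?m - i) {..?m}" by (auto intro!: inj_onI)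
  have im: "(%i. ?m - i) ` {..?m} = {..?m}"
  proof (intro equalityI subsetI)
   show "x : (%i. ?m - i) ` {..?m}" if "x : {..?m}" for x
    using that by (intro image_eqI[of _ _ "?m - x"]) auto
  qed auto
  show ?thesis
   unfolding cyclic_norm_def using O.finsum_reindex[OF tc inj] im by simp
 qed
 finally show ?thesis using L t_N(1)[OF x] by simp
qed

lemma N_one_minus_t: assumes "x <: obj Z n"
 shows "N n (x -[obj Z n] t n x) = 0[obj Z n]"
  and "N n x -[obj Z n] t n (N n x) = 0[obj Z n]"
 using assms
 by (simp_all add: lin_minus[OF obj_mod obj_mod N_linear] t_closed t_N O.minus_eq_zero_iff N_closed)

subsection \<open>The relations of the Tsygan double complex\<close>

abbreviation vert where "vert == tsygan_vert Z"
abbreviation hor where "hor == tsygan_hor Z"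

lemma vert_linear: "lmap k (obj Z (Suc q)) (obj Z q) (vert p (Suc q))"
 unfolding tsygan_vert_def[abs_def]
 using b_linear lin_uminus[OF obj_mod b'_linear] by (cases "even p") auto

lemma hor_linear: "lmap k (obj Z q) (obj Z q) (hor p q)"
 unfolding tsygan_hor_def[abs_def]
 using N_linear lin_diff[OF obj_mod lin_id t_linear] by (cases "odd p") auto

lemma vert_closed: "x <: obj Z (Suc q) ==> vert p (Suc q) x <: obj Z q"
 by (rule lin_closed[OF vert_linear])

lemma hor_closed: "x <: obj Z q ==> hor p q x <: obj Z q"
 by (rule lin_closed[OF hor_linear])

lemma vert_vert:
 assumes "x <: obj Z (Suc (Suc q))"
 shows "vert p (Suc q) (vert p (Suc (Suc q)) x) = 0[obj Z q]"
 using assms b_b[OF assms] b'_b'[OF assms] lin_closed[OF b'_linear]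
 by (simp add: tsygan_vert_def lin_neg[OF obj_mod obj_mod b'_linear])

lemma hor_hor:
 assumes "x <: obj Z q"
 shows "hor p q (hor (Suc p) q x) = 0[obj Z q]"
 using N_one_minus_t[OF assms] by (simp add: tsygan_hor_def)

lemma hor_vert:
 assumes "x <: obj Z (Suc q)"
 shows "hor (Suc p) q (vert (Suc p) (Suc q) x) +[obj Z q] vert p (Suc q) (hor (Suc p) (Suc q) x) = 0[obj Z q]"
proof -
 have c: "hb' Z (Suc q) x <: obj Z q" "hb Z (Suc q) x <: obj Z q"
  using assms lin_closed[OF b'_linear] lin_closed[OF b_linear] by auto
 show ?thesis
  using assms c t_closed[OF c(1)] N_closed[OF c(2)] t_closed[OF assms]
  by (simp add: tsygan_vert_def tsygan_hor_def b_one_minus_t b'_N lin_neg[OF obj_mod obj_mod t_linear]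
   O.r_neg)
   (simp add: a_minus_def O.minus_add O.a_ac O.r_neg O.r_neg1 O.r_neg2)
qed

end

section \<open>Direct sums and homology\<close>

lemma direct_sum_simps:
 "carrier (direct_sum I F) = {f : (\<Pi>\<^sub>E i\<in>I. carrier (F i)). finite {i\<in>I. f i ~= 0[F i]}}"
 "zero (direct_sum I F) = (\<lambda>i\<in>I. 0[F i])"
 "add (direct_sum I F) = (%f g. \<lambda>i\<in>I. f i +[F i] g i)"
 "smult (direct_sum I F) = (%a f. \<lambda>i\<in>I. a .[F i] f i)"
 by (simp_all add: direct_sum_def)

lemma direct_sum_closedI:
 assumes "!!i. i : I ==> f i <: F i" "!!i. i \<notin> I ==> f i = undefined"
  "{i\<in>I. f i ~= 0[F i]} <= S" "finite S"
 shows "f <: direct_sum I F"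
 using assms finite_subset[OF assms(3,4)] by (auto simp: direct_sum_simps PiE_def extensional_def)

lemma direct_sum_closedD: "f <: direct_sum I F ==> i : I ==> f i <: F i"
 by (auto simp: direct_sum_simps)

lemma direct_sum_ext:
 "f <: direct_sum I F ==> g <: direct_sum I F ==> (!!i. i : I ==> f i = g i) ==> f = g"
 by (auto simp: direct_sum_simps intro: PiE_ext)

lemma module_direct_sum:
 assumes k: "cring k" and F: "!!i. i : I ==> module k (F i)"
 shows "module k (direct_sum I F)"
proof -
 let ?D = "direct_sum I F"
 have ag: "abelian_group (F i)" if "i : I" for i using F[OF that] by (rule module_ab)
 note am = abelian_group.axioms(1)[OF ag]
 have ca: "f i <: F i" if "f <: ?D" "i : I" for f i by (rule direct_sum_closedD[OF that])
 have ad: "f +[?D] g <: ?D" if f: "f <: ?D" and g: "g <: ?D" for f g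
 proof (rule direct_sum_closedI)
  show "{i\<in>I. (f +[?D] g) i ~= 0[F i]} <= {i\<in>I. f i ~= 0[F i]} \<union> {i\<in>I. g i ~= 0[F i]}"
   using abelian_monoid.l_zero[OF am] abelian_monoid.zero_closed[OF am] by (auto simp: direct_sum_simps)
 qed (use f g abelian_monoid.a_closed[OF am] ca[OF f] ca[OF g] in \<open>auto simp: direct_sum_simps(3)\<close>,
    use f g in \<open>auto simp: direct_sum_simps\<close>)
 have sm: "a .[?D] f <: ?D" if a: "a <: k" and f: "f <: ?D" for a f
 proof (rule direct_sum_closedI)
  show "{i\<in>I. (a .[?D] f) i ~= 0[F i]} <= {i\<in>I. f i ~= 0[F i]}"
   using module.smult_r_null[OF F] a by (auto simp: direct_sum_simps)
 qed (use a f module.smult_closed[OF F] ca[OF f] in \<open>auto simp: direct_sum_simps(4)\<close>,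
    use f in \<open>auto simp: direct_sum_simps\<close>)
 have z: "0[?D] <: ?D"
  by (rule direct_sum_closedI[where S = "{}"])
   (auto simp: direct_sum_simps(2) abelian_monoid.zero_closed[OF am])
 have ng: "(\<lambda>i\<in>I. -[F i] f i) <: ?D" if f: "f <: ?D" for f
 proof (rule direct_sum_closedI)
  show "{i\<in>I. (\<lambda>i\<in>I. -[F i] f i) i ~= 0[F i]} <= {i\<in>I. f i ~= 0[F i]}"
   using abelian_group.neg_zero[OF ag] by auto
 qed (use f abelian_group.a_inv_closed[OF ag] ca[OF f] in auto, use f in \<open>auto simp: direct_sum_simps\<close>)
 have ab: "abelian_group ?D"
 proof (rule abelian_groupI)
  fix f g assume f: "f <: ?D" and g: "g <: ?D"
  show "f +[?D] g = g +[?D] f"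
   by (rule direct_sum_ext[OF ad[OF f g] ad[OF g f]])
    (simp add: direct_sum_simps(3) abelian_monoid.a_comm[OF am] ca f g)
  show "f +[?D] g +[?D] h = f +[?D] (g +[?D] h)" if h: "h <: ?D" for h
   by (rule direct_sum_ext[OF ad[OF ad[OF f g] h] ad[OF f ad[OF g h]]])
    (simp add: direct_sum_simps(3) abelian_monoid.a_assoc[OF am] ca f g h)
 next
  fix f assume f: "f <: ?D"
  show "0[?D] +[?D] f = f"
   by (rule direct_sum_ext[OF ad[OF z f] f])
    (simp add: direct_sum_simps(2,3) abelian_monoid.l_zero[OF am] ca f)
  have "(\<lambda>i\<in>I. -[F i] f i) +[?D] f = 0[?D]"
   by (rule direct_sum_ext[OF ad[OF ng[OF f] f] z])
    (simp add: direct_sum_simps(2,3) abelian_group.l_neg[OF ag] ca f)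
  then show "EX g:carrier ?D. g +[?D] f = 0[?D]" using ng[OF f] by blast
 qed (use ad z in auto)
 show ?thesis
 proof (rule moduleI[OF k ab])
  fix a b f assume a: "a <: k" and b: "b <: k" and f: "f <: ?D"
  have ab: "a +[k] b <: k" "a *[k] b <: k"
   using a b cring.cring_simprules[OF k] by auto
  show "(a +[k] b) .[?D] f = a .[?D] f +[?D] b .[?D] f"
   by (rule direct_sum_ext[OF sm[OF ab(1) f] ad[OF sm[OF a f] sm[OF b f]]])
    (simp add: direct_sum_simps(3,4) module.smult_l_distr[OF F] ca f a b)
  show "(a *[k] b) .[?D] f = a .[?D] (b .[?D] f)"
   by (rule direct_sum_ext[OF sm[OF ab(2) f] sm[OF a sm[OF b f]]])
    (simp add: direct_sum_simps(4) module.smult_assoc1[OF F] ca f a b)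
 next
  fix a f g assume a: "a <: k" and f: "f <: ?D" and g: "g <: ?D"
  show "a .[?D] (f +[?D] g) = a .[?D] f +[?D] a .[?D] g"
   by (rule direct_sum_ext[OF sm[OF a ad[OF f g]] ad[OF sm[OF a f] sm[OF a g]]])
    (simp add: direct_sum_simps(3,4) module.smult_r_distr[OF F] ca f g a)
 next
  fix f assume f: "f <: ?D"
  have o: "1[k] <: k" using cring.cring_simprules[OF k] by auto
  show "1[k] .[?D] f = f"
   by (rule direct_sum_ext[OF sm[OF o f] f]) (simp add: direct_sum_simps(4) module.smult_one[OF F] ca f)
 qed (rule sm)
qed

lemma module_zero_module: assumes "cring k" shows "module k (zero_module :: ('k, 'v) module)"
proof -
 have "abelian_group (zero_module :: ('k, 'v) module)"
  by (rule abelian_groupI) (auto simp: zero_module_def)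
 then show ?thesis by (intro moduleI assms) (auto simp: zero_module_def)
qed

locale chain_complex =
 fixes k :: "'k ring" and C :: "nat => ('k, 'y, 'z) module_scheme" and dC :: "nat => 'y => 'y"
 assumes C_module: "module k (C n)"
  and dC_linear: "lmap k (C (Suc n)) (C n) (dC (Suc n))"
  and dC_dC: "x <: C (Suc (Suc n)) ==> dC (Suc n) (dC (Suc (Suc n)) x) = 0[C n]"
begin

definition cycles where "cycles n = {x : carrier (C n). n = 0 \<or> dC n x = 0[C (n - 1)]}"
definition bounds where "bounds n = dC (Suc n) ` carrier (C (Suc n))"

lemma dC_closed: "x <: C (Suc n) ==> dC (Suc n) x <: C n"
 by (rule lin_closed[OF dC_linear])

lemma cycles_submodule: "submodule (cycles n) k (C n)"
proof (cases n)
 case 0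
 then show ?thesis using module.carrier_is_submodule[OF C_module] by (simp add: cycles_def)
next
 case (Suc m)
 then show ?thesis using submodule_kernel[OF C_module C_module dC_linear] by (simp add: cycles_def)
qed

lemma bounds_submodule: "submodule (bounds n) k (C n)"
 unfolding bounds_def by (rule submodule_image[OF C_module C_module dC_linear])

lemma bounds_cycles: "bounds n <= cycles n"
 by (cases n) (auto simp: bounds_def cycles_def dC_closed dC_dC)

lemma module_cycles: "module k (C n\<lparr>carrier := cycles n\<rparr>)"
 by (rule submodule_module[OF C_module cycles_submodule])

lemma bounds_submodule_cycles: "submodule (bounds n) k (C n\<lparr>carrier := cycles n\<rparr>)"
 by (rule submoduleI'[OF module_cycles])
  (use bounds_cycles submodule_zero[OF bounds_submodule] submodule_add[OF bounds_submodule]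
    submodule_smult[OF bounds_submodule] in auto)

lemma homology_eq: "homology C dC n = quot_module (C n\<lparr>carrier := cycles n\<rparr>) (bounds n)"
 by (simp add: homology_def cycles_def bounds_def)

lemma homology_quotient: "module_quotient k (C n\<lparr>carrier := cycles n\<rparr>) (bounds n)"
 using module_cycles bounds_submodule_cycles by (simp add: module_quotient_def module_quotient_axioms_def)

lemma module_homology: "module k (homology C dC n)"
 unfolding homology_eq by (rule module_quotient.module_quot[OF homology_quotient])

end

section \<open>Cyclic homology of an object with split cyclic homology\<close>

locale cyclic_comparison = precyclic k Z + chain_complex k C dC
 for k :: "'k ring" and Z :: "('k, 'c) cyclic_object"
  and C :: "nat => ('k, 'y, 'z) module_scheme" and dC :: "nat => 'y => 'y" +
 fixes \<Phi> :: "nat => nat => 'c => 'y"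
 assumes \<Phi>_linear: "lmap k (obj Z q) (C (p + q)) (\<Phi> p q)"
  and \<Phi>_chain: "p + q = Suc m ==> x <: obj Z q ==> dC (Suc m) (\<Phi> p q x) =
   (if q = 0 then 0[C m] else \<Phi> p (q - 1) (tsygan_vert Z p q x)) +[C m]
   (if p = 0 then 0[C m] else \<Phi> (p - 1) q (tsygan_hor Z p q x))"
  and b'_acyclic: "x <: obj Z n ==> n = 0 \<or> hb' Z n x = 0[obj Z (n - 1)] ==>
   EX y:carrier (obj Z (Suc n)). hb' Z (Suc n) y = x"
  and \<Phi>_inj: "z <: obj Z n ==> n = 0 \<or> hb Z n z = 0[obj Z (n - 1)] ==>
   \<Phi> 0 n z : dC (Suc n) ` carrier (C (Suc n)) ==> z : hb Z (Suc n) ` carrier (obj Z (Suc n))"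
  and \<Phi>_surj: "c <: C n ==> n = 0 \<or> dC n c = 0[C (n - 1)] ==>
   EX z:carrier (obj Z n). (n = 0 \<or> hb Z n z = 0[obj Z (n - 1)]) &
    \<Phi> 0 n z -[C n] c : dC (Suc n) ` carrier (C (Suc n))"
begin

interpretation O: module k "obj Z n" for n by (rule obj_mod)
interpretation C: module k "C n" for n by (rule C_module)

abbreviation Tot where "Tot == tsygan_tot Z"
abbreviation D where "D == tsygan_diff Z"

lemma tot_finite: "finite {(p, q). p + q = (n::nat)}"
 by (rule finite_subset[of _ "{..n} \<times> {..n}"]) auto

lemma totI: "(!!p q. p + q = n ==> f (p, q) <: obj Z q) ==>
  (!!p q. p + q ~= n ==> f (p, q) = undefined) ==> f <: Tot n"
 unfolding tsygan_tot_def
 by (rule direct_sum_closedI[OF _ _ _ tot_finite[of n]]) auto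

lemma totD: "f <: Tot n ==> p + q = n ==> f (p, q) <: obj Z q"
 unfolding tsygan_tot_def using direct_sum_closedD[of f "{(p, q). p + q = n}" "%(p, q). obj Z q" "(p, q)"] by simp

lemma tot_ext: "f <: Tot n ==> g <: Tot n ==>
  (!!p q. p + q = n ==> f (p, q) = g (p, q)) ==> f = g"
 unfolding tsygan_tot_def by (rule direct_sum_ext) auto

lemma tot_module: "module k (Tot n)"
 unfolding tsygan_tot_def by (rule module_direct_sum) (auto simp: obj_mod O.R.is_cring)

interpretation Tot: module k "Tot n" for n by (rule tot_module)

lemma eval_linear: "p + q = n ==> lmap k (Tot n) (obj Z q) (%f. f (p, q))"
 by (intro linI) (auto simp: totD, auto simp: tsygan_tot_def direct_sum_simps)

lemmas tot_add = lin_add[OF eval_linear]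
lemmas tot_zero = lin_zero[OF tot_module obj_mod eval_linear]
lemmas tot_minus = lin_minus[OF tot_module obj_mod eval_linear]
lemmas tot_smult = lin_smult[OF eval_linear]

text \<open>Linear maps into the total complex are given by their components.\<close>

lemma tot_linearI:
 assumes "module k V" "!!p q. p + q = n ==> lmap k V (obj Z q) (%x. F x p q)"
 shows "lmap k V (Tot n) (%x. restrict (%(p, q). F x p q) {(p, q). p + q = n})"
proof -
 interpret V: module k V by fact
 let ?r = "%x. restrict (%(p, q). F x p q) {(p, q). p + q = n}"
 have c: "?r x <: Tot n" if "x <: V" for x
  using that by (intro totI) (simp_all add: lin_closed[OF assms(2)])
 show ?thesis
 proof (rule linI)
  show "?r (x +[V] y) = ?r x +[Tot n] ?r y" if "x <: V" "y <: V" for x y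
   by (rule tot_ext[OF c Tot.a_closed[OF c c]])
    (use that in \<open>simp_all add: tot_add c lin_add[OF assms(2)]\<close>)
  show "?r (a .[V] x) = a .[Tot n] ?r x" if "a <: k" "x <: V" for a x
   by (rule tot_ext[OF c Tot.smult_closed[OF _ c]])
    (use that in \<open>simp_all add: tot_smult c lin_smult[OF assms(2)]\<close>)
 qed (rule c)
qed

lemma D_linear: "lmap k (Tot (Suc n)) (Tot n) (D (Suc n))"
 unfolding tsygan_diff_def[abs_def] diff_Suc_1
 by (intro tot_linearI tot_module lin_plus obj_mod lin_comp[OF vert_linear eval_linear]
   lin_comp[OF hor_linear eval_linear]) auto

lemma D_at: "p + q = n ==> D (Suc n) f (p, q) =
  vert p (Suc q) (f (p, Suc q)) +[obj Z q] hor (Suc p) q (f (Suc p, q))"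
 by (simp add: tsygan_diff_def)

lemma D_closed: "f <: Tot (Suc n) ==> D (Suc n) f <: Tot n"
 by (rule lin_closed[OF D_linear])

lemma D_D:
 assumes f: "f <: Tot (Suc (Suc n))"
 shows "D (Suc n) (D (Suc (Suc n)) f) = 0[Tot n]"
proof (rule tot_ext[OF D_closed[OF D_closed[OF f]] Tot.zero_closed])
 fix p q assume pq: "p + q = n"
 define x where "x = f (p, Suc (Suc q))"
 define y where "y = f (Suc p, Suc q)"
 define z where "z = f (Suc (Suc p), q)"
 have c: "x <: obj Z (Suc (Suc q))" "y <: obj Z (Suc q)" "z <: obj Z q"
  using totD[OF f] pq by (auto simp: x_def y_def z_def)
 have vy: "vert (Suc p) (Suc q) y <: obj Z q" "hor (Suc p) (Suc q) y <: obj Z (Suc q)"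
  using c vert_closed hor_closed by auto
 have "D (Suc n) (D (Suc (Suc n)) f) (p, q) =
   vert p (Suc q) (vert p (Suc (Suc q)) x +[obj Z (Suc q)] hor (Suc p) (Suc q) y) +[obj Z q]
   hor (Suc p) q (vert (Suc p) (Suc q) y +[obj Z q] hor (Suc (Suc p)) q z)"
  using pq by (simp add: D_at x_def y_def z_def)
 also have "... = vert p (Suc q) (hor (Suc p) (Suc q) y) +[obj Z q] hor (Suc p) q (vert (Suc p) (Suc q) y)"
  using c vy by (simp add: lin_add[OF vert_linear] lin_add[OF hor_linear] vert_closed hor_closed
    vert_vert hor_hor)
 also have "... = 0[obj Z q]"
  using hor_vert[OF c(2), of p] vy by (simp add: O.a_comm vert_closed hor_closed)
 finally show "D (Suc n) (D (Suc (Suc n)) f) (p, q) = 0[Tot n] (p, q)" using pq by (simp add: tot_zero)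
qed

interpretation TC: chain_complex k Tot D
 by unfold_locales (auto intro: tot_module D_linear D_D)

definition \<Psi> where "\<Psi> n f = (\<Oplus>\<^bsub>C n\<^esub>p\<in>{..n}. \<Phi> p (n - p) (f (p, n - p)))"

lemma \<Phi>_lin: "p + q = n ==> lmap k (obj Z q) (C n) (\<Phi> p q)"
 using \<Phi>_linear by blast

lemma \<Psi>_linear: "lmap k (Tot n) (C n) (\<Psi> n)"
 unfolding \<Psi>_def[abs_def]
 by (intro lin_finsum_fun[OF tot_module C_module] lin_comp[OF \<Phi>_lin eval_linear]) auto

lemma \<Psi>_closed: "f <: Tot n ==> \<Psi> n f <: C n"
 by (rule lin_closed[OF \<Psi>_linear])

lemma \<Psi>_D:
 assumes f: "f <: Tot (Suc n)"
 shows "dC (Suc n) (\<Psi> (Suc n) f) = \<Psi> n (D (Suc n) f)"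
proof -
 define F where "F p = f (p, Suc n - p)" for p
 define A where "A p = (if Suc n - p = 0 then 0[C n] else \<Phi> p (Suc n - p - 1) (vert p (Suc n - p) (F p)))" for p
 define B where "B p = (if p = 0 then 0[C n] else \<Phi> (p - 1) (Suc n - p) (hor p (Suc n - p) (F p)))" for p
 have F: "F p <: obj Z (Suc n - p)" if "p <= Suc n" for p
  unfolding F_def using totD[OF f] that by simp
 have A: "A p <: C n" if "p <= Suc n" for p
 proof (cases "p = Suc n")
  case False
  then have e: "Suc n - p = Suc (n - p)" "p <= n" using that by auto
  have "vert p (Suc (n - p)) (F p) <: obj Z (n - p)" using F[OF that] e by (intro vert_closed) simp
  then show ?thesis unfolding A_def e(1) using lin_closed[OF \<Phi>_lin] e(2) by simp
 qed (simp add: A_def)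
 have B: "B p <: C n" if "p <= Suc n" for p
  unfolding B_def using hor_closed[OF F[OF that], of p] lin_closed[OF \<Phi>_lin[of "p - 1" "Suc n - p" n]] that
  by auto
 have "dC (Suc n) (\<Psi> (Suc n) f) = (\<Oplus>\<^bsub>C n\<^esub>p\<in>{..Suc n}. dC (Suc n) (\<Phi> p (Suc n - p) (F p)))"
  unfolding \<Psi>_def F_def[symmetric] using F lin_closed[OF \<Phi>_lin]
  by (intro lin_finsum[OF C_module C_module dC_linear]) auto
 also have "... = (\<Oplus>\<^bsub>C n\<^esub>p\<in>{..Suc n}. A p +[C n] B p)"
  unfolding A_def B_def using F by (intro sum_cong \<Phi>_chain) auto
 also have "... = (\<Oplus>\<^bsub>C n\<^esub>p\<in>{..Suc n}. A p) +[C n] (\<Oplus>\<^bsub>C n\<^esub>p\<in>{..Suc n}. B p)"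
  using A B by (intro C.finsum_addf) auto
 also have "(\<Oplus>\<^bsub>C n\<^esub>p\<in>{..Suc n}. A p) = (\<Oplus>\<^bsub>C n\<^esub>p\<in>{..n}. A p)"
 proof -
  have "(\<Oplus>\<^bsub>C n\<^esub>p\<in>{..Suc n}. A p) = A (Suc n) +[C n] (\<Oplus>\<^bsub>C n\<^esub>p\<in>{..n}. A p)"
   using A by (intro C.finsum_Suc) auto
  moreover have "A (Suc n) = 0[C n]" by (simp add: A_def)
  moreover have "(\<Oplus>\<^bsub>C n\<^esub>p\<in>{..n}. A p) <: C n" using A by (intro C.finsum_closed) auto
  ultimately show ?thesis by simp
 qed
 also have "(\<Oplus>\<^bsub>C n\<^esub>p\<in>{..Suc n}. B p) = (\<Oplus>\<^bsub>C n\<^esub>p\<in>{..n}. B (Suc p))"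
 proof -
  have "(\<Oplus>\<^bsub>C n\<^esub>p\<in>{..Suc n}. B p) = (\<Oplus>\<^bsub>C n\<^esub>p\<in>{..n}. B (Suc p)) +[C n] B 0"
   using B by (intro C.finsum_Suc2) auto
  moreover have "B 0 = 0[C n]" by (simp add: B_def)
  moreover have "(\<Oplus>\<^bsub>C n\<^esub>p\<in>{..n}. B (Suc p)) <: C n" using B by (intro C.finsum_closed) auto
  ultimately show ?thesis by simp
 qed
 also have "(\<Oplus>\<^bsub>C n\<^esub>p\<in>{..n}. A p) +[C n] (\<Oplus>\<^bsub>C n\<^esub>p\<in>{..n}. B (Suc p)) =
   (\<Oplus>\<^bsub>C n\<^esub>p\<in>{..n}. A p +[C n] B (Suc p))"
  using A B by (intro C.finsum_addf[symmetric]) auto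
 also have "... = \<Psi> n (D (Suc n) f)"
  unfolding \<Psi>_def
 proof (rule sum_cong)
  fix p assume "p : {..n}"
  then have p: "p + (n - p) = n" "Suc n - p = Suc (n - p)" by auto
  have c: "f (p, Suc (n - p)) <: obj Z (Suc (n - p))" "f (Suc p, n - p) <: obj Z (n - p)"
   using totD[OF f] p by auto
  show "A p +[C n] B (Suc p) = \<Phi> p (n - p) (D (Suc n) f (p, n - p))"
   unfolding A_def B_def F_def using c
   by (simp add: p D_at lin_add[OF \<Phi>_lin[OF p(1)]] vert_closed hor_closed)
 qed
 finally show ?thesis .
qed

subsection \<open>The periodicity operator\<close>

definition Sh where "Sh i m f = restrict (%(p, q). f (p + 2 * i, q)) {(p, q). p + q = m}"
definition U where
 "U m g = restrict (%(p, q). if p < 2 then 0[obj Z q] else g (p - 2, q)) {(p, q). p + q = m + 2}"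
definition at where "at n a x = restrict (%(p, q). if p = a then x else 0[obj Z q]) {(p, q). p + q = n}"

lemma Sh_linear: "m + 2 * i = n ==> lmap k (Tot n) (Tot m) (Sh i m)"
 unfolding Sh_def[abs_def] by (intro tot_linearI tot_module eval_linear) auto

lemma Sh_closed: "f <: Tot n ==> m + 2 * i = n ==> Sh i m f <: Tot m"
 using lin_closed[OF Sh_linear] by blast

lemma Sh_at: "p + q = m ==> Sh i m f (p, q) = f (p + 2 * i, q)"
 by (simp add: Sh_def)

lemma Sh_D:
 assumes "f <: Tot (Suc n)" "m + 2 * i = n"
 shows "Sh i m (D (Suc n) f) = D (Suc m) (Sh i (Suc m) f)"
proof (rule tot_ext)
 show "Sh i m (D (Suc n) f) <: Tot m" by (rule Sh_closed[OF D_closed[OF assms(1)] assms(2)])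
 show "D (Suc m) (Sh i (Suc m) f) <: Tot m"
  using assms by (intro D_closed Sh_closed[OF assms(1)]) simp
 fix p q assume "p + q = m"
 then show "Sh i m (D (Suc n) f) (p, q) = D (Suc m) (Sh i (Suc m) f) (p, q)"
  using assms(2) by (simp add: Sh_at D_at tsygan_vert_def tsygan_hor_def)
qed

lemma Sh_0: "f <: Tot n ==> Sh 0 n f = f"
 by (rule tot_ext[OF Sh_closed]) (auto simp: Sh_at)

lemma Sh_Sh:
 assumes "f <: Tot n" "m + 2 = n" "l + 2 * i = m"
 shows "Sh i l (Sh 1 m f) = Sh (Suc i) l f"
 by (rule tot_ext[OF Sh_closed[OF Sh_closed[OF assms(1)]] Sh_closed[OF assms(1)]])
  (use assms in \<open>auto simp: Sh_at\<close>)

lemma U_closed: "g <: Tot m ==> U m g <: Tot (m + 2)"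
 unfolding U_def by (intro totI) (auto intro: totD)

lemma Sh_U: "g <: Tot m ==> Sh 1 m (U m g) = g"
 by (rule tot_ext[OF Sh_closed[OF U_closed]]) (auto simp: Sh_at U_def)

lemma at_closed: "a + q = n ==> x <: obj Z q ==> at n a x <: Tot n"
 unfolding at_def by (intro totI) auto

lemma vert_zero: "vert p (Suc q) 0[obj Z (Suc q)] = 0[obj Z q]"
 by (rule lin_zero[OF obj_mod obj_mod vert_linear])

lemma hor_zero: "hor p q 0[obj Z q] = 0[obj Z q]"
 by (rule lin_zero[OF obj_mod obj_mod hor_linear])

lemma \<Psi>_column_0:
 assumes f: "f <: Tot n" "!!p q. p + q = n ==> p >= 1 ==> f (p, q) = 0[obj Z q]"
 shows "\<Psi> n f = \<Phi> 0 n (f (0, n))"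
proof -
 have c: "\<Phi> 0 n (f (0, n)) <: C n"
  using lin_closed[OF \<Phi>_lin totD[OF f(1)], of 0 n n] by simp
 have "(\<Oplus>\<^bsub>C n\<^esub>p\<in>{0}. \<Phi> p (n - p) (f (p, n - p))) = \<Psi> n f"
  unfolding \<Psi>_def
 proof (rule C.add.finprod_mono_neutral_cong_left)
  show "\<Phi> i (n - i) (f (i, n - i)) = 0[C n]" if "i : {..n} - {0}" for i
  proof -
   have i: "i + (n - i) = n" "i >= 1" using that by auto
   show ?thesis
    unfolding f(2)[OF i] by (rule lin_zero[OF obj_mod C_module \<Phi>_lin[OF i(1)]])
  qed
  show "(%p. \<Phi> p (n - p) (f (p, n - p))) : {..n} \<rightarrow> carrier (C n)"
   using lin_closed[OF \<Phi>_lin totD[OF f(1)]] by auto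
 qed auto
 then show ?thesis using c by simp
qed

text \<open>The two-column complex \<open>ker S\<close> computes Hochschild homology, because the second column
  is acyclic.\<close>

lemma two_columns:
 assumes f: "f : TC.cycles n" and z: "!!p q. p + q = n ==> p >= 2 ==> f (p, q) = 0[obj Z q]"
  and bd: "\<Psi> n f : bounds n"
 shows "EX v:carrier (Tot (Suc n)). D (Suc n) v = f &
  (ALL p q. p + q = Suc n --> p >= 2 --> v (p, q) = 0[obj Z q])"
proof -
 have fT: "f <: Tot n" using f by (simp add: TC.cycles_def)
 have "EX v:carrier (Tot (Suc n)). (ALL p q. p + q = n --> p >= 1 --> D (Suc n) v (p, q) = f (p, q)) &
  (ALL p q. p + q = Suc n --> p >= 2 --> v (p, q) = 0[obj Z q])"
 proof (cases n)
  case 0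
  then show ?thesis by (intro bexI[of _ "0[Tot (Suc n)]"]) (auto simp: tot_zero)
 next
  case (Suc m)
  define x where "x = f (1, m)"
  have x: "x <: obj Z m" unfolding x_def using totD[OF fT] Suc by simp
  have "m = 0 \<or> hb' Z m x = 0[obj Z (m - 1)]"
  proof (cases m)
   case (Suc l)
   have bx: "hb' Z (Suc l) x <: obj Z l"
    using x Suc lin_closed[OF b'_linear] by simp
   have "0[Tot m] (1, l) = D (Suc m) f (1, l)" using f \<open>n = Suc m\<close> by (simp add: TC.cycles_def)
   then have "0[obj Z l] = vert 1 (Suc l) x +[obj Z l] hor 2 l (f (2, l))"
    using Suc tot_zero[of 1 l m] by (simp add: D_at x_def numeral_2_eq_2)
   also have "f (2, l) = 0[obj Z l]" using z[of 2 l] Suc \<open>n = Suc m\<close> by simp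
   finally have "-[obj Z l] hb' Z (Suc l) x = 0[obj Z l]"
    using bx by (simp add: hor_zero tsygan_vert_def)
   then have "hb' Z (Suc l) x = 0[obj Z l]" using bx by (metis O.minus_minus O.neg_zero)
   then show ?thesis using Suc by simp
  qed simp
  then obtain y where y: "y <: obj Z (Suc m)" "hb' Z (Suc m) y = x"
   using b'_acyclic[OF x] by blast
  define v where "v = at (Suc n) 1 (\<ominus>\<^bsub>obj Z n\<^esub> y)"
  have v: "v <: Tot (Suc n)" unfolding v_def using y Suc by (intro at_closed) auto
  have vz: "v (p, q) = 0[obj Z q]" if "p + q = Suc n" "p >= 2" for p q
   using that by (simp add: v_def at_def)
  have "D (Suc n) v (p, q) = f (p, q)" if pq: "p + q = n" "p >= 1" for p q
  proof (cases "p = 1")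
   case True
   then have q: "q = m" using pq Suc by simp
   have "v (1, Suc q) = -[obj Z n] y" using q Suc by (simp add: v_def at_def)
   then have "D (Suc n) v (1, q) = vert 1 (Suc m) (\<ominus>\<^bsub>obj Z (Suc m)\<^esub> y) +[obj Z m] 0[obj Z m]"
    using q Suc vz[of 2 m] by (simp add: D_at hor_zero numeral_2_eq_2)
   also have "... = x"
    using y x by (simp add: tsygan_vert_def lin_neg[OF obj_mod obj_mod b'_linear])
   finally show ?thesis using True q by (simp add: x_def)
  next
   case False
   then show ?thesis
    using pq vz[of p "Suc q"] vz[of "Suc p" q] z[of p q] by (simp add: D_at vert_zero hor_zero)
  qed
  then show ?thesis using v vz by blast
 qed
 then obtain v where v: "v <: Tot (Suc n)"
  "!!p q. p + q = n ==> p >= 1 ==> D (Suc n) v (p, q) = f (p, q)"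
  "!!p q. p + q = Suc n ==> p >= 2 ==> v (p, q) = 0[obj Z q]" by blast
 define g where "g = f -[Tot n] D (Suc n) v"
 have Dv: "D (Suc n) v <: Tot n" by (rule D_closed[OF v(1)])
 have g: "g <: Tot n" unfolding g_def using fT Dv by simp
 have g0: "g (p, q) = 0[obj Z q]" if "p + q = n" "p >= 1" for p q
  unfolding g_def using that v(2) totD[OF fT] fT Dv by (simp add: tot_minus O.minus_eq_zero_iff)
 have Dvc: "D (Suc n) v : TC.cycles n" using TC.bounds_cycles v(1) by (auto simp: TC.bounds_def)
 have gc: "g : TC.cycles n"
  unfolding g_def a_minus_def
  using submodule_add[OF TC.cycles_submodule] submodule_neg[OF tot_module TC.cycles_submodule] f Dvc by blast
 define x where "x = g (0, n)"
 have x: "x <: obj Z n" unfolding x_def using totD[OF g] by simp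
 have xc: "n = 0 \<or> hb Z n x = 0[obj Z (n - 1)]"
 proof (cases n)
  case (Suc m)
  have bx: "hb Z (Suc m) x <: obj Z m" using lin_closed[OF b_linear] x Suc by simp
  have "0[Tot m] (0, m) = D (Suc m) g (0, m)" using gc Suc by (simp add: TC.cycles_def)
  then have "0[obj Z m] = vert 0 (Suc m) x +[obj Z m] hor 1 m (g (1, m))"
   using Suc tot_zero[of 0 m m] by (simp add: D_at x_def)
  also have "g (1, m) = 0[obj Z m]" using g0[of 1 m] Suc by simp
  finally show ?thesis using bx Suc by (simp add: hor_zero tsygan_vert_def)
 qed simp
 have "\<Phi> 0 n x = \<Psi> n g" unfolding x_def by (rule \<Psi>_column_0[OF g g0, symmetric])
 also have "... = \<Psi> n f -[C n] \<Psi> n (D (Suc n) v)"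
  unfolding g_def by (rule lin_minus[OF tot_module C_module \<Psi>_linear fT Dv])
 also have "\<Psi> n (D (Suc n) v) = dC (Suc n) (\<Psi> (Suc n) v)" by (rule \<Psi>_D[OF v(1), symmetric])
 also have "\<Psi> n f -[C n] dC (Suc n) (\<Psi> (Suc n) v) : bounds n"
  unfolding a_minus_def
  using submodule_add[OF bounds_submodule bd submodule_neg[OF C_module bounds_submodule]] \<Psi>_closed[OF v(1)]
  by (simp add: bounds_def)
 finally have "x : hb Z (Suc n) ` carrier (obj Z (Suc n))"
  using \<Phi>_inj[OF x xc] by (simp add: bounds_def)
 then obtain y where y: "y <: obj Z (Suc n)" "x = hb Z (Suc n) y" by blast
 define w where "w = at (Suc n) 0 y"
 have w: "w <: Tot (Suc n)" unfolding w_def using y by (intro at_closed) auto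
 have wz: "w (p, q) = 0[obj Z q]" if "p + q = Suc n" "p >= 1" for p q
  using that by (simp add: w_def at_def)
 have "D (Suc n) w = g"
 proof (rule tot_ext[OF D_closed[OF w] g])
  fix p q assume pq: "p + q = n"
  show "D (Suc n) w (p, q) = g (p, q)"
  proof (cases "p = 0")
   case True
   moreover have "w (0, Suc n) = y" by (simp add: w_def at_def)
   ultimately show ?thesis
    using pq wz[of 1 q] y x by (simp add: D_at hor_zero tsygan_vert_def x_def[symmetric])
  next
   case False
   then show ?thesis
    using pq wz[of p "Suc q"] wz[of "Suc p" q] g0[of p q] by (simp add: D_at vert_zero hor_zero)
  qed
 qed
 then have "D (Suc n) (w +[Tot (Suc n)] v) = f"
  using lin_add[OF D_linear w v(1)] fT Dv
  by (simp add: g_def a_minus_def Tot.a_assoc Tot.l_neg)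
 moreover have "(w +[Tot (Suc n)] v) (p, q) = 0[obj Z q]" if "p + q = Suc n" "p >= 2" for p q
  using that w v(1) wz v(3) by (simp add: tot_add)
 ultimately show ?thesis using w v(1) by (intro bexI[of _ "w +[Tot (Suc n)] v"]) auto
qed

lemma Sh_cycles: "f : TC.cycles n ==> m + 2 * i = n ==> Sh i m f : TC.cycles m"
proof (cases m)
 case (Suc l)
 assume f: "f : TC.cycles n" and m: "m + 2 * i = n"
 have n: "n = Suc (l + 2 * i)" using m Suc by simp
 have fT: "f <: Tot (Suc (l + 2 * i))" using f n by (simp add: TC.cycles_def)
 have "D (Suc l) (Sh i (Suc l) f) = Sh i l (D n f)" unfolding n by (rule Sh_D[OF fT refl, symmetric])
 also have "D n f = 0[Tot (l + 2 * i)]" using f n by (simp add: TC.cycles_def)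
 also have "Sh i l ... = 0[Tot l]" by (rule lin_zero[OF tot_module tot_module Sh_linear]) simp
 finally show ?thesis using Sh_closed[of f n m i] f m Suc by (simp add: TC.cycles_def)
qed (auto simp: TC.cycles_def intro: Sh_closed)

text \<open>By induction along \<open>S\<close>: once \<open>S f\<close> is a boundary, \<open>f\<close> may be changed by a boundary to lie in the
  first two columns.\<close>

lemma cyclic_inj:
 "f : TC.cycles n ==> (!!i m. m + 2 * i = n ==> \<Psi> m (Sh i m f) : bounds m) ==> f : TC.bounds n"
proof (induction n arbitrary: f rule: less_induct)
 case (less n)
 have fT: "f <: Tot n" using less.prems by (simp add: TC.cycles_def)
 have f0: "\<Psi> n f : bounds n" using less.prems(2)[of n 0] Sh_0[OF fT] by simp
 show ?case
 proof (cases "n < 2")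
  case True
  then show ?thesis using two_columns[OF less.prems(1) _ f0] by (auto simp: TC.bounds_def)
 next
  case False
  define m where "m = n - 2"
  have m: "m + 2 = n" "m < n" using False by (auto simp: m_def)
  have "Sh 1 m f : TC.bounds m"
  proof (rule less.IH[OF m(2)])
   show "Sh 1 m f : TC.cycles m" using less.prems(1) m by (intro Sh_cycles) auto
   show "\<Psi> l (Sh i l (Sh 1 m f)) : bounds l" if "l + 2 * i = m" for i l
    unfolding Sh_Sh[OF fT m(1) that] using that m by (intro less.prems(2)) simp
  qed
  then obtain g where g: "g <: Tot (Suc m)" "Sh 1 m f = D (Suc m) g" by (auto simp: TC.bounds_def)
  define u where "u = U (Suc m) g"
  have u: "u <: Tot (Suc n)" using U_closed[OF g(1)] m by (simp add: u_def)
  have Du: "D (Suc n) u <: Tot n" by (rule D_closed[OF u])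
  define f' where "f' = f -[Tot n] D (Suc n) u"
  have "Sh 1 m (D (Suc n) u) = D (Suc m) (Sh 1 (Suc m) u)" by (rule Sh_D[OF u]) (use m in simp)
  also have "Sh 1 (Suc m) u = g" unfolding u_def by (rule Sh_U[OF g(1)])
  finally have e: "Sh 1 m f = Sh 1 m (D (Suc n) u)" using g(2) by simp
  have z: "f' (p, q) = 0[obj Z q]" if pq: "p + q = n" "p >= 2" for p q
  proof -
   obtain r where r: "p = r + 2" using pq(2) by (metis le_add_diff_inverse2)
   then have rq: "r + q = m" using pq m by simp
   have "f (p, q) = Sh 1 m f (r, q)" using r by (simp add: Sh_at[OF rq])
   also have "... = D (Suc n) u (p, q)" unfolding e using r by (simp add: Sh_at[OF rq])
   finally show ?thesis unfolding f'_def using pq fT Du totD[OF Du] by (simp add: tot_minus O.minus_eq_zero_iff)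
  qed
  have "D (Suc n) u : TC.cycles n" using TC.bounds_cycles u by (auto simp: TC.bounds_def)
  then have f'c: "f' : TC.cycles n"
   unfolding f'_def a_minus_def
   using submodule_add[OF TC.cycles_submodule] submodule_neg[OF tot_module TC.cycles_submodule] less.prems(1) by blast
  have "\<Psi> n f' = \<Psi> n f -[C n] dC (Suc n) (\<Psi> (Suc n) u)"
   unfolding f'_def \<Psi>_D[OF u] by (rule lin_minus[OF tot_module C_module \<Psi>_linear fT Du])
  then have "\<Psi> n f' : bounds n"
   unfolding a_minus_def
   using submodule_add[OF bounds_submodule f0 submodule_neg[OF C_module bounds_submodule]] \<Psi>_closed[OF u]
   by (simp add: bounds_def)
  then obtain v where v: "v <: Tot (Suc n)" "D (Suc n) v = f'"
   using two_columns[OF f'c z] by blast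
  have "D (Suc n) (v +[Tot (Suc n)] u) = f"
   using lin_add[OF D_linear v(1) u] v(2) fT Du by (simp add: f'_def a_minus_def Tot.a_assoc Tot.l_neg)
  then show ?thesis using v(1) u unfolding TC.bounds_def by (intro image_eqI[of _ _ "v +[Tot (Suc n)] u"]) auto
 qed
qed

lemma cyclic_surj_0:
 assumes "c : cycles n"
 shows "EX f:TC.cycles n. (ALL p q. p + q = n --> p >= 1 --> f (p, q) = 0[obj Z q]) & \<Psi> n f -[C n] c : bounds n"
proof -
 obtain z where z: "z <: obj Z n" "n = 0 \<or> hb Z n z = 0[obj Z (n - 1)]"
  "\<Phi> 0 n z -[C n] c : bounds n"
  using \<Phi>_surj[of c n] assms unfolding cycles_def bounds_def by blast
 define f where "f = at n 0 z"
 have f: "f <: Tot n" unfolding f_def using z(1) by (intro at_closed) auto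
 have f0: "f (p, q) = 0[obj Z q]" if "p + q = n" "p >= 1" for p q using that by (simp add: f_def at_def)
 have fz: "f (0, n) = z" by (simp add: f_def at_def)
 have "f : TC.cycles n"
 proof (cases n)
  case (Suc m)
  have fS: "f <: Tot (Suc m)" using f Suc by simp
  have "D (Suc m) f = 0[Tot m]"
  proof (rule tot_ext[OF D_closed[OF fS] Tot.zero_closed])
   fix p q assume pq: "p + q = m"
   show "D (Suc m) f (p, q) = 0[Tot m] (p, q)"
   proof (cases "p = 0")
    case True
    then show ?thesis
     using pq Suc z fz f0[of 1 m] by (simp add: D_at tot_zero hor_zero tsygan_vert_def)
   next
    case False
    then show ?thesis using pq Suc f0[of p "Suc q"] f0[of "Suc p" q]
     by (simp add: D_at tot_zero hor_zero vert_zero)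
   qed
  qed
  then show ?thesis using f Suc by (simp add: TC.cycles_def)
 qed (use f in \<open>simp add: TC.cycles_def\<close>)
 moreover have "\<Psi> n f = \<Phi> 0 n z" using \<Psi>_column_0[OF f f0] fz by simp
 ultimately show ?thesis using z(3) f0 by (intro bexI[of _ f]) auto
qed

text \<open>Extend a preimage of the classes of lower degree along \<open>S\<close>, then correct it by a cycle in column \<open>0\<close>.\<close>

lemma cyclic_surj:
 "(!!i m. m + 2 * i = n ==> c i : cycles m) ==>
  EX f:TC.cycles n. ALL i m. m + 2 * i = n --> \<Psi> m (Sh i m f) -[C m] c i : bounds m"
proof (induction n arbitrary: c rule: less_induct)
 case (less n)
 have c0: "c 0 : cycles n" using less.prems[of n 0] by simp
 show ?case
 proof (cases "n < 2")
  case True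
  obtain f where f: "f : TC.cycles n" "\<Psi> n f -[C n] c 0 : bounds n" using cyclic_surj_0[OF c0] by blast
  have fT: "f <: Tot n" using f by (simp add: TC.cycles_def)
  have "\<Psi> m (Sh i m f) -[C m] c i : bounds m" if "m + 2 * i = n" for i m
  proof -
   have "i = 0" "m = n" using that True by auto
   then show ?thesis using f(2) Sh_0[OF fT] by simp
  qed
  then show ?thesis using f(1) by blast
 next
  case False
  define m where "m = n - 2"
  have m: "m + 2 = n" "m < n" "n = Suc (Suc m)" using False by (auto simp: m_def)
  have "EX g:TC.cycles m. ALL i l. l + 2 * i = m --> \<Psi> l (Sh i l g) -[C l] c (Suc i) : bounds l"
   using m by (intro less.IH less.prems) auto
  then obtain g where g: "g : TC.cycles m"
   "!!i l. l + 2 * i = m ==> \<Psi> l (Sh i l g) -[C l] c (Suc i) : bounds l" by blast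
  have gT: "g <: Tot m" using g by (simp add: TC.cycles_def)
  define u where "u = U m g"
  have u: "u <: Tot (Suc (Suc m))" using U_closed[OF gT] by (simp add: u_def)
  define w where "w = D (Suc (Suc m)) u"
  have wT: "w <: Tot (Suc m)" unfolding w_def by (rule D_closed[OF u])
  have wc: "w : TC.cycles (Suc m)" using TC.bounds_cycles[of "Suc m"] u by (auto simp: TC.bounds_def w_def)
  have w0: "w (p, q) = 0[obj Z q]" if pq: "p + q = Suc m" "p >= 2" for p q
  proof -
   obtain r where r: "p = Suc (Suc r)" using pq(2) by (metis add_2_eq_Suc le_Suc_ex)
   have m': "m = Suc (r + q)" using pq r by simp
   have "Sh 1 (r + q) w = D (Suc (r + q)) (Sh 1 (Suc (r + q)) u)"
    unfolding w_def m' by (rule Sh_D) (use u m' in auto)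
   also have "Sh 1 (Suc (r + q)) u = g" unfolding u_def m'[symmetric] by (rule Sh_U[OF gT])
   also have "D (Suc (r + q)) g = 0[Tot (r + q)]" using g(1) m' by (simp add: TC.cycles_def)
   finally have "Sh 1 (r + q) w (r, q) = 0[obj Z q]" by (simp add: tot_zero)
   then show ?thesis using r by (simp add: Sh_at)
  qed
  have "\<Psi> (Suc m) w = dC (Suc (Suc m)) (\<Psi> (Suc (Suc m)) u)" unfolding w_def by (rule \<Psi>_D[OF u, symmetric])
  then have "\<Psi> (Suc m) w : bounds (Suc m)" using \<Psi>_closed[OF u] by (simp add: bounds_def)
  then obtain v where v: "v <: Tot (Suc (Suc m))" "D (Suc (Suc m)) v = w"
   "!!p q. p + q = Suc (Suc m) ==> p >= 2 ==> v (p, q) = 0[obj Z q]"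
   using two_columns[OF wc w0] by blast
  define f1 where "f1 = u -[Tot (Suc (Suc m))] v"
  have f1T: "f1 <: Tot (Suc (Suc m))" unfolding f1_def using u v(1) by simp
  have Df1: "D (Suc (Suc m)) f1 = 0[Tot (Suc m)]"
   unfolding f1_def lin_minus[OF tot_module tot_module D_linear u v(1)] v(2)
   using wT by (simp add: w_def[symmetric] Tot.minus_eq_zero_iff)
  have f1c: "f1 : TC.cycles n" using Df1 f1T m(3) by (simp add: TC.cycles_def)
  have Shf1: "f1 (p + 2, q) = g (p, q)" if "p + q = m" for p q
  proof -
   have "u (p + 2, q) = g (p, q)" using Sh_at[OF that, of 1 u] Sh_U[OF gT] by (simp add: u_def)
   then show ?thesis
    unfolding f1_def using that u v(1) v(3)[of "p + 2" q] totD[OF gT that] by (simp add: tot_minus)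
  qed
  have "dC (Suc (Suc m)) (\<Psi> (Suc (Suc m)) f1) = 0[C (Suc m)]"
   unfolding \<Psi>_D[OF f1T] Df1 by (rule lin_zero[OF tot_module C_module \<Psi>_linear])
  then have \<Psi>f1: "\<Psi> n f1 : cycles n" using \<Psi>_closed[OF f1T] m(3) by (simp add: cycles_def)
  have "c 0 -[C n] \<Psi> n f1 : cycles n"
   unfolding a_minus_def
   using submodule_add[OF cycles_submodule c0 submodule_neg[OF C_module cycles_submodule \<Psi>f1]] .
  from cyclic_surj_0[OF this] obtain f2 where f2: "f2 : TC.cycles n"
   "!!p q. p + q = n ==> p >= 1 ==> f2 (p, q) = 0[obj Z q]"
   "\<Psi> n f2 -[C n] (c 0 -[C n] \<Psi> n f1) : bounds n" by blast
  have f2T: "f2 <: Tot n" using f2(1) by (simp add: TC.cycles_def)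
  have f1n: "f1 <: Tot n" using f1T m(3) by simp
  define f where "f = f1 +[Tot n] f2"
  have f: "f : TC.cycles n" unfolding f_def by (rule submodule_add[OF TC.cycles_submodule f1c f2(1)])
  have fT: "f <: Tot n" using f by (simp add: TC.cycles_def)
  have Shf: "Sh 1 m f = g"
  proof (rule tot_ext[OF Sh_closed[OF fT] gT])
   show "Sh 1 m f (p, q) = g (p, q)" if pq: "p + q = m" for p q
    unfolding f_def using pq m Shf1[OF pq] f2(2)[of "p + 2" q] f1n f2T totD[OF gT pq]
    by (simp add: Sh_at tot_add)
  qed (use m in simp)
  have "\<Psi> l (Sh i l f) -[C l] c i : bounds l" if l: "l + 2 * i = n" for i l
  proof (cases i)
   case 0
   have cc: "c 0 <: C n" "\<Psi> n f1 <: C n" "\<Psi> n f2 <: C n"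
    using c0 \<Psi>f1 \<Psi>_closed[OF f2T] by (auto simp: cycles_def)
   have "\<Psi> n f -[C n] c 0 = \<Psi> n f2 -[C n] (c 0 -[C n] \<Psi> n f1)"
    unfolding f_def lin_add[OF \<Psi>_linear f1n f2T]
    using cc by (simp add: a_minus_def C.minus_add C.a_ac)
   then show ?thesis using 0 l f2(3) Sh_0[OF fT] by simp
  next
   case (Suc j)
   then have lj: "l + 2 * j = m" using l m by simp
   then show ?thesis using g(2)[OF lj] Sh_Sh[OF fT m(1) lj] Shf Suc by simp
  qed
  then show ?thesis using f by blast
 qed
qed

text \<open>The components \<open>\<Psi> \<circ> S\<^sup>i\<close> together give the decomposition.\<close>

theorem cyclic_homology_decomposition:
 "linear_isomorphic k (cyclic_homology Z n)
  (direct_sum (UNIV :: nat set) (%i. if 2 * i <= n then homology C dC (n - 2 * i) else zero_module))"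
proof -
 let ?F = "%i. if 2 * i <= n then homology C dC (n - 2 * i) else zero_module"
 let ?W = "direct_sum (UNIV :: nat set) ?F"
 let ?V = "Tot n\<lparr>carrier := TC.cycles n\<rparr>"
 define co where "co m x = bounds m +>\<^bsub>C m\<lparr>carrier := cycles m\<rparr>\<^esub> x" for m x
 define G where "G f i = (if 2 * i <= n then co (n - 2 * i) (\<Psi> (n - 2 * i) (Sh i (n - 2 * i) f)) else undefined)"
  for f and i :: nat
 have col: "lmap k (C m\<lparr>carrier := cycles m\<rparr>) (homology C dC m) (co m)" for m
  unfolding co_def homology_eq by (rule module_quotient.linear_coset[OF homology_quotient])
 have mF: "module k (?F i)" for i by (simp add: module_homology module_zero_module[OF O.R.is_cring])
 have mW: "module k ?W" by (rule module_direct_sum[OF O.R.is_cring mF])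
 have mV: "module k ?V" by (rule TC.module_cycles)
 have \<Psi>c: "\<Psi> m (Sh i m f) : cycles m" if f: "f : TC.cycles n" and m: "m + 2 * i = n" for f i m
 proof (cases m)
  case 0
  then show ?thesis using \<Psi>_closed[OF Sh_closed[of f n m i]] f m by (simp add: cycles_def TC.cycles_def)
 next
  case (Suc l)
  have s: "Sh i m f : TC.cycles m" by (rule Sh_cycles[OF f m])
  then have sT: "Sh i (Suc l) f <: Tot (Suc l)" "D (Suc l) (Sh i (Suc l) f) = 0[Tot l]"
   using Suc by (auto simp: TC.cycles_def)
  have "dC (Suc l) (\<Psi> (Suc l) (Sh i (Suc l) f)) = 0[C l]"
   unfolding \<Psi>_D[OF sT(1)] sT(2) by (rule lin_zero[OF tot_module C_module \<Psi>_linear])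
  then show ?thesis using Suc \<Psi>_closed[OF sT(1)] by (simp add: cycles_def)
 qed
 have Gl: "lmap k ?V (?F i) (%f. G f i)" for i
 proof (cases "2 * i <= n")
  case True
  then have m: "(n - 2 * i) + 2 * i = n" by simp
  note l = lin_comp[OF \<Psi>_linear Sh_linear[OF m]]
  have "lmap k ?V (C (n - 2 * i)\<lparr>carrier := cycles (n - 2 * i)\<rparr>) (%f. \<Psi> (n - 2 * i) (Sh i (n - 2 * i) f))"
   using l \<Psi>c[OF _ m] by (auto simp: linear_map_def TC.cycles_def)
  from lin_comp[OF col this] show ?thesis using True by (simp add: G_def)
 next
  case False
  then show ?thesis by (simp add: G_def linear_map_def zero_module_def)
 qed
 have Wc: "g <: ?W" if g: "!!i. g i <: ?F i" for g
 proof (rule direct_sum_closedI[where S = "{..n}"])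
  show "{i : UNIV. g i ~= 0[?F i]} <= {..n}"
  proof
   fix i assume i: "i : {i : UNIV. g i ~= 0[?F i]}"
   show "i : {..n}"
   proof (rule ccontr)
    assume "i \<notin> {..n}"
    then have "\<not> 2 * i <= n" by simp
    then show False using i g[of i] by (simp add: zero_module_def)
   qed
  qed
 qed (use g in auto)
 have Gc: "G f <: ?W" if "f <: ?V" for f
  by (rule Wc) (rule lin_closed[OF Gl that])
 have GL: "lmap k ?V ?W G"
 proof (rule linI[OF Gc])
  interpret V: module k ?V by (rule mV)
  interpret W: module k ?W by (rule mW)
  fix x y assume x: "x <: ?V" and y: "y <: ?V"
  show "G (x +[?V] y) = G x +[?W] G y"
   by (rule direct_sum_ext[OF Gc[OF V.a_closed[OF x y]] W.a_closed[OF Gc[OF x] Gc[OF y]]])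
    (use lin_add[OF Gl x y] in \<open>simp add: direct_sum_simps(3)\<close>)
 next
  interpret V: module k ?V by (rule mV)
  interpret W: module k ?W by (rule mW)
  fix a x assume a: "a <: k" and x: "x <: ?V"
  show "G (a .[?V] x) = a .[?W] G x"
   by (rule direct_sum_ext[OF Gc[OF V.smult_closed[OF a x]] W.smult_closed[OF a Gc[OF x]]])
    (use lin_smult[OF Gl a x] in \<open>simp add: direct_sum_simps(4)\<close>)
 qed
 have surj: "G ` carrier ?V = carrier ?W"
 proof (intro equalityI subsetI)
  show "g <: ?W" if "g : G ` carrier ?V" for g using that Gc by blast
  fix g assume g: "g <: ?W"
  have "EX c. c : cycles (n - 2 * i) & co (n - 2 * i) c = g i" if i: "2 * i <= n" for i
  proof -
   have "g i <: homology C dC (n - 2 * i)" using direct_sum_closedD[OF g, of i] i by simp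
   then show ?thesis
    unfolding homology_eq by (rule module_quotient.quot_cases[OF homology_quotient]) (auto simp: co_def)
  qed
  then obtain c where c: "!!i. 2 * i <= n ==> c i : cycles (n - 2 * i) & co (n - 2 * i) (c i) = g i" by metis
  have "EX f:TC.cycles n. ALL i m. m + 2 * i = n --> \<Psi> m (Sh i m f) -[C m] c i : bounds m"
  proof (rule cyclic_surj)
   fix i m assume "m + 2 * i = n"
   then have "2 * i <= n" "m = n - 2 * i" by auto
   then show "c i : cycles m" using c by simp
  qed
  then obtain f where f: "f : TC.cycles n"
   "!!i m. m + 2 * i = n ==> \<Psi> m (Sh i m f) -[C m] c i : bounds m" by blast
  have "G f = g"
  proof (rule direct_sum_ext[OF Gc g])
   show "f <: ?V" using f(1) by simp
   fix i :: nat
   show "G f i = g i"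
   proof (cases "2 * i <= n")
    case True
    then have m: "(n - 2 * i) + 2 * i = n" by simp
    let ?Y = "C (n - 2 * i)\<lparr>carrier := cycles (n - 2 * i)\<rparr>"
    have a: "-[?Y] x = -[C (n - 2 * i)] x" if "x : cycles (n - 2 * i)" for x
    proof -
     interpret Y: module k ?Y by (rule module_cycles)
     have xC: "x <: C (n - 2 * i)" using that by (simp add: cycles_def)
     have "-[C (n - 2 * i)] x <: ?Y" using submodule_neg[OF C_module cycles_submodule that] by simp
     moreover have "-[C (n - 2 * i)] x +[?Y] x = 0[?Y]" using C.l_neg[OF xC] by simp
     ultimately show ?thesis using that by (intro Y.minus_equality) auto
    qed
    have "\<Psi> (n - 2 * i) (Sh i (n - 2 * i) f) -[?Y] c i : bounds (n - 2 * i)"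
     using f(2)[OF m] a[of "c i"] c[OF True] by (simp add: a_minus_def)
    then have "co (n - 2 * i) (\<Psi> (n - 2 * i) (Sh i (n - 2 * i) f)) = co (n - 2 * i) (c i)"
     unfolding co_def
     using module_quotient.coset_eq_iff[OF homology_quotient] \<Psi>c[OF f(1) m] c[OF True] by simp
    then show ?thesis using c[OF True] True by (simp add: G_def)
   next
    case False
    then show ?thesis using direct_sum_closedD[OF g, of i] by (simp add: G_def zero_module_def)
   qed
  qed
  then show "g : G ` carrier ?V" using f(1) by (intro image_eqI[of _ _ f]) auto
 qed
 have ker: "TC.bounds n = {f : carrier ?V. G f = 0[?W]}"
 proof (intro equalityI subsetI)
  fix f assume f: "f : TC.bounds n"
  then have fc: "f : TC.cycles n" using TC.bounds_cycles by blast
  obtain g where g: "g <: Tot (Suc n)" "f = D (Suc n) g" using f by (auto simp: TC.bounds_def)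
  interpret W: module k ?W by (rule mW)
  have "G f = 0[?W]"
  proof (rule direct_sum_ext[OF Gc W.zero_closed])
   show "f <: ?V" using fc by simp
   fix i :: nat
   show "G f i = 0[?W] i"
   proof (cases "2 * i <= n")
    case True
    then have m: "(n - 2 * i) + 2 * i = n" by simp
    have s: "Sh i (Suc (n - 2 * i)) g <: Tot (Suc (n - 2 * i))" using m by (intro Sh_closed[OF g(1)]) simp
    have "\<Psi> (n - 2 * i) (Sh i (n - 2 * i) f) = dC (Suc (n - 2 * i)) (\<Psi> (Suc (n - 2 * i)) (Sh i (Suc (n - 2 * i)) g))"
     unfolding g(2) Sh_D[OF g(1) m] by (rule \<Psi>_D[OF s, symmetric])
    then have "\<Psi> (n - 2 * i) (Sh i (n - 2 * i) f) : bounds (n - 2 * i)"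
     using \<Psi>_closed[OF s] by (simp add: bounds_def)
    then show ?thesis
     using True \<Psi>c[OF fc m] module_quotient.coset_zero_iff[OF homology_quotient]
     by (simp add: G_def co_def direct_sum_simps(2) homology_eq)
   next
    case False
    then show ?thesis by (simp add: G_def direct_sum_simps(2) zero_module_def)
   qed
  qed
  then show "f : {f : carrier ?V. G f = 0[?W]}" using fc by simp
 next
  fix f assume "f : {f : carrier ?V. G f = 0[?W]}"
  then have f: "f : TC.cycles n" "G f = 0[?W]" by auto
  show "f : TC.bounds n"
  proof (rule cyclic_inj[OF f(1)])
   fix i m assume m: "m + 2 * i = n"
   then have e: "2 * i <= n" "n - 2 * i = m" by auto
   have "G f i = 0[homology C dC m]" using f(2) e by (simp add: direct_sum_simps(2))
   then show "\<Psi> m (Sh i m f) : bounds m"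
    using e \<Psi>c[OF f(1) m] module_quotient.coset_zero_iff[OF homology_quotient]
    by (simp add: G_def co_def homology_eq)
  qed
 qed
 show ?thesis
  unfolding cyclic_homology_def TC.homology_eq by (rule first_isomorphism[OF mV mW GL surj ker])
qed

end

section \<open>Comparison of resolutions\<close>

lemma lifts_kernel:
 assumes "lifts k A X Y' Y d" "rmap k A X Y \<psi>" "!!x. x <: X ==> \<psi> x : d ` carrier Y'"
 shows "EX \<phi>. rmap k A X Y' \<phi> & (ALL x:carrier X. d (\<phi> x) = \<psi> x)"
 using assms unfolding lifts_def by blast

lemma rmap_zero:
 assumes "rmod k A Y"
 shows "rmap k A X Y (%x. 0[Y])"
 unfolding rmodule_map_def
 using lin_const_zero[OF rmod_mod[OF assms]]
  lin_zero[OF rmod_mod[OF assms] rmod_mod[OF assms]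
   right_module.ract_linear_module[OF assms]] by auto

lemma rmap_id: "rmap k A X X (%x. x)"
 by (simp add: rmodule_map_def lin_id)

text \<open>The comparison theorem for resolutions.  Instead of projectivity it uses the lifting property against the differentials, which relatively
  free modules have as well.\<close>

lemma chain_map_exists:
 assumes X: "!!n. rmod k A (X n)" and Y: "!!n. rmod k A (Y n)"
  and dX: "!!n. rmap k A (X (Suc n)) (X n) (dX (Suc n))"
  and dXX: "!!n x. x <: X (Suc (Suc n)) ==> dX (Suc n) (dX (Suc (Suc n)) x) = 0[X n]"
  and eX: "rmap k A (X 0) R eX" "!!x. x <: X (Suc 0) ==> eX (dX (Suc 0) x) = 0[R]"
  and eY: "eY ` carrier (Y 0) = carrier R"
  and ex0: "!!y. y <: Y 0 ==> eY y = 0[R] ==> y : dY (Suc 0) ` carrier (Y (Suc 0))"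
  and ex: "!!n y. y <: Y (Suc n) ==> dY (Suc n) y = 0[Y n] ==> y : dY (Suc (Suc n)) ` carrier (Y (Suc (Suc n)))"
  and l0: "lifts k A (X 0) (Y 0) R eY" and l: "!!n. lifts k A (X (Suc n)) (Y (Suc n)) (Y n) (dY (Suc n))"
 shows "EX g. ALL n. rmap k A (X n) (Y n) (g n) & (ALL x:carrier (X 0). eY (g 0 x) = eX x) &
  (ALL x:carrier (X (Suc n)). dY (Suc n) (g (Suc n) x) = g n (dX (Suc n) x))"
proof -
 define G where "G n g \<longleftrightarrow> rmap k A (X n) (Y n) g & (n = 0 --> (ALL x:carrier (X 0). eY (g x) = eX x)) &
  (ALL x:carrier (X (Suc n)). g (dX (Suc n) x) : dY (Suc n) ` carrier (Y (Suc n)))" for n g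
 have "EX g. ALL n. G n (g n) & (ALL x:carrier (X (Suc n)). dY (Suc n) (g (Suc n) x) = g n (dX (Suc n) x))"
 proof (rule dependent_nat_choice)
  obtain g where g: "rmap k A (X 0) (Y 0) g" "ALL x:carrier (X 0). eY (g x) = eX x"
   using lifts_kernel[OF l0 eX(1)] rmap_closed[OF eX(1)] eY by blast
  have "g (dX (Suc 0) x) : dY (Suc 0) ` carrier (Y (Suc 0))" if "x <: X (Suc 0)" for x
   using g(2) eX(2)[OF that] rmap_closed[OF dX that] rmap_closed[OF g(1)] by (intro ex0) auto
  then show "EX g. G 0 g" using g by (auto simp: G_def)
 next
  fix g n assume G: "G n g"
  then have g: "rmap k A (X n) (Y n) g" by (simp add: G_def)
  have "EX g'. rmap k A (X (Suc n)) (Y (Suc n)) g' &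
    (ALL x:carrier (X (Suc n)). dY (Suc n) (g' x) = g (dX (Suc n) x))"
   using G by (intro lifts_kernel[OF l] rmap_comp[OF g dX]) (simp add: G_def)
  then obtain g' where g': "rmap k A (X (Suc n)) (Y (Suc n)) g'"
   "!!x. x <: X (Suc n) ==> dY (Suc n) (g' x) = g (dX (Suc n) x)" by blast
  have "g' (dX (Suc (Suc n)) x) : dY (Suc (Suc n)) ` carrier (Y (Suc (Suc n)))"
   if x: "x <: X (Suc (Suc n))" for x
  proof (rule ex)
   show "g' (dX (Suc (Suc n)) x) <: Y (Suc n)"
    by (rule rmap_closed[OF g'(1) rmap_closed[OF dX x]])
   have "dY (Suc n) (g' (dX (Suc (Suc n)) x)) = g 0[X n]"
    using g'(2)[OF rmap_closed[OF dX x]] dXX[OF x] by simp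
   then show "dY (Suc n) (g' (dX (Suc (Suc n)) x)) = 0[Y n]"
    using lin_zero[OF rmod_mod[OF X] rmod_mod[OF Y] rmap_linear[OF g]] by simp
  qed
  then show "EX g'. G (Suc n) g' & (ALL x:carrier (X (Suc n)). dY (Suc n) (g' x) = g (dX (Suc n) x))"
   using g' by (intro exI[of _ g']) (auto simp: G_def)
 qed
 then obtain g where g: "ALL n. G n (g n) & (ALL x:carrier (X (Suc n)). dY (Suc n) (g (Suc n) x) = g n (dX (Suc n) x))" ..
 have 1: "G n (g n)" for n using g by simp
 have 2: "rmap k A (X n) (Y n) (g n)" for n using 1[of n] by (simp add: G_def)
 have 3: "ALL x:carrier (X 0). eY (g 0 x) = eX x" using 1[of 0] by (simp add: G_def)
 show ?thesis using 2 3 g by (intro exI[of _ g]) simp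
qed

text \<open>A chain map whose values in degree \<open>0\<close> are boundaries is null-homotopic.\<close>

lemma null_homotopy_exists:
 assumes X: "!!n. rmod k A (X n)" and Y: "!!n. rmod k A (Y n)"
  and dX: "!!n. rmap k A (X (Suc n)) (X n) (dX (Suc n))"
  and dXX: "!!n x. x <: X (Suc (Suc n)) ==> dX (Suc n) (dX (Suc (Suc n)) x) = 0[X n]"
  and dY: "!!n. rmap k A (Y (Suc n)) (Y n) (dY (Suc n))"
  and ex: "!!n y. y <: Y (Suc n) ==> dY (Suc n) y = 0[Y n] ==> y : dY (Suc (Suc n)) ` carrier (Y (Suc (Suc n)))"
  and l: "!!n. lifts k A (X n) (Y (Suc n)) (Y n) (dY (Suc n))"
  and E: "!!n. rmap k A (X n) (Y n) (E n)"
  and Ec: "!!n x. x <: X (Suc n) ==> dY (Suc n) (E (Suc n) x) = E n (dX (Suc n) x)"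
  and E0: "!!x. x <: X 0 ==> E 0 x : dY (Suc 0) ` carrier (Y (Suc 0))"
 shows "EX h. (ALL n. rmap k A (X n) (Y (Suc n)) (h n)) & (ALL x:carrier (X 0). dY (Suc 0) (h 0 x) = E 0 x) &
  (ALL n. ALL x:carrier (X (Suc n)). dY (Suc (Suc n)) (h (Suc n) x) = E (Suc n) x -[Y (Suc n)] h n (dX (Suc n) x))"
proof -
 note mY = rmod_mod[OF Y] and mX = rmod_mod[OF X]
 define G where "G n h \<longleftrightarrow> rmap k A (X n) (Y (Suc n)) h &
  (n = 0 --> (ALL x:carrier (X 0). dY (Suc 0) (h x) = E 0 x)) &
  (ALL x:carrier (X (Suc n)). dY (Suc n) (h (dX (Suc n) x)) = E n (dX (Suc n) x))" for n h
 have "EX h. ALL n. G n (h n) &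
   (ALL x:carrier (X (Suc n)). dY (Suc (Suc n)) (h (Suc n) x) = E (Suc n) x -[Y (Suc n)] h n (dX (Suc n) x))"
 proof (rule dependent_nat_choice)
  obtain h where h: "rmap k A (X 0) (Y (Suc 0)) h" "ALL x:carrier (X 0). dY (Suc 0) (h x) = E 0 x"
   using lifts_kernel[OF l E E0] by blast
  then show "EX h. G 0 h" using rmap_closed[OF dX] by (auto simp: G_def)
 next
  fix h n assume G: "G n h"
  then have h: "rmap k A (X n) (Y (Suc n)) h" by (simp add: G_def)
  let ?\<psi> = "%x. E (Suc n) x -[Y (Suc n)] h (dX (Suc n) x)"
  have \<psi>: "rmap k A (X (Suc n)) (Y (Suc n)) ?\<psi>"
   by (intro rmap_diff Y E rmap_comp[OF h dX])
  have "?\<psi> x : dY (Suc (Suc n)) ` carrier (Y (Suc (Suc n)))" if x: "x <: X (Suc n)" for x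
  proof (rule ex[OF rmap_closed[OF \<psi> x]])
   interpret Yn: module k "Y n" by (rule mY)
   have c: "E n (dX (Suc n) x) <: Y n" by (rule rmap_closed[OF E rmap_closed[OF dX x]])
   have "dY (Suc n) (?\<psi> x) = E n (dX (Suc n) x) -[Y n] E n (dX (Suc n) x)"
    using lin_minus[OF mY mY rmap_linear[OF dY] rmap_closed[OF E x]
      rmap_closed[OF h rmap_closed[OF dX x]]] Ec[OF x] G x by (simp add: G_def)
   then show "dY (Suc n) (?\<psi> x) = 0[Y n]" using c by (simp add: Yn.minus_eq_zero_iff)
  qed
  then obtain h' where h': "rmap k A (X (Suc n)) (Y (Suc (Suc n))) h'"
   "ALL x:carrier (X (Suc n)). dY (Suc (Suc n)) (h' x) = ?\<psi> x"
   using lifts_kernel[OF l \<psi>] by blast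
  have "dY (Suc (Suc n)) (h' (dX (Suc (Suc n)) x)) = E (Suc n) (dX (Suc (Suc n)) x)"
   if x: "x <: X (Suc (Suc n))" for x
  proof -
   interpret Yn: module k "Y (Suc n)" by (rule mY)
   have "dY (Suc (Suc n)) (h' (dX (Suc (Suc n)) x)) =
     E (Suc n) (dX (Suc (Suc n)) x) -[Y (Suc n)] h 0[X n]"
    using h'(2) rmap_closed[OF dX x] dXX[OF x] by simp
   then show ?thesis
    using lin_zero[OF mX mY rmap_linear[OF h]] rmap_closed[OF E rmap_closed[OF dX x]]
    by simp
  qed
  then show "EX h'. G (Suc n) h' & (ALL x:carrier (X (Suc n)). dY (Suc (Suc n)) (h' x) = ?\<psi> x)"
   using h' by (intro exI[of _ h']) (auto simp: G_def)
 qed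
 then obtain h where h: "ALL n. G n (h n) &
   (ALL x:carrier (X (Suc n)). dY (Suc (Suc n)) (h (Suc n) x) = E (Suc n) x -[Y (Suc n)] h n (dX (Suc n) x))" ..
 have 1: "G n (h n)" for n using h by simp
 have 2: "rmap k A (X n) (Y (Suc n)) (h n)" for n using 1[of n] by (simp add: G_def)
 have 3: "ALL x:carrier (X 0). dY (Suc 0) (h 0 x) = E 0 x" using 1[of 0] by (simp add: G_def)
 show ?thesis using 2 3 h by (intro exI[of _ h]) simp
qed

lemma projective_resolution_facts:
 assumes "projective_resolution k A R P d e"
 shows "rmod k A (P n)" "projective_rmodule k A (P n)"
  "rmap k A (P (Suc n)) (P n) (d (Suc n))" "rmap k A (P 0) R e"
  "e ` carrier (P 0) = carrier R"
  "x <: P (Suc (Suc n)) ==> d (Suc n) (d (Suc (Suc n)) x) = 0[P n]"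
  "x <: P (Suc 0) ==> e (d (Suc 0) x) = 0[R]"
  "y <: P 0 ==> e y = 0[R] ==> y : d (Suc 0) ` carrier (P (Suc 0))"
  "y <: P (Suc n) ==> d (Suc n) y = 0[P n] ==> y : d (Suc (Suc n)) ` carrier (P (Suc (Suc n)))"
proof -
 note a = assms[unfolded projective_resolution_def]
 show p: "projective_rmodule k A (P n)" for n by (rule spec[OF a[THEN conjunct1]])
 show "rmod k A (P n)" using p[of n] by (simp add: projective_rmodule_def)
 show "rmap k A (P (Suc n)) (P n) (d (Suc n))"
  by (rule spec[OF a[THEN conjunct2, THEN conjunct1]])
 show "rmap k A (P 0) R e" by (rule a[THEN conjunct2, THEN conjunct2, THEN conjunct1])
 show "e ` carrier (P 0) = carrier R"
  by (rule a[THEN conjunct2, THEN conjunct2, THEN conjunct2, THEN conjunct1])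
 have k0: "{x : carrier (P 0). e x = 0[R]} = d (Suc 0) ` carrier (P (Suc 0))" using a by simp
 have kn: "{x : carrier (P (Suc n)). d (Suc n) x = 0[P n]} = d (Suc (Suc n)) ` carrier (P (Suc (Suc n)))" for n
 proof -
  have "ALL n>=1. {x : carrier (P n). d n x = 0[P (n - 1)]} = d (Suc n) ` carrier (P (Suc n))"
   by (rule a[THEN conjunct2, THEN conjunct2, THEN conjunct2, THEN conjunct2, THEN conjunct2])
  from spec[OF this, of "Suc n"] show ?thesis by simp
 qed
 show "x <: P (Suc (Suc n)) ==> d (Suc n) (d (Suc (Suc n)) x) = 0[P n]"
  "y <: P (Suc n) ==> d (Suc n) y = 0[P n] ==> y : d (Suc (Suc n)) ` carrier (P (Suc (Suc n)))"
  using kn[of n] by blast+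
 show "x <: P (Suc 0) ==> e (d (Suc 0) x) = 0[R]"
  "y <: P 0 ==> e y = 0[R] ==> y : d (Suc 0) ` carrier (P (Suc 0))"
  using k0 by blast+
qed

section \<open>The standard resolution\<close>

text \<open>An operator with the face relations of the last degeneracy is, up to sign, a contraction of \<open>b'\<close>.\<close>

lemma (in precyclic) b'_acyclic_degeneracy:
 assumes h: "!!n. lmap k (obj Z n) (obj Z (Suc n)) (h n)"
  and fh: "!!n x. x <: obj Z n ==> face Z (Suc n) n (h n x) = x"
  and fh': "!!n i x. i <= n ==> x <: obj Z (Suc n) ==>
   face Z (Suc (Suc n)) i (h (Suc n) x) = h n (face Z (Suc n) i x)"
  and x: "x <: obj Z n" "n = 0 \<or> hb' Z n x = 0[obj Z (n - 1)]"
 shows "EX y:carrier (obj Z (Suc n)). hb' Z (Suc n) y = x"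
proof -
 have hc: "h n x <: obj Z (Suc n)" if "x <: obj Z n" for n x
  by (rule lin_closed[OF h that])
 have e: "hb' Z (Suc n) (h n x) = signed (obj Z n) n x"
 proof (cases n)
  case 0
  have x0: "x <: obj Z 0" using x(1) 0 by simp
  interpret O: module k "obj Z 0" by (rule obj_mod)
  have "hb' Z (Suc 0) (h 0 x) = signed (obj Z 0) 0 x"
   using x0 hc[OF x0] fh[OF x0] b'_eq[OF hc[OF x0]] by (simp add: signed_even)
  then show ?thesis using 0 by simp
 next
  case (Suc m)
  have xm: "x <: obj Z (Suc m)" using x Suc by simp
  interpret O: module k "obj Z (Suc m)" by (rule obj_mod)
  have bs: "bs (Suc m) j (h (Suc m) x) = h m (bs m j x)" if "j <= Suc m" for j
   using that
  proof (induction j)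
   case 0
   show ?case using lin_zero[OF obj_mod obj_mod h] by simp
  next
   case (Suc j)
   then have c: "bs m j x <: obj Z m" "face Z (Suc m) j x <: obj Z m"
    using xm by (auto intro: bs_closed face_closed)
   show ?case
    using Suc c xm by (simp add: lin_add[OF h] fh' linear_signed[OF obj_mod obj_mod h]
      signed_closed[OF obj_mod])
  qed
  have "bs m (Suc m) x = 0[obj Z m]" using x(2) Suc b'_eq[OF xm] by simp
  then have "bs (Suc m) (Suc m) (h (Suc m) x) = 0[obj Z (Suc m)]"
   using bs[OF order_refl] lin_zero[OF obj_mod obj_mod h] by simp
  then show ?thesis
   using Suc fh[OF xm] b'_eq[OF hc[OF xm]] signed_closed[OF obj_mod xm] by simp
 qed
 have "hb' Z (Suc n) (signed (obj Z (Suc n)) n (h n x)) = signed (obj Z n) n (signed (obj Z n) n x)"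
  by (simp add: linear_signed[OF obj_mod obj_mod b'_linear hc[OF x(1)]] e)
 also have "... = x" using x by (simp add: signed_signed[OF obj_mod] signed_even)
 finally show ?thesis using signed_closed[OF obj_mod hc[OF x(1)]] by blast
qed

context hopf_algebra
begin

definition Tc where
 "Tc = \<lparr>obj = (%n. T' n), face = fc, degen = (%n i. comult_at k H n i), cyc = (%n. rt n 1[H])\<rparr>"

lemma Tc_simps [simp]: "obj Tc n = T' n" "face Tc n i = fc n i" "cyc Tc n = rt n 1[H]"
 by (simp_all add: Tc_def)

lemma Tc_precyclic: "precyclic k Tc"
proof (rule precyclic.intro)
 fix n and x assume "x <: obj Tc (Suc n)"
 then show "face Tc (Suc n) 0 (cyc Tc (Suc n) x) = face Tc (Suc n) (Suc n) x"
  by (simp add: fc_rt_0 counit_one module.smult_one[OF T_mod] fc_closed)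
qed (simp_all add: T_mod fc_linear rt_linear fc_fc fc_rt rt_order del: funpow.simps)

sublocale Tc: precyclic k Tc
 by (rule Tc_precyclic)

definition eps where "eps = lift k (ground_module k) (%hs. eH (hs ! 0))"

lemma eps_multilin: "multilin k H (Suc 0) (ground_module k) (%hs. eH (hs ! 0))"
proof (rule multilinI)
 show "lmap k H (ground_module k) (%x. eH ((us @ x # vs) ! 0))"
  if "Suc (length us + length vs) = Suc 0" for us vs
  using that counit_linear by simp
qed (auto simp: eps_cl subset_iff)

lemma eps_linear: "lmap k (T' 0) (ground_module k) eps"
 unfolding eps_def by (rule tpow_lift_linear[OF module_k eps_multilin])

lemma word_1: "length vs = Suc 0 ==> EX a. vs = [a]"
 by (auto simp: length_Suc_conv)

lemma eps_ptens: "a <: H ==> eps (pH [a]) = eH a"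
 unfolding eps_def using tpow_lift_ptens[OF module_k eps_multilin, of "[a]"] by simp

lemma eps_closed: "t <: T' 0 ==> eps t <: k"
 using lin_closed[OF eps_linear] by simp

lemma fc_eps: "t <: T' 0 ==> fc 0 0 t = eps t .[T 0] pH []"
 by (rule tpow_linear_ext[OF T_mod fc_linear scalar_lin[OF T_mod eps_linear nil_closed]])
  (auto dest!: word_1 simp: eps_ptens fc_ptens)

lemma trivial_simps:
 "carrier (trivial_rmodule k H) = carrier k" "add (trivial_rmodule k H) = add k"
 "zero (trivial_rmodule k H) = zero k" "smult (trivial_rmodule k H) = mult k"
 "ract (trivial_rmodule k H) c h = c *[k] eH h"
 by (simp_all add: trivial_rmodule_def module.extend_def rmodule.fields_def)

lemma module_trivial: "module k (trivial_rmodule k H)"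
 by (rule module_transfer[OF module_k]) (simp_all add: trivial_simps)

lemma right_module_trivial: "rmod k H (trivial_rmodule k H)"
proof (intro right_module.intro right_module_axioms.intro module_trivial)
 show "lmap k (trivial_rmodule k H) (trivial_rmodule k H) (%x. ract (trivial_rmodule k H) x a)"
  if "a <: H" for a
  using that eps_cl by (intro linI) (auto simp: trivial_simps R.l_distr R.m_assoc)
 show "lmap k H (trivial_rmodule k H) (ract (trivial_rmodule k H) x)"
  if "x <: trivial_rmodule k H" for x
  using that eps_cl lin_add[OF counit_linear] lin_smult[OF counit_linear]
  by (intro linI) (auto simp: trivial_simps R.r_distr R.m_ac)
qed (auto simp: trivial_simps counit_mult eps_cl R.m_assoc counit_one)

lemma eps_rmodule_map: "rmap k H (Dg 0) (trivial_rmodule k H) eps"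
proof -
 have "lmap k (Dg 0) (trivial_rmodule k H) eps"
  using eps_linear by (simp add: linear_map_def diag_simps trivial_simps)
 moreover have "eps (tm (Suc 0) t (it (Suc 0) h)) = eps t *[k] eH h"
  if t: "t <: T' 0" and h: "h <: H" for t h
 proof (rule tpow_linear_ext[OF module_k _ _ _ t, where f = "%t. eps (tm (Suc 0) t (it (Suc 0) h))"])
  show "lmap k (T' 0) (ground_module k) (%t. eps (tm (Suc 0) t (it (Suc 0) h)))"
   using h by (intro lin_comp[OF eps_linear] lin_tm lin_id it_closed)
  show "lmap k (T' 0) (ground_module k) (%t. eps t *[k] eH h)"
   using scalar_lin[OF module_k eps_linear, of "eH h"] h by (simp add: eps_cl)
  show "eps (tm (Suc 0) (pH vs) (it (Suc 0) h)) = eps (pH vs) *[k] eH h"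
   if "set vs <= carrier H" "length vs = Suc 0" for vs
   using that h word_1[of vs] by (auto simp: it.simps tm_ptens eps_ptens counit_mult)
 qed
 ultimately show ?thesis by (simp add: rmodule_map_def diag_simps trivial_simps)
qed

lemma fc_rmodule_map: "i <= Suc n ==> rmap k H (Dg (Suc n)) (Dg n) (fc (Suc n) i)"
 using fc_linear[of i "Suc n"]
 by (auto simp: rmodule_map_def diag_linear diag_simps fc_tm it_closed fc_it)

lemma signed_rmodule_map:
 "rmod k A Y ==> rmap k A X Y f ==> rmap k A X Y (%x. signed Y j (f x))"
 using rmap_uminus by (cases "even j") (auto simp: signed_def)

lemma diag_a_inv: "t <: T' n ==> -[Dg n] t = -[T' n] t"
proof -
 interpret M1: module k "Dg n" by (rule module_diag)
 interpret M2: module k "T' n" by (rule T_mod)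
 assume t: "t <: T' n"
 show ?thesis using t M2.l_neg[OF t] by (intro M1.minus_equality) (auto simp: diag_simps)
qed

lemma diag_minus: "s <: T' n ==> t <: T' n ==>
  s -[Dg n] t = s -[T' n] t"
 by (simp add: a_minus_def diag_a_inv diag_simps)

lemma diag_signed: "t <: T' n ==> signed (Dg n) j t = signed (T' n) j t"
 by (simp add: signed_def diag_a_inv)

lemma rmap_cong:
 assumes "rmod k A X" "!!x. x <: X ==> f x = g x" "rmap k A X Y g"
 shows "rmap k A X Y f"
proof -
 have "lmap k X Y f \<longleftrightarrow> lmap k X Y g"
  by (rule lin_cong[OF rmod_mod[OF assms(1)] assms(2)])
 then show ?thesis using assms ract_closed[OF assms(1)] by (simp add: rmodule_map_def)
qed

lemma bs_rmodule_map:
 "j <= Suc (Suc n) ==> rmap k H (Dg (Suc n)) (Dg n) (Tc.bs n j)"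
proof (induction j)
 case 0
 show ?case using rmap_zero[OF rmod_diag] by (simp add: Tc.bs.simps[abs_def] diag_simps)
next
 case (Suc j)
 have "rmap k H (Dg (Suc n)) (Dg n)
   (%x. Tc.bs n j x +[Dg n] signed (Dg n) j (fc (Suc n) j x))"
  using Suc by (intro rmap_plus rmod_diag signed_rmodule_map fc_rmodule_map) auto
 then show ?case
  by (rule rmap_cong[OF rmod_diag, rotated])
   (use Suc.prems in \<open>simp add: diag_simps diag_signed fc_closed\<close>)
qed

lemma b_rmodule_map: "rmap k H (Dg (Suc n)) (Dg n) (hb Tc (Suc n))"
 by (rule rmap_cong[OF rmod_diag _ bs_rmodule_map[of "Suc (Suc n)"]])
  (use Tc.b_eq in \<open>auto simp: diag_simps simp del: Tc.bs.simps\<close>)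

lemma b'_rmodule_map: "rmap k H (Dg (Suc n)) (Dg n) (hb' Tc (Suc n))"
 by (rule rmap_cong[OF rmod_diag _ bs_rmodule_map[of "Suc n"]])
  (use Tc.b'_eq in \<open>auto simp: diag_simps simp del: Tc.bs.simps\<close>)

text \<open>Inserting \<open>1\<close> in front is a contraction of the standard complex.\<close>

lemma bs_cns:
 assumes "j <= Suc (Suc n)" "x <: T' (Suc n)"
 shows "Tc.bs (Suc n) (Suc j) (cns (Suc (Suc n)) 1[H] x) =
  x -[T' (Suc n)] cns (Suc n) 1[H] (Tc.bs n j x)"
 using assms(1)
proof (induction j)
 case 0
 interpret M: module k "T' (Suc n)" by (rule T_mod)
 have "cns (Suc n) 1[H] 0[T' n] = 0[T' (Suc n)]"
  by (rule lin_zero[OF T_mod T_mod bil_right[OF cns_bilin one_closed]])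
 then show ?case using assms(2) by (simp add: fc_cns_0 counit_one signed_even)
next
 case (Suc j)
 interpret M: module k "T' (Suc n)" by (rule T_mod)
 let ?c = "cns (Suc n) 1[H]"
 have cl: "lmap k (T' n) (T' (Suc n)) ?c" by (rule bil_right[OF cns_bilin one_closed])
 have c: "fc (Suc n) j x <: T' n" "Tc.bs n j x <: T' n"
  using Suc.prems assms(2) Tc.bs_closed[of j n x] fc_closed[of j "Suc n" x] by auto
 have cc: "?c (fc (Suc n) j x) <: T' (Suc n)" "?c (Tc.bs n j x) <: T' (Suc n)"
  "signed (T' (Suc n)) j (?c (fc (Suc n) j x)) <: T' (Suc n)"
  using c by (auto intro!: lin_closed[OF cl] signed_closed[OF T_mod])
 have "Tc.bs (Suc n) (Suc (Suc j)) (cns (Suc (Suc n)) 1[H] x) =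
   (x -[T' (Suc n)] ?c (Tc.bs n j x)) +[T' (Suc n)]
    signed (T' (Suc n)) (Suc j) (?c (fc (Suc n) j x))"
  using Suc assms(2) fc_cns[of j "Suc n" x "1[H]"] by simp
 also have "signed (T' (Suc n)) (Suc j) (?c (fc (Suc n) j x)) =
   -[T' (Suc n)] signed (T' (Suc n)) j (?c (fc (Suc n) j x))"
  by (rule signed_Suc[OF T_mod cc(1)])
 also have "signed (T' (Suc n)) j (?c (fc (Suc n) j x)) = ?c (signed (T' n) j (fc (Suc n) j x))"
  by (rule linear_signed[OF T_mod T_mod cl c(1), symmetric])
 also have "(x -[T' (Suc n)] ?c (Tc.bs n j x)) +[T' (Suc n)]
   -[T' (Suc n)] ?c (signed (T' n) j (fc (Suc n) j x)) =
   x -[T' (Suc n)] ?c (Tc.bs n (Suc j) x)"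
 proof -
  have s: "signed (T' n) j (fc (Suc n) j x) <: T' n"
   by (rule signed_closed[OF T_mod c(1)])
  show ?thesis
   using assms(2) cc lin_closed[OF cl s]
   by (simp add: lin_add[OF cl c(2) s] a_minus_def M.minus_add M.a_assoc)
 qed
 finally show ?case .
qed

lemma standard_exact:
 assumes "x <: T' (Suc n)" "hb Tc (Suc n) x = 0[T' n]"
 shows "hb Tc (Suc (Suc n)) (cns (Suc (Suc n)) 1[H] x) = x"
proof -
 interpret M: module k "T' (Suc n)" by (rule T_mod)
 have c: "cns (Suc (Suc n)) 1[H] x <: (T (Suc (Suc (Suc n))))" using assms(1) by (simp add: cns_closed)
 have "Tc.bs n (Suc (Suc n)) x = 0[T' n]" using Tc.b_eq[of x n] assms by simp
 moreover have "cns (Suc n) 1[H] 0[T' n] = 0[T' (Suc n)]"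
  by (rule lin_zero[OF T_mod T_mod bil_right[OF cns_bilin one_closed]])
 ultimately show ?thesis
  using Tc.b_eq[of "cns (Suc (Suc n)) 1[H] x" "Suc n"] c bs_cns[OF order_refl assms(1)] assms(1)
  by (simp del: Tc.bs.simps)
qed

lemma standard_exact_0:
 assumes "x <: T' 0" "eps x = 0[k]"
 shows "hb Tc (Suc 0) (cns (Suc 0) 1[H] x) = x"
proof -
 interpret M: module k "T' 0" by (rule T_mod)
 interpret M0: module k "T 0" by (rule T_mod)
 have "fc 0 0 x = 0[T 0]" using assms by (simp add: fc_eps M0.smult_l_null nil_closed)
 then have "fc (Suc 0) (Suc 0) (cns (Suc 0) 1[H] x) = cns 0 1[H] 0[T 0]"
  using fc_cns[of 0 0 x "1[H]"] assms by simp
 also have "... = 0[T' 0]"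
  by (rule lin_zero[OF T_mod T_mod bil_right[OF cns_bilin one_closed]])
 finally show ?thesis
  using Tc.b_eq[of "cns (Suc 0) 1[H] x" 0] assms
  by (simp add: cns_closed fc_cns_0 counit_one signed_def)
qed

lemma eps_b:
 assumes "x <: T' (Suc 0)"
 shows "eps (hb Tc (Suc 0) x) = 0[k]"
proof (rule tpow_linear_ext[OF module_k _ _ _ assms, where g = "%x. 0[k]"])
 interpret M: module k "T' 0" by (rule T_mod)
 show "lmap k (T' (Suc 0)) (ground_module k) (%x. eps (hb Tc (Suc 0) x))"
  using lin_comp[OF eps_linear] Tc.b_linear[of 0] by simp
 show "lmap k (T' (Suc 0)) (ground_module k) (%x. 0[k])"
  using lin_const_zero[OF module_k] by simp
 fix vs assume "set vs <= carrier H" "length vs = Suc (Suc 0)"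
 then obtain a b where v: "vs = [a, b]" "a <: H" "b <: H" by (auto simp: length_Suc_conv)
 have p: "pH [a, b] <: T' (Suc 0)" "pH [a] <: T' 0"
  "pH [b] <: T' 0"
  using v by (auto intro!: ptens_closed)
 have "hb Tc (Suc 0) (pH [a, b]) =
   eH a .[T' 0] pH [b] -[T' 0] eH b .[T' 0] pH [a]"
  using Tc.b_eq[of "pH [a, b]" 0] p v by (simp add: fc_ptens signed_def smult_T eps_cl a_minus_def)
 then have "eps (hb Tc (Suc 0) (pH [a, b])) = eH a *[k] eH b -[ground_module k] eH b *[k] eH a"
  using p v by (simp add: lin_minus[OF T_mod module_k eps_linear] smult_T eps_cl
    lin_smult[OF eps_linear] eps_ptens)
 also have "... = 0[k]"
  using abelian_group.minus_eq_zero_iff[OF module_ab[OF module_k]] v eps_cl R.m_comm by simp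
 finally show "eps (hb Tc (Suc 0) (pH vs)) = 0[k]" using v by simp
qed

subsection \<open>Cocommutative Hopf algebras\<close>

context
 assumes cc: "cocommutative k H"
begin

lemma rt_rmodule_map: "rmap k H (Dg n) (Dg n) (rt n 1[H])"
 using rt_linear[OF one_closed, of n]
 by (auto simp: rmodule_map_def diag_linear diag_simps rt_tm it_closed rt_it[OF cc])

lemma t_rmodule_map: "rmap k H (Dg n) (Dg n) (signed_cyc Tc n)"
 by (rule rmap_cong[OF rmod_diag _ signed_rmodule_map[OF rmod_diag rt_rmodule_map]])
  (auto simp: signed_cyc_def diag_simps diag_signed rt_closed)

lemma t_power_rmodule_map: "rmap k H (Dg n) (Dg n) (signed_cyc Tc n ^^ j)"
proof (induction j)
 case 0
 show ?case using rmap_id by (simp add: id_def)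
next
 case (Suc j)
 show ?case using rmap_comp[OF t_rmodule_map Suc] by (simp add: comp_def)
qed

lemma N_rmodule_map: "rmap k H (Dg n) (Dg n) (cyclic_norm Tc n)"
proof -
 have "cyclic_norm Tc n (tm (Suc n) x (it (Suc n) h)) = tm (Suc n) (cyclic_norm Tc n x) (it (Suc n) h)"
  if x: "x <: T' n" and h: "h <: H" for x h
 proof -
  have "cyclic_norm Tc n (tm (Suc n) x (it (Suc n) h)) =
    (\<Oplus>\<^bsub>T' n\<^esub>j\<in>{..n}. tm (Suc n) ((signed_cyc Tc n ^^ j) x) (it (Suc n) h))"
   unfolding cyclic_norm_def Tc_simps
   using rmap_ract[OF t_power_rmodule_map, of x n h] x h by (intro sum_cong) (simp add: diag_simps)
  also have "... = tm (Suc n) (cyclic_norm Tc n x) (it (Suc n) h)"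
   unfolding cyclic_norm_def Tc_simps using Tc.t_power_closed[of x n] x h
   by (intro lin_finsum[OF T_mod T_mod bil_left[OF tm_bilin it_closed], symmetric]) auto
  finally show ?thesis .
 qed
 then show ?thesis using Tc.N_linear[of n] by (simp add: rmodule_map_def diag_linear diag_simps)
qed

lemma vert_rmodule_map: "rmap k H (Dg (Suc n)) (Dg n) (Tc.vert p (Suc n))"
proof (cases "even p")
 case True
 then show ?thesis using b_rmodule_map by (simp add: tsygan_vert_def[abs_def])
next
 case False
 have "rmap k H (Dg (Suc n)) (Dg n)
   (%x. -[Dg n] hb' Tc (Suc n) x)"
  by (intro rmap_uminus rmod_diag b'_rmodule_map)
 then show ?thesis
  by (rule rmap_cong[OF rmod_diag, rotated])
   (use False lin_closed[OF Tc.b'_linear] in \<open>simp add: tsygan_vert_def diag_simps diag_a_inv\<close>)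
qed

lemma hor_rmodule_map: "rmap k H (Dg n) (Dg n) (Tc.hor p n)"
proof (cases "odd p")
 case False
 then show ?thesis using N_rmodule_map by (simp add: tsygan_hor_def[abs_def])
next
 case True
 have "rmap k H (Dg n) (Dg n) (%x. x -[Dg n] signed_cyc Tc n x)"
  by (intro rmap_diff rmod_diag rmap_id t_rmodule_map)
 then show ?thesis
  by (rule rmap_cong[OF rmod_diag, rotated])
   (use True Tc.t_closed in \<open>simp add: tsygan_hor_def diag_simps diag_minus\<close>)
qed

text \<open>The total complex of the Tsygan double complex of the standard resolution maps to every
  projective resolution of \<open>k\<close>, over the augmentation of its component in bidegree \<open>(0, 0)\<close>.\<close>

lemma tsygan_to_resolution:
 assumes k: "field k" and P: "projective_resolution k H (trivial_rmodule k H) P d e"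
 shows "EX \<phi>. (ALL p q. rmap k H (Dg q) (P (p + q)) (\<phi> p q)) &
  (ALL x:carrier (T' 0). e (\<phi> 0 0 x) = eps x) &
  (ALL p q m. ALL x:carrier (T' q). p + q = Suc m --> d (Suc m) (\<phi> p q x) =
    (if q = 0 then 0[P m] else \<phi> p (q - 1) (Tc.vert p q x)) +[P m]
    (if p = 0 then 0[P m] else \<phi> (p - 1) q (Tc.hor p q x)))"
proof -
 note PR = projective_resolution_facts[OF P]
 note mP = rmod_mod[OF PR(1)]
 interpret Pm: module k "P n" for n by (rule mP)
 let ?D = "%q. Dg q"
 define \<psi> where "\<psi> m F p x =
   (if Suc m - p = 0 then 0[P m] else F p (Tc.vert p (Suc m - p) x)) +[P m]
   (if p = 0 then 0[P m] else F (p - 1) (Tc.hor p (Suc m - p) x))" for m F p x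
 define Lin where "Lin m F \<longleftrightarrow> (ALL p<=m. rmap k H (?D (m - p)) (P m) (F p))" for m F
 define G where "G m F \<longleftrightarrow> Lin m F & (m = 0 --> (ALL x:carrier (T' 0). e (F 0 x) = eps x)) &
  (ALL p<=Suc m. ALL x:carrier (T' (Suc m - p)). \<psi> m F p x : d (Suc m) ` carrier (P (Suc m)))" for m F
 have \<psi>l: "rmap k H (?D (Suc m - p)) (P m) (\<psi> m F p)" if L: "Lin m F" and p: "p <= Suc m" for m F p
 proof -
  have "rmap k H (?D (Suc m - p)) (P m)
    (%x. if Suc m - p = 0 then 0[P m] else F p (Tc.vert p (Suc m - p) x))"
  proof (cases "p = Suc m")
   case True
   then show ?thesis using rmap_zero[OF PR(1)] by simp
  next
   case False
   then have e: "Suc m - p = Suc (m - p)" "p <= m" using p by auto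
   have "rmap k H (?D (m - p)) (P m) (F p)" using L e(2) by (simp add: Lin_def)
   from rmap_comp[OF this vert_rmodule_map] show ?thesis by (simp add: e(1))
  qed
  moreover have "rmap k H (?D (Suc m - p)) (P m)
    (%x. if p = 0 then 0[P m] else F (p - 1) (Tc.hor p (Suc m - p) x))"
  proof (cases p)
   case 0
   then show ?thesis using rmap_zero[OF PR(1)] by simp
  next
   case (Suc r)
   have "rmap k H (?D (m - r)) (P m) (F r)" using L Suc p by (simp add: Lin_def)
   from rmap_comp[OF this hor_rmodule_map] show ?thesis by (simp add: Suc)
  qed
  ultimately show ?thesis unfolding \<psi>_def[abs_def] by (intro rmap_plus PR(1))
 qed
 \<comment> \<open>The obstruction to the next step is a cycle, because the Tsygan differentials square to zero.\<close>
 have cyc: "(if Suc (Suc m) - p = 0 then 0[P m] else \<psi> m F p (Tc.vert p (Suc (Suc m) - p) x)) +[P m]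
   (if p = 0 then 0[P m] else \<psi> m F (p - 1) (Tc.hor p (Suc (Suc m) - p) x)) = 0[P m]"
  if L: "Lin m F" and p: "p <= Suc (Suc m)" and x: "x <: (T (Suc (Suc (Suc m) - p)))" for m F p x
 proof -
  define q where "q = Suc (Suc m) - p"
  have pq: "p + q = Suc (Suc m)" and xq: "x <: T' q" using p x by (auto simp: q_def)
  have Fl: "lmap k (T' s) (P m) (F r)" if "r + s = m" for r s
  proof -
   have "m - r = s" "r <= m" using that by auto
   then have "rmap k H (?D s) (P m) (F r)" using L by (auto simp: Lin_def)
   then show ?thesis using rmap_linear by (simp add: rmodule_map_def diag_linear)
  qed
  have vz: "Tc.vert a (Suc s) y <: T' s" if "y <: T' (Suc s)" for a s y
   using Tc.vert_closed[of y s a] that by simp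
  have hz: "Tc.hor a s y <: T' s" if "y <: T' s" for a s y
   using Tc.hor_closed[of y s a] that by simp
  have F0: "F r 0[T' s] = 0[P m]" if "r + s = m" for r s
   by (rule lin_zero[OF T_mod mP Fl[OF that]])
  consider (a) "p = 0" "q = Suc (Suc m)" | (b) "q = 0" "p = Suc (Suc m)" | (c) "p = Suc 0" "q = Suc m"
   | (d) "q = Suc 0" "p = Suc m" | (e) r s where "p = Suc (Suc r)" "q = Suc (Suc s)" "r + s + 2 = m" "m >= 2"
   using pq by (cases p; cases "p - 1"; cases q; cases "q - 1") auto
  then show ?thesis
  proof cases
   case a
   have "Tc.vert 0 (Suc m) (Tc.vert 0 (Suc (Suc m)) x) = 0[T' m]"
    using Tc.vert_vert[of x m 0] xq a by simp
   then show ?thesis using a F0[of 0 m] by (simp add: \<psi>_def)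
  next
   case b
   have "Tc.hor (Suc m) 0 (Tc.hor (Suc (Suc m)) 0 x) = 0[T' 0]"
    using Tc.hor_hor[of x 0 "Suc m"] xq b by simp
   then show ?thesis using b F0[of m 0] by (simp add: \<psi>_def)
  next
   case c
   have xs: "x <: T' (Suc m)" using xq c by simp
   have hv: "Tc.hor (Suc 0) m (Tc.vert (Suc 0) (Suc m) x) +[T' m]
     Tc.vert 0 (Suc m) (Tc.hor (Suc 0) (Suc m) x) = 0[T' m]"
    using Tc.hor_vert[of x m 0] xs by simp
   show ?thesis
   proof (cases m)
    case 0
    then show ?thesis
     using c hv F0[of 0 m] vz[OF hz[OF xs]] hz[OF vz[OF xs]] lin_add[OF Fl[of 0 m], symmetric]
      lin_closed[OF Fl[of 0 m]]
     by (simp add: \<psi>_def)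
   next
    case (Suc l)
    have "Tc.vert (Suc 0) m (Tc.vert (Suc 0) (Suc m) x) = 0[T' l]"
     using Tc.vert_vert[of x l "Suc 0"] xs Suc by simp
    then show ?thesis
     using c hv F0[of 0 m] F0[of "Suc 0" l] vz[OF hz[OF xs]] hz[OF vz[OF xs]] Suc
      lin_add[OF Fl[of 0 m], symmetric] lin_closed[OF Fl[of 0 m]]
     by (simp add: \<psi>_def)
   qed
  next
   case d
   have xs: "x <: T' (Suc 0)" using xq d by simp
   have hv: "Tc.hor (Suc m) 0 (Tc.vert (Suc m) (Suc 0) x) +[T' 0]
     Tc.vert m (Suc 0) (Tc.hor (Suc m) (Suc 0) x) = 0[T' 0]"
    using Tc.hor_vert[of x 0 m] xs by simp
   show ?thesis
   proof (cases m)
    case 0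
    then show ?thesis
     using d hv F0[of 0 0] vz[OF hz[OF xs]] hz[OF vz[OF xs]] lin_add[OF Fl[of 0 0], symmetric]
      lin_closed[OF Fl[of 0 0]]
     by (simp add: \<psi>_def)
   next
    case (Suc l)
    have "Tc.hor (Suc l) (Suc 0) (Tc.hor (Suc (Suc l)) (Suc 0) x) = 0[T' (Suc 0)]"
     using Tc.hor_hor[of x "Suc 0" "Suc l"] xs by simp
    then show ?thesis
     using d hv F0[of m 0] F0[of l "Suc 0"] vz[OF hz[OF xs]] hz[OF vz[OF xs]] Suc
      lin_add[OF Fl[of m 0], symmetric] lin_closed[OF Fl[of m 0]]
     by (simp add: \<psi>_def)
   qed
  next
   case (e r s)
   have xs: "x <: (T (Suc (Suc (Suc s))))" using xq e by simp
   have m: "m = Suc (Suc (r + s))" using e by simp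
   have hv: "Tc.hor (Suc (Suc r)) (Suc s) (Tc.vert (Suc (Suc r)) (Suc (Suc s)) x) +[T' (Suc s)]
     Tc.vert (Suc r) (Suc (Suc s)) (Tc.hor (Suc (Suc r)) (Suc (Suc s)) x) = 0[T' (Suc s)]"
    using Tc.hor_vert[of x "Suc s" "Suc r"] xs by simp
   have hh: "Tc.hor (Suc r) (Suc (Suc s)) (Tc.hor (Suc (Suc r)) (Suc (Suc s)) x) = 0[T (Suc (Suc (Suc s)))]"
    using Tc.hor_hor[of x "Suc (Suc s)" "Suc r"] xs by simp
   have vv: "Tc.vert (Suc (Suc r)) (Suc s) (Tc.vert (Suc (Suc r)) (Suc (Suc s)) x) = 0[T' s]"
    using Tc.vert_vert[of x s "Suc (Suc r)"] xs by simp
   have i: "Suc (r + s) - r = Suc s" "Suc (Suc (r + s)) - r = Suc (Suc s)" "Suc (Suc (Suc (r + s))) - r = Suc (Suc (Suc s))" by auto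
   show ?thesis
    using e(1,2) hv hh vv m i F0[of "Suc r" "Suc s"] F0[of r "Suc (Suc s)"] F0[of "Suc (Suc r)" s]
     vz[OF hz[OF xs]] hz[OF vz[OF xs]]
     lin_add[OF Fl[of "Suc r" "Suc s"], symmetric] lin_closed[OF Fl[of "Suc r" "Suc s"]]
    by (simp add: \<psi>_def)
  qed
 qed
 have "EX F. ALL m. G m (F m) & (ALL p<=Suc m. ALL x:carrier (T' (Suc m - p)). d (Suc m) (F (Suc m) p x) = \<psi> m (F m) p x)"
 proof (rule dependent_nat_choice)
  have l: "lifts k H (?D 0) (P 0) (trivial_rmodule k H) e"
   by (rule diag_lifts[OF k PR(1) right_module_trivial PR(4)])
  obtain f where f: "rmap k H (?D 0) (P 0) f" "ALL x:carrier (?D 0). e (f x) = eps x"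
   using lifts_kernel[OF l eps_rmodule_map] rmap_closed[OF eps_rmodule_map] PR(5) by blast
  define F where "F = (%p::nat. f)"
  have L: "Lin 0 F" using f by (simp add: Lin_def F_def)
  have "\<psi> 0 F p x : d (Suc 0) ` carrier (P (Suc 0))" if p: "p <= Suc 0" and x: "x <: T' (Suc 0 - p)" for p x
  proof (rule PR(8))
   show "\<psi> 0 F p x <: P 0"
    using rmap_closed[OF \<psi>l[OF L p]] x by (simp add: diag_simps)
   consider "p = 0" | "p = Suc 0" using p by linarith
   then show "e (\<psi> 0 F p x) = 0[trivial_rmodule k H]"
   proof cases
    case 1
    have c: "hb Tc (Suc 0) x <: T' 0"
     using lin_closed[OF Tc.b_linear, of x 0] x 1 by simp
    have "\<psi> 0 F p x = f (hb Tc (Suc 0) x)"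
     using 1 c rmap_closed[OF f(1)] by (simp add: \<psi>_def F_def tsygan_vert_def diag_simps)
    then show ?thesis using f(2) c eps_b[of x] x 1 by (simp add: diag_simps trivial_simps)
   next
    case 2
    then have x1: "x <: T' 0" using x by simp
    interpret M: module k "T' 0" by (rule T_mod)
    have "signed_cyc Tc 0 x = x" using Tc.cyc_order[of x 0] x1 by (simp add: signed_cyc_def signed_even)
    then have "Tc.hor (Suc 0) 0 x = 0[T' 0]"
     using x1 by (simp add: tsygan_hor_def M.minus_eq_zero_iff)
    then have "\<psi> 0 F p x = f 0[T' 0]" "f 0[T' 0] <: P 0"
     using 2 rmap_closed[OF f(1)] by (simp_all add: \<psi>_def F_def diag_simps)
    then show ?thesis
     using f(2) lin_zero[OF T_mod module_k eps_linear] by (simp add: diag_simps trivial_simps)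
   qed
  qed
  then show "EX F. G 0 F" using L f(2) by (intro exI[of _ F]) (auto simp: G_def F_def diag_simps)
 next
  fix F m assume GF: "G m F"
  then have L: "Lin m F" by (simp add: G_def)
  have "EX f. rmap k H (?D (Suc m - p)) (P (Suc m)) f & (ALL x:carrier (?D (Suc m - p)). d (Suc m) (f x) = \<psi> m F p x)"
   if p: "p <= Suc m" for p
   using GF p by (intro lifts_kernel[OF diag_lifts[OF k PR(1) PR(1) PR(3)] \<psi>l[OF L p]]) (simp add: G_def diag_simps)
  then obtain F' where F': "!!p. p <= Suc m ==> rmap k H (?D (Suc m - p)) (P (Suc m)) (F' p) &
    (ALL x:carrier (?D (Suc m - p)). d (Suc m) (F' p x) = \<psi> m F p x)" by metis
  have L': "Lin (Suc m) F'" using F' by (simp add: Lin_def)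
  have rel: "d (Suc m) (F' p x) = \<psi> m F p x" if "p <= Suc m" "x <: T' (Suc m - p)" for p x
   using F' that by (simp add: diag_simps)
  have "\<psi> (Suc m) F' p x : d (Suc (Suc m)) ` carrier (P (Suc (Suc m)))"
   if p: "p <= Suc (Suc m)" and x: "x <: (T (Suc (Suc (Suc m) - p)))" for p x
  proof (rule PR(9))
   show "\<psi> (Suc m) F' p x <: P (Suc m)"
    using rmap_closed[OF \<psi>l[OF L' p]] x by (simp add: diag_simps)
   define a where "a = (if Suc (Suc m) - p = 0 then 0[P (Suc m)] else F' p (Tc.vert p (Suc (Suc m) - p) x))"
   define b where "b = (if p = 0 then 0[P (Suc m)] else F' (p - 1) (Tc.hor p (Suc (Suc m) - p) x))"
   note dl = rmap_linear[OF PR(3)]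
   have d0: "d (Suc m) 0[P (Suc m)] = 0[P m]" by (rule lin_zero[OF mP mP dl])
   have a: "a <: P (Suc m) & d (Suc m) a =
     (if Suc (Suc m) - p = 0 then 0[P m] else \<psi> m F p (Tc.vert p (Suc (Suc m) - p) x))"
   proof (cases "Suc (Suc m) - p = 0")
    case True
    then show ?thesis using d0 by (simp add: a_def)
   next
    case False
    then have i: "Suc (Suc m) - p = Suc (Suc m - p)" "p <= Suc m" using p by auto
    have v: "Tc.vert p (Suc (Suc m - p)) x <: T' (Suc m - p)"
     using Tc.vert_closed[of x "Suc m - p" p] x i by simp
    have "F' p (Tc.vert p (Suc (Suc m - p)) x) <: P (Suc m)"
     using F'[OF i(2)] v rmap_closed by (fastforce simp: diag_simps)
    then show ?thesis using False i rel[OF i(2) v] by (simp add: a_def)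
   qed
   have b: "b <: P (Suc m) & d (Suc m) b =
     (if p = 0 then 0[P m] else \<psi> m F (p - 1) (Tc.hor p (Suc (Suc m) - p) x))"
   proof (cases p)
    case 0
    then show ?thesis using d0 by (simp add: b_def)
   next
    case (Suc r)
    then have r: "r <= Suc m" using p by simp
    have h: "Tc.hor p (Suc m - r) x <: T' (Suc m - r)"
     using Tc.hor_closed[of x "Suc m - r" p] x Suc by simp
    have "F' r (Tc.hor p (Suc m - r) x) <: P (Suc m)"
     using F'[OF r] h rmap_closed by (fastforce simp: diag_simps)
    then show ?thesis using Suc rel[OF r h] by (simp add: b_def)
   qed
   have "d (Suc m) (\<psi> (Suc m) F' p x) = d (Suc m) a +[P m] d (Suc m) b"
    unfolding \<psi>_def a_def[symmetric] b_def[symmetric] using a b by (intro lin_add[OF dl]) auto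
   then show "d (Suc m) (\<psi> (Suc m) F' p x) = 0[P m]" using a b cyc[OF L p x] by simp
  qed
  then show "EX F'. G (Suc m) F' & (ALL p<=Suc m. ALL x:carrier (T' (Suc m - p)). d (Suc m) (F' p x) = \<psi> m F p x)"
   using L' rel by (intro exI[of _ F']) (auto simp: G_def)
 qed
 then obtain F where F: "!!m. G m (F m)"
  "!!m p x. p <= Suc m ==> x <: T' (Suc m - p) ==> d (Suc m) (F (Suc m) p x) = \<psi> m (F m) p x" by blast
 define \<phi> where "\<phi> p q = F (p + q) p" for p q
 have 1: "rmap k H (?D q) (P (p + q)) (\<phi> p q)" for p q
 proof -
  have "Lin (p + q) (F (p + q))" using F(1) by (simp add: G_def)
  then have "p <= p + q --> rmap k H (?D (p + q - p)) (P (p + q)) (F (p + q) p)"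
   unfolding Lin_def by (rule spec)
  then show ?thesis by (simp add: \<phi>_def)
 qed
 have 2: "e (\<phi> 0 0 x) = eps x" if "x <: T' 0" for x
  using F(1)[of 0] that by (simp add: G_def \<phi>_def)
 have 3: "d (Suc m) (\<phi> p q x) =
    (if q = 0 then 0[P m] else \<phi> p (q - 1) (Tc.vert p q x)) +[P m]
    (if p = 0 then 0[P m] else \<phi> (p - 1) q (Tc.hor p q x))"
  if x: "x <: T' q" and pq: "p + q = Suc m" for p q m x
 proof -
  have i: "p <= Suc m" "Suc m - p = q" using pq by auto
  have j: "p + (q - 1) = m" if "q ~= 0" using pq that by simp
  have l: "p - 1 + q = m" if "p ~= 0" using pq that by simp
  show ?thesis using F(2)[OF i(1), of x] x i(2) pq j l by (auto simp: \<phi>_def \<psi>_def)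
 qed
 show ?thesis using 1 2 3 by blast
qed

end

end

section \<open>The quotient Hopf algebra\<close>

lemma tpow_cong:
 "carrier V' = carrier V ==> add V' = add V ==> smult V' = smult V ==> tpow k V' n = tpow k V n"
 "carrier V' = carrier V ==> add V' = add V ==> smult V' = smult V ==> ptens k V' vs = ptens k V vs"
 by (simp_all add: tpow_def ptens_def multilinear_rels_def words_def)

locale normal_pair = hopf_algebra k H for k :: "'k ring" and H :: "('k, 'h) hopf" +
 fixes K :: "'h set"
 assumes normal: "normal_hopf_subalgebra k H K"
begin

abbreviation I where "I == aug_ideal k H K"
abbreviation Kp where "Kp == aug k H K"
abbreviation Q where "Q == quot_hopf k H K"
definition pr where "pr h = I +>\<^bsub>H\<^esub> h"

lemma K_sub: "submodule K k H" and K_one: "1[H] : K" and K_mult: "x : K ==> y : K ==> x *[H] y : K"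
 and K_comult: "x : K ==> comult H x : lin_span k (T 2) {pH [a, b] | a b. a : K & b : K}"
 and K_antipode: "x : K ==> antipode H x : K" and I_ideal: "ideal I H"
 using normal by (auto simp: normal_hopf_subalgebra_def hopf_subalgebra_def)

lemma K_closed: "x : K ==> x <: H"
 using submodule_subset[OF K_sub] by blast

lemma aug_D: "x : Kp ==> x : K" "x : Kp ==> x <: H"
 "x : Kp ==> eH x = 0[k]"
 by (auto simp: aug_def K_closed)

lemma aug_gens: "{x *[H] h | x h. x : Kp & h <: H} <= carrier H"
 by (auto simp: aug_D)

lemma I_sub: "submodule I k H"
 unfolding aug_ideal_def by (rule lin_span_submodule[OF module_H aug_gens])

sublocale MQ: module_quotient k H I
 by (intro module_quotient.intro module_quotient_axioms.intro module_H I_sub)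

lemma Q_simps: "carrier Q = carrier MQ.quot" "add Q = add MQ.quot" "zero Q = zero MQ.quot"
 "smult Q = smult MQ.quot" "mult Q = mult MQ.quot" "one Q = one MQ.quot"
 "counit Q = on_coset (eH)" "antipode Q = on_coset (%h. I +>\<^bsub>H\<^esub> antipode H h)"
 by (simp_all add: quot_hopf_def module.extend_def hopf.fields_def Let_def)

lemma comult_Q: "comult Q = on_coset (%h. lift k (tpow k Q 2) (%hs. ptens k Q (map pr hs)) (comult H h))"
proof -
 have e: "tpow k Q n = tpow k MQ.quot n" "ptens k Q vs = ptens k MQ.quot vs" for n vs
  by (rule tpow_cong; simp add: Q_simps)+
 show ?thesis
  unfolding e pr_def[abs_def] by (simp add: quot_hopf_def module.extend_def hopf.fields_def Let_def)
qed

lemma module_Q: "module k Q"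
 by (rule module_transfer[OF MQ.module_quot Q_simps(1-4)])

lemma pr_linear: "lmap k H Q pr"
 unfolding pr_def[abs_def] by (rule lin_transfer[OF MQ.linear_coset]) (simp_all add: Q_simps)

lemmas pr_closed = lin_closed[OF pr_linear]

lemma pr_cases: assumes "X <: Q" obtains h where "h <: H" "X = pr h"
 using assms MQ.quot_cases[of X] by (auto simp: Q_simps pr_def)

lemma pr_mult: "a <: H ==> b <: H ==> pr (a *[H] b) = pr a *[Q] pr b"
 by (simp add: pr_def Q_simps MQ.quot_simps ideal.rcoset_mult_add[OF I_ideal])

lemma pr_one: "pr 1[H] = 1[Q]"
 by (simp add: pr_def Q_simps MQ.quot_simps)

lemma assoc_algebra_Q: "assoc_algebra k Q"
proof -
 interpret Q: module k Q by (rule module_Q)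
 have "ring Q"
 proof (rule ringI)
  show "abelian_group Q" ..
  show "Group.monoid Q"
   by (rule monoidI) (auto elim!: pr_cases simp: pr_mult[symmetric] pr_one[symmetric] pr_closed m_assoc)
 qed (auto elim!: pr_cases simp: pr_mult[symmetric] lin_add[OF pr_linear, symmetric] pr_closed l_distr r_distr)
 then show ?thesis
  by (intro assoc_algebra.intro assoc_algebra_axioms.intro module_Q)
   (auto elim!: pr_cases simp: pr_mult[symmetric] lin_smult[OF pr_linear, symmetric] pr_closed
    smult_mult_left smult_mult_right)
qed

lemma pr_aug: assumes "x : Kp" "h <: H" shows "pr (x *[H] h) = 0[Q]"
proof -
 have "x *[H] h : I"
  unfolding aug_ideal_def using assms by (intro subsetD[OF lin_span_superset]) blast
 then show ?thesis using assms by (simp add: pr_def Q_simps MQ.coset_zero_iff aug_D)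
qed

lemma aug_minus: assumes "x : K" shows "x -[H] eH x .[H] 1[H] : Kp"
proof -
 have xH: "x <: H" using assms by (rule K_closed)
 have e: "eH x .[H] 1[H] : K" by (rule submodule_smult[OF K_sub eps_cl[OF xH] K_one])
 have "x -[H] eH x .[H] 1[H] : K"
  unfolding a_minus_def by (intro submodule_add[OF K_sub] submodule_neg[OF module_H K_sub] assms e)
 moreover have "eH (x -[H] eH x .[H] 1[H]) = 0[k]"
 proof -
  interpret G: module k "ground_module k" by (rule module_k)
  have "eH x -[ground_module k] eH x = 0[ground_module k]"
   using eps_cl[OF xH] G.minus_eq_zero_iff[of "eH x" "eH x"] by simp
  then show ?thesis
   using xH K_closed[OF e] eps_cl[OF xH]
   by (simp add: lin_minus[OF module_H module_k counit_linear] lin_smult[OF counit_linear] counit_one)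
 qed
 ultimately show ?thesis by (simp add: aug_def)
qed

text \<open>The elements of \<open>K\<close> act on the quotient through the counit.\<close>

lemma aug_invariant:
 assumes "module k W" "lmap k H W f" "!!x. x : Kp ==> f x = 0[W]" "x : K"
 shows "f x = eH x .[W] f 1[H]"
proof -
 interpret W: module k W by fact
 have x: "x <: H" using assms(4) by (rule K_closed)
 have "f (x -[H] eH x .[H] 1[H]) = 0[W]" by (rule assms(3)[OF aug_minus[OF assms(4)]])
 then have "f x -[W] eH x .[W] f 1[H] = 0[W]"
  using x by (simp add: lin_minus[OF module_H assms(1,2)] lin_smult[OF assms(2)] eps_cl)
 then show ?thesis
  using x by (simp add: W.minus_eq_zero_iff lin_closed[OF assms(2)] eps_cl)
qed

lemma pr_K: assumes "x : K" "h <: H" shows "pr (x *[H] h) = eH x .[Q] pr h"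
proof -
 have "lmap k H Q (%x. pr (x *[H] h))"
  by (rule lin_comp[OF pr_linear]) (intro lin assms)
 from aug_invariant[OF module_Q this pr_aug[OF _ assms(2)] assms(1)] show ?thesis using assms by simp
qed

lemma on_coset_pr:
 assumes "module k W" "lmap k H W f"
  "!!x h. x : Kp ==> h <: H ==> f (x *[H] h) = 0[W]"
 shows "lmap k Q W (on_coset f)" "h <: H ==> on_coset f (pr h) = f h"
proof -
 have z: "f x = 0[W]" if "x : I" for x
  using that unfolding aug_ideal_def
  by (elim lin_zero_on_span[OF module_H assms(1,2) aug_gens, rotated]) (auto simp: assms(3))
 show "lmap k Q W (on_coset f)"
  by (rule lin_transfer[OF MQ.on_coset_linear[OF assms(1,2) z]]) (simp_all add: Q_simps)
 show "h <: H ==> on_coset f (pr h) = f h"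
  unfolding pr_def by (rule MQ.on_coset_linear_eq[OF assms(1,2) z])
qed

text \<open>Since \<open>K\<close> is a subcoalgebra, the Sweedler components of its elements may be taken in \<open>K\<close>.\<close>

lemma sw_K:
 assumes W: "module k W" and f: "bilin k H H W f" and g: "bilin k H H W g"
  and eq: "!!a b. a : K ==> b : K ==> f a b = g a b" and x: "x : K"
 shows "sw' W f x = sw' W g x"
proof -
 interpret W: module k W by (rule W)
 note L = tpow_lift_linear[OF W sw_multilin]
 have v: "lift k W (%hs. f (hs ! 0) (hs ! Suc 0)) (pH [a, b]) = f a b"
  if "bilin k H H W f" "a : K" "b : K" for f a b
  using tpow_lift_ptens[OF W sw_multilin[OF that(1)], of "[a, b]"] that by (simp add: K_closed)
 let ?S = "{pH [a, b] | a b. a : K & b : K}"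
 have S: "?S <= carrier (T 2)" by (auto intro!: ptens_closed simp: K_closed)
 have "lift k W (%hs. f (hs ! 0) (hs ! 1)) (comult H x) -[W] lift k W (%hs. g (hs ! 0) (hs ! 1)) (comult H x) = 0[W]"
  by (rule lin_zero_on_span[OF T_mod W lin_diff[OF W L[OF f] L[OF g]] S _ K_comult[OF x]])
   (auto simp: v[OF f] v[OF g] K_closed eq bil_closed[OF g] W.minus_eq_zero_iff)
 then show ?thesis
  unfolding sw_def
  using lin_closed[OF L[OF f] comult_closed] lin_closed[OF L[OF g] comult_closed]
  by (simp add: W.minus_eq_zero_iff K_closed x)
qed

lemma pr_bilin: "bilin k Q Q W f ==> bilin k H H W (%a b. f (pr a) (pr b))"
 by (rule bilinI)
  (simp_all add: linear_bilin_right[where f = f, OF _ pr_linear] linear_bilin_left[where f = f, OF _ pr_linear]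
   pr_closed)

text \<open>For \<open>x \<in> K\<close> the elements \<open>\<Delta>(x h)\<close> and \<open>\<epsilon>(x) \<Delta>(h)\<close> agree in the tensor
  square of the quotient.\<close>

lemma sw_pr_aug:
 assumes W: "module k W" and f: "bilin k Q Q W f" and x: "x : Kp" and h: "h <: H"
 shows "sw' W (%a b. f (pr a) (pr b)) (x *[H] h) = 0[W]"
proof -
 interpret W: module k W by (rule W)
 note fb = pr_bilin[OF f]
 note s = lin_smult[OF bil_left[OF f]] lin_smult[OF bil_right[OF f]]
 let ?w = "sw' W (%c d. f (pr c) (pr d)) h"
 have w: "?w <: W" by (rule sw_closed[OF W fb h])
 have b2: "bilin k H H W (%c d. f (pr (a *[H] c)) (pr (b *[H] d)))"
  if "a <: H" "b <: H" for a b
  by (rule bilinI) (rule lin_comp[OF bil_right[OF fb]] lin_comp[OF bil_left[OF fb]];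
   (intro lin)?; simp add: that)+
 have b3: "bilin k H H W (%a b. f (pr (a *[H] c)) (pr (b *[H] d)))"
  if "c <: H" "d <: H" for c d
  by (rule bilinI) (rule lin_comp[OF bil_right[OF fb]] lin_comp[OF bil_left[OF fb]];
   (intro lin)?; simp add: that)+
 have b1: "bilin k H H W (%a b. sw' W (%c d. f (pr (a *[H] c)) (pr (b *[H] d))) h)"
  by (rule bilinI) (rule sw_param[OF module_H W], auto intro: b2 bil_left[OF b3] bil_right[OF b3] simp: h)+
 have b4: "bilin k H H W (%a b. eH a .[W] (eH b .[W] ?w))"
  by (intro bilinI lin) (simp_all add: W w eps_cl)
 have e: "sw' W (%c d. f (pr (a *[H] c)) (pr (b *[H] d))) h = eH a .[W] (eH b .[W] ?w)"
  if ab: "a : K" "b : K" for a b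
 proof -
  have "sw' W (%c d. f (pr (a *[H] c)) (pr (b *[H] d))) h =
    sw' W (%c d. (eH b *[k] eH a) .[W] f (pr c) (pr d)) h"
   by (rule sw_cong[OF h]) (simp add: pr_K ab s pr_closed module.smult_closed[OF module_Q] eps_cl K_closed
     bil_closed[OF f] W.smult_assoc1)
  also have "... = (eH b *[k] eH a) .[W] ?w"
   by (rule sw_hom[OF W W lin_smult_const[OF W lin_id] fb h, symmetric])
    (simp add: ab eps_cl K_closed)
  finally show ?thesis by (simp add: W.smult_assoc1[symmetric] R.m_comm ab eps_cl K_closed w)
 qed
 have "sw' W (%a b. f (pr a) (pr b)) (x *[H] h) =
   sw' W (%a b. sw' W (%c d. f (pr (a *[H] c)) (pr (b *[H] d))) h) x"
  by (rule sw_mult[OF W fb]) (simp_all add: aug_D x h)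
 also have "... = sw' W (%a b. eH a .[W] (eH b .[W] ?w)) x"
  by (rule sw_K[OF W b1 b4 e]) (simp_all add: aug_D x)
 also have "... = eH x .[W] ?w"
  by (rule sw_counit_left[OF W]) (intro lin, simp_all add: W w aug_D x)
 finally show ?thesis by (simp add: aug_D x w)
qed

sublocale TQ: tensor_power k Q
 by (rule tensor_power.intro[OF module_Q])

lemma pq_bilin: "bilin k Q Q (tpow k Q 2) (%X Y. ptens k Q [X, Y])"
 using multilin_linear[OF TQ.ptens_multilin, of "[]" "[_]" 2]
  multilin_linear[OF TQ.ptens_multilin, of "[_]" "[]" 2]
 by (auto intro!: bilinI)

lemma comult_Q_facts:
 shows comult_Q_linear: "lmap k Q (tpow k Q 2) (comult Q)"
  and comult_Q_pr: "h <: H ==> comult Q (pr h) = sw' (tpow k Q 2) (%a b. ptens k Q [pr a, pr b]) h"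
proof -
 let ?D = "%h. lift k (tpow k Q 2) (%hs. ptens k Q (map pr hs)) (comult H h)"
 let ?E = "sw' (tpow k Q 2) (%a b. ptens k Q [pr a, pr b])"
 have e: "?D h = ?E h" if "h <: H" for h
  unfolding sw_def by (rule tpow_lift_cong[OF comult_closed[OF that]]) (auto dest!: word_2)
 have "lmap k H (tpow k Q 2) ?E"
  by (rule sw_linear[OF TQ.T_mod pr_bilin[OF pq_bilin]])
 then have l: "lmap k H (tpow k Q 2) ?D" by (subst lin_cong[OF module_H, where g = ?E]) (rule e)
 have z: "?D (x *[H] h) = 0[tpow k Q 2]" if "x : Kp" "h <: H" for x h
  using sw_pr_aug[OF TQ.T_mod pq_bilin that] that by (simp add: e aug_D)
 show "lmap k Q (tpow k Q 2) (comult Q)"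
  unfolding comult_Q by (rule on_coset_pr(1)[OF TQ.T_mod l z])
 show "comult Q (pr h) = ?E h" if "h <: H"
  unfolding comult_Q using on_coset_pr(2)[OF TQ.T_mod l z that] e[OF that] by simp
qed

text \<open>Sweedler sums in the quotient are computed by lifting to \<open>H\<close>.\<close>

lemma sw_pr:
 assumes W: "module k W" and f: "bilin k Q Q W f" and h: "h <: H"
 shows "sw k Q W f (pr h) = sw' W (%a b. f (pr a) (pr b)) h"
proof -
 have F: "multilin k Q 2 W (%hs. f (hs ! 0) (hs ! 1))" by (rule multilin_2) (simp add: f)
 have v: "lift k W (%hs. f (hs ! 0) (hs ! Suc 0)) (ptens k Q [pr a, pr b]) = f (pr a) (pr b)"
  if "a <: H" "b <: H" for a b
  using TQ.tpow_lift_ptens[OF W F, of "[pr a, pr b]"] that by (simp add: pr_closed)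
 have "sw k Q W f (pr h) = sw' W (%a b. lift k W (%hs. f (hs ! 0) (hs ! 1)) (ptens k Q [pr a, pr b])) h"
  unfolding sw_def[of k Q] comult_Q_pr[OF h]
  by (rule sw_hom[OF TQ.T_mod W TQ.tpow_lift_linear[OF W F] pr_bilin[OF pq_bilin] h])
 also have "... = sw' W (%a b. f (pr a) (pr b)) h"
  by (rule sw_cong[OF h]) (simp add: v)
 finally show ?thesis .
qed

lemma counit_Q_facts:
 shows counit_Q_linear: "lmap k Q (ground_module k) (counit Q)"
  and counit_Q_pr: "h <: H ==> counit Q (pr h) = eH h"
 unfolding Q_simps(7)
 by (rule on_coset_pr[OF module_k counit_linear]; simp add: counit_mult eps_cl aug_D)+

lemma antipode_Q_facts:
 shows antipode_Q_linear: "lmap k Q Q (antipode Q)"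
  and antipode_Q_pr: "h <: H ==> antipode Q (pr h) = pr (antipode H h)"
proof -
 have z: "pr (antipode H (x *[H] h)) = 0[Q]" if x: "x : Kp" and h: "h <: H" for x h
 proof -
  interpret Q: assoc_algebra k Q by (rule assoc_algebra_Q)
  have sx: "antipode H x : K" "antipode H x <: H" by (auto intro: K_antipode antipode_closed simp: aug_D x)
  text \<open>The counit is invariant under the antipode, because \<open>\<epsilon>(S(x)) 1 = \<epsilon>(\<Sum> S(x\<^sub>1) x\<^sub>2) 1\<close>.\<close>
  have "eH (antipode H x) = 0[k]"
  proof -
   have "sw' (ground_module k) (%a b. eH (antipode H a *[H] b)) x = 0[k]"
    using sw_antipode_left[OF module_k counit_linear] by (simp add: aug_D x counit_one)
   moreover have "sw' (ground_module k) (%a b. eH (antipode H a *[H] b)) x =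
     sw' (ground_module k) (%a b. eH b .[ground_module k] eH (antipode H a)) x"
    by (rule sw_cong) (simp_all add: aug_D x counit_mult antipode_closed eps_cl R.m_comm)
   moreover have "... = eH (antipode H x)"
    by (rule sw_counit_right[OF module_k]) (auto intro: lin_comp[OF counit_linear antipode_linear] simp: aug_D x)
   ultimately show ?thesis by simp
  qed
  then have "pr (antipode H x *[H] 1[H]) = 0[Q]"
   by (intro pr_aug) (simp_all add: aug_def sx)
  then show ?thesis
   using x h by (simp add: antipode_mult aug_D pr_mult antipode_closed pr_closed)
 qed
 show "lmap k Q Q (antipode Q)" "h <: H ==> antipode Q (pr h) = pr (antipode H h)"
  unfolding Q_simps(8) pr_def[symmetric]
  by (rule on_coset_pr[OF module_Q lin_comp[OF pr_linear antipode_linear] z]; assumption)+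
qed

end

context normal_pair
begin

interpretation aQ: assoc_algebra k Q by (rule assoc_algebra_Q)

lemma multQ_bilin: "bilin k Q Q Q (mult Q)"
 by (intro bilinI linI) (simp_all add: aQ.l_distr aQ.r_distr aQ.smult_mult_left aQ.smult_mult_right)

lemma swQ_multilin: "bilin k Q Q W f ==> multilin k Q 2 W (%hs. f (hs ! 0) (hs ! 1))"
 by (rule multilin_2) simp

lemma swQ_linear: "module k W ==> bilin k Q Q W f ==> lmap k Q W (sw k Q W f)"
 unfolding sw_def[abs_def]
 by (rule lin_comp[OF TQ.tpow_lift_linear[OF _ swQ_multilin] comult_Q_linear])

lemma word_2Q: "set vs <= carrier V ==> length vs = 2 ==> EX a b. vs = [a, b] & a <: V & b <: V"
 by (auto simp: numeral_2_eq_2 length_Suc_conv)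

lemma swQ_cong:
 assumes "X <: Q" "!!a b. a <: Q ==> b <: Q ==> f [a, b] = g a b"
 shows "lift k W f (comult Q X) = sw k Q W g X"
 unfolding sw_def
 by (rule TQ.tpow_lift_cong[OF lin_closed[OF comult_Q_linear assms(1)]]) (auto dest!: word_2Q simp: assms(2))

lemma swQ_param:
 assumes "module k U" "module k W" "!!x. x <: U ==> bilin k Q Q W (f x)"
  and "!!a b. a <: Q ==> b <: Q ==> lmap k U W (%x. f x a b)" "X <: Q"
 shows "lmap k U W (%x. sw k Q W (f x) X)"
 unfolding sw_def
 by (rule TQ.tpow_lift_param[OF assms(1,2) swQ_multilin _ lin_closed[OF comult_Q_linear]])
  (auto dest!: word_2Q simp: assms)

lemma pQ_linear: "set us <= carrier Q ==> set vs <= carrier Q ==> n = Suc (length us + length vs) ==>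
  lmap k U Q g ==> lmap k U (tpow k Q n) (%x. ptens k Q (us @ g x # vs))"
 by (rule lin_comp[OF multilin_linear[OF TQ.ptens_multilin]]) simp_all

lemma coassoc_Q:
 assumes "X <: Q"
 shows "comult_at k Q 1 0 (comult Q X) = comult_at k Q 1 1 (comult Q X)"
proof -
 let ?W = "tpow k Q 3"
 have three: "1 + 2 = (3::nat)" by simp
 note pl = pQ_linear[where n = 3 and us = "[]" and vs = "[_, _]", simplified]
  pQ_linear[where n = 3 and us = "[_]" and vs = "[_]", simplified]
  pQ_linear[where n = 3 and us = "[_, _]" and vs = "[]", simplified]
 have b: "bilin k Q Q ?W (%c d. ptens k Q [c, d, b])" "bilin k Q Q ?W (%c d. ptens k Q [b, c, d])"
  if "b <: Q" for b
  using that by (auto intro!: bilinI pl lin_id)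
 have b': "bilin k Q Q ?W (%a b. sw k Q ?W (%c d. ptens k Q [c, d, b]) a)"
  "bilin k Q Q ?W (%a b. sw k Q ?W (%c d. ptens k Q [a, c, d]) b)"
  by (rule bilinI; (rule swQ_linear[OF TQ.T_mod b(1)] swQ_linear[OF TQ.T_mod b(2)]
    swQ_param[OF module_Q TQ.T_mod b(1)] swQ_param[OF module_Q TQ.T_mod b(2)]);
   (assumption | rule pl lin_id conjI)+)+
 obtain h where h: "h <: H" "X = pr h" using pr_cases[OF assms] .
 have "comult_at k Q 1 0 (comult Q X) = sw k Q ?W (%a b. sw k Q ?W (%c d. ptens k Q [c, d, b]) a) X"
  unfolding comult_at_def three
  by (rule swQ_cong[OF assms]) (auto intro!: swQ_cong simp: numeral_3_eq_3)
 also have "... = sw' ?W (%a b. sw k Q ?W (%c d. ptens k Q [c, d, pr b]) (pr a)) h"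
  unfolding h(2) by (rule sw_pr[OF TQ.T_mod b'(1) h(1)])
 also have "... = sw' ?W (%a b. sw' ?W (%c d. ptens k Q [pr c, pr d, pr b]) a) h"
  by (rule sw_cong[OF h(1)]) (simp add: sw_pr[OF TQ.T_mod b(1)] pr_closed)
 also have "... = sw' ?W (%a b. sw' ?W (%c d. ptens k Q [pr a, pr c, pr d]) b) h"
  by (rule sw_coassoc[OF TQ.T_mod h(1)]; rule pl; simp add: pr_closed pr_linear)
 also have "... = sw' ?W (%a b. sw k Q ?W (%c d. ptens k Q [pr a, c, d]) (pr b)) h"
  by (rule sw_cong[OF h(1)]) (simp add: sw_pr[OF TQ.T_mod b(2)] pr_closed)
 also have "... = sw k Q ?W (%a b. sw k Q ?W (%c d. ptens k Q [a, c, d]) b) X"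
  unfolding h(2) by (rule sw_pr[OF TQ.T_mod b'(2) h(1), symmetric])
 also have "... = comult_at k Q 1 1 (comult Q X)"
  unfolding comult_at_def three
  by (rule swQ_cong[OF assms, symmetric]) (auto intro!: swQ_cong simp: numeral_3_eq_3)
 finally show ?thesis .
qed

lemma comult_mult_Q:
 assumes "X <: Q" "Y <: Q"
 shows "comult Q (X *[Q] Y) = tpow_mult k Q 2 (comult Q X) (comult Q Y)"
proof -
 let ?W = "tpow k Q 2"
 let ?f = "%a b c d. ptens k Q [a *[Q] c, b *[Q] d]"
 obtain g where g: "g <: H" "X = pr g" using pr_cases[OF assms(1)] .
 obtain h where h: "h <: H" "Y = pr h" using pr_cases[OF assms(2)] .
 note ml = bil_left[OF multQ_bilin] bil_right[OF multQ_bilin]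
 have b: "bilin k Q Q ?W (?f a b)" "bilin k Q Q ?W (%c d. ?f c d a b)" if "a <: Q" "b <: Q" for a b
  by (rule bilinI; (rule lin_comp[OF bil_left[OF pq_bilin]] lin_comp[OF bil_right[OF pq_bilin]]);
   simp add: ml that)+
 have b': "bilin k Q Q ?W (%a b. sw k Q ?W (?f a b) Y)"
  by (rule bilinI; rule swQ_param[OF module_Q TQ.T_mod];
   simp add: b assms bil_left[OF b(2)] bil_right[OF b(2)])
 have "tpow_mult k Q 2 (comult Q X) (comult Q Y) = sw k Q ?W (%a b. sw k Q ?W (?f a b) Y) X"
  unfolding tpow_mult_def
  by (rule swQ_cong[OF assms(1)], rule swQ_cong[OF assms(2)]) simp
 also have "... = sw' ?W (%a b. sw k Q ?W (?f (pr a) (pr b)) Y) g"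
  unfolding g(2) by (rule sw_pr[OF TQ.T_mod b' g(1)])
 also have "... = sw' ?W (%a b. sw' ?W (%c d. ptens k Q [pr (a *[H] c), pr (b *[H] d)]) h) g"
  unfolding h(2)
  by (rule sw_cong[OF g(1)], subst sw_pr[OF TQ.T_mod b(1) h(1)], simp_all add: pr_closed)
   (rule sw_cong[OF h(1)], simp add: pr_mult)
 also have "... = sw' ?W (%a b. ptens k Q [pr a, pr b]) (g *[H] h)"
  by (rule sw_mult[OF TQ.T_mod pr_bilin[OF pq_bilin] g(1) h(1), symmetric])
 also have "... = comult Q (X *[Q] Y)"
  unfolding g(2) h(2) by (simp add: comult_Q_pr g h pr_mult[symmetric])
 finally show ?thesis ..
qed

text \<open>Every axiom is the image of the axiom of \<open>H\<close>, once the Sweedler sums are lifted by \<open>sw_pr\<close>.\<close>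

lemma hopf_algebra_Q: "hopf_algebra k Q"
proof (intro hopf_algebra.intro hopf_algebra_axioms.intro assoc_algebra_Q comult_Q_linear counit_Q_linear
  antipode_Q_linear coassoc_Q comult_mult_Q)
 note cl' = pr_closed eps_cl antipode_closed counit_Q_pr antipode_Q_pr
 have bs: "bilin k Q Q Q (%a b. counit Q a .[Q] b)" "bilin k Q Q Q (%a b. counit Q b .[Q] a)"
  by (rule bilinI; (rule scalar_lin[OF module_Q counit_Q_linear]
   lin_smult_const[OF module_Q lin_id]);
   simp add: lin_closed[OF counit_Q_linear, simplified])+
 have bm: "bilin k Q Q Q (%a b. antipode Q a *[Q] b)" "bilin k Q Q Q (%a b. a *[Q] antipode Q b)"
  by (rule bilinI; (simp add: bil_left[OF multQ_bilin] bil_right[OF multQ_bilin]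
   lin_comp[OF bil_left[OF multQ_bilin] antipode_Q_linear]
   lin_comp[OF bil_right[OF multQ_bilin] antipode_Q_linear]
   lin_closed[OF antipode_Q_linear]))+
 fix X assume X: "X <: Q"
 then obtain h where h: "h <: H" "X = pr h" by (rule pr_cases)
 have "lift k Q (%hs. counit Q (hs ! 0) .[Q] hs ! 1) (comult Q X) = sw' Q (%a b. counit Q (pr a) .[Q] pr b) h"
  unfolding h(2) by (subst sw_pr[OF module_Q bs(1) h(1), symmetric], rule swQ_cong) (simp_all add: h pr_closed)
 also have "... = sw' Q (%a b. eH a .[Q] pr b) h" by (rule sw_cong[OF h(1)]) (simp add: cl')
 finally show "lift k Q (%hs. counit Q (hs ! 0) .[Q] hs ! 1) (comult Q X) = X"
  by (simp add: sw_counit_left[OF module_Q pr_linear] h)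
 have "lift k Q (%hs. counit Q (hs ! 1) .[Q] hs ! 0) (comult Q X) = sw' Q (%a b. counit Q (pr b) .[Q] pr a) h"
  unfolding h(2) by (subst sw_pr[OF module_Q bs(2) h(1), symmetric], rule swQ_cong) (simp_all add: h pr_closed)
 also have "... = sw' Q (%a b. eH b .[Q] pr a) h" by (rule sw_cong[OF h(1)]) (simp add: cl')
 finally show "lift k Q (%hs. counit Q (hs ! 1) .[Q] hs ! 0) (comult Q X) = X"
  by (simp add: sw_counit_right[OF module_Q pr_linear] h)
 have "lift k Q (%hs. antipode Q (hs ! 0) *[Q] hs ! 1) (comult Q X) = sw' Q (%a b. antipode Q (pr a) *[Q] pr b) h"
  unfolding h(2) by (subst sw_pr[OF module_Q bm(1) h(1), symmetric], rule swQ_cong) (simp_all add: h pr_closed)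
 also have "... = sw' Q (%a b. pr (antipode H a *[H] b)) h"
  by (rule sw_cong[OF h(1)]) (simp add: cl' pr_mult)
 finally show "lift k Q (%hs. antipode Q (hs ! 0) *[Q] hs ! 1) (comult Q X) = counit Q X .[Q] 1[Q]"
  by (simp add: sw_antipode_left[OF module_Q pr_linear] h pr_one cl')
 have "lift k Q (%hs. hs ! 0 *[Q] antipode Q (hs ! 1)) (comult Q X) = sw' Q (%a b. pr a *[Q] antipode Q (pr b)) h"
  unfolding h(2) by (subst sw_pr[OF module_Q bm(2) h(1), symmetric], rule swQ_cong) (simp_all add: h pr_closed)
 also have "... = sw' Q (%a b. pr (a *[H] antipode H b)) h"
  by (rule sw_cong[OF h(1)]) (simp add: cl' pr_mult)
 finally show "lift k Q (%hs. hs ! 0 *[Q] antipode Q (hs ! 1)) (comult Q X) = counit Q X .[Q] 1[Q]"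
  by (simp add: sw_antipode_right[OF module_Q pr_linear] h pr_one cl')
 fix Y assume "Y <: Q"
 then obtain g where "g <: H" "Y = pr g" by (rule pr_cases)
 then show "counit Q (X *[Q] Y) = counit Q X *[k] counit Q Y"
  using h by (simp add: pr_mult[symmetric] counit_Q_pr counit_mult)
next
 show "counit Q 1[Q] = 1[k]" by (simp add: pr_one[symmetric] counit_Q_pr counit_one)
 show "comult Q 1[Q] = ptens k Q [1[Q], 1[Q]]"
  using sw_one[OF TQ.T_mod pr_bilin[OF pq_bilin]] by (simp add: pr_one[symmetric] comult_Q_pr)
qed

sublocale Q: hopf_algebra k Q by (rule hopf_algebra_Q)

definition Pi where "Pi n = lift k (tpow k Q n) (%hs. ptens k Q (map pr hs))"

lemma set_map_pr: "set hs <= carrier H ==> set (map pr hs) <= carrier Q"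
 by (auto simp: pr_closed)

lemma Pi_facts:
 shows Pi_linear: "lmap k (T n) (tpow k Q n) (Pi n)"
  and Pi_ptens: "set hs <= carrier H ==> length hs = n ==> Pi n (pH hs) = ptens k Q (map pr hs)"
proof -
 have m: "multilin k H n (tpow k Q n) (%hs. ptens k Q (map pr hs))"
  by (rule multilinI) (simp_all add: TQ.ptens_closed[OF set_map_pr] pQ_linear[OF set_map_pr set_map_pr] pr_linear)
 show "lmap k (T n) (tpow k Q n) (Pi n)" unfolding Pi_def by (rule tpow_lift_linear[OF TQ.T_mod m])
 show "set hs <= carrier H ==> length hs = n ==> Pi n (pH hs) = ptens k Q (map pr hs)"
  unfolding Pi_def by (rule tpow_lift_ptens[OF TQ.T_mod m])
qed

lemmas Pi_closed = lin_closed[OF Pi_linear]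
lemmas lin_Pi = lin_comp[OF Pi_linear]
lemmas Pi_smult = lin_smult[OF Pi_linear]

lemma Pi_snoc: assumes "z <: T n" "b <: H"
 shows "Pi (Suc n) (snoc n z b) = TQ.snoc n (Pi n z) (pr b)"
proof (rule tpow_linear_ext[OF TQ.T_mod _ _ _ assms(1)])
 show "lmap k (T n) (tpow k Q (Suc n)) (%z. Pi (Suc n) (snoc n z b))" by (intro lin_Pi lin_snoc lin_id assms)
 show "lmap k (T n) (tpow k Q (Suc n)) (%z. TQ.snoc n (Pi n z) (pr b))"
  by (intro TQ.lin_snoc Pi_linear pr_closed assms)
qed (simp add: snoc_ptens assms Pi_ptens TQ.snoc_ptens[OF set_map_pr] pr_closed)

lemma Pi_cns: assumes "z <: T n" "b <: H"
 shows "Pi (Suc n) (cns n b z) = TQ.cns n (pr b) (Pi n z)"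
proof (rule tpow_linear_ext[OF TQ.T_mod _ _ _ assms(1)])
 show "lmap k (T n) (tpow k Q (Suc n)) (%z. Pi (Suc n) (cns n b z))" by (intro lin_Pi lin_cns lin_id assms)
 show "lmap k (T n) (tpow k Q (Suc n)) (%z. TQ.cns n (pr b) (Pi n z))"
  by (intro TQ.lin_cns Pi_linear pr_closed assms)
qed (simp add: cns_ptens assms Pi_ptens TQ.cns_ptens[OF set_map_pr] pr_closed)

lemma Pi_tm: assumes s: "s <: T n" and t: "t <: T n"
 shows "Pi n (tm n s t) = Q.tm n (Pi n s) (Pi n t)"
proof (rule tpow_linear_ext[OF TQ.T_mod _ _ _ s])
 show "lmap k (T n) (tpow k Q n) (%s. Pi n (tm n s t))" by (intro lin_Pi lin_tm lin_id t)
 show "lmap k (T n) (tpow k Q n) (%s. Q.tm n (Pi n s) (Pi n t))" by (intro Q.lin_tm Pi_linear Pi_closed t)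
 fix as assume as: "set as <= carrier H" "length as = n"
 then have ac: "pH as <: T n" by (rule ptens_closed)
 show "Pi n (tm n (pH as) t) = Q.tm n (Pi n (pH as)) (Pi n t)"
 proof (rule tpow_linear_ext[OF TQ.T_mod _ _ _ t])
  show "lmap k (T n) (tpow k Q n) (%t. Pi n (tm n (pH as) t))" by (intro lin_Pi lin_tm lin_id ac)
  show "lmap k (T n) (tpow k Q n) (%t. Q.tm n (Pi n (pH as)) (Pi n t))"
   by (intro Q.lin_tm Pi_linear Pi_closed ac)
  fix bs assume bs: "set bs <= carrier H" "length bs = n"
  have "map pr (map2 (\<otimes>\<^bsub>H\<^esub>) as bs) = map2 (\<otimes>\<^bsub>Q\<^esub>) (map pr as) (map pr bs)"
   using as bs by (intro nth_equalityI) (simp_all add: pr_mult subset_iff)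
  moreover have "set (map2 (\<otimes>\<^bsub>H\<^esub>) as bs) <= carrier H"
   using as bs by (fastforce dest: set_zip_leftD set_zip_rightD)
  ultimately show "Pi n (tm n (pH as) (pH bs)) = Q.tm n (Pi n (pH as)) (Pi n (pH bs))"
   using as bs by (simp add: tm_ptens Pi_ptens Q.tm_ptens[OF set_map_pr _ set_map_pr])
 qed
qed

lemma Pi_it: "h <: H ==> Pi n (it n h) = Q.it n (pr h)"
proof (induction n arbitrary: h)
 case 0
 then show ?case using Pi_ptens[of "[]" 0]
  by (simp add: it.simps Q.it.simps Pi_smult eps_cl nil_closed counit_Q_pr)
next
 case (Suc n)
 have "Pi (Suc n) (it (Suc n) h) = sw' (tpow k Q (Suc n)) (%a b. Pi (Suc n) (snoc n (it n a) b)) h"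
  unfolding it_snoc[OF Suc.prems] by (rule sw_hom[OF T_mod TQ.T_mod Pi_linear snoc_it_bilin Suc.prems])
 also have "... = sw' (tpow k Q (Suc n)) (%a b. TQ.snoc n (Q.it n (pr a)) (pr b)) h"
  by (rule sw_cong[OF Suc.prems]) (simp add: Pi_snoc it_closed Suc.IH)
 also have "... = Q.it (Suc n) (pr h)"
  unfolding Q.it_snoc[OF pr_closed[OF Suc.prems]]
  by (rule sw_pr[OF TQ.T_mod Q.snoc_it_bilin Suc.prems, symmetric])
 finally show ?case .
qed

lemma Pi_fc: assumes "i <= n" "t <: T' n" shows "Pi n (fc n i t) = Q.fc n i (Pi (Suc n) t)"
proof (rule tpow_linear_ext[OF TQ.T_mod _ _ _ assms(2)])
 show "lmap k (T' n) (tpow k Q n) (%t. Pi n (fc n i t))" by (intro lin_Pi fc_linear assms)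
 show "lmap k (T' n) (tpow k Q n) (%t. Q.fc n i (Pi (Suc n) t))" by (intro Q.lin_fc Pi_linear assms)
 fix hs assume hs: "set hs <= carrier H" "length hs = Suc n"
 have c: "set (take i hs @ drop (Suc i) hs) <= carrier H" "length (take i hs @ drop (Suc i) hs) = n" "hs ! i <: H"
  using hs assms by (auto dest: in_set_takeD in_set_dropD)
 then show "Pi n (fc n i (pH hs)) = Q.fc n i (Pi (Suc n) (pH hs))"
  using hs assms
  by (simp add: fc_ptens Pi_ptens Q.fc_ptens[OF _ set_map_pr] Pi_smult[OF _ ptens_closed] eps_cl counit_Q_pr
   take_map drop_map flip: map_append del: set_append)
qed

text \<open>The rotation twisted by an element of \<open>K\<close> becomes, up to a scalar, the untwisted rotation.\<close>

lemma Pi_rt: assumes c: "c : K" and t: "t <: T' n"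
 shows "Pi (Suc n) (rt n c t) = eH c .[tpow k Q (Suc n)] Q.rt n 1[Q] (Pi (Suc n) t)"
proof (rule snoc_ext[OF TQ.T_mod _ _ _ t])
 have cH: "c <: H" and ck: "eH c <: k" by (simp_all add: c K_closed eps_cl)
 show "lmap k (T' n) (tpow k Q (Suc n)) (%t. Pi (Suc n) (rt n c t))" by (intro lin_Pi rt_linear cH)
 show "lmap k (T' n) (tpow k Q (Suc n)) (%t. eH c .[tpow k Q (Suc n)] Q.rt n 1[Q] (Pi (Suc n) t))"
  by (intro lin_smult_const TQ.T_mod Q.lin_rt Pi_linear ck aQ.one_closed)
 fix z b assume z: "z <: T n" "b <: H"
 have "pr (b *[H] c) = pr b *[Q] (eH c .[Q] 1[Q])"
  using pr_K[OF c one_closed] z cH by (simp add: pr_mult pr_one)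
 also have "... = eH c .[Q] pr b" using z ck by (simp add: aQ.smult_mult_right pr_closed)
 finally show "Pi (Suc n) (rt n c (snoc n z b)) =
   eH c .[tpow k Q (Suc n)] Q.rt n 1[Q] (Pi (Suc n) (snoc n z b))"
  using z cH ck lin_smult[OF bil_left[OF TQ.cns_bilin Pi_closed[OF z(1)]] ck pr_closed[OF z(2)]]
  by (simp add: rt_snoc Pi_cns Pi_snoc Q.rt_snoc Pi_closed pr_closed)
qed

lemma Pi_bs: "j <= Suc (Suc n) ==> x <: T' (Suc n) ==>
  Pi (Suc n) (Tc.bs n j x) = Q.Tc.bs n j (Pi (Suc (Suc n)) x)"
proof (induction j)
 case 0
 show ?case using lin_zero[OF T_mod TQ.T_mod Pi_linear] by simp
next
 case (Suc j)
 then have "fc (Suc n) j x <: T' n" "Tc.bs n j x <: T' n"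
  using Tc.bs_closed[of j n x] by (auto intro: fc_closed)
 then show ?case
  using Suc by (simp add: lin_add[OF Pi_linear] signed_closed[OF T_mod]
   linear_signed[OF T_mod TQ.T_mod Pi_linear] Pi_fc)
qed

lemma Pi_eps: assumes "t <: T' 0" shows "Q.eps (Pi (Suc 0) t) = eps t"
proof (rule tpow_linear_ext[OF module_k lin_comp[OF Q.eps_linear Pi_linear] eps_linear _ assms])
 fix vs assume vs: "set vs <= carrier H" "length vs = Suc 0"
 then obtain a where "vs = [a]" using word_1 by blast
 then show "Q.eps (Pi (Suc 0) (pH vs)) = eps (pH vs)"
  using vs by (simp add: Pi_ptens eps_ptens Q.eps_ptens pr_closed counit_Q_pr)
qed

end

section \<open>Tensoring with a left module\<close>

definition tmap where
 "tmap k A Y M f = lift k (tov k A Y M) (%(x, m). tns k A Y M (f x) m)"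

lemma tensor_over_algebraI: "rmod k A X ==> left_module k A M ==> tensor_over_algebra k X M A"
 by (intro tensor_over_algebra.intro tensor_over_algebra_axioms.intro tensor_product.intro)
  (auto simp: ract_closed left_module.axioms(1) intro: rmod_mod
   lin_closed[OF left_module.lact_linear_module])

context
 fixes k :: "'k ring" and A :: "('k, 'a, 'z) module_scheme" and M :: "('k, 'a, 'm, 'u) lmodule_scheme"
 assumes M: "left_module k A M"
begin

lemma module_over: "rmod k A X ==> module k (tov k A X M)"
 by (rule tensor_over_algebra.module_tensor_over[OF tensor_over_algebraI[OF _ M]])

lemma tmap_balanced:
 assumes X: "rmod k A X" and Y: "rmod k A Y" and f: "rmap k A X Y f"
 shows "balanced k A X M (tov k A Y M) (%x m. tns k A Y M (f x) m)"
proof -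
 interpret Y: tensor_over_algebra k Y M A by (rule tensor_over_algebraI[OF Y M])
 show ?thesis
  unfolding balanced_def
 proof (intro conjI ballI bilinI)
  fix m assume "m <: M"
  then show "lmap k X (tov k A Y M) (%x. tns k A Y M (f x) m)"
   by (rule linear_bilin_left[OF Y.tens_over_bilin rmap_linear[OF f]])
 qed (simp_all add: bil_right[OF Y.tens_over_bilin] Y.tens_over_move
   rmap_closed[OF f] rmap_ract[OF f])
qed

lemma tmap_linear: "rmod k A X ==> rmod k A Y ==> rmap k A X Y f ==>
  lmap k (tov k A X M) (tov k A Y M) (tmap k A Y M f)"
 unfolding tmap_def
 by (rule tensor_over_algebra.over_lift_linear[OF tensor_over_algebraI[OF _ M] module_over tmap_balanced])

lemma tmap_tens: "rmod k A X ==> rmod k A Y ==> rmap k A X Y f ==>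
  x <: X ==> m <: M ==> tmap k A Y M f (tns k A X M x m) = tns k A Y M (f x) m"
 unfolding tmap_def
 by (rule tensor_over_algebra.over_lift_tens[OF tensor_over_algebraI[OF _ M] module_over tmap_balanced])

lemma tens_bilin: "rmod k A X ==> bilin k X M (tov k A X M) (tns k A X M)"
 by (rule tensor_over_algebra.tens_over_bilin[OF tensor_over_algebraI[OF _ M]])

lemmas tens_closed = bil_closed[OF tens_bilin]
lemmas over_ext = tensor_over_algebra.over_linear_ext[OF tensor_over_algebraI[OF _ M]]

lemma tmap_cong:
 assumes "rmod k A X" "z <: tov k A X M" "!!x. x <: X ==> f x = g x"
 shows "tmap k A Y M f z = tmap k A Y M g z"
 unfolding tmap_def
 by (rule tensor_over_algebra.over_lift_cong[OF tensor_over_algebraI[OF assms(1) M] assms(2)]) (simp add: assms(3))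

lemma tmap_comp:
 assumes X: "rmod k A X" and Y: "rmod k A Y" and Z: "rmod k A Z"
  and f: "rmap k A X Y f" and g: "rmap k A Y Z g" and z: "z <: tov k A X M"
 shows "tmap k A Z M g (tmap k A Y M f z) = tmap k A Z M (%x. g (f x)) z"
 using z
 by (rule over_ext[OF X module_over[OF Z] lin_comp[OF tmap_linear[OF Y Z g] tmap_linear[OF X Y f]]
   tmap_linear[OF X Z rmap_comp[OF g f]], rotated])
  (simp add: tmap_tens[OF X Y f] tmap_tens[OF Y Z g] tmap_tens[OF X Z rmap_comp[OF g f]]
   rmap_closed[OF f])

lemma tmap_add:
 assumes X: "rmod k A X" and Y: "rmod k A Y"
  and f: "rmap k A X Y f" and g: "rmap k A X Y g" and z: "z <: tov k A X M"
 shows "tmap k A Y M (%x. f x +[Y] g x) z = tmap k A Y M f z +[tov k A Y M] tmap k A Y M g z"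
 using z
 by (rule over_ext[OF X module_over[OF Y] tmap_linear[OF X Y rmap_plus[OF Y f g]]
   lin_plus[OF module_over[OF Y] tmap_linear[OF X Y f] tmap_linear[OF X Y g]], rotated])
  (simp add: tmap_tens[OF X Y] f g rmap_plus[OF Y] lin_add[OF bil_left[OF tens_bilin[OF Y]]]
   rmap_closed[OF f] rmap_closed[OF g])

lemma tmap_uminus:
 assumes X: "rmod k A X" and Y: "rmod k A Y"
  and f: "rmap k A X Y f" and z: "z <: tov k A X M"
 shows "tmap k A Y M (%x. -[Y] f x) z = -[tov k A Y M] tmap k A Y M f z"
 using z
 by (rule over_ext[OF X module_over[OF Y] tmap_linear[OF X Y rmap_uminus[OF Y f]]
   lin_uminus[OF module_over[OF Y] tmap_linear[OF X Y f]], rotated])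
  (simp add: tmap_tens[OF X Y] f rmap_uminus[OF Y]
   lin_neg[OF rmod_mod[OF Y] module_over[OF Y] bil_left[OF tens_bilin[OF Y]]]
   rmap_closed[OF f])

lemma tmap_zero:
 assumes X: "rmod k A X" and Y: "rmod k A Y" and z: "z <: tov k A X M"
 shows "tmap k A Y M (%x. 0[Y]) z = 0[tov k A Y M]"
 using z
 by (rule over_ext[OF X module_over[OF Y] tmap_linear[OF X Y rmap_zero[OF Y]]
   lin_const_zero[OF module_over[OF Y]], rotated])
  (simp add: tmap_tens[OF X Y rmap_zero[OF Y]]
   lin_zero[OF rmod_mod[OF Y] module_over[OF Y] bil_left[OF tens_bilin[OF Y]]])

lemma tmap_id:
 assumes X: "rmod k A X" and z: "z <: tov k A X M"
 shows "tmap k A X M (%x. x) z = z"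
 using z
 by (rule over_ext[OF X module_over[OF X] tmap_linear[OF X X rmap_id] lin_id, rotated])
  (simp add: tmap_tens[OF X X rmap_id])

end

context hopf_algebra
begin

lemma T_2: "x <: H ==> it 2 x = sw' (T 2) (%a b. pH [a, b]) x"
 using it_cns[of x 1]
 by (simp add: numeral_2_eq_2) (rule sw_cong, simp_all add: it_1 snoc_ptens cns_ptens[where n = "Suc 0"])

text \<open>A Sweedler sum over \<open>h\<^sub>1 \<otimes> h\<^sub>2 \<otimes> h\<^sub>3\<close>, as two nested ones.\<close>

lemma lift_it_3:
 assumes W: "module k W" and h: "h <: H"
  and l: "!!b c. b <: H ==> c <: H ==> lmap k H W (%a. F a b c)"
   "!!a c. a <: H ==> c <: H ==> lmap k H W (%b. F a b c)"
   "!!a b. a <: H ==> b <: H ==> lmap k H W (%c. F a b c)"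
 shows "lift k W (%hs. F (hs ! 0) (hs ! 1) (hs ! 2)) (iter_comult k H 2 h) = sw' W (%x c. sw' W (%a b. F a b c) x) h"
proof -
 let ?G = "%hs. F (hs ! 0) (hs ! 1) (hs ! 2)"
 note G = multilin_3[of H k W F, OF l]
 have L: "lmap k (T 3) W (lift k W ?G)" by (rule tpow_lift_linear[OF W G])
 note p = pair_bilin
 have p3: "bilin k H H (T 3) (%a b. snoc 2 (pH [a, b]) c)" if "c <: H" for c
  using bilin_comp[OF bil_left[OF snoc_bilin that] p] by (simp add: numeral_3_eq_3 numeral_2_eq_2)
 have "iter_comult k H 2 h = it (Suc 2) h" by (rule it.simps(2)[symmetric])
 also have "... = sw' (T 3) (%x c. snoc 2 (it 2 x) c) h" unfolding it_snoc[OF h] by simp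
 also have "lift k W ?G ... = sw' W (%x c. lift k W ?G (snoc 2 (it 2 x) c)) h"
  using snoc_it_bilin[of 2] by (intro sw_hom[OF T_mod W L _ h]) simp
 also have "... = sw' W (%x c. sw' W (%a b. F a b c) x) h"
 proof (rule sw_cong[OF h])
  fix x c assume x: "x <: H" "c <: H"
  have "snoc 2 (it 2 x) c = sw' (T 3) (%a b. snoc 2 (pH [a, b]) c) x"
   unfolding T_2[OF x(1)] using sw_snoc[OF p x] by simp
  also have "lift k W ?G ... = sw' W (%a b. lift k W ?G (snoc 2 (pH [a, b]) c)) x"
   by (rule sw_hom[OF T_mod W L p3[OF x(2)] x(1)])
  also have "... = sw' W (%a b. F a b c) x"
  proof (rule sw_cong[OF x(1)])
   fix a b assume "a <: H" "b <: H"
   then show "lift k W ?G (snoc 2 (pH [a, b]) c) = F a b c"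
    using tpow_lift_ptens[OF W G, of "[a, b, c]"] x by (simp add: snoc_ptens)
  qed
  finally show "lift k W ?G (snoc 2 (it 2 x) c) = sw' W (%a b. F a b c) x" .
 qed
 finally show ?thesis .
qed

text \<open>The right side is \<open>\<Sum> R(h\<^sub>3 c S(h\<^sub>1))(t) h\<^sub>2\<close> for the rotation \<open>R\<close>.  In the front factor
  of its terms \<open>S(h\<^sub>1)\<close> meets \<open>h\<^sub>2\<close> and cancels.\<close>

lemma rt_ract:
 assumes c: "c <: H" and h: "h <: H" and t: "t <: T' n"
 shows "rt n c (tm (Suc n) t (it (Suc n) h)) = lift k (T' n)
  (%hs. tm (Suc n) (rt n (hs ! 2 *[H] c *[H] antipode H (hs ! 0)) t) (it (Suc n) (hs ! 1))) (iter_comult k H 2 h)"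
proof -
 let ?W = "T' n"
 note ll = lin lin_rt lin_tm lin_it T_mod module_H rt_closed tm_closed it_closed c h m_closed antipode_closed
 have "sw' ?W (%x d. sw' ?W (%a b. tm (Suc n) (rt n (d *[H] c *[H] antipode H a) t) (it (Suc n) b)) x) h =
   rt n c (tm (Suc n) t (it (Suc n) h))"
 proof (rule snoc_ext[OF T_mod _ _ _ t])
  show "lmap k ?W ?W (%t. sw' ?W (%x d. sw' ?W (%a b. tm (Suc n) (rt n (d *[H] c *[H] antipode H a) t)
    (it (Suc n) b)) x) h)"
   by (intro ll) (simp_all add: ll)
  show "lmap k ?W ?W (%t. rt n c (tm (Suc n) t (it (Suc n) h)))" by (intro ll)
  fix z y assume z: "z <: T n" and y: "y <: H"
  let ?f = "%v d. cns n (y *[H] (d *[H] c)) (tm n z (it n v))"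
  have "sw' ?W (%a b. tm (Suc n) (rt n (d *[H] c *[H] antipode H a) (snoc n z y)) (it (Suc n) b)) x = ?f x d"
   if x: "x <: H" and d: "d <: H" for x d
  proof -
   let ?g = "%v w. cns n (y *[H] (d *[H] c) *[H] w) (tm n z (it n v))"
   have gl: "lmap k H ?W (%w. ?g v w)" if "v <: H" for v
    by (intro ll) (simp_all add: ll d y z that)
   have "sw' ?W (%a b. tm (Suc n) (rt n (d *[H] c *[H] antipode H a) (snoc n z y)) (it (Suc n) b)) x =
     sw' ?W (%a b. sw' ?W (%u v. ?g v (antipode H a *[H] u)) b) x"
   proof (rule sw_cong[OF x])
    fix a b assume a: "a <: H" and b: "b <: H"
    let ?e = "d *[H] c *[H] antipode H a"
    have e: "?e <: H" by (simp add: a d c antipode_closed)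
    have "tm (Suc n) (cns n (y *[H] ?e) z) (it (Suc n) b) =
      sw' ?W (%u v. tm (Suc n) (cns n (y *[H] ?e) z) (cns n u (it n v))) b"
     unfolding it_cns[OF b]
     by (rule sw_hom[OF T_mod T_mod _ cns_it_bilin b])
      (simp add: bil_right[OF tm_bilin] cns_closed z y e)
    also have "... = sw' ?W (%u v. ?g v (antipode H a *[H] u)) b"
     by (rule sw_cong[OF b]) (simp add: tm_cns z y e it_closed m_assoc a d c antipode_closed)
    finally show "tm (Suc n) (rt n ?e (snoc n z y)) (it (Suc n) b) = sw' ?W (%u v. ?g v (antipode H a *[H] u)) b"
     by (simp add: rt_snoc z y e)
   qed
   also have "... = sw' ?W (%p v. sw' ?W (%a u. ?g v (antipode H a *[H] u)) p) x"
    by (rule sw_coassoc[OF T_mod x, symmetric]; (intro ll)?; simp add: ll d y z)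
   also have "... = sw' ?W (%p v. eH p .[?W] ?f v d) x"
    by (rule sw_cong[OF x]) (simp add: sw_antipode_left[OF T_mod gl] y d c)
   also have "... = ?f x d"
    by (rule sw_counit_left[OF T_mod _ x]) (intro ll; simp add: ll d y z)
   finally show ?thesis .
  qed
  then have "sw' ?W (%x d. sw' ?W (%a b. tm (Suc n) (rt n (d *[H] c *[H] antipode H a) (snoc n z y)) (it (Suc n) b)) x) h =
    sw' ?W ?f h" by (rule sw_cong[OF h])
  also have "... = sw' ?W (%x d. rt n c (tm (Suc n) (snoc n z y) (snoc n (it n x) d))) h"
   by (rule sw_cong[OF h]) (simp add: tm_snoc rt_snoc z y it_closed tm_closed c m_assoc)
  also have "... = rt n c (tm (Suc n) (snoc n z y) (it (Suc n) h))"
   unfolding it_snoc[OF h]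
   by (rule sw_hom[OF T_mod T_mod _ snoc_it_bilin h, symmetric]) (intro ll z; simp add: z y snoc_closed)
  finally show "sw' ?W (%x d. sw' ?W (%a b. tm (Suc n) (rt n (d *[H] c *[H] antipode H a) (snoc n z y))
    (it (Suc n) b)) x) h = rt n c (tm (Suc n) (snoc n z y) (it (Suc n) h))" .
 qed
 moreover have "lift k ?W (%hs. tm (Suc n) (rt n (hs ! 2 *[H] c *[H] antipode H (hs ! 0)) t) (it (Suc n) (hs ! 1)))
   (iter_comult k H 2 h) =
   sw' ?W (%x d. sw' ?W (%a b. tm (Suc n) (rt n (d *[H] c *[H] antipode H a) t) (it (Suc n) b)) x) h"
  by (rule lift_it_3[OF T_mod h]; (intro ll t)?; simp add: ll t)
 ultimately show ?thesis by simp
qed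

text \<open>The element \<open>z \<otimes> 1 \<otimes> \<dots> \<otimes> 1\<close> with \<open>l\<close> factors \<open>1\<close>.\<close>

primrec ones where
 "ones j 0 z = z"
| "ones j (Suc l) z = snoc (j + l) (ones j l z) 1[H]"

lemma ones_linear: "lmap k (T j) (T (j + l)) (ones j l)"
 by (induction l) (simp_all add: ones.simps[abs_def] lin_id lin_snoc)

lemmas ones_closed = lin_closed[OF ones_linear]

lemma cns_ones: "z <: T j ==> a <: H ==> cns (j + l) a (ones j l z) = ones (Suc j) l (cns j a z)"
 by (induction l) (simp_all add: cns_snoc ones_closed)

lemma ones_it_0: "c <: H ==> ones 0 l (it 0 c) = eH c .[T l] it l 1[H]"
proof (induction l)
 case 0
 then show ?case using module.smult_one[OF T_mod nil_closed] by (simp add: it.simps counit_one)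
next
 case (Suc l)
 then show ?case by (simp add: it_one_Suc snoc_smult eps_cl it_one_closed)
qed

text \<open>One more rotation turns \<open>\<Delta>\<^sup>j(c) \<otimes> 1 \<otimes> \<dots> \<otimes> 1\<close> into \<open>\<Delta>\<^sup>j\<^sup>+\<^sup>1(c) \<otimes> 1 \<otimes> \<dots> \<otimes> 1\<close>.\<close>

lemma rt_ones:
 assumes c: "c <: H" and s: "s <: T' (j + l)"
 shows "sw' (T' (j + l)) (%a b. rt (j + l) a (tm (Suc (j + l)) s (ones j (Suc l) (it j b)))) c =
  tm (Suc (j + l)) (rt (j + l) 1[H] s) (ones (Suc j) l (it (Suc j) c))"
proof -
 let ?n = "j + l" and ?W = "T' (j + l)"
 have e: "rt ?n a (tm (Suc ?n) s (snoc ?n w 1[H])) = tm (Suc ?n) (rt ?n 1[H] s) (cns ?n a w)"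
  if a: "a <: H" and w: "w <: T ?n" for a w
 proof (rule snoc_ext[OF T_mod _ _ _ s])
  show "lmap k ?W ?W (%s. rt ?n a (tm (Suc ?n) s (snoc ?n w 1[H])))"
   by (intro lin_rt lin_tm lin_id a snoc_closed w one_closed)
  show "lmap k ?W ?W (%s. tm (Suc ?n) (rt ?n 1[H] s) (cns ?n a w))"
   by (intro lin_rt lin_tm lin_id a cns_closed w one_closed)
 qed (simp add: tm_snoc rt_snoc tm_cns a w tm_closed)
 have "sw' ?W (%a b. rt ?n a (tm (Suc ?n) s (ones j (Suc l) (it j b)))) c =
   sw' ?W (%a b. tm (Suc ?n) (rt ?n 1[H] s) (ones (Suc j) l (cns j a (it j b)))) c"
  by (rule sw_cong[OF c]) (simp add: e ones_closed it_closed cns_ones)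
 also have "... = tm (Suc ?n) (rt ?n 1[H] s) (ones (Suc j) l (it (Suc j) c))"
  unfolding it_cns[OF c] using ones_linear[of "Suc j" l]
  by (intro sw_hom[OF T_mod T_mod _ cns_it_bilin c, symmetric] lin_tm) (simp_all add: rt_closed s)
 finally show ?thesis .
qed

end

section \<open>The cyclic object of a modular crossed module\<close>

locale hopf_coefficients = hopf_algebra k H + M: modular_crossed_module k H M
 for k :: "'k ring" and H :: "('k, 'h) hopf" and M :: "('k, 'h, 'm) crossed"
begin

text \<open>The sum \<open>\<Sum> g(m\<^sub>0, m\<^sub>1)\<close> over the coaction of \<open>m\<close>.\<close>

definition cs where "cs W g m = lift k W (%(m0, h). g m0 h) (coact M m)"

interpretation MH: tensor_product k M H
 by (rule tensor_product.intro) (rule M.module_axioms, rule module_H)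

lemma module_M: "module k M" by (rule M.module_axioms)
lemma left_M: "left_module k H M" by (rule M.left_module_axioms)

lemma coact_closed: "m <: M ==> coact M m <: tensor k M H"
 by (rule lin_closed[OF M.coact_linear])

lemma lact_closed: "h <: H ==> m <: M ==> lact M h m <: M"
 by (rule lin_closed[OF M.lact_linear_module])

lemma cs_linear: "module k W ==> bilin k M H W g ==> lmap k M W (cs W g)"
 unfolding cs_def[abs_def] by (rule lin_comp[OF MH.tensor_lift_linear M.coact_linear])

lemmas cs_closed = lin_closed[OF cs_linear]

lemma cs_cong: "m <: M ==> (!!x h. x <: M ==> h <: H ==> f x h = g x h) ==> cs W f m = cs W g m"
 unfolding cs_def by (rule MH.tensor_lift_cong[OF coact_closed])

lemma cs_hom: "module k W ==> module k U ==> lmap k W U L ==> bilin k M H W g ==> m <: M ==>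
  L (cs W g m) = cs U (%x h. L (g x h)) m"
 unfolding cs_def by (rule MH.tensor_lift_hom[OF _ _ _ _ coact_closed])

lemma cs_param:
 "module k U ==> module k W ==> (!!x. x <: U ==> bilin k M H W (g x)) ==>
  (!!v h. v <: M ==> h <: H ==> lmap k U W (%x. g x v h)) ==> m <: M ==>
  lmap k U W (%x. cs W (g x) m)"
 unfolding cs_def by (rule MH.tensor_lift_param[OF _ _ _ _ coact_closed])

lemma cs_counit:
 assumes W: "module k W" and f: "lmap k M W f" and m: "m <: M"
 shows "cs W (%x h. eH h .[W] f x) m = f m"
proof -
 have b: "bilin k M H M (%x h. eH h .[M] x)"
  by (rule bilinI) (auto intro: scalar_lin[OF module_M counit_linear]
   lin_smult_const[OF module_M lin_id] eps_cl)
 have "f m = f (cs M (%x h. eH h .[M] x) m)" using M.coact_counit[OF m] by (simp add: cs_def)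
 also have "... = cs W (%x h. f (eH h .[M] x)) m" by (rule cs_hom[OF module_M W f b m])
 also have "... = cs W (%x h. eH h .[W] f x) m"
  by (rule cs_cong[OF m]) (simp add: lin_smult[OF f] eps_cl)
 finally show ?thesis ..
qed

lemma cs_coassoc:
 assumes W: "module k W" and m: "m <: M"
  and b: "!!x. x <: M ==> bilin k H H W (F x)"
  and l: "!!g h. g <: H ==> h <: H ==> lmap k M W (%x. F x g h)"
 shows "cs W (%x h. cs W (%y g. F y g h) x) m = cs W (%x h. sw' W (F x) h) m"
proof -
 let ?U = "tensor k M (T 2)"
 interpret MT: tensor_product k M "T 2" by (rule tensor_product.intro) (rule module_M, rule T_mod)
 let ?f = "%x z. lift k W (%hs. F x (hs ! 0) (hs ! 1)) z"
 have f: "bilin k M (T 2) W ?f"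
 proof (rule bilinI)
  show "lmap k (T 2) W (?f x)" if "x <: M" for x
   by (rule tpow_lift_linear[OF W sw_multilin[OF b[OF that]]])
  show "lmap k M W (%x. ?f x z)" if "z <: T 2" for z
   by (rule tpow_lift_param[OF module_M W sw_multilin[OF b] _ that]) (auto dest!: word_2 simp: l)
 qed
 let ?L = "lift k W (%(x, z). ?f x z)"
 have L: "lmap k ?U W ?L" by (rule MT.tensor_lift_linear[OF W f])
 note Lt = MT.tensor_lift_tens[OF W f]
 note pb = pair_bilin
 have p: "bilin k M H ?U (%y g. tens k M (T 2) y (pH [g, h]))" if "h <: H" for h
  by (rule bilinI) (simp_all add: lin_comp[OF bil_right[OF MT.tens_bilin] bil_left[OF pb that]]
   bil_left[OF MT.tens_bilin] bil_closed[OF pb] that)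
 have q: "bilin k M H ?U (%x h. cs ?U (%y g. tens k M (T 2) y (pH [g, h])) x)"
  by (rule bilinI) (auto intro!: cs_param[OF module_H MT.module_tensor p] cs_linear[OF MT.module_tensor p]
   lin_comp[OF bil_right[OF MT.tens_bilin] bil_right[OF pb]])
 have r: "bilin k M H ?U (%x h. tens k M (T 2) x (comult H h))"
  by (rule bilinI) (simp_all add: lin_comp[OF bil_right[OF MT.tens_bilin] comult_linear]
   bil_left[OF MT.tens_bilin] comult_closed)
 have "cs ?U (%x h. cs ?U (%y g. tens k M (T 2) y (pH [g, h])) x) m = cs ?U (%x h. tens k M (T 2) x (comult H h)) m"
  using M.coact_coassoc[OF m] by (simp add: cs_def)
 then have "?L (cs ?U (%x h. cs ?U (%y g. tens k M (T 2) y (pH [g, h])) x) m) =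
   ?L (cs ?U (%x h. tens k M (T 2) x (comult H h)) m)" by simp
 moreover have "?L (cs ?U (%x h. cs ?U (%y g. tens k M (T 2) y (pH [g, h])) x) m) =
   cs W (%x h. cs W (%y g. F y g h) x) m"
  unfolding cs_hom[OF MT.module_tensor W L q m]
 proof (rule cs_cong[OF m])
  fix x h assume x: "x <: M" and h: "h <: H"
  show "?L (cs ?U (%y g. tens k M (T 2) y (pH [g, h])) x) = cs W (%y g. F y g h) x"
   unfolding cs_hom[OF MT.module_tensor W L p[OF h] x]
  proof (rule cs_cong[OF x])
   fix y g assume "y <: M" "g <: H"
   then show "?L (tens k M (T 2) y (pH [g, h])) = F y g h"
    using tpow_lift_ptens[OF W sw_multilin[OF b], of y "[g, h]"] h
    by (subst Lt) (simp_all add: bil_closed[OF pb])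
  qed
 qed
 moreover have "?L (cs ?U (%x h. tens k M (T 2) x (comult H h)) m) = cs W (%x h. sw' W (F x) h) m"
  unfolding cs_hom[OF MT.module_tensor W L r m]
  by (rule cs_cong[OF m], subst Lt) (simp_all add: comult_closed sw_def)
 ultimately show ?thesis by simp
qed

lemma cs_lact:
 assumes W: "module k W" and g: "bilin k M H W g" and h: "h <: H" and m: "m <: M"
 shows "cs W g (lact M h m) = lift k W (%hs. cs W
  (%x c. g (lact M (hs ! 1) x) (hs ! 2 *[H] c *[H] antipode H (hs ! 0))) m) (iter_comult k H 2 h)"
proof -
 let ?U = "tensor k M H"
 let ?f = "%a b d x c. tens k M H (lact M b x) (d *[H] c *[H] antipode H a)"
 let ?F = "%a b d. cs ?U (?f a b d) m"
 have tl: "lmap k U ?U (%x. tens k M H (p x) y)" if "lmap k U M p" "y <: H"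
  for U :: "('k, 'u, 'v) module_scheme" and p y
  by (rule linear_bilin_left[OF MH.tens_bilin that])
 have tr: "lmap k U ?U (%x. tens k M H y (p x))" if "lmap k U H p" "y <: M"
  for U :: "('k, 'u, 'v) module_scheme" and p y
  by (rule linear_bilin_right[OF MH.tens_bilin that])
 have b: "bilin k M H ?U (?f a b d)" if "a <: H" "b <: H" "d <: H" for a b d
  by (rule bilinI; (rule tr | rule tl); (intro lin | rule M.lact_linear_module)?)
   (simp_all add: that antipode_closed lact_closed)
 have F: "multilin k H 3 ?U (%hs. ?F (hs ! 0) (hs ! 1) (hs ! 2))"
 proof (rule multilin_3[where F = ?F]; rule cs_param[OF module_H MH.module_tensor b _ m]; assumption?)
 qed ((rule tr | rule tl); (intro lin | rule M.lact_linear_algebra)?; simp add: antipode_closed lact_closed)+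
 have it3: "iter_comult k H 2 h <: T 3"
  using it_closed[OF h, of "Suc 2", unfolded it.simps(2)] by simp
 let ?L = "lift k W (%(x, h). g x h)"
 have L: "lmap k ?U W ?L" by (rule MH.tensor_lift_linear[OF W g])
 have "cs W g (lact M h m) = ?L (lift k ?U (%hs. ?F (hs ! 0) (hs ! 1) (hs ! 2)) (iter_comult k H 2 h))"
  using M.coact_lact[OF h m] by (simp add: cs_def)
 also have "... = lift k W (%hs. ?L (?F (hs ! 0) (hs ! 1) (hs ! 2))) (iter_comult k H 2 h)"
  by (rule tpow_lift_hom[OF MH.module_tensor W L F it3])
 also have "... = lift k W (%hs. cs W (%x c. g (lact M (hs ! 1) x) (hs ! 2 *[H] c *[H] antipode H (hs ! 0))) m)
   (iter_comult k H 2 h)"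
 proof (rule tpow_lift_cong[OF it3])
  fix hs :: "'h list" assume hs: "set hs <= carrier H" "length hs = 3"
  then have c: "hs ! 0 <: H" "hs ! 1 <: H" "hs ! 2 <: H" by (auto simp: subset_iff)
  show "?L (?F (hs ! 0) (hs ! 1) (hs ! 2)) =
    cs W (%x c. g (lact M (hs ! 1) x) (hs ! 2 *[H] c *[H] antipode H (hs ! 0))) m"
   unfolding cs_hom[OF MH.module_tensor W L b[OF c] m]
   by (rule cs_cong[OF m], rule MH.tensor_lift_tens[OF W g]) (simp_all add: c[unfolded One_nat_def] lact_closed antipode_closed)
 qed
 finally show ?thesis .
qed

abbreviation ZO where "ZO n == Z_obj k H M n"
abbreviation Zt where "Zt n == Z_tens k H M n"
abbreviation Zc where "Zc == Z_cyclic k H M"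

lemma module_Z: "module k (ZO n)"
 unfolding Z_obj_def by (rule module_over[OF left_M rmod_diag])

lemma Zt_bilin: "bilin k (T' n) M (ZO n) (Zt n)"
 using tens_bilin[OF left_M rmod_diag, of n]
 unfolding Z_obj_def Z_tens_def[abs_def] bilin_def by (simp add: diag_simps diag_linear)

lemmas Zt_closed = bil_closed[OF Zt_bilin]
lemmas lin_Zt = linear_bilin_left[OF Zt_bilin] linear_bilin_right[OF Zt_bilin]

lemma Zt_move: "t <: T' n ==> h <: H ==> m <: M ==>
  Zt n (tm (Suc n) t (it (Suc n) h)) m = Zt n t (lact M h m)"
 using tensor_over_algebra.tens_over_move[OF tensor_over_algebraI[OF rmod_diag left_M], of t n h m]
 by (simp add: Z_tens_def diag_simps)

lemma Z_ext:
 assumes "module k W" "lmap k (ZO n) W f" "lmap k (ZO n) W g"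
  "!!t m. t <: T' n ==> m <: M ==> f (Zt n t m) = g (Zt n t m)" "z <: ZO n"
 shows "f z = g z"
 using over_ext[OF left_M rmod_diag assms(1), of n f g z] assms(2-)
 by (simp add: Z_obj_def Z_tens_def diag_simps)

definition cy where "cy n t m = cs (ZO n) (%x c. Zt n (rt n c t) x) m"

lemma cy_cs: "t <: T' n ==> bilin k M H (ZO n) (%x c. Zt n (rt n c t) x)"
 by (rule bilinI) (intro lin_Zt lin_rt lin_id rt_closed; assumption)+

lemma cy_bilin: "bilin k (T' n) M (ZO n) (cy n)"
 unfolding cy_def[abs_def]
 by (rule bilinI, rule cs_linear[OF module_Z cy_cs], assumption,
   rule cs_param[OF T_mod module_Z cy_cs]) (simp_all add: lin_Zt lin_rt lin_id)

text \<open>The condition relating action and coaction is what makes the cyclic operator well defined on the tensor product over \<open>H\<close>.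
  The sum over the coaction and the Sweedler sum have to be exchanged.\<close>

lemma cy_move:
 assumes t: "t <: T' n" and h: "h <: H" and m: "m <: M"
 shows "cy n (tm (Suc n) t (it (Suc n) h)) m = cy n t (lact M h m)"
proof -
 let ?W = "T' n"
 let ?e = "%hs c. hs ! 2 *[H] c *[H] antipode H (hs ! 0)"
 let ?G = "%c hs. tm (Suc n) (rt n (?e hs c) t) (it (Suc n) (hs ! 1))"
 note ll = lin lin_rt lin_tm lin_it T_mod module_H rt_closed tm_closed it_closed m_closed antipode_closed
 have G: "multilin k H 3 ?W (?G c)" if "c <: H" for c
  by (rule multilin_3[where F = "%a b d. tm (Suc n) (rt n (d *[H] c *[H] antipode H a) t) (it (Suc n) b)"];
   (intro ll t that)?; simp add: ll t that)
 have it3: "iter_comult k H 2 h <: T 3"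
  using it_closed[OF h, of "Suc 2", unfolded it.simps(2)] by simp
 have w3: "hs ! 0 <: H" "hs ! 1 <: H" "hs ! 2 <: H"
  if "set hs <= carrier H" "length hs = 3" for hs :: "'h list" using that by (auto simp: subset_iff)
 let ?B = "%hs x c. Zt n (?G c hs) x"
 have B: "bilin k M H (ZO n) (?B hs)" if hs: "set hs <= carrier H" "length hs = 3" for hs
 proof (rule bilinI)
  show "lmap k H (ZO n) (%c. ?B hs x c)" if x: "x <: M" for x
   by (rule lin_Zt(1)[OF _ x], intro ll t) (simp_all add: ll w3[unfolded One_nat_def] hs t)
  show "lmap k M (ZO n) (%x. ?B hs x c)" if "c <: H" for c
   by (rule bil_right[OF Zt_bilin]) (simp add: ll w3[unfolded One_nat_def] hs t that)
 qed
 have "cy n (tm (Suc n) t (it (Suc n) h)) m = cs (ZO n) (%x c. Zt n (lift k ?W (?G c) (iter_comult k H 2 h)) x) m"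
  unfolding cy_def by (rule cs_cong[OF m]) (simp add: rt_ract[OF _ h t])
 also have "... = cs (ZO n) (%x c. lift k (ZO n) (%hs. ?B hs x c) (iter_comult k H 2 h)) m"
  by (rule cs_cong[OF m], rule tpow_lift_hom[OF T_mod module_Z bil_left[OF Zt_bilin] G it3])
 also have "... = lift k (ZO n) (%hs. cs (ZO n) (?B hs) m) (iter_comult k H 2 h)"
 proof -
  text \<open>The two sums may be exchanged: both sides are linear in the element of \<open>H\<^sup>\<otimes>\<^sup>3\<close>.\<close>
  have lB: "lmap k U (ZO n) (%u. Zt n (F u) x)" if "lmap k U ?W F" "x <: M"
   for U :: "('k, 'u, 'v) module_scheme" and F x by (rule linear_bilin_left[OF Zt_bilin that])
  have bm: "multilin k H 3 (ZO n) (%hs. ?B hs x c)" if "x <: M" "c <: H" for x c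
   using multilin_comp[OF bil_left[OF Zt_bilin that(1)] G[OF that(2)]] .
  have bc: "multilin k H 3 (ZO n) (%hs. cs (ZO n) (?B hs) m)"
  proof (rule multilinI)
   show "cs (ZO n) (?B hs) m <: ZO n" if "set hs <= carrier H" "length hs = 3" for hs
    by (rule cs_closed[OF module_Z B[OF that] m])
   show "lmap k H (ZO n) (%y. cs (ZO n) (?B (us @ y # vs)) m)"
    if "set us <= carrier H" "set vs <= carrier H" "Suc (length us + length vs) = 3" for us vs
    by (rule cs_param[OF module_H module_Z B _ m]; (rule multilin_linear[OF bm])?) (use that in simp_all)
  qed
  have "lift k (ZO n) (%hs. cs (ZO n) (?B hs) m) z = cs (ZO n) (%x c. lift k (ZO n) (%hs. ?B hs x c) z) m"
   if z: "z <: T 3" for z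
  proof (rule tpow_linear_ext[OF module_Z tpow_lift_linear[OF module_Z bc] _ _ z])
   have lb: "bilin k M H (ZO n) (%x c. lift k (ZO n) (%hs. ?B hs x c) z)" if "z <: T 3" for z
    by (rule bilinI; rule tpow_lift_param[OF _ module_Z bm _ that])
     (assumption | rule module_H module_M bil_left[OF B] bil_right[OF B])+
   show "lmap k (T 3) (ZO n) (%z. cs (ZO n) (%x c. lift k (ZO n) (%hs. ?B hs x c) z) m)"
    by (rule cs_param[OF T_mod module_Z lb tpow_lift_linear[OF module_Z bm] m])
   fix hs assume hs: "set hs <= carrier H" "length hs = 3"
   show "lift k (ZO n) (%hs. cs (ZO n) (?B hs) m) (pH hs) =
     cs (ZO n) (%x c. lift k (ZO n) (%hs. ?B hs x c) (pH hs)) m"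
    unfolding tpow_lift_ptens[OF module_Z bc hs]
    by (rule cs_cong[OF m]) (simp only: tpow_lift_ptens[OF module_Z bm hs])
  qed
  from this[OF it3] show ?thesis by simp
 qed
 also have "... = lift k (ZO n) (%hs. cs (ZO n) (%x c. Zt n (rt n (?e hs c) t) (lact M (hs ! 1) x)) m) (iter_comult k H 2 h)"
  by (rule tpow_lift_cong[OF it3], rule cs_cong[OF m], rule Zt_move) (simp_all add: w3[unfolded One_nat_def] rt_closed t antipode_closed)
 also have "... = cy n t (lact M h m)"
  unfolding cy_def by (rule cs_lact[OF module_Z cy_cs[OF t] h m, symmetric])
 finally show ?thesis .
qed

lemma Zc_simps: "obj Zc n = ZO n" "face Zc (Suc n) i = tmap k H (Dg n) M (fc (Suc n) i)"
 "degen Zc n i = tmap k H (Dg (Suc n)) M (comult_at k H n i)"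
 by (simp_all add: Z_cyclic_def tmap_def Z_obj_def Z_tens_def fc_def)

lemma cyc_facts:
 shows cyc_Z_linear: "lmap k (ZO n) (ZO n) (cyc Zc n)"
  and cyc_Zt: "t <: T' n ==> m <: M ==> cyc Zc n (Zt n t m) = cy n t m"
proof -
 interpret D: tensor_over_algebra k "Dg n" M H
  by (rule tensor_over_algebraI[OF rmod_diag left_M])
 have c: "cyc Zc n = lift k (ZO n) (%(t, m). cy n t m)"
  by (simp add: Z_cyclic_def cy_def[abs_def] cs_def rt_def)
 have b: "balanced k H (Dg n) M (ZO n) (cy n)"
  using cy_bilin[of n] unfolding balanced_def bilin_def by (simp add: diag_simps diag_linear cy_move)
 show "lmap k (ZO n) (ZO n) (cyc Zc n)"
  unfolding c Z_obj_def by (rule D.over_lift_linear[OF module_Z[unfolded Z_obj_def] b[unfolded Z_obj_def]])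
 show "t <: T' n ==> m <: M ==> cyc Zc n (Zt n t m) = cy n t m"
  unfolding c Z_tens_def by (rule D.over_lift_tens[OF module_Z b]) (simp_all add: diag_simps)
qed

lemma face_Z_linear: "i <= Suc n ==> lmap k (ZO (Suc n)) (ZO n) (face Zc (Suc n) i)"
 unfolding Zc_simps Z_obj_def by (rule tmap_linear[OF left_M rmod_diag rmod_diag fc_rmodule_map])

lemma face_Zt: "i <= Suc n ==> t <: T' (Suc n) ==> m <: M ==>
  face Zc (Suc n) i (Zt (Suc n) t m) = Zt n (fc (Suc n) i t) m"
 unfolding Zc_simps Z_tens_def
 by (rule tmap_tens[OF left_M rmod_diag rmod_diag fc_rmodule_map]) (simp_all add: diag_simps)

text \<open>After \<open>j\<close> rotations the coaction has been applied \<open>j\<close> times; coassociativity collects the factors in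
  \<open>\<Delta>\<^sup>j(m\<^sub>1)\<close>.\<close>

lemma cyc_power:
 "j + l = Suc n ==> t <: T' n ==> m <: M ==>
  (cyc Zc n ^^ j) (Zt n t m) =
  cs (ZO n) (%x c. Zt n (tm (Suc n) ((rt n 1[H] ^^ j) t) (ones j l (it j c))) x) m"
proof (induction j arbitrary: l)
 case 0
 have "cs (ZO n) (%x c. Zt n (tm (Suc n) t (ones 0 (Suc n) (it 0 c))) x) m =
   cs (ZO n) (%x c. eH c .[ZO n] Zt n t x) m"
  by (rule cs_cong[OF 0(3)]) (simp add: ones_it_0 tm_smult eps_cl it_one_closed 0 tm_one
   lin_smult[OF bil_left[OF Zt_bilin]] del: ones.simps)
 also have "... = Zt n t m" by (rule cs_counit[OF module_Z bil_right[OF Zt_bilin] 0(3)]) (rule 0)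
 finally show ?case using 0 by simp
next
 case (Suc j)
 define s where "s = (rt n 1[H] ^^ j) t"
 have s: "s <: T' n" unfolding s_def by (rule lin_closed[OF rt_power_linear Suc(3)])
 have n: "n = j + l" using Suc.prems by simp
 let ?o = "%c. ones j (Suc l) (it j c)"
 have ol: "lmap k H (T' n) ?o"
  using lin_comp[OF ones_linear[of j "Suc l"] it_linear] by (simp add: n)
 note oc = lin_closed[OF ol]
 have b1: "bilin k M H (ZO n) (%x c. Zt n (tm (Suc n) s (?o c)) x)"
  by (rule bilinI) (intro lin_Zt lin_tm ol lin_id tm_closed s oc; assumption)+
 have b2: "bilin k H H (T' n) (%a b. rt n a (tm (Suc n) s (?o b)))"
  by (rule bilinI) (intro lin_rt lin_tm ol lin_id tm_closed s oc; assumption)+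
 have b3: "bilin k H H (ZO n) (%a b. Zt n (rt n a (tm (Suc n) s (?o b))) x)" if "x <: M" for x
  by (rule bilin_comp[OF bil_left[OF Zt_bilin that] b2])
 have "(cyc Zc n ^^ Suc j) (Zt n t m) = cyc Zc n (cs (ZO n) (%x c. Zt n (tm (Suc n) s (?o c)) x) m)"
  using Suc.IH[of "Suc l"] Suc.prems by (simp add: s_def)
 also have "... = cs (ZO n) (%x b. cyc Zc n (Zt n (tm (Suc n) s (?o b)) x)) m"
  by (rule cs_hom[OF module_Z module_Z cyc_Z_linear b1 Suc(4)])
 also have "... = cs (ZO n) (%x b. cs (ZO n) (%y a. Zt n (rt n a (tm (Suc n) s (?o b))) y) x) m"
  by (rule cs_cong[OF Suc(4)]) (simp add: cyc_Zt tm_closed s oc cy_def del: ones.simps)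
 also have "... = cs (ZO n) (%x c. sw' (ZO n) (%a b. Zt n (rt n a (tm (Suc n) s (?o b))) x) c) m"
  by (rule cs_coassoc[OF module_Z Suc(4) b3]) (simp_all add: bil_right[OF Zt_bilin] rt_closed tm_closed s oc del: ones.simps)
 also have "... = cs (ZO n) (%x c. Zt n (tm (Suc n) ((rt n 1[H] ^^ Suc j) t) (ones (Suc j) l (it (Suc j) c))) x) m"
 proof (rule cs_cong[OF Suc(4)])
  fix x c assume x: "x <: M" and c: "c <: H"
  have "sw' (ZO n) (%a b. Zt n (rt n a (tm (Suc n) s (?o b))) x) c =
    Zt n (sw' (T' n) (%a b. rt n a (tm (Suc n) s (?o b))) c) x"
   by (rule sw_hom[OF T_mod module_Z bil_left[OF Zt_bilin x] b2 c, symmetric])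
  then show "sw' (ZO n) (%a b. Zt n (rt n a (tm (Suc n) s (?o b))) x) c =
    Zt n (tm (Suc n) ((rt n 1[H] ^^ Suc j) t) (ones (Suc j) l (it (Suc j) c))) x"
   using rt_ones[OF c, of s j l] s by (simp add: n s_def)
 qed
 finally show ?case .
qed

text \<open>The full turn multiplies by \<open>\<Delta>\<^sup>n(m\<^sub>1)\<close>, which modularity turns into the identity.\<close>

lemma cyc_order_Zt: assumes t: "t <: T' n" and m: "m <: M"
 shows "(cyc Zc n ^^ Suc n) (Zt n t m) = Zt n t m"
proof -
 have b: "bilin k M H M (%x c. lact M c x)"
  by (rule bilinI) (auto intro: M.lact_linear_algebra M.lact_linear_module)
 have "(cyc Zc n ^^ Suc n) (Zt n t m) = cs (ZO n) (%x c. Zt n (tm (Suc n) t (it (Suc n) c)) x) m"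
  using cyc_power[of "Suc n" 0 n, OF _ t m] rt_order[OF t] by simp
 also have "... = cs (ZO n) (%x c. Zt n t (lact M c x)) m" by (rule cs_cong[OF m]) (simp add: Zt_move t)
 also have "... = Zt n t (cs M (%x c. lact M c x) m)"
  by (rule cs_hom[OF module_M module_Z bil_right[OF Zt_bilin t] b m, symmetric])
 also have "cs M (%x c. lact M c x) m = m" using M.modular[OF m] by (simp add: cs_def)
 finally show ?thesis .
qed

lemma Z_precyclic: "precyclic k Zc"
proof (rule precyclic.intro, unfold Zc_simps(1))
 fix i j n :: nat
 show "module k (ZO n)" by (rule module_Z)
 show cl: "lmap k (ZO n) (ZO n) (cyc Zc n)" for n by (rule cyc_Z_linear)
 note fl = face_Z_linear
 show "i <= Suc n ==> lmap k (ZO (Suc n)) (ZO n) (face Zc (Suc n) i)" by (rule fl)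
 show "face Zc (Suc n) i (face Zc (Suc (Suc n)) (Suc j) x) = face Zc (Suc n) j (face Zc (Suc (Suc n)) i x)"
  if ij: "i <= j" "j <= Suc n" "x <: ZO (Suc (Suc n))" for x
 proof (rule Z_ext[OF module_Z _ _ _ ij(3)])
  show "lmap k (ZO (Suc (Suc n))) (ZO n) (%x. face Zc (Suc n) i (face Zc (Suc (Suc n)) (Suc j) x))"
   "lmap k (ZO (Suc (Suc n))) (ZO n) (%x. face Zc (Suc n) j (face Zc (Suc (Suc n)) i x))"
   using ij by (auto intro!: lin_comp[OF fl fl])
 qed (use ij in \<open>simp add: face_Zt fc_closed fc_fc\<close>)
 show "face Zc (Suc n) 0 (cyc Zc (Suc n) x) = face Zc (Suc n) (Suc n) x" if x: "x <: ZO (Suc n)" for x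
 proof (rule Z_ext[OF module_Z lin_comp[OF fl cl] fl _ x])
  fix t m assume t: "t <: T' (Suc n)" and m: "m <: M"
  have "face Zc (Suc n) 0 (cy (Suc n) t m) = cs (ZO n) (%x c. face Zc (Suc n) 0 (Zt (Suc n) (rt (Suc n) c t) x)) m"
   unfolding cy_def by (rule cs_hom[OF module_Z module_Z fl cy_cs[OF t] m]) simp
  also have "... = cs (ZO n) (%x c. eH c .[ZO n] Zt n (fc (Suc n) (Suc n) t) x) m"
   by (rule cs_cong[OF m]) (simp add: face_Zt rt_closed t fc_rt_0 fc_closed eps_cl
    lin_smult[OF bil_left[OF Zt_bilin]])
  also have "... = Zt n (fc (Suc n) (Suc n) t) m"
   by (rule cs_counit[OF module_Z bil_right[OF Zt_bilin] m]) (simp add: fc_closed t)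
  finally show "face Zc (Suc n) 0 (cyc Zc (Suc n) (Zt (Suc n) t m)) = face Zc (Suc n) (Suc n) (Zt (Suc n) t m)"
   by (simp add: cyc_Zt face_Zt t m)
 qed simp_all
 show "face Zc (Suc n) (Suc i) (cyc Zc (Suc n) x) = cyc Zc n (face Zc (Suc n) i x)"
  if i: "i <= n" and x: "x <: ZO (Suc n)" for x
 proof (rule Z_ext[OF module_Z lin_comp[OF fl cl] lin_comp[OF cl fl] _ x])
  fix t m assume t: "t <: T' (Suc n)" and m: "m <: M"
  have "face Zc (Suc n) (Suc i) (cy (Suc n) t m) =
    cs (ZO n) (%x c. face Zc (Suc n) (Suc i) (Zt (Suc n) (rt (Suc n) c t) x)) m"
   unfolding cy_def by (rule cs_hom[OF module_Z module_Z fl cy_cs[OF t] m]) (simp add: i)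
  also have "... = cy n (fc (Suc n) i t) m"
   unfolding cy_def by (rule cs_cong[OF m]) (simp add: face_Zt rt_closed t fc_rt i)
  finally show "face Zc (Suc n) (Suc i) (cyc Zc (Suc n) (Zt (Suc n) t m)) = cyc Zc n (face Zc (Suc n) i (Zt (Suc n) t m))"
   using i by (simp add: cyc_Zt face_Zt t m fc_closed)
 qed (use i in simp_all)
 show "(cyc Zc n ^^ Suc n) x = x" if x: "x <: ZO n" for x
 proof (rule Z_ext[OF module_Z _ lin_id cyc_order_Zt x])
  have "lmap k (ZO n) (ZO n) (cyc Zc n ^^ j)" for j
   by (induction j) (simp_all add: lin_id id_def lin_comp[OF cl] comp_def)
  then show "lmap k (ZO n) (ZO n) (cyc Zc n ^^ Suc n)" .
 qed
qed

end

section \<open>Integrals and relative projectivity\<close>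

context normal_pair
begin

text \<open>A minimal left ideal of \<open>K\<close> on which the counit does not vanish is spanned by a left
  integral \<open>\<Lambda>\<close>.  It is also a right integral: the left ideal \<open>\<Lambda> K\<^sub>+\<close> has square zero, and in a sum of
  minimal left ideals such an ideal is zero.\<close>

lemma integral_exists:
 assumes k: "field k" and ss: "semisimple_ring (H\<lparr>carrier := K\<rparr>)"
 shows "EX \<Lambda>:K. eH \<Lambda> = 1[k] & (ALL x:Kp. \<Lambda> *[H] x = 0[H])"
proof -
 interpret k: field k by (rule k)
 let ?R = "H\<lparr>carrier := K\<rparr>"
 have mR: "module k ?R" by (rule submodule_module[OF module_H K_sub])
 interpret R: module k ?R by (rule mR)
 note Kc = K_closed
 have K0: "0[H] : K" by (rule submodule_zero[OF K_sub])
 have \<epsilon>lin: "lmap k ?R (ground_module k) (eH)"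
  by (rule linI) (simp_all add: eps_cl Kc lin_add[OF counit_linear] lin_smult[OF counit_linear, simplified])
 have ideal: "left_ideal ?R J" if J: "J <= K" "0[H] : J"
  "!!x y. x : J ==> y : J ==> x +[H] y : J" "!!a x. a : K ==> x : J ==> a *[H] x : J" for J
 proof -
  have n1: "-[H] 1[H] : K" by (rule submodule_neg[OF module_H K_sub K_one])
  have neg: "-[?R] x : J" if x: "x : J" for x
  proof -
   have xK: "x : K" using x \<open>J \<subseteq> K\<close> by blast
   have "-[H] 1[H] *[H] x = -[H] x" using Kc[OF xK] by (simp add: l_minus)
   moreover have "-[?R] x = -[H] x"
    using xK submodule_neg[OF module_H K_sub xK] by (intro R.minus_equality) (simp_all add: Kc l_neg)
   ultimately show ?thesis using J(4)[OF n1 x] by simp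
  qed
  show ?thesis
   unfolding left_ideal_def additive_subgroup_def
  proof (intro conjI ballI)
   show "subgroup J (add_monoid ?R)"
    by (rule R.add.subgroupI) (use J neg in \<open>auto simp: a_inv_def[symmetric]\<close>)
  qed (use J in simp)
 qed
 have idealD: "L <= K" "!!a x. a : K ==> x : L ==> a *[H] x : L" "!!x y. x : L ==> y : L ==> x +[H] y : L"
  "0[H] : L" if "minimal_left_ideal ?R L" for L
  using that additive_subgroup.a_subset[of L ?R] additive_subgroup.a_closed[of L ?R]
   additive_subgroup.zero_closed[of L ?R]
  by (auto simp: minimal_left_ideal_def left_ideal_def)
 have minimal: "J = {0[H]} \<or> J = L" if "minimal_left_ideal ?R L" "left_ideal ?R J" "J <= L" for J L
  using that by (simp add: minimal_left_ideal_def)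
 obtain \<L> f where L: "!!L. L : \<L> ==> minimal_left_ideal ?R L" and f: "!!L. L : \<L> ==> f L : L"
  and fin: "finite {L\<in>\<L>. f L ~= 0[H]}" and one: "1[H] = (\<Oplus>\<^bsub>?R\<^esub>L\<in>{L\<in>\<L>. f L ~= 0[H]}. f L)"
 proof -
  obtain \<L> where L: "ALL L:\<L>. minimal_left_ideal ?R L" and ex: "ALL x:carrier ?R. EX! f. f : (\<Pi>\<^sub>E L\<in>\<L>. L) &
    finite {L\<in>\<L>. f L ~= 0[?R]} & x = (\<Oplus>\<^bsub>?R\<^esub>L\<in>{L\<in>\<L>. f L ~= 0[?R]}. f L)"
   using ss unfolding semisimple_ring_def by blast
  from ex have "EX f. f : (\<Pi>\<^sub>E L\<in>\<L>. L) & finite {L\<in>\<L>. f L ~= 0[?R]} & 1[H] = (\<Oplus>\<^bsub>?R\<^esub>L\<in>{L\<in>\<L>. f L ~= 0[?R]}. f L)"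
   using K_one by (auto dest!: bspec[of _ _ "1[H]"] elim: ex1E)
  then obtain f where "f : (\<Pi>\<^sub>E L\<in>\<L>. L)" "finite {L\<in>\<L>. f L ~= 0[?R]}"
   "1[H] = (\<Oplus>\<^bsub>?R\<^esub>L\<in>{L\<in>\<L>. f L ~= 0[?R]}. f L)" by blast
  then show ?thesis using L by (intro that[of \<L> f]) (auto simp: PiE_iff)
 qed
 let ?S = "{L\<in>\<L>. f L ~= 0[H]}"
 have fS: "f : ?S \<rightarrow> carrier ?R" using f idealD(1)[OF L] by auto
 obtain L0 where L0: "L0 : ?S" "eH (f L0) ~= 0[k]"
 proof (rule ccontr)
  assume n: "\<not> thesis"
  note L0 = that
  have z: "eH (f L) = 0[k]" if "L : ?S" for L using that n L0 by blast
  interpret G: module k "ground_module k" by (rule module_k)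
  have "eH 1[H] = (\<Oplus>\<^bsub>ground_module k\<^esub>L\<in>?S. eH (f L))"
   unfolding one by (rule lin_finsum[OF mR module_k \<epsilon>lin fin fS])
  also have "... = (\<Oplus>\<^bsub>ground_module k\<^esub>L\<in>?S. 0[ground_module k])" by (rule sum_cong) (simp add: z)
  also have "... = 0[ground_module k]" by (rule G.finsum_zero)
  finally show False using k.one_not_zero by (simp add: counit_one)
 qed
 have mL: "minimal_left_ideal ?R L0" using L0(1) L by simp
 note D = idealD[OF mL]
 have fL: "f L0 : L0" using L0(1) f by simp
 let ?u = "inv\<^bsub>k\<^esub> eH (f L0)"
 have fc: "f L0 <: H" "eH (f L0) <: k" using fL D(1) by (auto intro: Kc eps_cl)
 have u: "?u <: k" "?u *[k] eH (f L0) = 1[k]"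
  using k.field_Units fc L0(2) by auto
 define \<Lambda> where "\<Lambda> = (?u .[H] 1[H]) *[H] f L0"
 have \<Lambda>L: "\<Lambda> : L0" unfolding \<Lambda>_def by (intro D(2) fL submodule_smult[OF K_sub] u K_one)
 then have \<Lambda>K: "\<Lambda> : K" and \<Lambda>H: "\<Lambda> <: H" using D(1) Kc by auto
 have \<epsilon>\<Lambda>: "eH \<Lambda> = 1[k]"
  unfolding \<Lambda>_def using u fc by (simp add: smult_mult_left lin_smult[OF counit_linear])
 have left: "x *[H] \<Lambda> = 0[H]" if x: "x : Kp" for x
 proof -
  let ?J = "{z : L0. eH z = 0[k]}"
  have "left_ideal ?R ?J"
   using D Kc lin_zero[OF module_H module_k counit_linear]
   by (intro ideal) (auto simp: lin_add[OF counit_linear] counit_mult eps_cl subset_iff)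
  then have "?J = {0[H]} \<or> ?J = L0" by (intro minimal[OF mL]) auto
  moreover have "\<Lambda> \<notin> ?J" using \<epsilon>\<Lambda> k.one_not_zero by simp
  moreover have "x *[H] \<Lambda> : ?J"
   using D(2)[OF aug_D(1)[OF x] \<Lambda>L] x by (simp add: counit_mult aug_D \<Lambda>H eps_cl)
  ultimately show ?thesis using \<Lambda>L by blast
 qed
 have left': "a *[H] \<Lambda> = eH a .[H] \<Lambda>" if a: "a : K" for a
 proof -
  have l: "lmap k H H (%a. a *[H] \<Lambda>)" by (intro lin \<Lambda>H)
  from aug_invariant[OF module_H l left a] show ?thesis by (simp add: \<Lambda>H)
 qed
 let ?J = "(%x. \<Lambda> *[H] x) ` Kp"
 have augs: "submodule (Kp) k H"
  using lin_zero[OF module_H module_k counit_linear]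
  by (intro submoduleI'[OF module_H])
   (auto simp: aug_def Kc lin_add[OF counit_linear] lin_smult[OF counit_linear] K0
    intro: submodule_add[OF K_sub] submodule_smult[OF K_sub])
 have JK: "?J <= K" using \<Lambda>K by (auto intro: K_mult simp: aug_D)
 have JJ: "j *[H] j = 0[H]" if j: "j : ?J" for j
 proof -
  obtain x where x: "x : Kp" "j = \<Lambda> *[H] x" using j by blast
  have xc: "x <: H" using x(1) by (rule aug_D)
  have "j *[H] j = \<Lambda> *[H] (x *[H] \<Lambda>) *[H] x" using xc by (simp add: x(2) m_assoc \<Lambda>H)
  then show ?thesis using xc by (simp add: left[OF x(1)] \<Lambda>H)
 qed
 have JI: "a *[H] j : ?J" if a: "a : K" and j: "j : ?J" for a j
 proof -
  obtain x where x: "x : Kp" "j = \<Lambda> *[H] x" using j by blast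
  have "a *[H] j = \<Lambda> *[H] (eH a .[H] x)"
   using x(1) a by (simp add: x(2) m_assoc[symmetric] left' \<Lambda>H Kc aug_D smult_mult_left smult_mult_right eps_cl)
  then show ?thesis using submodule_smult[OF augs eps_cl[OF Kc[OF a]] x(1)] by blast
 qed
 have Jadd: "i +[H] j : ?J" if i: "i : ?J" and j: "j : ?J" for i j
 proof -
  obtain x y where "x : Kp" "i = \<Lambda> *[H] x" "y : Kp" "j = \<Lambda> *[H] y" using i j by blast
  then show ?thesis
   using submodule_add[OF augs, of x y] by (auto simp: r_distr[symmetric] \<Lambda>H aug_D)
 qed
 have J0: "0[H] : ?J" using submodule_zero[OF augs] \<Lambda>H by (auto intro!: image_eqI[of _ _ "0[H]"])
 have kill: "j *[H] y = 0[H]" if j: "j : ?J" and L': "L' : \<L>" and y: "y : L'" for j y L'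
 proof -
  note D' = idealD[OF L[OF L']]
  have yc: "y <: H" using y D'(1) Kc by blast
  have Jc: "i <: H" if "i : ?J" for i using that JK Kc by blast
  let ?I = "(%j. j *[H] y) ` ?J"
  have sub: "?I <= L'" using JK y by (auto intro!: D'(2))
  have "left_ideal ?R ?I"
  proof (rule ideal)
   show "?I <= K" using sub D'(1) by blast
   show "0[H] : ?I" by (rule image_eqI[OF _ J0]) (simp add: yc)
   show "p +[H] q : ?I" if pq: "p : ?I" "q : ?I" for p q
   proof -
    obtain i j where ij: "i : ?J" "p = i *[H] y" "j : ?J" "q = j *[H] y"
     using pq(1) pq(2) by (elim imageE) blast
    have "p +[H] q = (i +[H] j) *[H] y" unfolding ij(2,4) by (rule l_distr[symmetric, OF Jc[OF ij(1)] Jc[OF ij(3)] yc])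
    then show ?thesis by (rule image_eqI[OF _ Jadd[OF ij(1,3)]])
   qed
   show "a *[H] p : ?I" if a: "a : K" and p: "p : ?I" for a p
   proof -
    obtain i where i: "i : ?J" "p = i *[H] y" using p by (elim imageE) blast
    have "a *[H] p = (a *[H] i) *[H] y" unfolding i(2) by (rule m_assoc[symmetric, OF Kc[OF a] Jc[OF i(1)] yc])
    then show ?thesis by (rule image_eqI[OF _ JI[OF a i(1)]])
   qed
  qed
  from minimal[OF L[OF L'] this sub] show ?thesis
  proof
   assume "?I = {0[H]}"
   then show ?thesis using imageI[OF j, of "%j. j *[H] y"] by (simp only: singleton_iff)
  next
   assume "?I = L'"
   then obtain i where i: "i : ?J" "y = i *[H] y" using y by blast
   have ic: "i <: H" by (rule Jc[OF i(1)])
   have "y = i *[H] (i *[H] y)" using i(2) by simp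
   also have "... = (i *[H] i) *[H] y" by (rule m_assoc[symmetric, OF ic ic yc])
   finally have "y = 0[H]" using JJ[OF i(1)] yc by simp
   then show ?thesis using Jc[OF j] by simp
  qed
 qed
 have "\<Lambda> *[H] x = 0[H]" if x: "x : Kp" for x
 proof -
  let ?j = "\<Lambda> *[H] x"
  have j: "?j : ?J" "?j : K" "?j <: H" using x JK Kc by blast+
  have l: "lmap k ?R ?R (%y. ?j *[H] y)"
   using j by (intro linI) (simp_all add: K_mult Kc r_distr smult_mult_right)
  have "?j = ?j *[H] 1[H]" using j by simp
  also have "... = (\<Oplus>\<^bsub>?R\<^esub>L\<in>?S. ?j *[H] f L)"
   unfolding one by (rule lin_finsum[OF mR mR l fin fS])
  also have "... = (\<Oplus>\<^bsub>?R\<^esub>L\<in>?S. 0[?R])" by (rule sum_cong) (simp add: kill[OF j(1) _ f])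
  also have "... = 0[?R]" by (rule R.finsum_zero)
  finally show ?thesis by simp
 qed
 then show ?thesis using \<Lambda>K \<epsilon>\<Lambda> by blast
qed

text \<open>Restriction of scalars along \<open>H \<rightarrow> H / K\<^sub>+H\<close>.\<close>

definition res where
 "res X = module.extend (module.truncate X) (rmodule.fields (%x h. ract X x (pr h)))"

lemma res_simps: "carrier (res X) = carrier X" "add (res X) = add X" "zero (res X) = zero X"
 "smult (res X) = smult X" "ract (res X) x h = ract X x (pr h)"
 by (simp_all add: res_def module.extend_def module.truncate_def rmodule.fields_def)

lemma res_linear: "lmap k (res X) W f \<longleftrightarrow> lmap k X W f" "lmap k V (res X) g \<longleftrightarrow> lmap k V X g"
 by (simp_all add: linear_map_def res_simps)

lemma rmod_res: assumes "rmod k Q X" shows "rmod k H (res X)"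
proof -
 interpret X: right_module k Q X by (rule assms)
 have "module k (res X)" by (rule module_transfer[OF X.module_axioms]) (simp_all add: res_simps)
 then show ?thesis
  by (intro right_module.intro right_module_axioms.intro)
   (simp_all add: res_simps res_linear X.ract_linear_module pr_closed lin_comp[OF X.ract_linear_algebra pr_linear]
    pr_mult X.ract_mult pr_one X.ract_one)
qed

lemma rmap_res: "rmap k Q X Y f ==> rmap k H (res X) (res Y) f"
 by (simp add: rmodule_map_def res_simps res_linear pr_closed)

text \<open>The elements killed by \<open>K\<^sub>+\<close>; they form the largest submodule on which \<open>H\<close> acts through the
  quotient.\<close>

definition Inv where
 "Inv Y = module.extend
   ((module.truncate Y)\<lparr>carrier := {y : carrier Y. ALL x:Kp. ract Y y x = 0[Y]}\<rparr>)
   (rmodule.fields (%y. on_coset (ract Y y)))"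

lemma inv_simps: "carrier (Inv Y) = {y : carrier Y. ALL x:Kp. ract Y y x = 0[Y]}"
 "add (Inv Y) = add Y" "zero (Inv Y) = zero Y" "smult (Inv Y) = smult Y"
 "ract (Inv Y) y = on_coset (ract Y y)"
 by (simp_all add: Inv_def module.extend_def module.truncate_def rmodule.fields_def)

context
 fixes Y :: "('k, 'h, 'y) rmodule"
 assumes Y: "rmod k H Y"
begin

interpretation Y: right_module k H Y by (rule Y)

lemma inv_closed: "y <: Inv Y ==> y <: Y"
 by (simp add: inv_simps)

lemma inv_ract:
 assumes y: "y <: Inv Y"
 shows "lmap k Q Y (ract (Inv Y) y)" "h <: H ==> ract (Inv Y) y (pr h) = ract Y y h"
proof -
 have z: "ract Y y (x *[H] h) = 0[Y]" if "x : Kp" "h <: H" for x h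
  using y that lin_zero[OF Y.module_axioms Y.module_axioms Y.ract_linear_module[OF that(2)]]
  by (simp add: inv_simps Y.ract_mult aug_D)
 note c = on_coset_pr[OF Y.module_axioms Y.ract_linear_algebra[OF inv_closed[OF y]] z]
 show "lmap k Q Y (ract (Inv Y) y)" "h <: H ==> ract (Inv Y) y (pr h) = ract Y y h"
  unfolding inv_simps by (rule c; assumption)+
qed

lemma inv_ract_closed:
 assumes y: "y <: Inv Y" and h: "h <: H"
 shows "ract Y y h <: Inv Y"
proof -
 have "ract Y (ract Y y h) x = 0[Y]" if x: "x : Kp" for x
 proof -
  note xc = aug_D(2)[OF x]
  have px: "pr x = 0[Q]" using pr_aug[OF x one_closed] xc by simp
  have "ract Y (ract Y y h) x = ract Y y (h *[H] x)" using inv_closed[OF y] by (simp add: Y.ract_mult h xc)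
  also have "... = ract (Inv Y) y (pr (h *[H] x))" by (simp add: inv_ract(2)[OF y] h xc)
  also have "pr (h *[H] x) = 0[Q]" using h by (simp add: pr_mult xc px pr_closed)
  finally show ?thesis using lin_zero[OF module_Q Y.module_axioms inv_ract(1)[OF y]] by simp
 qed
 then show ?thesis using ract_closed[OF Y inv_closed[OF y] h] by (simp add: inv_simps)
qed

lemma right_module_inv: "rmod k Q (Inv Y)"
proof -
 have s: "submodule (carrier (Inv Y)) k Y"
  by (intro submoduleI'[OF Y.module_axioms])
   (auto simp: inv_simps aug_D lin_add[OF Y.ract_linear_module] lin_smult[OF Y.ract_linear_module]
    lin_zero[OF Y.module_axioms Y.module_axioms Y.ract_linear_module])
 have m: "module k (Inv Y)"
  by (rule module_transfer[OF submodule_module[OF Y.module_axioms s]]) (simp_all add: inv_simps)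
 have l: "lmap k (Inv Y) (Inv Y) (%y. ract (Inv Y) y X)" if X: "X <: Q" for X
 proof -
  obtain h where h: "h <: H" "X = pr h" using X by (rule pr_cases)
  note lh = Y.ract_linear_module[OF h(1)]
  show ?thesis
  proof (rule linI)
   fix y assume y: "y <: Inv Y"
   show "ract (Inv Y) y X <: Inv Y" by (simp add: h inv_ract(2)[OF y] inv_ract_closed[OF y])
   fix y' assume y': "y' <: Inv Y"
   have a: "y +[Inv Y] y' <: Inv Y"
    using submodule_add[OF s y y'] by (simp add: inv_simps(2))
   show "ract (Inv Y) (y +[Inv Y] y') X =
     ract (Inv Y) y X +[Inv Y] ract (Inv Y) y' X"
    unfolding h(2) inv_ract(2)[OF y h(1)] inv_ract(2)[OF y' h(1)] inv_ract(2)[OF a h(1)]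
    by (simp add: inv_simps(2) lin_add[OF lh] inv_closed[OF y] inv_closed[OF y'])
  next
   fix a y assume a: "a <: k" and y: "y <: Inv Y"
   have c: "a .[Inv Y] y <: Inv Y"
    using submodule_smult[OF s a y] by (simp add: inv_simps(4))
   show "ract (Inv Y) (a .[Inv Y] y) X = a .[Inv Y] ract (Inv Y) y X"
    unfolding h(2) inv_ract(2)[OF y h(1)] inv_ract(2)[OF c h(1)]
    by (simp add: inv_simps(4) lin_smult[OF lh a inv_closed[OF y]])
  qed
 qed
 show ?thesis
 proof (intro right_module.intro m right_module_axioms.intro l)
  fix y assume y: "y <: Inv Y"
  show "lmap k Q (Inv Y) (ract (Inv Y) y)"
   using lin_closed[OF l y] inv_ract(1)[OF y] by (simp add: linear_map_def inv_simps(2,4))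
  show "ract (Inv Y) y 1[Q] = y"
   using inv_closed[OF y] by (simp add: pr_one[symmetric] inv_ract(2)[OF y] Y.ract_one)
  fix X X' assume "X <: Q" "X' <: Q"
  then obtain h h' where "h <: H" "X = pr h" "h' <: H" "X' = pr h'" by (elim pr_cases)
  then show "ract (Inv Y) y (X *[Q] X') = ract (Inv Y) (ract (Inv Y) y X) X'"
   using inv_closed[OF y] inv_ract_closed[OF y]
   by (simp add: pr_mult[symmetric] inv_ract(2) y Y.ract_mult)
 qed
qed

end

text \<open>A projective module over the quotient is projective over \<open>H\<close>: a preimage of an invariant element can
  be made invariant by multiplying it with an integral.\<close>

lemma res_lifts:
 fixes X :: "('k, 'h set, 'p) rmodule" and Y :: "('k, 'h, 'y) rmodule" and Y' :: "('k, 'h, 'z) rmodule"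
 assumes k: "field k" and ss: "semisimple_ring (H\<lparr>carrier := K\<rparr>)" and X: "projective_rmodule k Q X"
  and Y': "rmod k H Y'" and Y: "rmod k H Y" and d: "rmap k H Y' Y d"
 shows "lifts k H (res X) Y' Y d"
 unfolding lifts_def
proof (intro allI impI)
 fix \<psi> assume a: "rmap k H (res X) Y \<psi> & \<psi> ` carrier (res X) <= d ` carrier Y'"
 then have \<psi>: "rmap k H (res X) Y \<psi>" and im: "!!x. x <: X ==> \<psi> x : d ` carrier Y'"
  by (auto simp: res_simps)
 interpret X: right_module k Q X using X by (simp add: projective_rmodule_def)
 interpret Y: right_module k H Y by (rule Y)
 interpret Y': right_module k H Y' by (rule Y')
 obtain \<Lambda> where \<Lambda>: "\<Lambda> : K" "eH \<Lambda> = 1[k]" "!!x. x : Kp ==> \<Lambda> *[H] x = 0[H]"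
  using integral_exists[OF k ss] by blast
 note \<Lambda>H = K_closed[OF \<Lambda>(1)]
 have \<psi>r: "\<psi> (ract X x (pr h)) = ract Y (\<psi> x) h" if "x <: X" "h <: H" for x h
  using rmap_ract[OF \<psi>, of x h] that by (simp add: res_simps)
 have \<psi>l: "lmap k X Y \<psi>" using rmap_linear[OF \<psi>] by (simp add: res_linear)
 have dz: "d 0[Y'] = 0[Y]" by (rule lin_zero[OF Y'.module_axioms Y.module_axioms rmap_linear[OF d]])
 have dinv: "d y <: Inv Y" if y: "y <: Inv Y'" for y
  using y rmap_closed[OF d, of y] rmap_ract[OF d, of y, symmetric] by (auto simp: inv_simps aug_D dz)
 have \<psi>inv: "\<psi> x <: Inv Y" if x: "x <: X" for x
 proof -
  have "ract Y (\<psi> x) a = 0[Y]" if a: "a : Kp" for a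
  proof -
   have "pr a = 0[Q]" using pr_aug[OF a one_closed] by (simp add: aug_D a)
   then have "ract Y (\<psi> x) a = \<psi> 0[X]"
    using \<psi>r[OF x aug_D(2)[OF a]] lin_zero[OF module_Q X.module_axioms X.ract_linear_algebra[OF x]] by simp
   then show ?thesis using lin_zero[OF X.module_axioms Y.module_axioms \<psi>l] by simp
  qed
  then show ?thesis using lin_closed[OF \<psi>l x] by (simp add: inv_simps)
 qed
 have dQ: "rmap k Q (Inv Y') (Inv Y) d"
  unfolding rmodule_map_def
 proof (intro conjI ballI)
  show "lmap k (Inv Y') (Inv Y) d"
   using rmap_linear[OF d] dinv inv_closed[OF Y'] by (simp add: linear_map_def inv_simps(2,4))
  fix y A assume y: "y <: Inv Y'" and "A <: Q"
  then obtain h where "h <: H" "A = pr h" by (elim pr_cases)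
  then show "d (ract (Inv Y') y A) = ract (Inv Y) (d y) A"
   by (simp add: inv_ract(2)[OF Y' y] inv_ract(2)[OF Y dinv[OF y]] rmap_ract[OF d] inv_closed[OF Y' y])
 qed
 have \<psi>Q: "rmap k Q X (Inv Y) \<psi>"
  unfolding rmodule_map_def
 proof (intro conjI ballI)
  show "lmap k X (Inv Y) \<psi>"
   using \<psi>l \<psi>inv by (simp add: linear_map_def inv_simps(2,4))
  fix x A assume x: "x <: X" and "A <: Q"
  then obtain h where "h <: H" "A = pr h" by (elim pr_cases)
  then show "\<psi> (ract X x A) = ract (Inv Y) (\<psi> x) A"
   by (simp add: inv_ract(2)[OF Y \<psi>inv[OF x]] \<psi>r x)
 qed
 have im': "\<psi> x : d ` carrier (Inv Y')" if x: "x <: X" for x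
 proof -
  obtain y where y: "y <: Y'" "\<psi> x = d y" using im[OF x] by blast
  have "ract Y' (ract Y' y \<Lambda>) a = 0[Y']" if a: "a : Kp" for a
   using lin_zero[OF module_H Y'.module_axioms Y'.ract_linear_algebra[OF y(1)]] \<Lambda>(3)[OF a]
   by (simp add: Y'.ract_mult[symmetric] y \<Lambda>H aug_D a)
  then have "ract Y' y \<Lambda> <: Inv Y'" using ract_closed[OF Y' y(1) \<Lambda>H] by (simp add: inv_simps)
  moreover have "d (ract Y' y \<Lambda>) = \<psi> x"
  proof -
   have "pr \<Lambda> = 1[Q]" using pr_K[OF \<Lambda>(1) one_closed] MQ.module_quot \<Lambda>H
    module.smult_one[OF module_Q pr_closed[OF one_closed]] by (simp add: \<Lambda>(2) pr_one)
   then show ?thesis using \<psi>r[OF x \<Lambda>H] by (simp add: rmap_ract[OF d] y \<Lambda>H X.ract_one x)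
  qed
  ultimately show ?thesis by (metis image_eqI)
 qed
 obtain \<phi> where \<phi>: "rmap k Q X (Inv Y') \<phi>" "!!x. x <: X ==> d (\<phi> x) = \<psi> x"
  using lifts_kernel[OF assoc_algebra.projective_lifts[OF assoc_algebra_Q X right_module_inv[OF Y']
   right_module_inv[OF Y] dQ] \<psi>Q im'] by blast
 have "rmap k H (res X) Y' \<phi>"
  unfolding rmodule_map_def
 proof (intro conjI ballI)
  show "lmap k (res X) Y' \<phi>"
   unfolding res_linear using rmap_linear[OF \<phi>(1)] by (auto simp: linear_map_def inv_simps(1,2,4))
  fix x h assume "x <: res X" and h: "h <: H"
  then have x: "x <: X" by (simp add: res_simps)
  show "\<phi> (ract (res X) x h) = ract Y' (\<phi> x) h"
   using rmap_ract[OF \<phi>(1) x pr_closed[OF h]]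
   by (simp add: res_simps inv_ract(2)[OF Y' rmap_closed[OF \<phi>(1) x]] h)
 qed
 then show "EX \<phi>. rmap k H (res X) Y' \<phi> & (ALL x:carrier (res X). d (\<phi> x) = \<psi> x)"
  using \<phi>(2) by (auto simp: res_simps)
qed

lemma Pi_rmodule_map: "rmap k H (Dg n) (res (diag_module k Q n)) (Pi (Suc n))"
 unfolding rmodule_map_def
 by (simp add: res_linear diag_linear Q.diag_linear Pi_linear diag_simps Q.diag_simps res_simps Pi_tm it_closed Pi_it)

end

section \<open>The comparison\<close>

text \<open>A null-homotopic map sends cycles to boundaries after tensoring with \<open>M\<close>.\<close>

lemma tmap_null_homotopic:
 assumes M: "left_module k A M" and X: "!!n. rmod k A (X n)" and Y: "!!n. rmod k A (Y n)"
  and dX: "!!n. rmap k A (X (Suc n)) (X n) (dX (Suc n))"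
  and dY: "!!n. rmap k A (Y (Suc n)) (Y n) (dY (Suc n))"
  and E: "!!n. rmap k A (X n) (Y n) (E n)" and h: "!!n. rmap k A (X n) (Y (Suc n)) (h n)"
  and h0: "!!x. x <: X 0 ==> dY (Suc 0) (h 0 x) = E 0 x"
  and hS: "!!n x. x <: X (Suc n) ==>
   dY (Suc (Suc n)) (h (Suc n) x) = E (Suc n) x -[Y (Suc n)] h n (dX (Suc n) x)"
  and z: "z <: tov k A (X n) M"
  and cyc: "n = 0 \<or> tmap k A (X (n - 1)) M (dX n) z = 0[tov k A (X (n - 1)) M]"
 shows "tmap k A (Y n) M (E n) z : tmap k A (Y n) M (dY (Suc n)) ` carrier (tov k A (Y (Suc n)) M)"
proof (rule image_eqI)
 note mo = module_over[OF M]
 show "tmap k A (Y (Suc n)) M (h n) z <: tov k A (Y (Suc n)) M"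
  by (rule lin_closed[OF tmap_linear[OF M X Y h] z])
 have c: "tmap k A (Y n) M (dY (Suc n)) (tmap k A (Y (Suc n)) M (h n) z) = tmap k A (Y n) M (%x. dY (Suc n) (h n x)) z"
  by (rule tmap_comp[OF M X Y Y h dY z])
 show "tmap k A (Y n) M (E n) z = tmap k A (Y n) M (dY (Suc n)) (tmap k A (Y (Suc n)) M (h n) z)"
 proof (cases n)
  case 0
  show ?thesis unfolding c by (rule tmap_cong[OF M X z]) (use h0 0 in simp)
 next
  case (Suc m)
  interpret Y: module k "tov k A (Y n) M" by (rule mo[OF Y])
  have hd: "rmap k A (X n) (Y n) (%x. h m (dX n x))" using rmap_comp[OF h dX] Suc by simp
  note nhd = rmap_uminus[OF Y hd]
  have "tmap k A (Y n) M (%x. h m (dX n x)) z = tmap k A (Y n) M (h m) (tmap k A (X m) M (dX n) z)"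
   using tmap_comp[OF M X X Y dX h, of z m] z Suc by simp
  also have "... = 0[tov k A (Y n) M]"
   using cyc lin_zero[OF mo[OF X] mo[OF Y] tmap_linear[OF M X Y h]] Suc by simp
  finally have e: "tmap k A (Y n) M (%x. h m (dX n x)) z = 0[tov k A (Y n) M]" .
  have "tmap k A (Y n) M (%x. dY (Suc n) (h n x)) z =
    tmap k A (Y n) M (%x. E n x +[Y n] -[Y n] h m (dX n x)) z"
   by (rule tmap_cong[OF M X z]) (use hS[of _ m] Suc in \<open>simp add: a_minus_def\<close>)
  also have "... = tmap k A (Y n) M (E n) z"
   using lin_closed[OF tmap_linear[OF M X Y E] z]
   by (simp add: tmap_add[OF M X Y E nhd z] tmap_uminus[OF M X Y hd z] e)
  finally show ?thesis unfolding c ..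
 qed
qed

text \<open>The target complex may be replaced by an isomorphic one.\<close>

lemma (in cyclic_comparison) transport:
 assumes E: "!!n. module k (E n)" and dE: "!!n. lmap k (E (Suc n)) (E n) (dE (Suc n))"
  and \<Theta>: "!!n. lmap k (C n) (E n) (\<Theta> n)" and bij: "!!n. bij_betw (\<Theta> n) (carrier (C n)) (carrier (E n))"
  and ch: "!!n x. x <: C (Suc n) ==> dE (Suc n) (\<Theta> (Suc n) x) = \<Theta> n (dC (Suc n) x)"
 shows "cyclic_comparison k Z E dE (%p q z. \<Theta> (p + q) (\<Phi> p q z))"
proof -
 have im: "EX c:carrier (C n). y = \<Theta> n c" if "y <: E n" for y n
  using that bij_betw_imp_surj_on[OF bij] by blast
 have inj: "\<Theta> n x = \<Theta> n y ==> x = y" if "x <: C n" "y <: C n" for x y n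
  using that bij_betw_imp_inj_on[OF bij] by (auto dest: inj_onD)
 note \<Theta>0 = lin_zero[OF C_module E \<Theta>]
 show ?thesis
 proof (intro cyclic_comparison.intro chain_complex.intro cyclic_comparison_axioms.intro E dE)
 have \<Phi>c: "\<Phi> p q z <: C (p + q)" if "z <: obj Z q" for p q z
  using lin_closed[OF \<Phi>_linear that] .
 show "precyclic k Z" by (rule precyclic_axioms)
 show "dE (Suc n) (dE (Suc (Suc n)) x) = 0[E n]" if x: "x <: E (Suc (Suc n))" for n x
 proof -
  obtain c where c: "c <: C (Suc (Suc n))" "x = \<Theta> (Suc (Suc n)) c" using im[OF x] by blast
  then show ?thesis by (simp add: ch dC_closed dC_dC \<Theta>0)
 qed
 show "lmap k (obj Z q) (E (p + q)) (%z. \<Theta> (p + q) (\<Phi> p q z))" for p q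
  by (rule lin_comp[OF \<Theta> \<Phi>_linear])
 show "EX y:carrier (obj Z (Suc n)). hb' Z (Suc n) y = x"
  if "x <: obj Z n" "n = 0 \<or> hb' Z n x = 0[obj Z (n - 1)]" for n x
  by (rule b'_acyclic[OF that])
 fix p q m x assume pq: "p + q = Suc m" and x: "x <: obj Z q"
 let ?a = "if q = 0 then 0[C m] else \<Phi> p (q - 1) (tsygan_vert Z p q x)"
 let ?b = "if p = 0 then 0[C m] else \<Phi> (p - 1) q (tsygan_hor Z p q x)"
 interpret C: module k "C m" by (rule C_module)
 have ab: "?a <: C m" "?b <: C m"
  using pq x \<Phi>c[OF vert_closed, of x "q - 1" p p] \<Phi>c[OF hor_closed[OF x], of "p - 1" p] by (auto split: nat_diff_split)
 have "dE (Suc m) (\<Theta> (p + q) (\<Phi> p q x)) = \<Theta> m (?a +[C m] ?b)"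
  using \<Phi>_chain[OF pq x] ch[of "\<Phi> p q x" m] \<Phi>c[OF x, of p] pq by simp
 also have "... = \<Theta> m ?a +[E m] \<Theta> m ?b" by (rule lin_add[OF \<Theta> ab])
 finally show "dE (Suc m) (\<Theta> (p + q) (\<Phi> p q x)) =
   (if q = 0 then 0[E m] else \<Theta> (p + (q - 1)) (\<Phi> p (q - 1) (tsygan_vert Z p q x))) +[E m]
   (if p = 0 then 0[E m] else \<Theta> (p - 1 + q) (\<Phi> (p - 1) q (tsygan_hor Z p q x)))"
  using pq by (cases q; cases p) (simp_all add: \<Theta>0)
next
 have \<Phi>c: "\<Phi> 0 q z <: C q" if "z <: obj Z q" for q z
  using lin_closed[OF \<Phi>_linear that, of 0] by simp
 fix n z assume z: "z <: obj Z n" "n = 0 \<or> hb Z n z = 0[obj Z (n - 1)]"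
  and "\<Theta> (0 + n) (\<Phi> 0 n z) : dE (Suc n) ` carrier (E (Suc n))"
 then obtain y where y: "y <: E (Suc n)" "\<Theta> n (\<Phi> 0 n z) = dE (Suc n) y" by auto
 obtain c where c: "c <: C (Suc n)" "y = \<Theta> (Suc n) c" using im[OF y(1)] by blast
 have "\<Phi> 0 n z = dC (Suc n) c"
  using y(2) by (intro inj[OF \<Phi>c[OF z(1)] dC_closed[OF c(1)]]) (simp add: c ch)
 then show "z : hb Z (Suc n) ` carrier (obj Z (Suc n))" using \<Phi>_inj[OF z] c(1) by blast
next
 fix n y assume y: "y <: E n" "n = 0 \<or> dE n y = 0[E (n - 1)]"
 obtain c where c: "c <: C n" "y = \<Theta> n c" using im[OF y(1)] by blast
 have "n = 0 \<or> dC n c = 0[C (n - 1)]"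
 proof (cases n)
  case (Suc m)
  interpret C: module k "C m" by (rule C_module)
  show ?thesis
   using y(2) c dC_closed[of c m] inj[of "dC n c" m "0[C m]"] by (simp add: Suc ch \<Theta>0)
 qed simp
 from \<Phi>_surj[OF c(1) this] obtain z where z: "z <: obj Z n"
  "n = 0 \<or> hb Z n z = 0[obj Z (n - 1)]" "\<Phi> 0 n z -[C n] c : dC (Suc n) ` carrier (C (Suc n))" by blast
 have \<Phi>z: "\<Phi> 0 n z <: C n" using lin_closed[OF \<Phi>_linear z(1), of 0] by simp
 obtain w where w: "w <: C (Suc n)" "\<Phi> 0 n z -[C n] c = dC (Suc n) w" using z(3) by blast
 have "\<Theta> (0 + n) (\<Phi> 0 n z) -[E n] y = dE (Suc n) (\<Theta> (Suc n) w)"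
  using lin_minus[OF C_module E \<Theta> \<Phi>z c(1)] by (simp add: c(2) w ch)
 then show "EX z:carrier (obj Z n). (n = 0 \<or> hb Z n z = 0[obj Z (n - 1)]) &
   \<Theta> (0 + n) (\<Phi> 0 n z) -[E n] y : dE (Suc n) ` carrier (E (Suc n))"
  using z(1,2) lin_closed[OF \<Theta> w(1)] by blast
 qed
qed

locale comparison = normal_pair k H K + hopf_coefficients k H M
 for k :: "'k ring" and H :: "('k, 'h) hopf" and K :: "'h set" and M :: "('k, 'h, 'm) crossed"
begin

abbreviation N where "N == aug_submodule k H K M"
abbreviation Mb where "Mb == quot_crossed k H K M"

lemma N_gens: "{lact M x m | x m. x : Kp & m <: M} <= carrier M"
 by (auto simp: lact_closed aug_D)

lemma N_sub: "submodule N k M"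
 unfolding aug_submodule_def by (rule lin_span_submodule[OF module_M N_gens])

interpretation MN: module_quotient k M N
 by (intro module_quotient.intro module_quotient_axioms.intro module_M N_sub)

lemma lact_aug: "x : Kp ==> m <: M ==> lact M x m : N"
 unfolding aug_submodule_def by (rule subsetD[OF lin_span_superset]) blast

lemma Mb_simps: "carrier Mb = carrier MN.quot" "add Mb = add MN.quot" "zero Mb = zero MN.quot"
 "smult Mb = smult MN.quot" "lact Mb X Y = on_coset (%(h, m). N +>\<^bsub>M\<^esub> lact M h m) (X \<times> Y)"
 by (simp_all add: quot_crossed_def module.extend_def lmodule.extend_def lmodule.fields_def crossed.fields_def Let_def)

definition pm where "pm m = N +>\<^bsub>M\<^esub> m"

lemma module_Mb: "module k Mb"
 by (rule module_transfer[OF MN.module_quot Mb_simps(1-4)])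

lemma pm_linear: "lmap k M Mb pm"
 unfolding pm_def[abs_def] by (rule lin_transfer[OF MN.linear_coset]) (simp_all add: Mb_simps)

lemmas pm_closed = lin_closed[OF pm_linear]

lemma pm_cases: assumes "Y <: Mb" obtains m where "m <: M" "Y = pm m"
 using assms MN.quot_cases[of Y] by (auto simp: Mb_simps pm_def)

lemma pm_zero: "m : N ==> pm m = 0[Mb]"
 using MN.coset_zero_iff[of m] submodule_subset[OF N_sub] by (auto simp: pm_def Mb_simps)

lemma pm_I: assumes "h : I" "m <: M" shows "pm (lact M h m) = 0[Mb]"
proof (rule lin_zero_on_span[OF module_H module_Mb lin_comp[OF pm_linear M.lact_linear_algebra[OF assms(2)]]
  aug_gens _ assms(1)[unfolded aug_ideal_def]])
 fix y assume "y : {x *[H] h | x h. x : Kp & h <: H}"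
 then obtain x h where x: "x : Kp" "h <: H" "y = x *[H] h" by blast
 show "pm (lact M y m) = 0[Mb]"
  using pm_zero[OF lact_aug[OF x(1) lact_closed[OF x(2) assms(2)]]] x assms(2) by (simp add: M.lact_mult aug_D)
qed

lemma pm_N: assumes "h <: H" "m : N" shows "pm (lact M h m) = 0[Mb]"
proof (rule lin_zero_on_span[OF module_M module_Mb lin_comp[OF pm_linear M.lact_linear_module[OF assms(1)]]
  N_gens _ assms(2)[unfolded aug_submodule_def]])
 fix y assume "y : {lact M x m | x m. x : Kp & m <: M}"
 then obtain x m where x: "x : Kp" "m <: M" "y = lact M x m" by blast
 have "x *[H] 1[H] : I"
  unfolding aug_ideal_def using x by (intro subsetD[OF lin_span_superset]) blast
 then have "h *[H] x : I" using ideal.I_l_closed[OF I_ideal _ assms(1)] x by (simp add: aug_D)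
 then show "pm (lact M h y) = 0[Mb]" using pm_I x assms by (simp add: M.lact_mult[symmetric] aug_D)
qed

text \<open>The action is given on pairs of cosets, so independence of both representatives is needed: \<open>K\<^sub>+H M\<close> and \<open>H
  K\<^sub>+M\<close> lie in \<open>K\<^sub>+M\<close>, the latter by normality.\<close>

lemma lact_Mb: assumes h: "h <: H" and m: "m <: M"
 shows "lact Mb (pr h) (pm m) = pm (lact M h m)"
proof -
 interpret Mb: module k Mb by (rule module_Mb)
 have eq: "pm (lact M h' m') = pm (lact M h m)" if h': "h' : pr h" and m': "m' : pm m" for h' m'
 proof -
  have hc: "h' <: H" "h' -[H] h : I"
   using h' h a_r_coset_subset_G[OF MQ.a_subset h] MQ.a_rcos_module_imp[OF h, of h'] by (auto simp: pr_def a_minus_def)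
  have mc: "m' <: M" "m' -[M] m : N"
   using m' m M.a_r_coset_subset_G[OF MN.a_subset m] MN.a_rcos_module_imp[OF m, of m'] by (auto simp: pm_def a_minus_def)
  have "pm (lact M h' m') -[Mb] pm (lact M h m') = 0[Mb]"
   using pm_I[OF hc(2) mc(1)]
    lin_minus[OF module_H module_Mb lin_comp[OF pm_linear M.lact_linear_algebra[OF mc(1)]] hc(1) h] by simp
  moreover have "pm (lact M h m') -[Mb] pm (lact M h m) = 0[Mb]"
   using pm_N[OF h mc(2)]
    lin_minus[OF module_M module_Mb lin_comp[OF pm_linear M.lact_linear_module[OF h]] mc(1) m] by simp
  ultimately show ?thesis
   using h m hc(1) mc(1) by (simp add: Mb.minus_eq_zero_iff pm_closed lact_closed)
 qed
 have ne: "(h, m) : pr h \<times> pm m"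
  using h m MQ.a_rcos_self[of h] MN.a_rcos_self[of m] by (simp add: pr_def pm_def)
 have "(%(h, m). pm (lact M h m)) ` (pr h \<times> pm m) = (%_. pm (lact M h m)) ` (pr h \<times> pm m)"
  by (rule image_cong[OF refl]) (clarsimp simp only: mem_Times_iff split: prod.splits, rule eq, simp_all)
 also have "... = {pm (lact M h m)}" by (rule image_constant[OF ne])
 finally have "(%(h, m). pm (lact M h m)) ` (pr h \<times> pm m) = {pm (lact M h m)}" .
 then show ?thesis by (simp add: Mb_simps on_coset_def pm_def[symmetric])
qed

lemma left_Mb: "left_module k Q Mb"
proof (intro left_module.intro module_Mb left_module_axioms.intro)
 fix X assume "X <: Q"
 then obtain h where h: "h <: H" "X = pr h" by (rule pr_cases)
 note l = lin_comp[OF pm_linear M.lact_linear_module[OF h(1)]]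
 show "lmap k Mb Mb (lact Mb X)"
  by (rule linI; elim pm_cases; simp add: h(2) lact_Mb[OF h(1)] pm_closed lact_closed h(1)
   lin_add[OF pm_linear, symmetric] lin_smult[OF pm_linear, symmetric]
   lin_add[OF l] lin_smult[OF l])
next
 fix Y assume "Y <: Mb"
 then obtain m where m: "m <: M" "Y = pm m" by (rule pm_cases)
 note l = lin_comp[OF pm_linear M.lact_linear_algebra[OF m(1)]]
 show "lmap k Q Mb (%X. lact Mb X Y)"
  by (rule linI; elim pr_cases; simp add: m(2) lact_Mb[OF _ m(1)] pm_closed lact_closed m(1)
   lin_add[OF pr_linear, symmetric] lin_smult[OF pr_linear, symmetric]
   lin_add[OF l] lin_smult[OF l])
 show "lact Mb 1[Q] Y = Y" by (simp add: pr_one[symmetric] m lact_Mb M.lact_one)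
 fix X X' assume "X <: Q" "X' <: Q"
 then obtain h h' where "h <: H" "X = pr h" "h' <: H" "X' = pr h'" by (elim pr_cases)
 then show "lact Mb (X *[Q] X') Y = lact Mb X (lact Mb X' Y)"
  by (simp add: pr_mult[symmetric] m lact_Mb M.lact_mult lact_closed)
qed

end

lemma (in abelian_group) minus_minus_swap: "x <: G ==> y <: G ==> y \<ominus> (y \<ominus> x) = x"
 by (simp add: a_minus_def minus_add r_neg a_assoc[symmetric])

lemma tmap_diff:
 assumes M: "left_module k A M" and X: "rmod k A X" and Y: "rmod k A Y"
  and f: "rmap k A X Y f" and g: "rmap k A X Y g" and z: "z <: tov k A X M"
 shows "tmap k A Y M (%x. f x -[Y] g x) z = tmap k A Y M f z -[tov k A Y M] tmap k A Y M g z"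
 using tmap_add[OF M X Y f rmap_uminus[OF Y g] z] tmap_uminus[OF M X Y g z] by (simp add: a_minus_def)

context comparison
begin

interpretation MN: module_quotient k M N
 by (intro module_quotient.intro module_quotient_axioms.intro module_M N_sub)

interpretation Z: precyclic k Zc by (rule Z_precyclic)

text \<open>The elements of \<open>K\<^sub>+\<close> act by zero on \<open>X\<close>, so \<open>x \<otimes> m\<close> depends only on the class of
  \<open>m\<close> modulo \<open>K\<^sub>+M\<close>.\<close>

lemma base_change:
 fixes X :: "('k, 'h set, 'x) rmodule"
 assumes X: "rmod k Q X"
 shows "EX \<Theta>. lmap k (tov k H (res X) M) (tov k Q X Mb) \<Theta> &
  bij_betw \<Theta> (carrier (tov k H (res X) M)) (carrier (tov k Q X Mb)) &
  (ALL x:carrier X. ALL m:carrier M. \<Theta> (tns k H (res X) M x m) = tns k Q X Mb x (pm m))"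
proof -
 let ?U = "tov k H (res X) M" and ?V = "tov k Q X Mb"
 let ?u = "tns k H (res X) M" and ?v = "tns k Q X Mb"
 note rX = rmod_res[OF X]
 note mX = rmod_mod[OF X]
 interpret U: tensor_over_algebra k "res X" M H by (rule tensor_over_algebraI[OF rX left_M])
 interpret V: tensor_over_algebra k X Mb Q by (rule tensor_over_algebraI[OF X left_Mb])
 note mU = U.module_tensor_over and mV = V.module_tensor_over
 have ub: "bilin k X M ?U ?u" using U.tens_over_bilin by (simp add: bilin_def res_simps res_linear)
 have b1: "balanced k H (res X) M ?V (%x m. ?v x (pm m))"
  unfolding balanced_def
  by (intro conjI ballI bilinI)
   (simp_all add: res_linear res_simps lin_comp[OF bil_right[OF V.tens_over_bilin] pm_linear]
    bil_left[OF V.tens_over_bilin] pm_closed V.tens_over_move pr_closed lact_Mb)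
 let ?f = "%x. on_coset (?u x)"
 have z: "?u x y = 0[?U]" if x: "x <: X" and y: "y : N" for x y
 proof (rule lin_zero_on_span[OF module_M mU bil_right[OF ub x] N_gens _ y[unfolded aug_submodule_def]])
  fix y assume "y : {lact M a m | a m. a : Kp & m <: M}"
  then obtain a m where a: "a : Kp" "m <: M" "y = lact M a m" by blast
  have "?u x y = ?u (ract X x (pr a)) m"
   using U.tens_over_move[of x a m] x a by (simp add: res_simps aug_D)
  also have "pr a = 0[Q]" using pr_aug[OF a(1) one_closed] a by (simp add: aug_D)
  also have "ract X x 0[Q] = 0[X]"
   by (rule lin_zero[OF module_Q mX right_module.ract_linear_algebra[OF X x]])
  finally show "?u x y = 0[?U]" using lin_zero[OF mX mU bil_left[OF ub a(2)]] by simp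
 qed
 have fl: "lmap k Mb ?U (?f x)" if x: "x <: X" for x
  by (rule lin_transfer[OF MN.on_coset_linear[OF mU bil_right[OF ub x] z[OF x]]]) (simp_all add: Mb_simps)
 have fv: "?f x (pm m) = ?u x m" if "x <: X" "m <: M" for x m
  unfolding pm_def by (rule MN.on_coset_linear_eq[OF mU bil_right[OF ub that(1)] z[OF that(1)] that(2)])
 have b2: "balanced k Q X Mb ?U ?f"
  unfolding balanced_def
 proof (intro conjI ballI bilinI fl)
  fix Y assume "Y <: Mb"
  then obtain m where m: "m <: M" "Y = pm m" by (rule pm_cases)
  show "lmap k X ?U (%x. ?f x Y)"
   by (subst lin_cong[OF mX, where g = "%x. ?u x m"]) (simp_all add: m fv bil_left[OF ub])
  fix x A assume x: "x <: X" and "A <: Q"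
  then obtain h where h: "h <: H" "A = pr h" by (elim pr_cases)
  show "?f (ract X x A) Y = ?f x (lact Mb A Y)"
   using U.tens_over_move[of x h m] ract_closed[OF X x pr_closed[OF h(1)]]
   by (simp add: h m lact_Mb fv x lact_closed res_simps)
 qed
 let ?\<Theta> = "lift k ?V (%(x, m). ?v x (pm m))" and ?\<Xi> = "lift k ?U (%(x, Y). ?f x Y)"
 note \<Theta>l = U.over_lift_linear[OF mV b1] and \<Xi>l = V.over_lift_linear[OF mU b2]
 have \<Theta>t: "?\<Theta> (?u x m) = ?v x (pm m)" if "x <: X" "m <: M" for x m
  by (rule U.over_lift_tens[OF mV b1]) (simp_all add: that res_simps)
 have \<Xi>t: "?\<Xi> (?v x (pm m)) = ?u x m" if "x <: X" "m <: M" for x m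
  using V.over_lift_tens[OF mU b2 that(1) pm_closed[OF that(2)]] fv[OF that] by simp
 have "?\<Xi> (?\<Theta> y) = y" if "y <: ?U" for y
  by (rule U.over_linear_ext[OF mU lin_comp[OF \<Xi>l \<Theta>l] lin_id _ that]) (simp add: \<Theta>t \<Xi>t res_simps)
 moreover have "?\<Theta> (?\<Xi> y) = y" if "y <: ?V" for y
  by (rule V.over_linear_ext[OF mV lin_comp[OF \<Theta>l \<Xi>l] lin_id _ that]) (auto elim!: pm_cases simp: \<Theta>t \<Xi>t)
 ultimately have "bij_betw ?\<Theta> (carrier ?U) (carrier ?V)"
  using lin_closed[OF \<Theta>l] lin_closed[OF \<Xi>l] by (intro bij_betwI[of _ _ _ ?\<Xi>]) auto
 then show ?thesis using \<Theta>l \<Theta>t by blast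
qed

text \<open>The map \<open>Z(H, M) \<rightarrow> X \<otimes>\<^sub>H M\<close> induced by a \<open>Q\<close>-linear map \<open>f\<close> on the
  standard complex of \<open>Q\<close>.\<close>

abbreviation Lm where "Lm X n f == tmap k H (res X) M (%t. f (Pi (Suc n) t))"

lemma Lm_map: "rmap k Q (diag_module k Q n) X f ==>
  rmap k H (Dg n) (res X) (%t. f (Pi (Suc n) t))"
 by (rule rmap_comp[OF rmap_res Pi_rmodule_map])

lemma bs_Zt: "j <= Suc (Suc n) ==> t <: T' (Suc n) ==> m <: M ==>
  Z.bs n j (Zt (Suc n) t m) = Zt n (Tc.bs n j t) m"
proof (induction j)
 case 0
 then show ?case using lin_zero[OF T_mod module_Z bil_left[OF Zt_bilin]] by (simp add: Zc_simps(1))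
next
 case (Suc j)
 then have "fc (Suc n) j t <: T' n" "Tc.bs n j t <: T' n"
  using Tc.bs_closed[of j n t] by (auto intro: fc_closed)
 then show ?case
  using Suc by (simp add: lin_add[OF bil_left[OF Zt_bilin]] signed_closed[OF T_mod]
   linear_signed[OF T_mod module_Z bil_left[OF Zt_bilin]] face_Zt Zc_simps(1))
qed

lemma b_Zt:
 assumes "t <: T' (Suc n)" "m <: M"
 shows "hb Zc (Suc n) (Zt (Suc n) t m) = Zt n (hb Tc (Suc n) t) m"
  "hb' Zc (Suc n) (Zt (Suc n) t m) = Zt n (hb' Tc (Suc n) t) m"
 using assms Zt_closed[OF assms]
 by (simp_all add: Z.b_eq Z.b'_eq Tc.b_eq Tc.b'_eq bs_Zt Zc_simps(1) del: Z.bs.simps Tc.bs.simps)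

lemma Pi_b:
 assumes "t <: T' (Suc n)"
 shows "Pi (Suc n) (hb Tc (Suc n) t) = hb Q.Tc (Suc n) (Pi (Suc (Suc n)) t)"
  "Pi (Suc n) (hb' Tc (Suc n) t) = hb' Q.Tc (Suc n) (Pi (Suc (Suc n)) t)"
 using assms Pi_closed[OF assms]
 by (simp_all add: Q.Tc.b_eq Q.Tc.b'_eq Tc.b_eq Tc.b'_eq Pi_bs del: Q.Tc.bs.simps Tc.bs.simps)

lemma b_Z:
 assumes "z <: ZO (Suc n)"
 shows "hb Zc (Suc n) z = tmap k H (Dg n) M (hb Tc (Suc n)) z"
proof (rule Z_ext[OF module_Z _ _ _ assms])
 show "lmap k (ZO (Suc n)) (ZO n) (hb Zc (Suc n))" using Z.b_linear[of n] by (simp add: Zc_simps(1))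
 show "lmap k (ZO (Suc n)) (ZO n) (tmap k H (Dg n) M (hb Tc (Suc n)))"
  unfolding Z_obj_def by (rule tmap_linear[OF left_M rmod_diag rmod_diag b_rmodule_map])
 fix t m assume t: "t <: T' (Suc n)" "m <: M"
 show "hb Zc (Suc n) (Zt (Suc n) t m) =
   tmap k H (Dg n) M (hb Tc (Suc n)) (Zt (Suc n) t m)"
  unfolding b_Zt(1)[OF t] unfolding Z_tens_def using t
  by (intro tmap_tens[OF left_M rmod_diag rmod_diag b_rmodule_map, symmetric]) (simp_all add: diag_simps)
qed

lemma Z_acyclic:
 assumes "x <: ZO n" "n = 0 \<or> hb' Zc n x = 0[ZO (n - 1)]"
 shows "EX y:carrier (ZO (Suc n)). hb' Zc (Suc n) y = x"
proof -
 have sgm: "rmap k H (Dg n) (Dg (Suc n)) (sg n)" for n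
  by (simp add: rmodule_map_def diag_linear sg_linear diag_simps sg_tm it_closed it_Suc_Suc)
 have l: "lmap k (ZO n) (ZO (Suc n)) (degen Zc n n)" for n
  unfolding Zc_simps Z_obj_def by (rule tmap_linear[OF left_M rmod_diag rmod_diag sgm])
 have v: "degen Zc n n (Zt n t m) = Zt (Suc n) (sg n t) m" if "t <: T' n" "m <: M" for n t m
  using tmap_tens[OF left_M rmod_diag rmod_diag sgm, of t n m] that
  by (simp add: Zc_simps Z_tens_def diag_simps)
 have "face Zc (Suc n) n (degen Zc n n x) = x" if "x <: ZO n" for n x
  by (rule Z_ext[OF module_Z lin_comp[OF face_Z_linear l] lin_id _ that])
   (simp_all add: v face_Zt sg_closed fc_sg_last)
 moreover have "face Zc (Suc (Suc n)) i (degen Zc (Suc n) (Suc n) x) = degen Zc n n (face Zc (Suc n) i x)"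
  if "i <= n" "x <: ZO (Suc n)" for n i x
  by (rule Z_ext[OF module_Z lin_comp[OF face_Z_linear l] lin_comp[OF l face_Z_linear] _ that(2)])
   (use that(1) in \<open>simp_all add: v face_Zt sg_closed fc_closed fc_sg\<close>)
 ultimately show ?thesis
  using Z.b'_acyclic_degeneracy[of "%n. degen Zc n n" x n] l assms by (simp add: Zc_simps(1))
qed

context
 assumes cc: "cocommutative k Q" and cw: "coact_within k H K M"
begin

lemma cs_K:
 assumes W: "module k W" and f: "bilin k M H W f" and g: "bilin k M H W g"
  and eq: "!!x c. x <: M ==> c : K ==> f x c = g x c" and m: "m <: M"
 shows "cs W f m = cs W g m"
proof -
 interpret W: module k W by (rule W)
 interpret MH: tensor_product k M H by (rule tensor_product.intro) (rule module_M, rule module_H)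
 note L = MH.tensor_lift_linear[OF W]
 have S: "{tens k M H x c | x c. x <: M & c : K} <= carrier (tensor k M H)"
  by (auto intro!: MH.tens_closed simp: K_closed)
 have "coact M m : lin_span k (tensor k M H) {tens k M H x c | x c. x <: M & c : K}"
  using cw m unfolding coact_within_def by blast
 then have "cs W f m -[W] cs W g m = 0[W]"
  unfolding cs_def
  by (rule lin_zero_on_span[OF MH.module_tensor W lin_diff[OF W L[OF f] L[OF g]] S, rotated])
   (auto simp: MH.tensor_lift_tens[OF W f] MH.tensor_lift_tens[OF W g] K_closed eq bil_closed[OF g] W.minus_eq_zero_iff)
 then show ?thesis using cs_closed[OF W f m] cs_closed[OF W g m] by (simp add: W.minus_eq_zero_iff)
qed

context
 fixes X :: "('k, 'h set, 'x) rmodule"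
 assumes X: "rmod k Q X"
begin

abbreviation XM where "XM == tov k H (res X) M"

lemma module_XM: "module k XM" by (rule module_over[OF left_M rmod_res[OF X]])

lemma XM_bilin: "bilin k X M XM (tns k H (res X) M)"
 using tens_bilin[OF left_M rmod_res[OF X]] by (simp add: bilin_def res_simps res_linear)

lemma Lm_linear: "rmap k Q (diag_module k Q n) X f ==> lmap k (ZO n) XM (Lm X n f)"
 unfolding Z_obj_def by (rule tmap_linear[OF left_M rmod_diag rmod_res[OF X] Lm_map])

lemma Lm_Zt: "rmap k Q (diag_module k Q n) X f ==> t <: T' n ==> m <: M ==>
  Lm X n f (Zt n t m) = tns k H (res X) M (f (Pi (Suc n) t)) m"
 unfolding Z_tens_def
 by (rule tmap_tens[OF left_M rmod_diag rmod_res[OF X] Lm_map]) (simp_all add: diag_simps)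

lemma fm_linear: "rmap k Q (diag_module k Q n) X f ==> m <: M ==>
  lmap k (tpow k Q (Suc n)) XM (%y. tns k H (res X) M (f y) m)"
 by (rule lin_comp[OF bil_left[OF XM_bilin]]) (simp_all add: rmodule_map_def Q.diag_linear)

lemma Lm_vert:
 assumes f: "rmap k Q (diag_module k Q n) X f" and z: "z <: ZO (Suc n)"
 shows "Lm X n f (tsygan_vert Zc p (Suc n) z) = Lm X (Suc n) (%y. f (tsygan_vert Q.Tc p (Suc n) y)) z"
proof (rule Z_ext[OF module_XM lin_comp[OF Lm_linear[OF f]] Lm_linear[OF rmap_comp[OF f Q.vert_rmodule_map[OF cc]]] _ z])
 show "lmap k (ZO (Suc n)) (ZO n) (tsygan_vert Zc p (Suc n))" using Z.vert_linear by (simp add: Zc_simps(1))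
 fix t m assume t: "t <: T' (Suc n)" and m: "m <: M"
 have bc: "hb Tc (Suc n) t <: T' n" "hb' Tc (Suc n) t <: T' n"
  using lin_closed[OF Tc.b_linear, of t n] lin_closed[OF Tc.b'_linear, of t n] t by simp_all
 note lP = lin_neg[OF T_mod TQ.T_mod Pi_linear]
 have "tsygan_vert Zc p (Suc n) (Zt (Suc n) t m) = Zt n (Tc.vert p (Suc n) t) m"
  using bc t m by (simp add: tsygan_vert_def b_Zt Zc_simps(1)
   lin_neg[OF T_mod module_Z bil_left[OF Zt_bilin]])
 moreover have "Pi (Suc n) (Tc.vert p (Suc n) t) = tsygan_vert Q.Tc p (Suc n) (Pi (Suc (Suc n)) t)"
  using bc t by (simp add: tsygan_vert_def Pi_b lP)
 moreover have "Tc.vert p (Suc n) t <: T' n" using Tc.vert_closed[of t n p] t by simp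
 ultimately show "Lm X n f (tsygan_vert Zc p (Suc n) (Zt (Suc n) t m)) =
   Lm X (Suc n) (%y. f (tsygan_vert Q.Tc p (Suc n) y)) (Zt (Suc n) t m)"
  using t m by (simp add: Lm_Zt[OF f] Lm_Zt[OF rmap_comp[OF f Q.vert_rmodule_map[OF cc]]])
qed

text \<open>Here the two conditions on \<open>Q\<close> and on the coaction meet: \<open>m\<^sub>1 \<in> K\<close> becomes a scalar in
  \<open>Q\<close> and is absorbed by the counit axiom of the coaction, and the rotation that is left is \<open>Q\<close>-linear.\<close>

lemma Lm_t:
 assumes f: "rmap k Q (diag_module k Q n) X f" and z: "z <: ZO n"
 shows "Lm X n f (signed_cyc Zc n z) = Lm X n (%y. f (signed_cyc Q.Tc n y)) z"
proof (rule Z_ext[OF module_XM lin_comp[OF Lm_linear[OF f]] Lm_linear[OF rmap_comp[OF f Q.t_rmodule_map[OF cc]]] _ z])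
 show "lmap k (ZO n) (ZO n) (signed_cyc Zc n)" using Z.t_linear[of n] by (simp add: Zc_simps(1))
 fix t m assume t: "t <: T' n" and m: "m <: M"
 let ?y = "Q.rt n 1[Q] (Pi (Suc n) t)" and ?v = "tns k H (res X) M"
 have oneQ: "1[Q] <: Q" using pr_closed[OF one_closed] by (simp add: pr_one)
 have y: "?y <: tpow k Q (Suc n)" by (rule Q.rt_closed[OF oneQ Pi_closed[OF t]])
 note fl = rmap_linear[OF f, unfolded Q.diag_linear]
 have fy: "f ?y <: X" by (rule lin_closed[OF fl y])
 have cyc: "cy n t m <: ZO n" by (rule bil_closed[OF cy_bilin t m])
 have b1: "bilin k M H XM (%x c. Lm X n f (Zt n (rt n c t) x))"
  by (rule bilin_comp[OF Lm_linear[OF f] cy_cs[OF t]])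
 have b2: "bilin k M H XM (%x c. eH c .[XM] ?v (f ?y) x)"
  by (rule bilinI) (simp_all add: scalar_lin[OF module_XM counit_linear] bil_closed[OF XM_bilin fy]
   lin_smult_const[OF module_XM bil_right[OF XM_bilin fy]] eps_cl)
 have "Lm X n f (cy n t m) = cs XM (%x c. Lm X n f (Zt n (rt n c t) x)) m"
  unfolding cy_def by (rule cs_hom[OF module_Z module_XM Lm_linear[OF f] cy_cs[OF t] m])
 also have "... = cs XM (%x c. eH c .[XM] ?v (f ?y) x) m"
  by (rule cs_K[OF module_XM b1 b2 _ m])
   (simp add: Lm_Zt[OF f] rt_closed t K_closed Pi_rt lin_smult[OF fl] lin_smult[OF bil_left[OF XM_bilin]]
    eps_cl y fy)
 also have "... = ?v (f ?y) m" by (rule cs_counit[OF module_XM bil_right[OF XM_bilin fy] m])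
 finally have c: "Lm X n f (cy n t m) = ?v (f ?y) m" .
 have "Lm X n f (signed_cyc Zc n (Zt n t m)) = signed XM n (?v (f ?y) m)"
  by (simp add: signed_cyc_def cyc_Zt t m Zc_simps(1) linear_signed[OF module_Z module_XM Lm_linear[OF f] cyc] c)
 also have "... = ?v (f (signed (tpow k Q (Suc n)) n ?y)) m"
  by (rule linear_signed[OF TQ.T_mod module_XM fm_linear[OF f m] y, symmetric])
 finally show "Lm X n f (signed_cyc Zc n (Zt n t m)) = Lm X n (%y. f (signed_cyc Q.Tc n y)) (Zt n t m)"
  unfolding Lm_Zt[OF rmap_comp[OF f Q.t_rmodule_map[OF cc]] t m] by (simp add: signed_cyc_def[of Q.Tc])
qed

lemma Lm_t_power: "rmap k Q (diag_module k Q n) X f ==> z <: ZO n ==>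
  Lm X n f ((signed_cyc Zc n ^^ j) z) = Lm X n (%y. f ((signed_cyc Q.Tc n ^^ j) y)) z"
proof (induction j arbitrary: f)
 case (Suc j)
 have "(signed_cyc Zc n ^^ j) z <: ZO n" using Z.t_power_closed[of z n j] Suc.prems(2) by (simp add: Zc_simps(1))
 then have "Lm X n f ((signed_cyc Zc n ^^ Suc j) z) = Lm X n (%y. f (signed_cyc Q.Tc n y)) ((signed_cyc Zc n ^^ j) z)"
  by (simp add: Lm_t[OF Suc.prems(1)])
 also have "... = Lm X n (%y. f (signed_cyc Q.Tc n ((signed_cyc Q.Tc n ^^ j) y))) z"
  by (rule Suc.IH[OF rmap_comp[OF Suc.prems(1) Q.t_rmodule_map[OF cc]] Suc.prems(2)])
 finally show ?case by simp
qed simp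

lemma Lm_hor:
 assumes f: "rmap k Q (diag_module k Q n) X f" and z: "z <: ZO n"
 shows "Lm X n f (tsygan_hor Zc p n z) = Lm X n (%y. f (tsygan_hor Q.Tc p n y)) z"
proof (rule Z_ext[OF module_XM lin_comp[OF Lm_linear[OF f]] Lm_linear[OF rmap_comp[OF f Q.hor_rmodule_map[OF cc]]] _ z])
 show "lmap k (ZO n) (ZO n) (tsygan_hor Zc p n)" using Z.hor_linear by (simp add: Zc_simps(1))
 fix t m assume t: "t <: T' n" and m: "m <: M"
 let ?g = "%y. tns k H (res X) M (f y) m" and ?y = "Pi (Suc n) t"
 have zt: "Zt n t m <: ZO n" by (rule Zt_closed[OF t m])
 have y: "?y <: tpow k Q (Suc n)" by (rule Pi_closed[OF t])
 have v: "Lm X n f ((signed_cyc Zc n ^^ j) (Zt n t m)) = ?g ((signed_cyc Q.Tc n ^^ j) ?y)" for j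
  by (simp only: Lm_t_power[OF f zt] Lm_Zt[OF rmap_comp[OF f Q.t_power_rmodule_map[OF cc]] t m])
 note tc = Z.t_power_closed[of "Zt n t m" n, unfolded Zc_simps, OF zt] Q.Tc.t_power_closed[of ?y n, unfolded Q.Tc_simps, OF y]
 have "Lm X n f (tsygan_hor Zc p n (Zt n t m)) = ?g (tsygan_hor Q.Tc p n ?y)"
 proof (cases "odd p")
  case True
  then show ?thesis
   using lin_minus[OF module_Z module_XM Lm_linear[OF f] zt tc(1)[of 1]]
    lin_minus[OF TQ.T_mod module_XM fm_linear[OF f m] y tc(2)[of 1]] v[of 0] v[of 1]
   by (simp add: tsygan_hor_def Zc_simps(1))
 next
  case False
  have "Lm X n f (cyclic_norm Zc n (Zt n t m)) = (\<Oplus>\<^bsub>XM\<^esub>j\<in>{..n}. Lm X n f ((signed_cyc Zc n ^^ j) (Zt n t m)))"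
   unfolding cyclic_norm_def Zc_simps(1)
   by (rule lin_finsum[OF module_Z module_XM Lm_linear[OF f]]) (auto intro: tc)
  also have "... = (\<Oplus>\<^bsub>XM\<^esub>j\<in>{..n}. ?g ((signed_cyc Q.Tc n ^^ j) ?y))" unfolding v ..
  also have "... = ?g (cyclic_norm Q.Tc n ?y)"
   unfolding cyclic_norm_def Q.Tc_simps
   by (rule lin_finsum[OF TQ.T_mod module_XM fm_linear[OF f m], symmetric]) (auto intro: tc)
  finally show ?thesis using False by (simp add: tsygan_hor_def)
 qed
 then show "Lm X n f (tsygan_hor Zc p n (Zt n t m)) = Lm X n (%y. f (tsygan_hor Q.Tc p n y)) (Zt n t m)"
  by (simp only: Lm_Zt[OF rmap_comp[OF f Q.hor_rmodule_map[OF cc]] t m])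
qed

end

end

end

context comparison
begin

interpretation Z: precyclic k Zc by (rule Z_precyclic)

lemma Lm_cong:
 assumes z: "z <: ZO n" and eq: "!!y. y <: tpow k Q (Suc n) ==> f y = g y"
 shows "Lm X n f z = Lm X n g z"
 by (rule tmap_cong[OF left_M rmod_diag z[unfolded Z_obj_def] eq[OF Pi_closed]]) (simp add: diag_simps)

context
 fixes P :: "nat => ('k, 'h set, 'p) rmodule" and d :: "nat => 'p => 'p" and e :: "'p => 'k"
 assumes k: "field k" and ss: "semisimple_ring (H\<lparr>carrier := K\<rparr>)"
  and cc: "cocommutative k Q" and cw: "coact_within k H K M"
  and PR: "projective_resolution k Q (trivial_rmodule k Q) P d e"
begin

abbreviation RP where "RP n == res (P n)"
abbreviation CC where "CC n == tov k H (RP n) M"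
abbreviation dCC where "dCC n == tmap k H (RP (n - 1)) M (d n)"
abbreviation b where "b n == hb Tc n"

lemmas PRf = projective_resolution_facts[OF PR]
lemmas rP = rmod_res[OF PRf(1)]
lemmas rD = rmod_diag
lemmas mCC = module_over[OF left_M rP]
lemmas rd = rmap_res[OF PRf(3)]

text \<open>Let \<open>F : T(H) \<rightarrow> P\<close> be column \<open>0\<close>, \<open>g : P \<rightarrow> T(H)\<close> a chain map the other way,
  and \<open>E\<close>, \<open>E'\<close> the differences of the two composites with the identity.  Being null-homotopic, they give injectivity and
  surjectivity of \<open>\<Phi>\<close> on homology.\<close>

lemma comparison_exists: "EX \<Phi>. cyclic_comparison k Zc CC dCC \<Phi>"
proof -
 obtain \<phi> where \<phi>: "!!p q. rmap k Q (diag_module k Q q) (P (p + q)) (\<phi> p q)"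
  and \<phi>0: "!!x. x <: tpow k Q (Suc 0) ==> e (\<phi> 0 0 x) = Q.eps x"
  and \<phi>d: "!!p q m x. x <: tpow k Q (Suc q) ==> p + q = Suc m ==> d (Suc m) (\<phi> p q x) =
    (if q = 0 then 0[P m] else \<phi> p (q - 1) (tsygan_vert Q.Tc p q x)) +[P m]
    (if p = 0 then 0[P m] else \<phi> (p - 1) q (tsygan_hor Q.Tc p q x))"
  using Q.tsygan_to_resolution[OF cc k PR] by blast
 define \<Phi> where "\<Phi> p q = Lm (P (p + q)) q (\<phi> p q)" for p q
 define F where "F n t = \<phi> 0 n (Pi (Suc n) t)" for n t
 have Fm: "rmap k H (Dg n) (RP n) (F n)" for n
  unfolding F_def using Lm_map[OF \<phi>[of n 0]] by simp
 have \<Phi>F: "\<Phi> 0 n = tmap k H (RP n) M (F n)" for n by (simp add: \<Phi>_def F_def[abs_def])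
 have eH: "rmap k H (RP 0) (trivial_rmodule k H) e"
  using PRf(4) by (simp add: rmodule_map_def res_simps trivial_simps Q.trivial_simps linear_map_def pr_closed counit_Q_pr)
 have eps_surj: "eps ` carrier (Dg 0) = carrier (trivial_rmodule k H)"
 proof (intro equalityI subsetI)
  fix c assume c: "c <: trivial_rmodule k H"
  have o: "pH [1[H]] <: T' 0" by (rule ptens_closed) simp_all
  have "eps (c .[T' 0] pH [1[H]]) = c"
   using lin_smult[OF eps_linear _ o] c by (simp add: trivial_simps eps_ptens counit_one)
  moreover have "c .[T' 0] pH [1[H]] <: Dg 0" using c o by (simp add: smult_T trivial_simps diag_simps)
  ultimately show "c : eps ` carrier (Dg 0)" by (metis imageI)
 qed (auto simp: diag_simps trivial_simps eps_closed)
 have ex0: "y : b (Suc 0) ` carrier (Dg (Suc 0))" if "y <: Dg 0" "eps y = 0[trivial_rmodule k H]" for y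
  using that by (intro image_eqI[where x = "cns (Suc 0) 1[H] y"]) (simp_all add: standard_exact_0 diag_simps trivial_simps cns_closed)
 have ex: "y : b (Suc (Suc n)) ` carrier (Dg (Suc (Suc n)))"
  if "y <: Dg (Suc n)" "b (Suc n) y = 0[Dg n]" for n y
  using that by (intro image_eqI[where x = "cns (Suc (Suc n)) 1[H] y"]) (simp_all add: standard_exact diag_simps cns_closed)
 have dd: "d (Suc n) (d (Suc (Suc n)) x) = 0[RP n]" if "x <: RP (Suc (Suc n))" for n x
  using that PRf(6) by (simp add: res_simps)
 have bb: "b (Suc n) (b (Suc (Suc n)) x) = 0[Dg n]" if "x <: Dg (Suc (Suc n))" for n x
  using that Tc.b_b[of x n] by (simp add: diag_simps)
 have exP: "y : d (Suc (Suc n)) ` carrier (RP (Suc (Suc n)))"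
  if "y <: RP (Suc n)" "d (Suc n) y = 0[RP n]" for n y using that PRf(9) by (simp add: res_simps)
 have ed: "e (d (Suc 0) x) = 0[trivial_rmodule k H]" if "x <: RP (Suc 0)" for x
  using PRf(7)[of x] that by (simp add: res_simps trivial_simps Q.trivial_simps)
 obtain g where "ALL n. rmap k H (RP n) (Dg n) (g n) & (ALL x:carrier (RP 0). eps (g 0 x) = e x) &
   (ALL x:carrier (RP (Suc n)). b (Suc n) (g (Suc n) x) = g n (d (Suc n) x))"
  by (rule exE[OF chain_map_exists[where A = H and X = "%n. RP n" and Y = Dg and dX = d and dY = b,
    OF rP rD rd dd eH ed eps_surj ex0 ex
    res_lifts[OF k ss PRf(2) rD right_module_trivial eps_rmodule_map] res_lifts[OF k ss PRf(2) rD rD b_rmodule_map]]])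
 then have gm: "!!n. rmap k H (RP n) (Dg n) (g n)" and g0: "!!x. x <: P 0 ==> eps (g 0 x) = e x"
  and gd: "!!n x. x <: P (Suc n) ==> b (Suc n) (g (Suc n) x) = g n (d (Suc n) x)" by (simp_all add: res_simps)
 have F0: "e (F 0 t) = eps t" if "t <: T' 0" for t
  using that by (simp add: F_def \<phi>0 Pi_closed Pi_eps)
 have Fd: "d (Suc n) (F (Suc n) t) = F n (b (Suc n) t)" if t: "t <: T' (Suc n)" for n t
 proof -
  interpret Pn: module k "P n" by (rule rmod_mod[OF PRf(1)])
  have bt: "b (Suc n) t <: T' n" using lin_closed[OF Tc.b_linear] t by simp
  have "F n (b (Suc n) t) <: P n"
   using rmap_closed[OF Fm, of "b (Suc n) t" n] bt by (simp add: diag_simps res_simps)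
  then show ?thesis
   using \<phi>d[OF Pi_closed[OF t], of 0 n] t by (simp add: F_def tsygan_vert_def Pi_b)
 qed
 define E where "E n t = g n (F n t) -[Dg n] t" for n t
 define E' where "E' n x = F n (g n x) -[RP n] x" for n x
 note gF = rmap_comp[OF gm Fm] and Fg = rmap_comp[OF Fm gm]
 have Em: "rmap k H (Dg n) (Dg n) (E n)" for n
  unfolding E_def by (rule rmap_diff[OF rD gF rmap_id])
 have Em': "rmap k H (RP n) (RP n) (E' n)" for n
  unfolding E'_def by (rule rmap_diff[OF rP Fg rmap_id])
 have cl: "F n t <: P n" "g n (F n t) <: Dg n" if "t <: Dg n" for n t
  using rmap_closed[OF Fm that] rmap_closed[OF gF that] by (simp_all add: res_simps)
 have cl': "g n x <: Dg n" "F n (g n x) <: RP n" if "x <: RP n" for n x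
  using rmap_closed[OF gm that] rmap_closed[OF Fg that] by simp_all
 have Ec: "b (Suc n) (E (Suc n) x) = E n (b (Suc n) x)" if x: "x <: Dg (Suc n)" for n x
  unfolding E_def using x cl[OF x]
  by (subst lin_minus[OF module_diag module_diag rmap_linear[OF b_rmodule_map]])
   (simp_all add: gd Fd diag_simps(1))
 have Ec': "d (Suc n) (E' (Suc n) x) = E' n (d (Suc n) x)" if x: "x <: RP (Suc n)" for n x
  unfolding E'_def using x cl'[OF x]
  by (subst lin_minus[OF rmod_mod[OF rP] rmod_mod[OF rP] rmap_linear[OF rd]])
   (simp_all add: gd Fd diag_simps(1) res_simps(1))
 interpret G: module k "ground_module k" by (rule module_k)
 have E0: "E 0 x : b (Suc 0) ` carrier (Dg (Suc 0))" if x: "x <: Dg 0" for x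
 proof (rule ex0)
  show "E 0 x <: Dg 0" by (rule rmap_closed[OF Em x])
  have "eps (E 0 x) = eps (g 0 (F 0 x)) -[trivial_rmodule k H] eps x"
   unfolding E_def by (rule lin_minus[OF module_diag module_trivial rmap_linear[OF eps_rmodule_map] cl(2)[OF x] x])
  also have "... = eps x -[trivial_rmodule k H] eps x" using x cl(1)[OF x] by (simp add: g0 F0 diag_simps)
  also have "... = 0[trivial_rmodule k H]"
   using abelian_group.minus_eq_zero_iff[OF module_ab[OF module_trivial]] x by (simp add: trivial_simps eps_closed diag_simps)
  finally show "eps (E 0 x) = 0[trivial_rmodule k H]" .
 qed
 have E0': "E' 0 x : d (Suc 0) ` carrier (RP (Suc 0))" if x: "x <: RP 0" for x
 proof -
  note R = rmod_mod[OF rP]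
  have "e (E' 0 x) = e (F 0 (g 0 x)) -[trivial_rmodule k H] e x"
   unfolding E'_def by (rule lin_minus[OF R module_trivial rmap_linear[OF eH] cl'(2)[OF x] x])
  also have "... = e x -[trivial_rmodule k H] e x" using x cl'(1)[OF x] by (simp add: g0 F0 diag_simps res_simps)
  also have "... = 0[trivial_rmodule k H]"
   using abelian_group.minus_eq_zero_iff[OF module_ab[OF module_trivial]] rmap_closed[OF eH x] by simp
  finally show ?thesis
   using PRf(8)[of "E' 0 x"] rmap_closed[OF Em' x] by (simp add: res_simps trivial_simps Q.trivial_simps)
 qed
 obtain h where h: "(ALL n. rmap k H (Dg n) (Dg (Suc n)) (h n)) & (ALL x:carrier (Dg 0). b (Suc 0) (h 0 x) = E 0 x) &
   (ALL n. ALL x:carrier (Dg (Suc n)). b (Suc (Suc n)) (h (Suc n) x) = E (Suc n) x -[Dg (Suc n)] h n (b (Suc n) x))"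
  by (rule exE[OF null_homotopy_exists[where A = H and X = Dg and Y = Dg and dX = b and dY = b and E = E,
   OF rD rD b_rmodule_map bb b_rmodule_map ex diag_lifts[OF k rD rD b_rmodule_map] Em Ec E0]])
 note h = spec[OF conjunct1[OF h]] bspec[OF conjunct1[OF conjunct2[OF h]]] bspec[OF spec[OF conjunct2[OF conjunct2[OF h]]]]
 obtain h' where h': "(ALL n. rmap k H (RP n) (RP (Suc n)) (h' n)) & (ALL x:carrier (RP 0). d (Suc 0) (h' 0 x) = E' 0 x) &
   (ALL n. ALL x:carrier (RP (Suc n)). d (Suc (Suc n)) (h' (Suc n) x) = E' (Suc n) x -[RP (Suc n)] h' n (d (Suc n) x))"
  by (rule exE[OF null_homotopy_exists[where A = H and X = "%n. RP n" and Y = "%n. RP n" and dX = d and dY = d and E = E',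
   OF rP rP rd dd rd exP res_lifts[OF k ss PRf(2) rP rP rd] Em' Ec' E0']])
 note h' = spec[OF conjunct1[OF h']] bspec[OF conjunct1[OF conjunct2[OF h']]] bspec[OF spec[OF conjunct2[OF conjunct2[OF h']]]]
 note gl = tmap_linear[OF left_M rP rD gm, folded Z_obj_def]
 have gb: "hb Zc (Suc n) (tmap k H (Dg (Suc n)) M (g (Suc n)) c) = tmap k H (Dg n) M (g n) (dCC (Suc n) c)"
  if c: "c <: CC (Suc n)" for n c
 proof -
  have "hb Zc (Suc n) (tmap k H (Dg (Suc n)) M (g (Suc n)) c) =
    tmap k H (Dg n) M (%x. b (Suc n) (g (Suc n) x)) c"
   unfolding b_Z[OF lin_closed[OF gl c]] by (rule tmap_comp[OF left_M rP rD rD gm b_rmodule_map c])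
  also have "... = tmap k H (Dg n) M (%x. g n (d (Suc n) x)) c"
   by (rule tmap_cong[OF left_M rP c]) (simp add: gd res_simps)
  also have "... = tmap k H (Dg n) M (g n) (dCC (Suc n) c)"
   using tmap_comp[OF left_M rP rP rD rd gm c] by simp
  finally show ?thesis .
 qed
 have \<Phi>l: "lmap k (ZO q) (CC (p + q)) (\<Phi> p q)" for p q
  unfolding \<Phi>_def by (rule Lm_linear[OF cc cw PRf(1) \<phi>])
 have "cyclic_comparison k Zc CC dCC \<Phi>"
 proof (intro cyclic_comparison.intro Z_precyclic chain_complex.intro cyclic_comparison_axioms.intro mCC, unfold Zc_simps(1))
  show l: "lmap k (CC (Suc n)) (CC n) (dCC (Suc n))" for n using tmap_linear[OF left_M rP rP rd] by simp
  show "dCC (Suc n) (dCC (Suc (Suc n)) x) = 0[CC n]" if x: "x <: CC (Suc (Suc n))" for n x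
  proof -
   have "dCC (Suc n) (dCC (Suc (Suc n)) x) = tmap k H (RP n) M (%x. 0[RP n]) x"
    using tmap_comp[OF left_M rP rP rP rd rd x] tmap_cong[OF left_M rP x dd] by simp
   then show ?thesis using tmap_zero[OF left_M rP rP x] by simp
  qed
  show "lmap k (ZO q) (CC (p + q)) (\<Phi> p q)" for p q by (rule \<Phi>l)
  show "EX y:carrier (ZO (Suc n)). hb' Zc (Suc n) y = x"
   if "x <: ZO n" "n = 0 \<or> hb' Zc n x = 0[ZO (n - 1)]" for n x by (rule Z_acyclic[OF that])
 next
  fix p q m x assume pq: "p + q = Suc m" and x: "x <: ZO q"
  let ?a = "%y. if q = 0 then 0[P m] else \<phi> p (q - 1) (tsygan_vert Q.Tc p q y)"
  let ?b = "%y. if p = 0 then 0[P m] else \<phi> (p - 1) q (tsygan_hor Q.Tc p q y)"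
  note z0 = rmap_zero[OF PRf(1)]
  have a: "rmap k Q (diag_module k Q q) (P m) ?a"
  proof (cases q)
   case (Suc r)
   then have "p + r = m" using pq by simp
   then show ?thesis using rmap_comp[OF \<phi>[of r p] Q.vert_rmodule_map[OF cc, of r p]] Suc by simp
  qed (simp add: z0)
  have b: "rmap k Q (diag_module k Q q) (P m) ?b"
  proof (cases p)
   case (Suc r)
   then have "r + q = m" using pq by simp
   then show ?thesis using rmap_comp[OF \<phi>[of q r] Q.hor_rmodule_map[OF cc, of q p]] Suc by simp
  qed (simp add: z0)
  have xD: "x <: tov k H (Dg q) M" using x by (simp add: Z_obj_def)
  have "dCC (Suc m) (\<Phi> p q x) = Lm (P m) q (%y. d (Suc m) (\<phi> p q y)) x"
   using tmap_comp[OF left_M rD rP rP Lm_map[OF \<phi>[of q p]], of m "d (Suc m)" x] rd[of m] xD pq by (simp add: \<Phi>_def)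
  also have "... = Lm (P m) q (%y. ?a y +[RP m] ?b y) x"
   by (rule Lm_cong[OF x]) (unfold res_simps(2), rule \<phi>d[OF _ pq])
  also have "... = Lm (P m) q ?a x +[CC m] Lm (P m) q ?b x"
   by (rule tmap_add[OF left_M rD rP Lm_map[OF a] Lm_map[OF b] xD])
  also have "Lm (P m) q ?a x = (if q = 0 then 0[CC m] else \<Phi> p (q - 1) (tsygan_vert Zc p q x))"
  proof (cases q)
   case 0
   then show ?thesis using tmap_zero[OF left_M rD rP xD, of m] by (simp add: res_simps)
  next
   case (Suc r)
   then have "p + r = m" using pq by simp
   then show ?thesis using Lm_vert[OF cc cw PRf(1) \<phi>[of r p], of x p] x Suc by (simp add: \<Phi>_def)
  qed
  also have "Lm (P m) q ?b x = (if p = 0 then 0[CC m] else \<Phi> (p - 1) q (tsygan_hor Zc p q x))"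
  proof (cases p)
   case 0
   then show ?thesis using tmap_zero[OF left_M rD rP xD, of m] by (simp add: res_simps)
  next
   case (Suc r)
   then have "r + q = m" using pq by simp
   then show ?thesis using Lm_hor[OF cc cw PRf(1) \<phi>[of q r] x, of p] Suc by (simp add: \<Phi>_def)
  qed
  finally show "dCC (Suc m) (\<Phi> p q x) = (if q = 0 then 0[CC m] else \<Phi> p (q - 1) (tsygan_vert Zc p q x)) +[CC m]
    (if p = 0 then 0[CC m] else \<Phi> (p - 1) q (tsygan_hor Zc p q x))" .
 next
  fix n z assume z: "z <: ZO n" and cyc: "n = 0 \<or> hb Zc n z = 0[ZO (n - 1)]"
   and "\<Phi> 0 n z : dCC (Suc n) ` carrier (CC (Suc n))"
  then obtain c where c: "c <: CC (Suc n)" "\<Phi> 0 n z = dCC (Suc n) c" by blast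
  interpret Zn: module k "ZO n" by (rule module_Z)
  note zD = z[unfolded Z_obj_def]
  let ?c = "tmap k H (Dg (Suc n)) M (g (Suc n)) c"
  have "n = 0 \<or> tmap k H (Dg (n - 1)) M (b n) z = 0[tov k H (Dg (n - 1)) M]"
   using cyc b_Z[of z "n - 1"] z by (cases n) (simp_all add: Z_obj_def)
  from tmap_null_homotopic[OF left_M rD rD b_rmodule_map b_rmodule_map Em h zD this]
  obtain w where w: "w <: ZO (Suc n)" "tmap k H (Dg n) M (E n) z = hb Zc (Suc n) w"
   using b_Z by (auto simp: Z_obj_def)
  have "tmap k H (Dg n) M (E n) z = tmap k H (Dg n) M (%t. g n (F n t)) z -[ZO n] z"
   unfolding E_def[abs_def]
   using tmap_diff[OF left_M rD rD gF rmap_id zD] tmap_id[OF left_M rD zD] by (simp add: Z_obj_def)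
  also have "tmap k H (Dg n) M (%t. g n (F n t)) z = hb Zc (Suc n) ?c"
   using tmap_comp[OF left_M rD rP rD Fm gm zD] c gb[OF c(1)] by (simp add: \<Phi>F)
  finally have "hb Zc (Suc n) w = hb Zc (Suc n) ?c -[ZO n] z" by (simp add: w)
  moreover have bl: "lmap k (ZO (Suc n)) (ZO n) (hb Zc (Suc n))" using Z.b_linear[of n] by (simp add: Zc_simps(1))
  note cZ = lin_closed[OF gl c(1)]
  ultimately have "z = hb Zc (Suc n) (?c -[ZO (Suc n)] w)"
   using lin_minus[OF module_Z module_Z bl cZ w(1)] Zn.minus_minus_swap[OF z lin_closed[OF bl cZ]] by simp
  moreover have "?c -[ZO (Suc n)] w <: ZO (Suc n)"
   by (rule abelian_group.minus_closed[OF module_ab[OF module_Z] cZ w(1)])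
  ultimately show "z : hb Zc (Suc n) ` carrier (ZO (Suc n))" by blast
 next
  fix n c assume c: "c <: CC n" and cyc: "n = 0 \<or> dCC n c = 0[CC (n - 1)]"
  let ?z = "tmap k H (Dg n) M (g n) c"
  have z: "?z <: ZO n" by (rule lin_closed[OF gl c])
  have "n = 0 \<or> hb Zc n ?z = 0[ZO (n - 1)]"
  proof (cases n)
   case (Suc m)
   then show ?thesis using cyc gb[of c m] c lin_zero[OF mCC module_Z gl, of m] by simp
  qed simp
  moreover have "\<Phi> 0 n ?z -[CC n] c = tmap k H (RP n) M (E' n) c"
   unfolding E'_def[abs_def] \<Phi>F
   using tmap_diff[OF left_M rP rP Fg rmap_id c] tmap_id[OF left_M rP c] tmap_comp[OF left_M rP rD rP gm Fm c] by simp
  moreover have "... : dCC (Suc n) ` carrier (CC (Suc n))"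
   using tmap_null_homotopic[OF left_M rP rP rd rd Em' h' c cyc] by simp
  ultimately show "EX z:carrier (ZO n). (n = 0 \<or> hb Zc n z = 0[ZO (n - 1)]) &
    \<Phi> 0 n z -[CC n] c : dCC (Suc n) ` carrier (CC (Suc n))" using z by (intro bexI[of _ ?z]) simp_all
 qed
 then show ?thesis by blast
qed

lemma HC_Tor: "linear_isomorphic k (HC k H M n)
  (direct_sum (UNIV :: nat set) (%i. Tor k Q P d Mb (int n - 2 * int i)))"
proof -
 let ?D = "%n. tov k Q (P n) Mb" and ?dD = "%n. tmap k Q (P (n - 1)) Mb (d n)"
 obtain \<Phi> where "cyclic_comparison k Zc CC dCC \<Phi>" using comparison_exists by blast
 then interpret cyclic_comparison k Zc CC dCC \<Phi> .
 obtain \<Theta> where \<Theta>: "!!n. lmap k (CC n) (?D n) (\<Theta> n)" "!!n. bij_betw (\<Theta> n) (carrier (CC n)) (carrier (?D n))"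
  "!!n x m. x <: P n ==> m <: M ==> \<Theta> n (tns k H (RP n) M x m) = tns k Q (P n) Mb x (pm m)"
  using base_change[OF PRf(1)] by metis
 note mD = module_over[OF left_Mb PRf(1)]
 have dl: "lmap k (?D (Suc n)) (?D n) (?dD (Suc n))" for n using tmap_linear[OF left_Mb PRf(1) PRf(1) PRf(3)] by simp
 have "?dD (Suc n) (\<Theta> (Suc n) x) = \<Theta> n (dCC (Suc n) x)" if x: "x <: CC (Suc n)" for n x
 proof (rule over_ext[OF left_M rP mD lin_comp[OF dl \<Theta>(1)] lin_comp[OF \<Theta>(1) dC_linear] _ x])
  fix y m assume "y <: RP (Suc n)" and m: "m <: M"
  then have y: "y <: P (Suc n)" by (simp add: res_simps)
  show "?dD (Suc n) (\<Theta> (Suc n) (tns k H (RP (Suc n)) M y m)) =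
    \<Theta> n (dCC (Suc n) (tns k H (RP (Suc n)) M y m))"
   using tmap_tens[OF left_Mb PRf(1) PRf(1) PRf(3) y pm_closed[OF m]] tmap_tens[OF left_M rP rP rd, of y n m]
    rmap_closed[OF PRf(3) y] y m by (simp add: \<Theta>(3) res_simps)
 qed
 from cyclic_comparison.cyclic_homology_decomposition[OF transport[OF mD dl \<Theta>(1,2) this]]
 have "linear_isomorphic k (HC k H M n)
   (direct_sum UNIV (%i. if 2 * i <= n then homology ?D ?dD (n - 2 * i) else zero_module))"
  by (simp add: HC_def)
 moreover have "(if 2 * i <= n then homology ?D ?dD (n - 2 * i) else zero_module) = Tor k Q P d Mb (int n - 2 * int i)" for i
 proof -
  have "nat (int n - 2 * int i) = n - 2 * i" by arith
  then show ?thesis by (simp add: Tor_def tmap_def)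
 qed
 ultimately show ?thesis by simp
qed

end

end

theorem corollary5p7:
  fixes k :: "'k ring"
    and H :: "('k, 'h) hopf"
    and K :: "'h set"
    and M :: "('k, 'h, 'm) crossed"
    and P :: "nat \<Rightarrow> ('k, 'h set, 'p) rmodule"
    and d :: "nat \<Rightarrow> 'p \<Rightarrow> 'p"
    and e :: "'p \<Rightarrow> 'k"
    and n :: nat
  assumes "field k"
    and "\<forall>j::nat. j > 0 \<longrightarrow> [j] \<cdot>\<^bsub>k\<^esub> \<one>\<^bsub>k\<^esub> \<noteq> \<zero>\<^bsub>k\<^esub>"
    and "hopf_algebra k H"
    and "bij_betw (antipode H) (carrier H) (carrier H)"
    and "normal_hopf_subalgebra k H K"
    and "semisimple_ring (H\<lparr>carrier := K\<rparr>)"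
    and "modular_crossed_module k H M"
    and "cocommutative k (quot_hopf k H K)"
    and "coact_within k H K M"
    and "projective_resolution k (quot_hopf k H K) (trivial_rmodule k (quot_hopf k H K)) P d e"
  shows "linear_isomorphic k (HC k H M n)
    (direct_sum (UNIV :: nat set)
       (\<lambda>i. Tor k (quot_hopf k H K) P d (quot_crossed k H K M) (int n - 2 * int i)))"
proof -
  have "comparison k H K M"
    by (intro comparison.intro normal_pair.intro normal_pair_axioms.intro hopf_coefficients.intro assms)
  from comparison.HC_Tor[OF this assms(1,6,8,9,10)] show ?thesis .
qed


end
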